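(* Let $\mu\in C^1([0,1];\mathbb{R})$, $\lambda\in C^1([0,1]^2;\mathbb{R})$, $W,\theta\in C([0,1]^2;\mathbb{R})$, $\sigma\in C([0,1]^3;\mathbb{R})$, $q\in C([0,1];\mathbb{R})$, with $\mu(x)>0$ for all $x\in[0,1]$ and $\lambda(x,y)\ge\underline\lambda$ on $[0,1]^2$ for some constant $\underline\lambda>0$. Let $(k,\bar k)$ be the unique continuous solution of the continuum kernel equations with these parameters (see context). For $n\in\mathbb{N}$, consider the $n+1$ system $$u^i_t(t,x)+\lambda_i(x)u^i_x(t,x)=\frac1n\sum_{j=1}^n\sigma_{i,j}(x)u^j(t,x)+W_i(x)v(t,x),\quad i=1,\dots,n,$$ $$v_t(t,x)-\mu(x)v_x(t,x)=\frac1n\sum_{j=1}^n\theta_j(x)u^j(t,x),$$ for $t\ge0$, $x\in[0,1]$, with boundary conditions $u^i(t,0)=q_iv(t,0)$, $v(t,1)=U(t)$, whose parameters $\lambda_i,\mu,W_i,\theta_i,\sigma_{i,j},q_i$ satisfy $\lambda_i\in C^1([0,1];\mathbb{R})$, $\lambda_i>0$ on $[0,1]$, $W_i,\theta_i,\sigma_{i,j}\in C([0,1];\mathbb{R})$, $q_i\in\mathbb{R}$, and are related to the continuum parameters by $$\lambda(x,i/n)=\lambda_i(x),\quad W(x,i/n)=W_i(x),\quad \theta(x,i/n)=\theta_i(x),\quad \sigma(x,i/n,j/n)=\sigma_{i,j}(x),\quad q(i/n)=q_i$$ for all $x\in[0,1]$ and $i,j=1,\dots,n$. Then, if $n$ is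 sufficiently large (i.e., there is $N\in\mathbb{N}$ such that this holds for every $n\ge N$), the $n+1$ system is exponentially stabilized (on $E$) by the control law $$U(t)=\int_0^1\left[\frac1n\sum_{i=1}^n\widetilde k^i(1,\xi)u^i(t,\xi)+\widetilde k^{n+1}(1,\xi)v(t,\xi)\right]d\xi,$$ where $\widetilde k^i(x,\xi)=k(x,\xi,i/n)$ for $i=1,\dots,n$ and $\widetilde k^{n+1}(x,\xi)=\bar k(x,\xi)$.
   Context: Let $\mathcal{T}=\{(x,\xi)\in[0,1]^2:0\le\xi\le x\le1\}$. Continuum kernel equations: for $(x,\xi)\in\mathcal{T}$ and almost every $y\in[0,1]$, $$\mu(x)k_x(x,\xi,y)-\lambda(\xi,y)k_\xi(x,\xi,y)-\theta(\xi,y)\bar k(x,\xi)=\lambda_\xi(\xi,y)k(x,\xi,y)+\int_0^1\sigma(\xi,\eta,y)k(x,\xi,\eta)\,d\eta,$$ $$\mu(x)\bar k_x(x,\xi)+\mu(\xi)\bar k_\xi(x,\xi)=-\mu'(\xi)\bar k(x,\xi)+\int_0^1W(\xi,y)k(x,\xi,y)\,dy,$$ with boundary conditions, for all $x\in[0,1]$, $$k(x,x,y)=-\frac{\theta(x,y)}{\lambda(x,y)+\mu(x)},\qquad \mu(0)\bar k(x,0)=\int_0^1q(y)\lambda(0,y)k(x,0,y)\,dy.$$ As the coefficients are only continuous, solutions are continuous functions satisfying the PDEs along characteristics (the first-order differential expressions on the left being derivatives along characteristic curves). It is known that under the stated hypotheses there is a unique continuous solution $(k,\bar k)$, $k$ on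 $\mathcal{T}\times[0,1]$ and $\bar k$ on $\mathcal{T}$. State space: $E=L^2([0,1];\mathbb{R}^{n+1})$ with norm $\left\|(\mathbf{u},v)\right\|_E^2=\int_0^1\left(\frac1n\sum_{i=1}^n|u^i(x)|^2+|v(x)|^2\right)dx$. Weak solutions: for $U\in L^2_{\mathrm{loc}}([0,\infty);\mathbb{R})$ and initial data in $E$, the weak solution is the function in $C([0,\infty);E)$ obtained as the limit in $E$, uniformly on compact time intervals, of classical solutions whose ($H^1$, boundary-compatible) initial data and ($H^1_{\mathrm{loc}}$) inputs converge to the given ones in $E$ and in $L^2_{\mathrm{loc}}$. Exponentially stabilized means: under the given control law, there exist $M,c>0$ such that for every initial condition $z_0\in E$ the weak solution $z(t)=(u^1(t,\cdot),\dots,u^n(t,\cdot),v(t,\cdot))$ of the closed-loop system satisfies $\|z(t)\|_E\le Me^{-ct}\|z_0\|_E$ for all $t\ge0$. *)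

theory Defs
  imports "HOL-Analysis.Analysis"
begin

section \<open>Function spaces\<close>

text \<open>
  Functions on \<open>S\<close> are represented by total functions of which only the values on \<open>S\<close> matter;
  derivatives are therefore taken within \<open>S\<close> (one-sided at the boundary).
\<close>

definition C1_on :: "'a::real_normed_vector set \<Rightarrow> ('a \<Rightarrow> 'b::real_normed_vector) \<Rightarrow> bool" where
  "C1_on S f \<longleftrightarrow> (\<exists>D :: 'a \<Rightarrow> 'a \<Rightarrow>\<^sub>L 'b.
     (\<forall>x\<in>S. (f has_derivative blinfun_apply (D x)) (at x within S)) \<and> continuous_on S D)"

definition L2_on :: "real set \<Rightarrow> (real \<Rightarrow> real) \<Rightarrow> bool" where
  "L2_on S f \<longleftrightarrow> f \<in> borel_measurable (lebesgue_on S) \<and> integrable (lebesgue_on S) (\<lambda>x. (f x)\<^sup>2)"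

definition L2_loc :: "(real \<Rightarrow> real) \<Rightarrow> bool" where
  "L2_loc f \<longleftrightarrow> (\<forall>T>0. L2_on {0..T} f)"

text \<open>
  \<open>has_H1_derivative f g a b\<close>: \<open>f\<close> is the continuous representative of an element of
  \<open>H\<^sup>1(a,b)\<close> and \<open>g\<close> is its weak derivative.
\<close>

definition has_H1_derivative :: "(real \<Rightarrow> real) \<Rightarrow> (real \<Rightarrow> real) \<Rightarrow> real \<Rightarrow> real \<Rightarrow> bool" where
  "has_H1_derivative f g a b \<longleftrightarrow>
     L2_on {a..b} g \<and> (\<forall>x\<in>{a..b}. f x = f a + integral {a..x} g)"

definition H1_loc :: "(real \<Rightarrow> real) \<Rightarrow> bool" where
  "H1_loc f \<longleftrightarrow> (\<forall>T>0. \<exists>g. has_H1_derivative f g 0 T)"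

section \<open>Continuum kernel equations\<close>

definition kernel_triangle :: "(real \<times> real) set" where
  "kernel_triangle = {(x, \<xi>). 0 \<le> \<xi> \<and> \<xi> \<le> x \<and> x \<le> 1}"

definition integral_curve :: "(real \<Rightarrow> real) \<Rightarrow> (real \<Rightarrow> real) \<Rightarrow> real set \<Rightarrow> bool" where
  "integral_curve f X I \<longleftrightarrow> (\<forall>s\<in>I. (X has_real_derivative f (X s)) (at s within I))"

text \<open>
  The differential expression \<open>\<mu>(x) k\<^sub>x - \<lambda>(\<xi>,y) k\<^sub>\<xi>\<close> is the derivative of \<open>k(\<cdot>,\<cdot>,y)\<close> along the
  curves with \<open>x' = \<mu>(x)\<close>, \<open>\<xi>' = -\<lambda>(\<xi>,y)\<close>, and \<open>\<mu>(x) kbar\<^sub>x + \<mu>(\<xi>) kbar\<^sub>\<xi>\<close> is the derivative of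
  \<open>kbar\<close> along the curves with \<open>x' = \<mu>(x)\<close>, \<open>\<xi>' = \<mu>(\<xi>)\<close>. The exceptional null set of \<open>y\<close> is
  independent of the point \<open>(x,\<xi>)\<close>.
\<close>

definition continuum_kernel_solution ::
  "(real \<Rightarrow> real) \<Rightarrow> (real \<Rightarrow> real \<Rightarrow> real) \<Rightarrow> (real \<Rightarrow> real \<Rightarrow> real) \<Rightarrow> (real \<Rightarrow> real \<Rightarrow> real) \<Rightarrow>
   (real \<Rightarrow> real \<Rightarrow> real \<Rightarrow> real) \<Rightarrow> (real \<Rightarrow> real) \<Rightarrow>
   (real \<Rightarrow> real \<Rightarrow> real \<Rightarrow> real) \<Rightarrow> (real \<Rightarrow> real \<Rightarrow> real) \<Rightarrow> bool" where
  "continuum_kernel_solution \<mu> lam W \<theta> \<sigma> q k kbar \<longleftrightarrow>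
     continuous_on (kernel_triangle \<times> {0..1}) (\<lambda>((x, \<xi>), y). k x \<xi> y) \<and>
     continuous_on kernel_triangle (\<lambda>(x, \<xi>). kbar x \<xi>) \<and>
     (AE y in lebesgue_on {0..1}. \<forall>a b X \<Xi>.
        a < b \<longrightarrow> integral_curve \<mu> X {a..b} \<longrightarrow> integral_curve (\<lambda>\<xi>. - lam \<xi> y) \<Xi> {a..b} \<longrightarrow>
        (\<forall>s\<in>{a..b}. (X s, \<Xi> s) \<in> kernel_triangle) \<longrightarrow>
        (\<forall>s\<in>{a..b}. ((\<lambda>s. k (X s) (\<Xi> s) y) has_real_derivative
            \<theta> (\<Xi> s) y * kbar (X s) (\<Xi> s)
            + vector_derivative (\<lambda>\<xi>. lam \<xi> y) (at (\<Xi> s) within {0..1}) * k (X s) (\<Xi> s) y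
            + integral {0..1} (\<lambda>\<eta>. \<sigma> (\<Xi> s) \<eta> y * k (X s) (\<Xi> s) \<eta>)) (at s within {a..b}))) \<and>
     (\<forall>a b X \<Xi>.
        a < b \<longrightarrow> integral_curve \<mu> X {a..b} \<longrightarrow> integral_curve \<mu> \<Xi> {a..b} \<longrightarrow>
        (\<forall>s\<in>{a..b}. (X s, \<Xi> s) \<in> kernel_triangle) \<longrightarrow>
        (\<forall>s\<in>{a..b}. ((\<lambda>s. kbar (X s) (\<Xi> s)) has_real_derivative
            - vector_derivative \<mu> (at (\<Xi> s) within {0..1}) * kbar (X s) (\<Xi> s)
            + integral {0..1} (\<lambda>y. W (\<Xi> s) y * k (X s) (\<Xi> s) y)) (at s within {a..b}))) \<and>
     (\<forall>x\<in>{0..1}. \<forall>y\<in>{0..1}. k x x y = - (\<theta> x y / (lam x y + \<mu> x))) \<and>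
     (\<forall>x\<in>{0..1}. \<mu> 0 * kbar x 0 = integral {0..1} (\<lambda>y. q y * lam 0 y * k x 0 y))"

section \<open>The state space \<open>E\<close>\<close>

text \<open>
  A state of the \<open>n + 1\<close> system is a pair \<open>u\<close>, \<open>v\<close> where the components of \<open>u\<close> are \<open>u 1, \<dots>, u n\<close>.
  Elements of \<open>E\<close> are represented by functions, so that equality in \<open>E\<close> means that the difference
  has \<open>E_norm\<close> zero.
\<close>

definition in_E :: "nat \<Rightarrow> (nat \<Rightarrow> real \<Rightarrow> real) \<Rightarrow> (real \<Rightarrow> real) \<Rightarrow> bool" where
  "in_E n u v \<longleftrightarrow> (\<forall>i\<in>{1..n}. L2_on {0..1} (u i)) \<and> L2_on {0..1} v"

definition E_norm :: "nat \<Rightarrow> (nat \<Rightarrow> real \<Rightarrow> real) \<Rightarrow> (real \<Rightarrow> real) \<Rightarrow> real" where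
  "E_norm n u v = sqrt (integral {0..1} (\<lambda>x. 1 / real n * (\<Sum>i=1..n. \<bar>u i x\<bar>\<^sup>2) + \<bar>v x\<bar>\<^sup>2))"

definition E_continuous ::
  "nat \<Rightarrow> (real \<Rightarrow> nat \<Rightarrow> real \<Rightarrow> real) \<Rightarrow> (real \<Rightarrow> real \<Rightarrow> real) \<Rightarrow> bool" where
  "E_continuous n u v \<longleftrightarrow>
     (\<forall>t\<ge>0. in_E n (u t) (v t)) \<and>
     (\<forall>t\<ge>0. ((\<lambda>s. E_norm n (u s - u t) (v s - v t)) \<longlongrightarrow> 0) (at t within {0..}))"

definition E_has_derivative ::
  "nat \<Rightarrow> (real \<Rightarrow> nat \<Rightarrow> real \<Rightarrow> real) \<Rightarrow> (real \<Rightarrow> real \<Rightarrow> real) \<Rightarrow>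
   (real \<Rightarrow> nat \<Rightarrow> real \<Rightarrow> real) \<Rightarrow> (real \<Rightarrow> real \<Rightarrow> real) \<Rightarrow> bool" where
  "E_has_derivative n u v u' v' \<longleftrightarrow>
     (\<forall>t\<ge>0. ((\<lambda>s. E_norm n (\<lambda>i x. (u s i x - u t i x) / (s - t) - u' t i x)
                           (\<lambda>x. (v s x - v t x) / (s - t) - v' t x)) \<longlongrightarrow> 0) (at t within {0..}))"

section \<open>Solutions of the \<open>n + 1\<close> system\<close>

text \<open>
  Classical solutions have values in \<open>H\<^sup>1\<close> and are of class \<open>C\<^sup>1\<close> in time with values in \<open>E\<close>
  (continuity in time with values in \<open>H\<^sup>1\<close> then follows from the equations). In particular the
  initial values at time \<open>0\<close> are in \<open>H\<^sup>1\<close> and compatible with the boundary conditions.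
\<close>

definition classical_solution ::
  "nat \<Rightarrow> (nat \<Rightarrow> real \<Rightarrow> real) \<Rightarrow> (real \<Rightarrow> real) \<Rightarrow> (nat \<Rightarrow> nat \<Rightarrow> real \<Rightarrow> real) \<Rightarrow>
   (nat \<Rightarrow> real \<Rightarrow> real) \<Rightarrow> (nat \<Rightarrow> real \<Rightarrow> real) \<Rightarrow> (nat \<Rightarrow> real) \<Rightarrow>
   (real \<Rightarrow> real) \<Rightarrow> (real \<Rightarrow> nat \<Rightarrow> real \<Rightarrow> real) \<Rightarrow> (real \<Rightarrow> real \<Rightarrow> real) \<Rightarrow> bool" where
  "classical_solution n lam \<mu> \<sigma> W \<theta> q U u v \<longleftrightarrow>
     (\<exists>ut vt ux vx.
        E_continuous n u v \<and> E_continuous n ut vt \<and> E_has_derivative n u v ut vt \<and>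
        (\<forall>t\<ge>0. \<forall>i\<in>{1..n}. has_H1_derivative (u t i) (ux t i) 0 1) \<and>
        (\<forall>t\<ge>0. has_H1_derivative (v t) (vx t) 0 1) \<and>
        (\<forall>t\<ge>0. \<forall>i\<in>{1..n}. AE x in lebesgue_on {0..1}.
           ut t i x + lam i x * ux t i x
             = 1 / real n * (\<Sum>j=1..n. \<sigma> i j x * u t j x) + W i x * v t x) \<and>
        (\<forall>t\<ge>0. AE x in lebesgue_on {0..1}.
           vt t x - \<mu> x * vx t x = 1 / real n * (\<Sum>j=1..n. \<theta> j x * u t j x)) \<and>
        (\<forall>t\<ge>0. \<forall>i\<in>{1..n}. u t i 0 = q i * v t 0) \<and>
        (\<forall>t\<ge>0. v t 1 = U t))"

definition weak_solution ::
  "nat \<Rightarrow> (nat \<Rightarrow> real \<Rightarrow> real) \<Rightarrow> (real \<Rightarrow> real) \<Rightarrow> (nat \<Rightarrow> nat \<Rightarrow> real \<Rightarrow> real) \<Rightarrow>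
   (nat \<Rightarrow> real \<Rightarrow> real) \<Rightarrow> (nat \<Rightarrow> real \<Rightarrow> real) \<Rightarrow> (nat \<Rightarrow> real) \<Rightarrow>
   (nat \<Rightarrow> real \<Rightarrow> real) \<Rightarrow> (real \<Rightarrow> real) \<Rightarrow>
   (real \<Rightarrow> real) \<Rightarrow> (real \<Rightarrow> nat \<Rightarrow> real \<Rightarrow> real) \<Rightarrow> (real \<Rightarrow> real \<Rightarrow> real) \<Rightarrow> bool" where
  "weak_solution n lam \<mu> \<sigma> W \<theta> q u0 v0 U u v \<longleftrightarrow>
     in_E n u0 v0 \<and> L2_loc U \<and> E_continuous n u v \<and>
     (\<exists>Um um vm.
        (\<forall>m::nat. H1_loc (Um m) \<and> classical_solution n lam \<mu> \<sigma> W \<theta> q (Um m) (um m) (vm m)) \<and>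
        (\<lambda>m. E_norm n (um m 0 - u0) (vm m 0 - v0)) \<longlonglongrightarrow> 0 \<and>
        (\<forall>T>0. (\<lambda>m. integral {0..T} (\<lambda>t. (Um m t - U t)\<^sup>2)) \<longlonglongrightarrow> 0) \<and>
        (\<forall>T>0. uniform_limit {0..T} (\<lambda>m t. E_norm n (um m t - u t) (vm m t - v t))
                  (\<lambda>t. 0) sequentially))"

text \<open>
  \<open>K\<close> is a state feedback law, i.e. the input is \<open>U(t) = K (u(t)) (v(t))\<close>. The phrase ``the weak
  solution'' is read as existence and uniqueness in \<open>C([0,\<infinity>);E)\<close>.
\<close>

definition exponentially_stabilized ::
  "nat \<Rightarrow> (nat \<Rightarrow> real \<Rightarrow> real) \<Rightarrow> (real \<Rightarrow> real) \<Rightarrow> (nat \<Rightarrow> nat \<Rightarrow> real \<Rightarrow> real) \<Rightarrow>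
   (nat \<Rightarrow> real \<Rightarrow> real) \<Rightarrow> (nat \<Rightarrow> real \<Rightarrow> real) \<Rightarrow> (nat \<Rightarrow> real) \<Rightarrow>
   ((nat \<Rightarrow> real \<Rightarrow> real) \<Rightarrow> (real \<Rightarrow> real) \<Rightarrow> real) \<Rightarrow> bool" where
  "exponentially_stabilized n lam \<mu> \<sigma> W \<theta> q K \<longleftrightarrow>
     (\<exists>M>0. \<exists>c>0. \<forall>u0 v0. in_E n u0 v0 \<longrightarrow>
        (\<exists>u v. weak_solution n lam \<mu> \<sigma> W \<theta> q u0 v0 (\<lambda>t. K (u t) (v t)) u v \<and>
           (\<forall>u' v'. weak_solution n lam \<mu> \<sigma> W \<theta> q u0 v0 (\<lambda>t. K (u' t) (v' t)) u' v' \<longrightarrow>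
              (\<forall>t\<ge>0. E_norm n (u' t - u t) (v' t - v t) = 0)) \<and>
           (\<forall>t\<ge>0. E_norm n (u t) (v t) \<le> M * exp (- c * t) * E_norm n u0 v0)))"

end

theory Submission
  imports Defs
begin

text \<open>
  With \<open>\<beta> = v - \<integral>\<^sub>0\<^sup>x (1/n \<Sum> k\<^sup>i u\<^sup>i + kbar v) d\<xi>\<close> the closed loop has \<open>\<beta>(t, 1) = 0\<close>, and by the continuum
  kernel equations \<open>\<beta>\<^sub>t - \<mu> \<beta>\<^sub>x\<close> consists only of the errors of Riemann sums with step \<open>1/n\<close>, which
  are uniformly small by continuity of the data. Hence for large \<open>n\<close> the functional
  \<open>1/n \<Sum> \<integral> e\<^sup>-\<^sup>\<delta>\<^sup>x (u\<^sup>i)\<^sup>2 / \<lambda>\<^sub>i + A \<integral> e\<^sup>\<delta>\<^sup>x \<beta>\<^sup>2 / \<mu>\<close> decays exponentially along continuously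
  differentiable solutions.

  Such solutions are time averages of mild solutions, which a contraction argument on characteristics
  provides; their initial values are dense in \<open>E\<close>, so that by linearity and the decay estimate they
  converge, uniformly in time, to weak solutions with the same decay. Uniqueness follows from an energy
  estimate for classical solutions with arbitrary input and Gronwall's inequality, as the feedback is
  bounded on \<open>E\<close>.
\<close>

section \<open>Calculus along characteristics\<close>

text \<open>Two regularity gaps shape the argument. The kernels are only continuous, differentiable
  only along characteristics, and \<open>k\<close> only for almost every \<open>y\<close>, while the
  feedback samples \<open>k\<close> at the grid points \<open>i / n\<close>. The kernel equations
  are therefore used solely through the \<open>x\<close>-derivative of integrals of the kernels
  against continuously differentiable functions, an identity continuous in \<open>y\<close>.
  Secondly, continuously differentiable solutions call for initial data meeting a first-order
  compatibility condition that involves the coefficients and the nonlocal feedback; averaging in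
  time produces such data without differentiating any coefficient.

  Dividing the squares by the transport speeds keeps derivatives of the speeds out of the
  integrations by parts. The functional contains \<open>\<beta>\<close> but not \<open>v\<close>,
  which is recovered as \<beta> plus a Volterra integral of \<open>u\<close> and \<open>v\<close>; a
  large exponent \<delta> makes that integral small. The constants \<delta>, \<open>A\<close> and
  the tolerance for quadrature errors depend only on bounds of the continuum data, so they are fixed
  before \<open>n\<close>, and \<open>N\<close> is what the tolerance demands.\<close>

lemma continuous_on_comp2:
  assumes "continuous_on T (\<lambda>(x, y). f x y)" "continuous_on S g" "continuous_on S h"
    and "\<And>s. s \<in> S \<Longrightarrow> (g s, h s) \<in> T"
  shows "continuous_on S (\<lambda>s. f (g s) (h s))"
  using continuous_on_compose2[OF assms(1) continuous_on_Pair[OF assms(2,3)]] assms(4) by force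

lemma continuous_on_comp3:
  assumes "continuous_on T (\<lambda>(x, y, z). f x y z)" "continuous_on S g" "continuous_on S h" "continuous_on S k"
    and "\<And>s. s \<in> S \<Longrightarrow> (g s, h s, k s) \<in> T"
  shows "continuous_on S (\<lambda>s. f (g s) (h s) (k s))"
  using continuous_on_compose2[OF assms(1) continuous_on_Pair[OF assms(2) continuous_on_Pair[OF assms(3,4)]]] assms(5) by force

text \<open>Rescaling by \<open>s = m x * \<theta>\<close> turns the moving interval into
  \<open>{0..1}\<close>, where integrals with a parameter are continuous; the factor
  \<open>m x\<close> also covers the degenerate case \<open>m x = 0\<close>.\<close>

lemma continuous_on_integral_upper:
  fixes f :: "'a::topological_space \<Rightarrow> real \<Rightarrow> real"
  assumes m: "continuous_on S m" "\<And>x. x \<in> S \<Longrightarrow> 0 \<le> m x"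
    and f: "continuous_on {(x, s). x \<in> S \<and> 0 \<le> s \<and> s \<le> m x} (\<lambda>(x, s). f x s)"
  shows "continuous_on S (\<lambda>x. integral {0..m x} (f x))"
proof -
  have eq: "integral {0..m x} (f x) = m x * integral {0..1} (\<lambda>\<theta>. f x (m x * \<theta>))" if "x \<in> S" for x
  proof -
    have c: "continuous_on {0..m x} (f x)"
      by (rule continuous_on_comp2[OF f]) (use that in \<open>auto intro!: continuous_intros\<close>)
    have "((\<lambda>\<theta>. m x *\<^sub>R f x (m x * \<theta>)) has_integral (integral {m x * 0..m x * 1} (f x))) {0..1}"
      by (rule has_integral_substitution[where c=0 and d="m x"])
        (use m(2)[OF that] c in \<open>auto intro!: derivative_eq_intros mult_left_le\<close>)
    then show ?thesis by (simp add: has_integral_iff)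
  qed
  have "continuous_on (S \<times> cbox 0 (1::real)) (\<lambda>(x, \<theta>). f x (m x * \<theta>))"
  proof -
    have "continuous_on (S \<times> cbox 0 (1::real)) (\<lambda>z. (fst z, m (fst z) * snd z))"
      by (intro continuous_intros continuous_on_compose2[OF m(1)]) auto
    then have "continuous_on (S \<times> cbox 0 (1::real)) (\<lambda>z. (\<lambda>(x, s). f x s) (fst z, m (fst z) * snd z))"
      by (rule continuous_on_compose2[OF f]) (use m(2) in \<open>auto intro!: mult_left_le\<close>)
    then show ?thesis by (simp add: case_prod_unfold)
  qed
  from integral_continuous_on_param[OF this]
  have "continuous_on S (\<lambda>x. m x * integral {0..1} (\<lambda>\<theta>. f x (m x * \<theta>)))"
    using m(1) by (auto intro!: continuous_intros)
  then show ?thesis using eq by (simp cong: continuous_on_cong)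
qed

text \<open>\<open>P\<close> is the travel time from \<open>0\<close> at speed \<open>a\<close>, and
  its inverse \<open>Q\<close> is the trajectory starting at \<open>0\<close>. In the coordinate
  \<open>P x\<close> the motion has unit speed, which straightens the characteristics.\<close>

lemma flow_coordinates:
  fixes a :: "real \<Rightarrow> real"
  assumes "continuous_on {0..1} a" "\<And>x. x \<in> {0..1} \<Longrightarrow> a x > 0"
  obtains T P Q where "T > 0" "P 0 = 0" "P 1 = T" "Q 0 = 0" "Q T = 1"
    "\<And>x. x \<in> {0..1} \<Longrightarrow> P x \<in> {0..T}" "\<And>p. p \<in> {0..T} \<Longrightarrow> Q p \<in> {0..1}"
    "\<And>x. x \<in> {0..1} \<Longrightarrow> Q (P x) = x" "\<And>p. p \<in> {0..T} \<Longrightarrow> P (Q p) = p"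
    "\<And>x. x \<in> {0..1} \<Longrightarrow> (P has_real_derivative 1 / a x) (at x within {0..1})"
    "\<And>p. p \<in> {0..T} \<Longrightarrow> (Q has_real_derivative a (Q p)) (at p within {0..T})"
proof -
  \<comment> \<open>Clamping the argument extends the speed past both ends, so that \<open>0\<close>
    and \<open>1\<close> become interior points and the two-sided rule for inverse functions applies
    there as well.\<close>
  define a' where "a' x = a (max 0 (min 1 x))" for x
  have a'c: "continuous_on {-1..2} (\<lambda>x. 1 / a' x)"
    unfolding a'_def
    by (intro continuous_intros continuous_on_compose2[OF assms(1)] ballI)
      (auto simp: less_imp_neq[OF assms(2), symmetric])
  have a'p: "a' x > 0" for x unfolding a'_def by (rule assms(2)) auto
  have a'a: "a' x = a x" if "x \<in> {0..1}" for x using that by (auto simp: a'_def min_def max_def)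
  define P where "P x = integral {-1..x} (\<lambda>x. 1 / a' x) - integral {-1..0} (\<lambda>x. 1 / a' x)" for x
  have dP: "(P has_real_derivative 1 / a' x) (at x within {-1..2})" if "x \<in> {-1..2}" for x
    unfolding P_def using integral_has_real_derivative[OF a'c that] 
    by (auto intro!: derivative_eq_intros)
  have dP': "DERIV P x :> 1 / a' x" if "-1 < x" "x < 2" for x
    using dP[of x] that by (simp add: at_within_Icc_at)
  have cP: "continuous_on {-1..2} P" using dP by (rule DERIV_continuous_on)
  have mono: "P x < P y" if "-1 \<le> x" "x < y" "y \<le> 2" for x y
    by (rule DERIV_pos_imp_increasing_open[OF that(2)])
       (use that dP' a'p in \<open>force intro: continuous_on_subset[OF cP]\<close>)+
  have inj: "inj_on P {-1..2}"
    by (rule inj_onI) (metis atLeastAtMost_iff linorder_neqE mono order_less_irrefl)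
  define Q where "Q = inv_into {-1..2} P"
  have QP: "Q (P x) = x" if "x \<in> {-1..2}" for x
    unfolding Q_def by (rule inv_into_f_f[OF inj that])
  have im: "\<exists>x\<in>{x..y}. P x = p" if "P x \<le> p" "p \<le> P y" "-1 \<le> x" "x \<le> y" "y \<le> 2" for p x y
    using IVT'[of P x p y] that continuous_on_subset[OF cP, of "{x..y}"] by auto
  have PQ: "P (Q p) = p" "Q p \<in> {x..y}" if "P x \<le> p" "p \<le> P y" "-1 \<le> x" "x \<le> y" "y \<le> 2" for p x y
    using im[OF that] QP that by auto
  have cQ: "continuous_on (P ` {-1..2}) Q"
    by (rule continuous_on_inv[OF cP]) (use QP in auto)
  have dQ: "DERIV Q p :> a (Q p)" if "p \<in> {P 0..P 1}" for p
  proof -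
    have Qp: "Q p \<in> {0..1}" using PQ(2)[of 0 p 1] that by auto
    have lt: "P (-1) < P 0" "P 1 < P 2" by (auto intro!: mono)
    have sub: "{P (-1)<..<P 2} \<subseteq> P ` {-1..2}" 
    proof
      fix q assume "q \<in> {P (-1)<..<P 2}"
      then obtain x where "x \<in> {-1..2}" "P x = q" using im[of "-1" q 2] by auto
      then show "q \<in> P ` {-1..2}" by auto
    qed
    have "isCont Q p"
      using continuous_on_subset[OF cQ sub] lt that
      by (metis atLeastAtMost_iff continuous_on_eq_continuous_at greaterThanLessThan_iff order_le_less_trans order_less_le_trans open_greaterThanLessThan)
    then have "DERIV Q p :> inverse (1 / a' (Q p))"
      using DERIV_inverse_function[OF dP', of "Q" p "P (-1)" "P 2"] Qp lt that PQ(1)[of "-1" _ 2] a'p[of "Q p"]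
      by auto
    then show ?thesis using a'a[OF Qp] by simp
  qed
  have P0: "P 0 = 0" by (simp add: P_def)
  show ?thesis
  proof (rule that[of "P 1" P Q])
    show "P 1 > 0" using mono[of 0 1] P0 by auto
    show "P 0 = 0" "P 1 = P 1" by (simp_all add: P0)
    show "Q 0 = 0" "Q (P 1) = 1" using QP[of 0] QP[of 1] by (simp_all add: P0)
    show "P x \<in> {0..P 1}" if "x \<in> {0..1}" for x
      using mono[of 0 x] mono[of x 1] that P0 by (cases "x = 0"; cases "x = 1") auto
    show "Q p \<in> {0..1}" if "p \<in> {0..P 1}" for p using PQ(2)[of 0 p 1] that P0 by auto
    show "Q (P x) = x" if "x \<in> {0..1}" for x using QP that by auto
    show "P (Q p) = p" if "p \<in> {0..P 1}" for p using PQ(1)[of 0 p 1] that P0 by auto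
    show "(P has_real_derivative 1 / a x) (at x within {0..1})" if "x \<in> {0..1}" for x
      using dP'[of x] that a'a[OF that] by (auto intro: has_field_derivative_at_within)
    show "(Q has_real_derivative a (Q p)) (at p within {0..P 1})" if "p \<in> {0..P 1}" for p
      using dQ[of p] that P0 by (auto intro: has_field_derivative_at_within)
  qed
qed

text \<open>The integral with free upper limit, \<open>\<Phi> p c\<close>, has both partial
  derivatives, and the one in \<open>c\<close> is continuous. It is therefore jointly
  differentiable, and the chain rule along \<open>p \<mapsto> (p, g p)\<close> gives the boundary
  terms.\<close>

lemma has_real_derivative_moving_integral:
  fixes H h :: "real \<Rightarrow> real \<Rightarrow> real"
  assumes ab: "p \<in> {a..b}"
    and Hc: "continuous_on ({a..b} \<times> {A..C}) (\<lambda>(p, c). H p c)"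
    and hc: "continuous_on ({a..b} \<times> {A..C}) (\<lambda>(p, c). h p c)"
    and Hd: "\<And>p c. p \<in> {a..b} \<Longrightarrow> c \<in> {A..C} \<Longrightarrow> ((\<lambda>p. H p c) has_real_derivative h p c) (at p within {a..b})"
    and lm: "\<And>p. p \<in> {a..b} \<Longrightarrow> A \<le> l p \<and> l p \<le> m p \<and> m p \<le> C"
    and l: "(l has_real_derivative l') (at p within {a..b})"
    and m: "(m has_real_derivative m') (at p within {a..b})"
  shows "((\<lambda>p. integral {l p..m p} (H p)) has_real_derivative
     integral {l p..m p} (h p) + H p (m p) * m' - H p (l p) * l') (at p within {a..b})"
proof -
  define \<Phi> where "\<Phi> p c = integral {A..c} (H p)" for p c
  have Hc1: "continuous_on {A..C} (H p)" if "p \<in> {a..b}" for p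
    by (rule continuous_on_comp2[OF Hc]) (use that in \<open>auto intro!: continuous_intros\<close>)
  have hc1: "continuous_on {A..C} (h p)" if "p \<in> {a..b}" for p
    by (rule continuous_on_comp2[OF hc]) (use that in \<open>auto intro!: continuous_intros\<close>)
  have d\<Phi>: "((\<lambda>p. \<Phi> p (g p)) has_real_derivative integral {A..g p} (h p) + H p (g p) * g') (at p within {a..b})"
    if g: "(g has_real_derivative g') (at p within {a..b})" and gr: "\<And>p. p \<in> {a..b} \<Longrightarrow> g p \<in> {A..C}" for g g'
  proof -
    define y where "y = g p"
    have y: "y \<in> {A..C}" unfolding y_def using gr ab by auto
    have 1: "((\<lambda>p. \<Phi> p y) has_real_derivative integral {A..y} (h p)) (at p within {a..b})"
      unfolding \<Phi>_def cbox_interval[symmetric]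
    proof (rule leibniz_rule_field_derivative)
      show "continuous_on (cbox a b \<times> cbox A y) (\<lambda>(x, t). h x t)"
        using hc by (rule continuous_on_subset) (use y in auto)
      show "H x integrable_on cbox A y" if "x \<in> cbox a b" for x
        unfolding cbox_interval
        by (rule integrable_continuous_real, rule continuous_on_subset[OF Hc1]) (use that y in auto)
    qed (use Hd ab y in auto)
    have 2: "((\<lambda>(p, c). \<Phi> p c) has_derivative (\<lambda>(tx, ty). tx * integral {A..y} (h p)
         + blinfun_apply (blinfun_mult_right (H p y)) ty)) (at (p, y) within {a..b} \<times> {A..C})"
    proof (rule has_derivative_partialsI[where fy = "\<lambda>p y. blinfun_mult_right (H p y)" and fx = "\<lambda>tx. tx * integral {A..y} (h p)"])
      show "((\<lambda>x. \<Phi> x y) has_derivative (\<lambda>tx. tx * integral {A..y} (h p))) (at p within {a..b})"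
        using 1 by (simp add: has_field_derivative_def mult_commute_abs)
      show "((\<lambda>y. \<Phi> x y) has_derivative blinfun_apply (blinfun_mult_right (H x y))) (at y within {A..C})"
        if "x \<in> {a..b}" "y \<in> {A..C}" for x y
        using integral_has_real_derivative[OF Hc1[OF that(1)] that(2)]
        by (simp add: \<Phi>_def has_field_derivative_def)
      show "continuous (at (p, y) within {a..b} \<times> {A..C}) (\<lambda>(x, y). blinfun_mult_right (H x y))"
      proof -
        have "continuous_on ({a..b} \<times> {A..C}) (\<lambda>z. blinfun_mult_right ((\<lambda>(p, c). H p c) z))"
          by (intro bounded_linear.continuous_on[OF bounded_linear_blinfun_mult_right] Hc)
        then show ?thesis
          using ab y by (auto simp: continuous_on_eq_continuous_within case_prod_unfold)
      qed
    qed (use y in auto)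
    have 3: "((\<lambda>p. (p, g p)) has_derivative (\<lambda>t. (t, g' * t))) (at p within {a..b})"
      using g by (auto intro!: derivative_eq_intros simp: has_field_derivative_def)
    have "((\<lambda>p. (\<lambda>(p, c). \<Phi> p c) (p, g p)) has_derivative (\<lambda>t. (\<lambda>(tx, ty). tx * integral {A..y} (h p)
         + blinfun_apply (blinfun_mult_right (H p y)) ty) (t, g' * t))) (at p within {a..b})"
    proof -
      have "((\<lambda>(p, c). \<Phi> p c) has_derivative (\<lambda>(tx, ty). tx * integral {A..y} (h p)
         + blinfun_apply (blinfun_mult_right (H p y)) ty)) (at (p, g p) within (\<lambda>p. (p, g p)) ` {a..b})"
        using 2 unfolding y_def by (rule has_derivative_subset) (use gr in auto)
      from diff_chain_within[OF 3 this] show ?thesis by (simp add: o_def)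
    qed
    then show ?thesis
      unfolding has_field_derivative_def y_def
      by (simp, elim back_subst[where P = "\<lambda>F. (_ has_derivative F) _"]) (auto simp: algebra_simps)
  qed
  have "((\<lambda>p. \<Phi> p (m p) - \<Phi> p (l p)) has_real_derivative
     (integral {A..m p} (h p) + H p (m p) * m') - (integral {A..l p} (h p) + H p (l p) * l')) (at p within {a..b})"
    using lm by (intro DERIV_diff d\<Phi> l m) force+
  moreover have "integral {A..m p} f - integral {A..l p} f = integral {l p..m p} f"
    if "continuous_on {A..C} f" "p \<in> {a..b}" for f :: "real \<Rightarrow> real" and p
  proof -
    have "integral {A..l p} f + integral {l p..m p} f = integral {A..m p} f"
      by (rule Henstock_Kurzweil_Integration.integral_combine)
         (use lm[OF that(2)] in \<open>auto intro!: integrable_continuous_real continuous_on_subset[OF that(1)]\<close>)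
    then show ?thesis by simp
  qed
  note * = this
  have e1: "\<Phi> p (m p) - \<Phi> p (l p) = integral {l p..m p} (H p)" if "p \<in> {a..b}" for p
    unfolding \<Phi>_def using *[OF Hc1[OF that] that] .
  have e2: "integral {A..m p} (h p) + H p (m p) * m' - (integral {A..l p} (h p) + H p (l p) * l')
     = integral {l p..m p} (h p) + H p (m p) * m' - H p (l p) * l'"
    using *[OF hc1[OF ab] ab] by simp
  ultimately have "((\<lambda>p. \<Phi> p (m p) - \<Phi> p (l p)) has_real_derivative
     integral {l p..m p} (h p) + H p (m p) * m' - H p (l p) * l') (at p within {a..b})"
    by simp
  then show ?thesis
    by (rule has_field_derivative_transform_within[OF _ zero_less_one ab]) (use e1 in auto)
qed

text \<open>Here \<open>H\<close> is differentiable in \<open>p\<close> only from the region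
  \<open>l p \<le> c \<le> m p\<close> up to the exit parameter \<open>p0 c\<close>, as for a kernel
  that satisfies its equation only inside the triangle. Integrating \<open>h\<close> backwards from
  \<open>p0 c\<close> yields \<open>G\<close>, which is differentiable on the whole rectangle and
  equals \<open>H\<close> on the region, so the rule for full rectangles applies to
  \<open>G\<close>.\<close>

lemma has_real_derivative_integral_region:
  fixes H h :: "real \<Rightarrow> real \<Rightarrow> real"
  assumes p: "p \<in> {0..b}"
    and Hc: "continuous_on ({0..b} \<times> {0..C}) (\<lambda>(p, c). H p c)"
    and hc: "continuous_on ({0..b} \<times> {0..C}) (\<lambda>(p, c). h p c)"
    and p0: "continuous_on {0..C} p0" "\<And>c. c \<in> {0..C} \<Longrightarrow> p0 c \<in> {0..b}"
    and reg: "\<And>p c. p \<in> {0..b} \<Longrightarrow> l p \<le> c \<Longrightarrow> c \<le> m p \<Longrightarrow> p \<le> p0 c"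
    and Hd: "\<And>p c s. p \<in> {0..b} \<Longrightarrow> l p \<le> c \<Longrightarrow> c \<le> m p \<Longrightarrow> p < p0 c \<Longrightarrow> s \<in> {p..p0 c} \<Longrightarrow>
        ((\<lambda>s. H s c) has_real_derivative h s c) (at s within {p..p0 c})"
    and lm: "\<And>p. p \<in> {0..b} \<Longrightarrow> 0 \<le> l p \<and> l p \<le> m p \<and> m p \<le> C"
    and l: "(l has_real_derivative l') (at p within {0..b})"
    and m: "(m has_real_derivative m') (at p within {0..b})"
  shows "((\<lambda>p. integral {l p..m p} (H p)) has_real_derivative
     integral {l p..m p} (h p) + H p (m p) * m' - H p (l p) * l') (at p within {0..b})"
proof -
  define G where "G p c = (H (p0 c) c - integral {0..p0 c} (\<lambda>s. h s c)) + integral {0..p} (\<lambda>s. h s c)" for p c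
  have hc1: "continuous_on {0..b} (\<lambda>s. h s c)" if "c \<in> {0..C}" for c
    by (rule continuous_on_comp2[OF hc]) (use that in \<open>auto intro!: continuous_intros\<close>)
  have GH: "G p c = H p c" if pc: "p \<in> {0..b}" "l p \<le> c" "c \<le> m p" for p c
  proof -
    have c: "c \<in> {0..C}" using lm[OF pc(1)] pc by auto
    have le: "p \<le> p0 c" "p0 c \<in> {0..b}" using reg[OF pc] p0(2)[OF c] by auto
    have "((\<lambda>s. h s c) has_integral (H (p0 c) c - H p c)) {p..p0 c}"
    proof (cases "p < p0 c")
      case True
      then show ?thesis using Hd[OF pc]
        by (intro fundamental_theorem_of_calculus) (auto simp: has_real_derivative_iff_has_vector_derivative)
    next
      case False then show ?thesis using le by (simp add: has_integral_refl(2))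
    qed
    moreover have "integral {0..p} (\<lambda>s. h s c) + integral {p..p0 c} (\<lambda>s. h s c) = integral {0..p0 c} (\<lambda>s. h s c)"
      by (rule Henstock_Kurzweil_Integration.integral_combine)
         (use le pc in \<open>auto intro!: integrable_continuous_real continuous_on_subset[OF hc1[OF c]]\<close>)
    ultimately show ?thesis by (simp add: G_def has_integral_iff)
  qed
  have Gc: "continuous_on ({0..b} \<times> {0..C}) (\<lambda>(p, c). G p c)"
  proof -
    have c1: "continuous_on ({0..b} \<times> {0..C}) (\<lambda>z. p0 (snd z))"
      by (rule continuous_on_compose2[OF p0(1)]) (auto intro!: continuous_intros)
    have "continuous_on ({0..b} \<times> {0..C}) (\<lambda>z. H (p0 (snd z)) (snd z))"
      by (rule continuous_on_comp2[OF Hc c1]) (use p0(2) in \<open>auto intro!: continuous_intros\<close>)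
    moreover have "continuous_on ({0..b} \<times> {0..C}) (\<lambda>z. integral {0..p0 (snd z)} (\<lambda>s. h s (snd z)))"
      by (rule continuous_on_integral_upper[OF c1])
         (use p0(2) in \<open>force simp: case_prod_unfold intro!: continuous_on_comp2[OF hc] continuous_intros\<close>)+
    moreover have "continuous_on ({0..b} \<times> {0..C}) (\<lambda>z. integral {0..fst z} (\<lambda>s. h s (snd z)))"
      by (rule continuous_on_integral_upper)
         (force simp: case_prod_unfold intro!: continuous_on_comp2[OF hc] continuous_intros)+
    ultimately show ?thesis unfolding G_def case_prod_unfold by (intro continuous_intros)
  qed
  have "((\<lambda>p. integral {l p..m p} (G p)) has_real_derivative
     integral {l p..m p} (h p) + G p (m p) * m' - G p (l p) * l') (at p within {0..b})"
  proof (rule has_real_derivative_moving_integral[OF p Gc hc _ lm l m])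
    show "((\<lambda>p. G p c) has_real_derivative h p c) (at p within {0..b})" if "p \<in> {0..b}" "c \<in> {0..C}" for p c
      unfolding G_def using integral_has_real_derivative[OF hc1[OF that(2)] that(1)]
      by (auto intro!: derivative_eq_intros)
  qed
  then have "((\<lambda>p. integral {l p..m p} (G p)) has_real_derivative
     integral {l p..m p} (h p) + H p (m p) * m' - H p (l p) * l') (at p within {0..b})"
    using GH[OF p] lm[OF p] by simp
  then show ?thesis
    by (rule has_field_derivative_transform_within[OF _ zero_less_one p])
       (auto intro!: Henstock_Kurzweil_Integration.integral_cong GH)
qed

section \<open>Transport systems with state feedback\<close>

text \<open>
  Component \<open>0\<close> is \<open>v\<close>, which enters at \<open>x = 1\<close> with speed \<open>a 0 < 0\<close>; components \<open>1, \<dots>, n\<close> are the \<open>u\<^sup>i\<close>,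
  which enter at \<open>x = 0\<close>. All zero-order couplings are in \<open>cf\<close> and the gains of the feedback law in \<open>kk\<close>.
\<close>

locale transport =
  fixes n :: nat and a :: "nat \<Rightarrow> real \<Rightarrow> real" and cf :: "nat \<Rightarrow> nat \<Rightarrow> real \<Rightarrow> real"
    and q :: "nat \<Rightarrow> real" and kk :: "nat \<Rightarrow> real \<Rightarrow> real"
  assumes a_cont: "i \<le> n \<Longrightarrow> continuous_on {0..1} (a i)"
    and a_pos: "i \<in> {1..n} \<Longrightarrow> x \<in> {0..1} \<Longrightarrow> a i x > 0"
    and a_neg: "x \<in> {0..1} \<Longrightarrow> a 0 x < 0"
    and cf_cont: "i \<le> n \<Longrightarrow> j \<le> n \<Longrightarrow> continuous_on {0..1} (cf i j)"
    and kk_cont: "j \<le> n \<Longrightarrow> continuous_on {0..1} (kk j)"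
begin

definition inflow :: "nat \<Rightarrow> real" where "inflow i = (if i = 0 then 1 else 0)"

definition feedback :: "(nat \<Rightarrow> real \<Rightarrow> real) \<Rightarrow> real" where
  "feedback z = (\<Sum>j\<le>n. integral {0..1} (\<lambda>\<xi>. kk j \<xi> * z j \<xi>))"

definition bval :: "nat \<Rightarrow> (nat \<Rightarrow> real \<Rightarrow> real) \<Rightarrow> real" where
  "bval i z = (if i = 0 then feedback z else q i * z 0 0)"

definition src :: "(nat \<Rightarrow> real \<Rightarrow> real \<Rightarrow> real) \<Rightarrow> nat \<Rightarrow> real \<Rightarrow> real \<Rightarrow> real" where
  "src z i t x = (\<Sum>j\<le>n. cf i j x * z j t x)"

text \<open>The feedback is built into the boundary value, so this describes the closed loop and not
  a system with free input. Joint continuity of both derivatives permits differentiation under every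
  spatial integral.\<close>

definition smooth_sol :: "(nat \<Rightarrow> real \<Rightarrow> real \<Rightarrow> real) \<Rightarrow> (nat \<Rightarrow> real \<Rightarrow> real \<Rightarrow> real) \<Rightarrow>
    (nat \<Rightarrow> real \<Rightarrow> real \<Rightarrow> real) \<Rightarrow> bool" where
  "smooth_sol z zt zx \<longleftrightarrow> (\<forall>i\<le>n.
     continuous_on ({0..} \<times> {0..1}) (\<lambda>(t, x). z i t x) \<and>
     continuous_on ({0..} \<times> {0..1}) (\<lambda>(t, x). zt i t x) \<and>
     continuous_on ({0..} \<times> {0..1}) (\<lambda>(t, x). zx i t x) \<and>
     (\<forall>t\<ge>0. z i t (inflow i) = bval i (\<lambda>j. z j t) \<and>
       (\<forall>x\<in>{0..1}. ((\<lambda>t. z i t x) has_real_derivative zt i t x) (at t within {0..}) \<and>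
         (z i t has_real_derivative zx i t x) (at x within {0..1}) \<and>
         zt i t x + a i x * zx i t x = src z i t x)))"

lemma a_nonzero: "i \<le> n \<Longrightarrow> x \<in> {0..1} \<Longrightarrow> a i x \<noteq> 0"
  using a_pos[of i x] a_neg[of x] by (cases "i = 0") auto

lemma inflow_in: "inflow i \<in> {0..1}" by (simp add: inflow_def)

lemma cf_bound: "\<exists>M>0. \<forall>i\<le>n. \<forall>x\<in>{0..1}. (\<Sum>j\<le>n. \<bar>cf i j x\<bar>) \<le> M"
proof -
  have c: "continuous_on {0..1} (\<lambda>x. \<Sum>i\<le>n. \<Sum>j\<le>n. \<bar>cf i j x\<bar>)"
    by (intro continuous_intros cf_cont) auto
  from compact_imp_bounded[OF compact_continuous_image[OF c compact_Icc]]
  obtain M where M: "M > 0" "\<And>x. x \<in> {0..1} \<Longrightarrow> \<bar>\<Sum>i\<le>n. \<Sum>j\<le>n. \<bar>cf i j x\<bar>\<bar> \<le> M"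
    unfolding bounded_pos by auto
  have "(\<Sum>j\<le>n. \<bar>cf i j x\<bar>) \<le> M" if "i \<le> n" "x \<in> {0..1}" for i x
  proof -
    have "(\<Sum>j\<le>n. \<bar>cf i j x\<bar>) \<le> (\<Sum>i\<le>n. \<Sum>j\<le>n. \<bar>cf i j x\<bar>)"
      by (rule member_le_sum[of i "{..n}" "\<lambda>i. \<Sum>j\<le>n. \<bar>cf i j x\<bar>"]) (use that in \<open>auto intro: sum_nonneg\<close>)
    then show ?thesis using M(2)[OF that(2)] by linarith
  qed
  then show ?thesis using M(1) by blast
qed

lemma kk_bound: "\<exists>M>0. \<forall>x\<in>{0..1}. (\<Sum>j\<le>n. \<bar>kk j x\<bar>) \<le> M"
proof -
  have c: "continuous_on {0..1} (\<lambda>x. \<Sum>j\<le>n. \<bar>kk j x\<bar>)"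
    by (intro continuous_intros kk_cont) auto
  from compact_imp_bounded[OF compact_continuous_image[OF c compact_Icc]]
  obtain M where M: "M > 0" "\<And>x. x \<in> {0..1} \<Longrightarrow> \<bar>\<Sum>j\<le>n. \<bar>kk j x\<bar>\<bar> \<le> M"
    unfolding bounded_pos by auto
  then show ?thesis by force
qed

lemma src_cont:
  assumes "i \<le> n" "\<And>j. j \<le> n \<Longrightarrow> continuous_on ({0..} \<times> {0..1}) (\<lambda>(t, x). z j t x)"
  shows "continuous_on ({0..} \<times> {0..1}) (\<lambda>(t, x). src z i t x)"
  unfolding src_def case_prod_unfold
  by (intro continuous_intros continuous_on_comp2[OF assms(2)] continuous_on_compose2[OF cf_cont[OF assms(1)]]) auto

lemma feedback_cont:
  assumes "\<And>j. j \<le> n \<Longrightarrow> continuous_on ({0..} \<times> {0..1}) (\<lambda>(t, x). z j t x)"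
  shows "continuous_on {0..} (\<lambda>t. feedback (\<lambda>j. z j t))"
  unfolding feedback_def
proof (intro continuous_on_sum)
  fix j assume "j \<in> {..n}"
  then have "continuous_on ({0..} \<times> cbox 0 1) (\<lambda>(t, x). kk j x * z j t x)"
    unfolding case_prod_unfold
    by (intro continuous_intros continuous_on_comp2[OF assms] continuous_on_compose2[OF kk_cont]) auto
  from integral_continuous_on_param[OF this]
  show "continuous_on {0..} (\<lambda>t. integral {0..1} (\<lambda>x. kk j x * z j t x))" by simp
qed

lemma bval_cont:
  assumes "\<And>j. j \<le> n \<Longrightarrow> continuous_on ({0..} \<times> {0..1}) (\<lambda>(t, x). z j t x)"
  shows "continuous_on {0..} (\<lambda>t. bval i (\<lambda>j. z j t))"
  using feedback_cont[of z, OF assms]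
  by (cases "i = 0") (auto simp: bval_def intro!: continuous_intros continuous_on_comp2[OF assms[of 0]])

lemma feedback_diff:
  assumes "\<And>j. j \<le> n \<Longrightarrow> continuous_on {0..1} (z j)" "\<And>j. j \<le> n \<Longrightarrow> continuous_on {0..1} (z' j)"
  shows "feedback (\<lambda>j x. z j x - z' j x) = feedback z - feedback z'"
  unfolding feedback_def sum_subtractf[symmetric]
proof (rule sum.cong[OF refl])
  fix j assume "j \<in> {..n}"
  then have "(\<lambda>x. kk j x * z j x) integrable_on {0..1}" "(\<lambda>x. kk j x * z' j x) integrable_on {0..1}"
    by (auto intro!: integrable_continuous_real continuous_intros kk_cont assms)
  from integral_diff[OF this]
  show "integral {0..1} (\<lambda>x. kk j x * (z j x - z' j x)) =
    integral {0..1} (\<lambda>x. kk j x * z j x) - integral {0..1} (\<lambda>x. kk j x * z' j x)"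
    by (simp add: algebra_simps)
qed

lemma bval_diff:
  assumes "\<And>j. j \<le> n \<Longrightarrow> continuous_on {0..1} (z j)" "\<And>j. j \<le> n \<Longrightarrow> continuous_on {0..1} (z' j)"
  shows "bval i (\<lambda>j x. z j x - z' j x) = bval i z - bval i z'"
  using feedback_diff[OF assms] by (simp add: bval_def algebra_simps)

end

section \<open>Mild solutions as fixed points along characteristics\<close>

locale transport_coords = transport +
  fixes T :: "nat \<Rightarrow> real" and P Q :: "nat \<Rightarrow> real \<Rightarrow> real"
  assumes T_pos: "i \<le> n \<Longrightarrow> T i > 0"
    and P_in: "i \<le> n \<Longrightarrow> x \<in> {0..1} \<Longrightarrow> P i x \<in> {0..T i}"
    and Q_in: "i \<le> n \<Longrightarrow> Q i p \<in> {0..1}"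
    and Q_cont: "i \<le> n \<Longrightarrow> continuous_on UNIV (Q i)"
    and QP: "i \<le> n \<Longrightarrow> x \<in> {0..1} \<Longrightarrow> Q i (P i x) = x"
    and PQ: "i \<le> n \<Longrightarrow> p \<in> {0..T i} \<Longrightarrow> P i (Q i p) = p"
    and Q_inflow: "i \<le> n \<Longrightarrow> p \<le> 0 \<Longrightarrow> Q i p = inflow i"
    and P_deriv: "i \<le> n \<Longrightarrow> x \<in> {0..1} \<Longrightarrow> (P i has_real_derivative 1 / a i x) (at x within {0..1})"
begin

lemma P_cont: "i \<le> n \<Longrightarrow> continuous_on {0..1} (P i)"
  using P_deriv by (rule DERIV_continuous_on)

lemma P_inflow: "i \<le> n \<Longrightarrow> P i (inflow i) = 0"
  using PQ[of i 0] Q_inflow[of i 0] T_pos[of i] by auto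

text \<open>
  \<open>P i x\<close> is the travel time from the inflow boundary to \<open>x\<close> and \<open>Q i\<close> its inverse, extended by constants.
  Hence the integral in \<open>Tm\<close> also collects the source at the inflow boundary before the characteristic
  enters; \<open>bd\<close> subtracts this part again, and subtracting \<open>bd z i 0\<close> makes \<open>Tm\<close> continuous without
  compatibility conditions.
\<close>

definition bd :: "(nat \<Rightarrow> real \<Rightarrow> real \<Rightarrow> real) \<Rightarrow> nat \<Rightarrow> real \<Rightarrow> real" where
  "bd z i s = bval i (\<lambda>j. z j s) - integral {0..s} (\<lambda>\<sigma>. src z i \<sigma> (inflow i))"

definition Tm :: "(nat \<Rightarrow> real \<Rightarrow> real) \<Rightarrow> (nat \<Rightarrow> real \<Rightarrow> real \<Rightarrow> real) \<Rightarrow> nat \<Rightarrow> real \<Rightarrow> real \<Rightarrow> real" where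
  "Tm z0 z i t x = z0 i (Q i (P i x - t)) + (bd z i (max 0 (t - P i x)) - bd z i 0)
     + integral {0..t} (\<lambda>s. src z i s (Q i (P i x - t + s)))"

lemma bd_cont:
  assumes "i \<le> n" and z: "\<And>j. j \<le> n \<Longrightarrow> continuous_on ({0..} \<times> {0..1}) (\<lambda>(t, x). z j t x)"
  shows "continuous_on {0..} (bd z i)"
proof -
  have "continuous_on {0..} (\<lambda>s. integral {0..s} (\<lambda>\<sigma>. src z i \<sigma> (inflow i)))"
    by (rule continuous_on_integral_upper)
      (use inflow_in in \<open>auto simp: case_prod_unfold intro!: continuous_intros continuous_on_comp2[OF src_cont[OF assms]]\<close>)
  then show ?thesis
    unfolding bd_def by (intro continuous_on_diff bval_cont[OF z])
qed

lemma Tm_cont: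
  assumes i: "i \<le> n" and z: "\<And>j. j \<le> n \<Longrightarrow> continuous_on ({0..} \<times> {0..1}) (\<lambda>(t, x). z j t x)"
    and z0: "continuous_on {0..1} (z0 i)"
  shows "continuous_on ({0..} \<times> {0..1}) (\<lambda>(t, x). Tm z0 z i t x)"
proof -
  let ?S = "{0..} \<times> {0..1::real} :: (real \<times> real) set"
  have Pc: "continuous_on ?S (\<lambda>u. P i (snd u))"
    by (rule continuous_on_compose2[OF P_cont[OF i]]) (auto intro!: continuous_intros)
  have c1: "continuous_on ?S (\<lambda>u. z0 i (Q i (P i (snd u) - fst u)))"
    by (rule continuous_on_compose2[OF z0], rule continuous_on_compose2[OF Q_cont[OF i]])
      (use Q_in i in \<open>auto intro!: continuous_intros Pc\<close>)
  have c2: "continuous_on ?S (\<lambda>u. bd z i (max 0 (fst u - P i (snd u))))"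
    by (rule continuous_on_compose2[OF bd_cont[OF i z]])
      (auto intro!: continuous_intros Pc)
  have c3: "continuous_on ?S (\<lambda>u. integral {0..fst u} (\<lambda>s. src z i s (Q i (P i (snd u) - fst u + s))))"
  proof (rule continuous_on_integral_upper)
    let ?R = "{(u, s). u \<in> ?S \<and> 0 \<le> s \<and> s \<le> fst u}"
    have Pc2: "continuous_on ?R (\<lambda>v. P i (snd (fst v)))"
      by (rule continuous_on_compose2[OF Pc]) (auto intro!: continuous_intros)
    have "continuous_on ?R (\<lambda>v. Q i (P i (snd (fst v)) - fst (fst v) + snd v))"
      by (rule continuous_on_compose2[OF Q_cont[OF i]]) (auto intro!: continuous_intros Pc2)
    then show "continuous_on ?R (\<lambda>(u, s). src z i s (Q i (P i (snd u) - fst u + s)))"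
      unfolding case_prod_unfold
      by (intro continuous_on_comp2[OF src_cont[OF i z]]) (use Q_in[OF i] in \<open>auto intro!: continuous_intros\<close>)
  qed (auto intro!: continuous_intros)
  show ?thesis unfolding Tm_def case_prod_unfold
    by (intro continuous_intros c1 c2 c3)
qed

end

lemma integral_exp_bound:
  fixes f :: "real \<Rightarrow> real"
  assumes "continuous_on {0..c} f" "\<And>s. s \<in> {0..c} \<Longrightarrow> \<bar>f s\<bar> \<le> L * exp (\<gamma> * s)" "\<gamma> > 0" "c \<ge> 0" "L \<ge> 0"
  shows "\<bar>integral {0..c} f\<bar> \<le> L * (exp (\<gamma> * c) / \<gamma>)"
proof -
  have "((\<lambda>s. L * exp (\<gamma> * s)) has_integral (L * (exp (\<gamma> * c) / \<gamma>) - L * (exp (\<gamma> * 0) / \<gamma>))) {0..c}"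
    by (rule fundamental_theorem_of_calculus)
       (use assms(3,4) in \<open>auto simp: has_real_derivative_iff_has_vector_derivative[symmetric] intro!: derivative_eq_intros\<close>)
  then have i: "(\<lambda>s. L * exp (\<gamma> * s)) integrable_on {0..c}" "integral {0..c} (\<lambda>s. L * exp (\<gamma> * s)) = L * (exp (\<gamma> * c) / \<gamma>) - L / \<gamma>"
    by (auto simp: has_integral_iff)
  have "norm (integral {0..c} f) \<le> integral {0..c} (\<lambda>s. L * exp (\<gamma> * s))"
    by (rule integral_norm_bound_integral[OF integrable_continuous_real[OF assms(1)] i(1)]) (use assms(2) in auto)
  then show ?thesis using i(2) divide_nonneg_pos[OF assms(5,3)] by simp
qed

context transport_coords
begin

text \<open>
  The weights by which \<open>Tm\<close> becomes a contraction: a large \<open>\<kappa>\<close> makes the feedback from the \<open>u\<^sup>i\<close> small, and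
  \<open>exp (- \<delta> (1 - x))\<close> with large \<open>\<delta>\<close> both the feedback from \<open>v\<close> and the reflection at \<open>x = 0\<close>.
\<close>

definition wt :: "real \<Rightarrow> real \<Rightarrow> nat \<Rightarrow> real \<Rightarrow> real" where
  "wt \<kappa> \<delta> j x = (if j = 0 then exp (- \<delta> * (1 - x)) else 1 / \<kappa>)"

text \<open>\<open>Tm\<close> is affine in \<open>z\<close>, with the contribution of
  \<open>z0\<close> as constant part; a bound for zero initial data is thus a Lipschitz bound for
  arbitrary data.\<close>

lemma Tm_diff:
  assumes i: "i \<le> n" and t: "t \<ge> 0" and x: "x \<in> {0..1}"
    and z: "\<And>j. j \<le> n \<Longrightarrow> continuous_on ({0..} \<times> {0..1}) (\<lambda>(t, x). z j t x)"
    and z': "\<And>j. j \<le> n \<Longrightarrow> continuous_on ({0..} \<times> {0..1}) (\<lambda>(t, x). z' j t x)"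
  shows "Tm z0 z i t x - Tm z0 z' i t x = Tm (\<lambda>_ _. 0) (\<lambda>j t x. z j t x - z' j t x) i t x"
proof -
  have src: "src (\<lambda>j t x. z j t x - z' j t x) i s x = src z i s x - src z' i s x" for s x
    by (simp add: src_def sum_subtractf algebra_simps)
  have sc: "continuous_on {0..c} (\<lambda>s. src z i s (g s))"
    if "\<And>j. j \<le> n \<Longrightarrow> continuous_on ({0..} \<times> {0..1}) (\<lambda>(t, x). z j t x)"
      "continuous_on {0..c} g" "\<And>s. g s \<in> {0..1}" for z g c
    by (rule continuous_on_comp2[OF src_cont[OF i that(1)]]) (use that in \<open>auto intro!: continuous_intros\<close>)
  have int: "integral {0..c} (\<lambda>s. src z i s (g s) - src z' i s (g s)) =
      integral {0..c} (\<lambda>s. src z i s (g s)) - integral {0..c} (\<lambda>s. src z' i s (g s))"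
    if "continuous_on {0..c} g" "\<And>s. g s \<in> {0..1}" for c g
    by (rule integral_diff) (auto intro!: integrable_continuous_real sc z z' that)
  have slice: "continuous_on {0..1} (z j s)" if "j \<le> n" "s \<ge> 0"
    "\<And>j. j \<le> n \<Longrightarrow> continuous_on ({0..} \<times> {0..1}) (\<lambda>(t, x). z j t x)" for z j s
    by (rule continuous_on_comp2[OF that(3)[OF that(1)]]) (use that in \<open>auto intro!: continuous_intros\<close>)
  have bd: "bd (\<lambda>j t x. z j t x - z' j t x) i s = bd z i s - bd z' i s" if "s \<ge> 0" for s
  proof -
    have "bval i (\<lambda>j x. z j s x - z' j s x) = bval i (\<lambda>j. z j s) - bval i (\<lambda>j. z' j s)"
      by (rule bval_diff) (use that z z' in \<open>auto intro!: slice\<close>)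
    then show ?thesis unfolding bd_def src by (subst int) (use inflow_in[of i] in auto)
  qed
  have Qc: "continuous_on {0..t} (\<lambda>s. Q i (P i x - t + s))"
    by (rule continuous_on_compose2[OF Q_cont[OF i]]) (auto intro!: continuous_intros)
  show ?thesis
    unfolding Tm_def src using bd by (subst int[OF Qc]) (use Q_in[OF i] in auto)
qed

text \<open>The speed of \<open>v\<close> is at most \<open>M\<close>, so the way from the inflow
  point \<open>1\<close> to \<open>x\<close> takes at least \<open>(1 - x) / M\<close>. This
  converts the delay factor \<open>exp (- \<gamma> * P 0 x)\<close> into the spatial weight of
  component \<open>0\<close>.\<close>

lemma P0_lower:
  assumes M: "\<And>x. x \<in> {0..1} \<Longrightarrow> - a 0 x \<le> M" "M > 0" and x: "x \<in> {0..1}"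
  shows "(1 - x) / M \<le> P 0 x"
proof (cases "x = 1")
  case True
  then show ?thesis using P_in[of 0 x] by auto
next
  case False
  have c: "continuous_on {x..1} (P 0)" using P_cont[of 0] by (rule continuous_on_subset) (use x in auto)
  have d: "\<exists>y. DERIV (\<lambda>u. P 0 u + u / M) u :> y \<and> y \<le> 0" if "x < u" "u < 1" for u
  proof -
    have u: "u \<in> {0..1}" using that x by auto
    have "DERIV (P 0) u :> 1 / a 0 u"
      using P_deriv[of 0 u] that x by (simp add: at_within_Icc_at)
    then have "DERIV (\<lambda>u. P 0 u + u / M) u :> 1 / a 0 u + 1 / M" using M(2) by (auto intro!: derivative_eq_intros)
    moreover have "1 / a 0 u + 1 / M \<le> 0"
    proof -
      have "1 / M \<le> 1 / (- a 0 u)"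
        using M u a_neg[OF u] by (intro divide_left_mono) (auto intro: mult_pos_neg)
      then show ?thesis by simp
    qed
    ultimately show ?thesis by blast
  qed
  have "P 0 1 + 1 / M \<le> P 0 x + x / M"
    by (rule DERIV_nonpos_imp_decreasing_open[of x 1 "\<lambda>u. P 0 u + u / M"])
       (use d x c M(2) in \<open>auto intro!: continuous_intros\<close>)
  moreover have "P 0 1 = 0" using P_inflow[of 0] by (simp add: inflow_def)
  ultimately show ?thesis by (simp add: diff_divide_distrib)
qed

text \<open>A boundary value reaches \<open>x\<close> with delay \<open>P i x\<close>, which in a
  norm growing like \<open>exp (\<gamma> * t)\<close> is worth a factor
  \<open>exp (- \<gamma> * P i x)\<close>; a source gains \<open>1 / \<gamma>\<close> from the time
  integral. Conditions \<open>c1\<close> and \<open>c2\<close> say that these contributions add up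
  to at most half of the weight, for \<open>v\<close> and for the components
  \<open>1, ..., n\<close> respectively.\<close>

lemma Tm_weighted_bound:
  assumes Cm: "\<And>i x. i \<le> n \<Longrightarrow> x \<in> {0..1} \<Longrightarrow> (\<Sum>j\<le>n. \<bar>cf i j x\<bar>) \<le> Cm" "Cm > 0"
    and Km: "\<And>x. x \<in> {0..1} \<Longrightarrow> (\<Sum>j\<le>n. \<bar>kk j x\<bar>) \<le> Km" "Km > 0"
    and Qm: "\<And>i. i \<le> n \<Longrightarrow> \<bar>q i\<bar> \<le> Qm" "Qm > 0"
    and M: "\<And>x. x \<in> {0..1} \<Longrightarrow> - a 0 x \<le> M" "M > 0"
    and \<kappa>: "\<kappa> \<ge> 1" and \<delta>: "\<delta> > 0" and \<gamma>: "\<gamma> > 0" "\<gamma> \<ge> \<delta> * M"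
    and c1: "2 * (Km / \<kappa> + Km / \<delta> + Cm / \<gamma>) + Cm / \<gamma> * exp \<delta> \<le> 1 / 2"
    and c2: "2 * (Qm * exp (- \<delta>) + Cm / \<gamma>) + Cm / \<gamma> \<le> 1 / (2 * \<kappa>)"
    and z: "\<And>j. j \<le> n \<Longrightarrow> continuous_on ({0..} \<times> {0..1}) (\<lambda>(t, x). z j t x)"
    and N: "N \<ge> 0" "\<And>j t x. j \<le> n \<Longrightarrow> t \<ge> 0 \<Longrightarrow> x \<in> {0..1} \<Longrightarrow> \<bar>z j t x\<bar> \<le> N * (exp (\<gamma> * t) * wt \<kappa> \<delta> j x)"
    and i: "i \<le> n" and t: "t \<ge> 0" and x: "x \<in> {0..1}"
  shows "\<bar>Tm (\<lambda>_ _. 0) z i t x\<bar> \<le> N * (exp (\<gamma> * t) * wt \<kappa> \<delta> i x) / 2"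
proof -
  have wt1: "wt \<kappa> \<delta> j y \<le> 1" if "y \<in> {0..1}" for j y
    using that \<kappa> \<delta> by (auto simp: wt_def)
  have z1: "\<bar>z j s y\<bar> \<le> N * exp (\<gamma> * s)" if "j \<le> n" "s \<ge> 0" "y \<in> {0..1}" for j s y
  proof -
    have "N * (exp (\<gamma> * s) * wt \<kappa> \<delta> j y) \<le> N * (exp (\<gamma> * s) * 1)"
      using N(1) wt1[OF that(3)] by (intro mult_left_mono) auto
    then show ?thesis using N(2)[OF that] by simp
  qed
  have src: "\<bar>src z i s y\<bar> \<le> Cm * N * exp (\<gamma> * s)" if "s \<ge> 0" "y \<in> {0..1}" for s y
  proof -
    have "\<bar>src z i s y\<bar> \<le> (\<Sum>j\<le>n. \<bar>cf i j y\<bar> * (N * exp (\<gamma> * s)))"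
      unfolding src_def by (rule order_trans[OF sum_abs]) (auto simp: abs_mult intro!: sum_mono mult_left_mono z1 that)
    also have "\<dots> \<le> Cm * (N * exp (\<gamma> * s))"
      unfolding sum_distrib_right[symmetric] using Cm(1)[OF i that(2)] N(1) by (intro mult_right_mono) auto
    finally show ?thesis by (simp add: mult.assoc)
  qed
  have isrc: "\<bar>integral {0..c} (\<lambda>s. src z i s (g s))\<bar> \<le> Cm * N * (exp (\<gamma> * c) / \<gamma>)"
    if "c \<ge> 0" "continuous_on {0..c} g" "\<And>s. g s \<in> {0..1}" for c g
    by (rule integral_exp_bound)
       (use that src Cm(2) N(1) \<gamma> in \<open>auto intro!: continuous_intros continuous_on_comp2[OF src_cont[OF i z]]\<close>)
  have eint: "((\<lambda>x. Km * (N * exp (\<gamma> * s)) * (exp (- \<delta> * (1 - x)) + 1 / \<kappa>)) has_integral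
       Km * (N * exp (\<gamma> * s)) * (exp (- \<delta> * (1 - 1)) / \<delta> + 1 / \<kappa>) - Km * (N * exp (\<gamma> * s)) * (exp (- \<delta> * (1 - 0)) / \<delta> + 0 / \<kappa>)) {0..1}" for s
    by (rule fundamental_theorem_of_calculus)
       (use \<delta> \<kappa> in \<open>auto simp: has_real_derivative_iff_has_vector_derivative[symmetric] intro!: derivative_eq_intros\<close>)
  have fb: "\<bar>feedback (\<lambda>j. z j s)\<bar> \<le> N * exp (\<gamma> * s) * (Km / \<kappa> + Km / \<delta>)" if s: "s \<ge> 0" for s
  proof -
    have kz: "continuous_on {0..1} (\<lambda>\<xi>. kk j \<xi> * z j s \<xi>)" if "j \<le> n" for j
      using that s by (auto intro!: continuous_intros kk_cont continuous_on_comp2[OF z])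
    have e: "feedback (\<lambda>j. z j s) = integral {0..1} (\<lambda>\<xi>. \<Sum>j\<le>n. kk j \<xi> * z j s \<xi>)"
      unfolding feedback_def by (rule integral_sum[symmetric]) (auto intro!: integrable_continuous_real kz)
    have "norm (integral {0..1} (\<lambda>\<xi>. \<Sum>j\<le>n. kk j \<xi> * z j s \<xi>)) \<le>
        integral {0..1} (\<lambda>x. Km * (N * exp (\<gamma> * s)) * (exp (- \<delta> * (1 - x)) + 1 / \<kappa>))"
    proof (rule integral_norm_bound_integral)
      show "(\<lambda>\<xi>. \<Sum>j\<le>n. kk j \<xi> * z j s \<xi>) integrable_on {0..1}"
        by (auto intro!: integrable_continuous_real continuous_on_sum kz)
      show "(\<lambda>x. Km * (N * exp (\<gamma> * s)) * (exp (- \<delta> * (1 - x)) + 1 / \<kappa>)) integrable_on {0..1}"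
        using eint by blast
      fix \<xi> :: real assume \<xi>: "\<xi> \<in> {0..1}"
      have "\<bar>\<Sum>j\<le>n. kk j \<xi> * z j s \<xi>\<bar> \<le> (\<Sum>j\<le>n. \<bar>kk j \<xi>\<bar> * ((N * exp (\<gamma> * s)) * (exp (- \<delta> * (1 - \<xi>)) + 1 / \<kappa>)))"
      proof (rule order_trans[OF sum_abs], rule sum_mono)
        fix j assume j: "j \<in> {..n}"
        have "wt \<kappa> \<delta> j \<xi> \<le> exp (- \<delta> * (1 - \<xi>)) + 1 / \<kappa>" using \<kappa> by (auto simp: wt_def)
        then have "N * (exp (\<gamma> * s) * wt \<kappa> \<delta> j \<xi>) \<le> N * exp (\<gamma> * s) * (exp (- \<delta> * (1 - \<xi>)) + 1 / \<kappa>)"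
          using N(1) by (simp add: mult.assoc mult_left_mono)
        then have "\<bar>z j s \<xi>\<bar> \<le> N * exp (\<gamma> * s) * (exp (- \<delta> * (1 - \<xi>)) + 1 / \<kappa>)"
          using N(2)[OF _ s \<xi>, of j] j by auto
        then show "\<bar>kk j \<xi> * z j s \<xi>\<bar> \<le> \<bar>kk j \<xi>\<bar> * (N * exp (\<gamma> * s) * (exp (- \<delta> * (1 - \<xi>)) + 1 / \<kappa>))"
          by (simp add: abs_mult mult_left_mono)
      qed
      also have "\<dots> \<le> Km * ((N * exp (\<gamma> * s)) * (exp (- \<delta> * (1 - \<xi>)) + 1 / \<kappa>))"
        unfolding sum_distrib_right[symmetric] using Km(1)[OF \<xi>] N(1) \<kappa> by (intro mult_right_mono) auto
      finally show "norm (\<Sum>j\<le>n. kk j \<xi> * z j s \<xi>) \<le> Km * (N * exp (\<gamma> * s)) * (exp (- \<delta> * (1 - \<xi>)) + 1 / \<kappa>)"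
        by (simp add: mult.assoc)
    qed
    also have "\<dots> \<le> Km * (N * exp (\<gamma> * s)) * (1 / \<delta> + 1 / \<kappa>)"
      unfolding integral_unique[OF eint] using Km(2) N(1) \<delta> by simp
    finally show ?thesis unfolding e by (simp add: algebra_simps)
  qed
  \<comment> \<open>Weighted norm of the boundary operator. Integrating the weights
    \<open>1 / \<kappa>\<close> and \<open>exp (- \<delta> * (1 - x))\<close> over
    \<open>{0..1}\<close> gives the two terms for the feedback; \<open>exp (- \<delta>)\<close> is
    the weight of \<open>v\<close> at the reflecting end \<open>x = 0\<close>.\<close>
  define b where "b = (if i = 0 then Km / \<kappa> + Km / \<delta> else Qm * exp (- \<delta>))"
  have bv: "\<bar>bval i (\<lambda>j. z j s)\<bar> \<le> N * exp (\<gamma> * s) * b" if s: "s \<ge> 0" for s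
  proof (cases "i = 0")
    case True then show ?thesis using fb[OF s] by (simp add: bval_def b_def)
  next
    case False
    have "\<bar>q i\<bar> * \<bar>z 0 s 0\<bar> \<le> Qm * (N * (exp (\<gamma> * s) * exp (- \<delta>)))"
      using N(2)[of 0 s 0] s Qm(1)[OF i] Qm(2) by (intro mult_mono) (auto simp: wt_def)
    then show ?thesis using False by (simp add: bval_def b_def abs_mult algebra_simps)
  qed
  have bdb: "\<bar>bd z i s\<bar> \<le> N * exp (\<gamma> * s) * (b + Cm / \<gamma>)" if "s \<ge> 0" for s
    using bv[OF that] isrc[OF that, of "\<lambda>_. inflow i"] inflow_in[of i]
    by (auto simp: bd_def algebra_simps intro!: order_trans[OF abs_triangle_ineq4])
  have b0: "b + Cm / \<gamma> \<ge> 0" using Km(2) \<kappa> \<delta> Qm(2) Cm(2) \<gamma> by (auto simp: b_def)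
  define c where "c = max 0 (t - P i x)"
  have Pn: "P i x \<ge> 0" using P_in[OF i x] by auto
  \<comment> \<open>The factor \<open>2\<close> pays for the subtracted value
    \<open>bd z i 0\<close>; as long as the boundary signal has not arrived, \<open>c = 0\<close>
    and the difference vanishes.\<close>
  have bdd: "\<bar>bd z i c - bd z i 0\<bar> \<le> N * exp (\<gamma> * (t - P i x)) * (2 * (b + Cm / \<gamma>))"
  proof (cases "t \<le> P i x")
    case True then show ?thesis using b0 N(1) by (simp add: c_def)
  next
    case False
    have "\<bar>bd z i 0\<bar> \<le> N * exp (\<gamma> * c) * (b + Cm / \<gamma>)"
    proof -
      have "N * 1 \<le> N * exp (\<gamma> * c)" using N(1) \<gamma>(1) by (intro mult_left_mono) (auto simp: c_def)
      then have "N * 1 * (b + Cm / \<gamma>) \<le> N * exp (\<gamma> * c) * (b + Cm / \<gamma>)" using b0 by (rule mult_right_mono)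
      then show ?thesis using bdb[of 0] by simp
    qed
    moreover have "\<bar>bd z i c\<bar> \<le> N * exp (\<gamma> * c) * (b + Cm / \<gamma>)" by (rule bdb) (simp add: c_def)
    ultimately have "\<bar>bd z i c - bd z i 0\<bar> \<le> N * exp (\<gamma> * c) * (2 * (b + Cm / \<gamma>))"
      unfolding mult.left_commute[of _ 2] by linarith
    moreover have "c = t - P i x" using False by (simp add: c_def)
    ultimately show ?thesis by simp
  qed
  have "\<bar>integral {0..t} (\<lambda>s. src z i s (Q i (P i x - t + s)))\<bar> \<le> Cm * N * (exp (\<gamma> * t) / \<gamma>)"
    by (rule isrc[OF t]) (use Q_in[OF i] in \<open>auto intro!: continuous_intros continuous_on_compose2[OF Q_cont[OF i]]\<close>)
  with bdd have main: "\<bar>Tm (\<lambda>_ _. 0) z i t x\<bar> \<le> N * exp (\<gamma> * (t - P i x)) * (2 * (b + Cm / \<gamma>)) + Cm * N * (exp (\<gamma> * t) / \<gamma>)"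
    unfolding Tm_def c_def by linarith
  have ex: "exp (\<gamma> * (t - P i x)) = exp (\<gamma> * t) * exp (- \<gamma> * P i x)"
    by (simp add: exp_add[symmetric] algebra_simps)
  have key: "exp (- \<gamma> * P i x) * (2 * (b + Cm / \<gamma>)) + Cm / \<gamma> \<le> wt \<kappa> \<delta> i x / 2"
  proof (cases "i = 0")
    case True
    have "\<delta> * (1 - x) \<le> \<gamma> * ((1 - x) / M)"
    proof -
      have "\<delta> \<le> \<gamma> / M" using \<gamma>(2) M(2) by (simp add: pos_le_divide_eq)
      then have "\<delta> * (1 - x) \<le> \<gamma> / M * (1 - x)" using x by (intro mult_right_mono) auto
      then show ?thesis by simp
    qed
    also have "\<dots> \<le> \<gamma> * P i x" using P0_lower[OF M x] True \<gamma>(1) by (intro mult_left_mono) auto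
    finally have "exp (- \<gamma> * P i x) \<le> exp (- \<delta> * (1 - x))" by simp
    then have "exp (- \<gamma> * P i x) * (2 * (b + Cm / \<gamma>)) \<le> exp (- \<delta> * (1 - x)) * (2 * (b + Cm / \<gamma>))"
      using b0 by (intro mult_right_mono) auto
    \<comment> \<open>The source acts without delay, so it has to be compared with the smallest
      value \<open>exp (- \<delta>)\<close> of the weight; this is where \<open>exp \<delta>\<close>
      in \<open>c1\<close> comes from.\<close>
    moreover have "Cm / \<gamma> \<le> exp (- \<delta> * (1 - x)) * (Cm / \<gamma> * exp \<delta>)"
    proof -
      have "1 \<le> exp (- \<delta> * (1 - x)) * exp \<delta>" using \<delta> x by (simp add: exp_add[symmetric] algebra_simps)
      then have "Cm / \<gamma> * 1 \<le> Cm / \<gamma> * (exp (- \<delta> * (1 - x)) * exp \<delta>)"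
        using Cm(2) \<gamma> by (intro mult_left_mono) auto
      then show ?thesis by (simp add: algebra_simps)
    qed
    ultimately have "exp (- \<gamma> * P i x) * (2 * (b + Cm / \<gamma>)) + Cm / \<gamma> \<le>
        exp (- \<delta> * (1 - x)) * (2 * (b + Cm / \<gamma>) + Cm / \<gamma> * exp \<delta>)"
      by (simp add: distrib_left)
    also have "\<dots> \<le> exp (- \<delta> * (1 - x)) * (1 / 2)"
      using c1 True by (intro mult_left_mono) (auto simp: b_def)
    finally show ?thesis using True by (simp add: wt_def)
  next
    case False
    have "exp (- \<gamma> * P i x) * (2 * (b + Cm / \<gamma>)) \<le> 1 * (2 * (b + Cm / \<gamma>))"
      using b0 Pn \<gamma> by (intro mult_right_mono) auto
    then show ?thesis using c2 False by (simp add: b_def wt_def)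
  qed
  have "N * exp (\<gamma> * (t - P i x)) * (2 * (b + Cm / \<gamma>)) + Cm * N * (exp (\<gamma> * t) / \<gamma>)
     = N * exp (\<gamma> * t) * (exp (- \<gamma> * P i x) * (2 * (b + Cm / \<gamma>)) + Cm / \<gamma>)"
    unfolding ex by (simp add: algebra_simps)
  also have "\<dots> \<le> N * exp (\<gamma> * t) * (wt \<kappa> \<delta> i x / 2)"
    using key N(1) by (intro mult_left_mono) auto
  finally have "\<bar>Tm (\<lambda>_ _. 0) z i t x\<bar> \<le> N * exp (\<gamma> * t) * (wt \<kappa> \<delta> i x / 2)"
    using main by (rule order_trans[rotated])
  then show ?thesis by (simp add: mult.assoc)
qed

end

lemma continuous_on_UNIV_nat_prod:
  fixes f :: "nat \<times> 'a::topological_space \<Rightarrow> 'b::topological_space"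
  assumes "\<And>i. continuous_on UNIV (\<lambda>y. f (i, y))"
  shows "continuous_on UNIV f"
proof -
  have "continuous_on ({i} \<times> UNIV) f" for i
  proof -
    have "continuous_on ({i} \<times> UNIV) (\<lambda>u. (\<lambda>y. f (i, y)) (snd u))"
      by (rule continuous_on_compose2[OF assms]) (auto intro!: continuous_intros)
    then show ?thesis by (rule continuous_on_eq) auto
  qed
  then have "continuous_on (\<Union>i. {i} \<times> UNIV) f"
    by (intro continuous_on_open_UN) (auto intro!: open_Times open_discrete)
  moreover have "(\<Union>i. {i} \<times> UNIV) = (UNIV :: (nat \<times> 'a) set)" by auto
  ultimately show ?thesis by simp
qed

text \<open>The library has the instance \<open>complete_space\<close> only for metric domains.\<close>

lemma complete_bcontfun: "complete (UNIV :: ('a::topological_space \<Rightarrow>\<^sub>C 'b::complete_space) set)"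
proof (rule completeI)
  fix f :: "nat \<Rightarrow> ('a, 'b) bcontfun"
  assume "Cauchy f"
  then obtain g where "uniform_limit UNIV f g sequentially"
    using uniformly_convergent_eq_cauchy[of "\<lambda>_. True" f]
    unfolding Cauchy_def uniform_limit_sequentially_iff
    by (metis dist_fun_lt_imp_dist_val_lt)
  from uniform_limit_bcontfunE[OF this sequentially_bot]
  obtain l where "g = apply_bcontfun l" "f \<longlonglongrightarrow> l" by metis
  then show "\<exists>l\<in>UNIV. f \<longlonglongrightarrow> l" by blast
qed

lemma contraction_arith:
  fixes k l c d e :: real
  shows "k \<le> 1 / 16 \<Longrightarrow> l \<le> 1 / 16 \<Longrightarrow> c \<le> 1 / 16 \<Longrightarrow> d \<le> 1 / 16 \<Longrightarrow> 2 * (k + l + c) + d \<le> 1 / 2"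
    and "k \<le> 2 * e \<Longrightarrow> c \<le> e \<Longrightarrow> e \<ge> 0 \<Longrightarrow> 2 * (k + c) + c \<le> 8 * e"
  by auto

context transport
begin

text \<open>The constants are chosen in the order \<kappa>, \<delta>, \<gamma>, each large in terms
  of the previous ones. The factor \<open>exp \<delta>\<close> caused by the weight of
  \<open>v\<close> is harmless because \<gamma> comes last.\<close>

lemma contraction_constants:
  fixes Cm Km Qm M :: real
  assumes "Cm > 0" "Km > 0" "Qm > 0" "M > 0"
  obtains \<kappa> \<delta> \<gamma> :: real where "\<kappa> \<ge> 1" "\<delta> > 0" "\<gamma> > 0" "\<gamma> \<ge> \<delta> * M"
    "2 * (Km / \<kappa> + Km / \<delta> + Cm / \<gamma>) + Cm / \<gamma> * exp \<delta> \<le> 1 / 2"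
    "2 * (Qm * exp (- \<delta>) + Cm / \<gamma>) + Cm / \<gamma> \<le> 1 / (2 * \<kappa>)"
proof -
  define \<kappa> where "\<kappa> = 16 * Km + 1"
  define \<delta> where "\<delta> = 16 * Km + 8 * \<kappa> * Qm"
  define \<gamma> where "\<gamma> = max (\<delta> * M) (16 * Cm * (exp \<delta> + \<kappa>))"
  have \<kappa>: "\<kappa> \<ge> 1" using assms by (simp add: \<kappa>_def)
  have \<delta>: "\<delta> > 0" using assms \<kappa> by (simp add: \<delta>_def add_pos_pos)
  have g: "\<gamma> \<ge> 16 * Cm * (exp \<delta> + \<kappa>)" by (simp add: \<gamma>_def)
  have "16 * Cm * (exp \<delta> + \<kappa>) > 0" using assms \<kappa> by (intro mult_pos_pos add_pos_nonneg) auto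
  then have \<gamma>: "\<gamma> > 0" using g by linarith
  have C: "Cm / \<gamma> * (exp \<delta> + \<kappa>) \<le> 1 / 16" using g \<gamma> by (simp add: field_simps)
  have C0: "Cm / \<gamma> \<ge> 0" using assms \<gamma> by simp
  have C1: "Cm / \<gamma> * exp \<delta> \<le> 1 / 16" "Cm / \<gamma> * \<kappa> \<le> 1 / 16"
    using C[unfolded distrib_left] mult_nonneg_nonneg[OF C0, of "exp \<delta>"] mult_nonneg_nonneg[OF C0, of \<kappa>] \<kappa>
      exp_ge_zero[of \<delta>] by linarith+
  have C2: "Cm / \<gamma> \<le> 1 / 16" using order_trans[OF mult_left_mono[OF \<kappa> C0] C1(2)] by simp
  have K: "Km / \<kappa> \<le> 1 / 16" "Km / \<delta> \<le> 1 / 16"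
    using assms \<kappa> \<delta> by (auto simp: field_simps \<kappa>_def \<delta>_def)
  have "exp (- \<delta>) \<le> 1 / \<delta>"
  proof -
    have "\<delta> \<le> exp \<delta>" using exp_ge_add_one_self[of \<delta>] by linarith
    then show ?thesis using \<delta> by (simp add: exp_minus field_simps)
  qed
  then have "Qm * exp (- \<delta>) \<le> Qm * (1 / \<delta>)" using assms by (intro mult_left_mono) auto
  also have "\<dots> \<le> 1 / (8 * \<kappa>)" using assms \<kappa> \<delta> by (simp add: field_simps \<delta>_def)
  finally have Q: "Qm * exp (- \<delta>) \<le> 1 / (8 * \<kappa>)" .
  have C3: "Cm / \<gamma> \<le> 1 / (16 * \<kappa>)" using C1(2) \<kappa> by (simp add: field_simps)
  show ?thesis
  proof (rule that[of \<kappa> \<delta> \<gamma>])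
    show "2 * (Km / \<kappa> + Km / \<delta> + Cm / \<gamma>) + Cm / \<gamma> * exp \<delta> \<le> 1 / 2" 
      using contraction_arith(1)[OF K C2 C1(1)] .
    have "1 / (2 * \<kappa>) = 8 * (1 / (16 * \<kappa>))" "1 / (8 * \<kappa>) = 2 * (1 / (16 * \<kappa>))" by simp_all
    moreover have "1 / (16 * \<kappa>) \<ge> 0" using \<kappa> by simp
    ultimately show "2 * (Qm * exp (- \<delta>) + Cm / \<gamma>) + Cm / \<gamma> \<le> 1 / (2 * \<kappa>)" 
      using contraction_arith(2)[of "Qm * exp (- \<delta>)" "1 / (16 * \<kappa>)" "Cm / \<gamma>"] Q C3 by (metis (no_types))
  qed (use \<kappa> \<delta> \<gamma> in \<open>auto simp: \<gamma>_def\<close>)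
qed

end

context transport_coords
begin

text \<open>The fixed point is sought for the quotient of \<open>z\<close> by its weight, a bounded
  continuous function of index, time and position. Growth in time is absorbed by the weight, so a
  single application of Banach's theorem yields a solution for all times.\<close>

lemma mild_exists:
  assumes z0: "\<And>i. i \<le> n \<Longrightarrow> continuous_on {0..1} (z0 i)"
  shows "\<exists>w. (\<forall>i\<le>n. continuous_on ({0..} \<times> {0..1}) (\<lambda>(t, x). w i t x)) \<and>
    (\<forall>i\<le>n. \<forall>t\<ge>0. \<forall>x\<in>{0..1}. w i t x = Tm z0 w i t x)"
proof -
  obtain Cm where Cm: "Cm > 0" "\<And>i x. i \<le> n \<Longrightarrow> x \<in> {0..1} \<Longrightarrow> (\<Sum>j\<le>n. \<bar>cf i j x\<bar>) \<le> Cm"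
    using cf_bound by blast
  obtain Km where Km: "Km > 0" "\<And>x. x \<in> {0..1} \<Longrightarrow> (\<Sum>j\<le>n. \<bar>kk j x\<bar>) \<le> Km"
    using kk_bound by blast
  define Qm where "Qm = 1 + (\<Sum>i\<le>n. \<bar>q i\<bar>)"
  have Qm: "Qm > 0" "\<And>i. i \<le> n \<Longrightarrow> \<bar>q i\<bar> \<le> Qm"
  proof -
    show "Qm > 0" unfolding Qm_def by (simp add: add_pos_nonneg sum_nonneg)
    show "\<bar>q i\<bar> \<le> Qm" if "i \<le> n" for i
      using member_le_sum[of i "{..n}" "\<lambda>i. \<bar>q i\<bar>"] that by (simp add: Qm_def)
  qed
  from compact_imp_bounded[OF compact_continuous_image[OF a_cont[of 0] compact_Icc]]
  obtain M where M: "M > 0" "\<And>x. x \<in> {0..1} \<Longrightarrow> \<bar>a 0 x\<bar> \<le> M" unfolding bounded_pos by auto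
  then have M': "\<And>x. x \<in> {0..1} \<Longrightarrow> - a 0 x \<le> M" by (auto simp: abs_le_iff)
  have "\<exists>Z. \<forall>x\<in>{0..1}. \<bar>z0 i x\<bar> \<le> Z" if "i \<le> n" for i
    using compact_imp_bounded[OF compact_continuous_image[OF z0[OF that] compact_Icc]]
    unfolding bounded_iff by auto
  then obtain Z where Z: "\<And>i x. i \<le> n \<Longrightarrow> x \<in> {0..1} \<Longrightarrow> \<bar>z0 i x\<bar> \<le> Z i" by metis
  obtain \<kappa> \<delta> \<gamma> where \<kappa>: "\<kappa> \<ge> 1" and \<delta>: "\<delta> > 0" and \<gamma>: "\<gamma> > 0" "\<gamma> \<ge> \<delta> * M" and
    c1: "2 * (Km / \<kappa> + Km / \<delta> + Cm / \<gamma>) + Cm / \<gamma> * exp \<delta> \<le> 1 / 2" and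
    c2: "2 * (Qm * exp (- \<delta>) + Cm / \<gamma>) + Cm / \<gamma> \<le> 1 / (2 * \<kappa>)"
    using contraction_constants[OF Cm(1) Km(1) Qm(1) M(1)] by blast
  have bound: "\<bar>Tm (\<lambda>_ _. 0) z i t x\<bar> \<le> N * (exp (\<gamma> * t) * wt \<kappa> \<delta> i x) / 2"
    if "\<And>j. j \<le> n \<Longrightarrow> continuous_on ({0..} \<times> {0..1}) (\<lambda>(t, x). z j t x)" "N \<ge> 0"
      "\<And>j t x. j \<le> n \<Longrightarrow> t \<ge> 0 \<Longrightarrow> x \<in> {0..1} \<Longrightarrow> \<bar>z j t x\<bar> \<le> N * (exp (\<gamma> * t) * wt \<kappa> \<delta> j x)"
      "i \<le> n" "t \<ge> 0" "x \<in> {0..1}" for z N i t x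
    by (rule Tm_weighted_bound[where Cm = Cm and Km = Km and Qm = Qm and M = M])
      (assumption | rule that Cm Km Qm M' M \<kappa> \<delta> \<gamma> c1 c2)+
  define W where "W i t x = exp (\<gamma> * t) * wt \<kappa> \<delta> i x" for i t x
  have Wp: "W i t x > 0" for i t x using \<kappa> by (auto simp: W_def wt_def)
  have Wc: "continuous_on S (\<lambda>u. W i (f u) (g u))" if "continuous_on S f" "continuous_on S g"
    for S :: "'x::topological_space set" and f g i
    using that \<kappa> by (cases "i = 0") (auto simp: W_def wt_def intro!: continuous_intros)
  \<comment> \<open>A lower bound for the weight keeps the contribution of the initial data bounded
    after division by the weight.\<close>
  have Wlow: "1 / W i t x \<le> exp \<delta> + \<kappa>" if "t \<ge> 0" "x \<in> {0..1}" for i t x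
  proof -
    have "1 / W i t x = exp (- (\<gamma> * t)) * (1 / wt \<kappa> \<delta> i x)" by (simp add: W_def exp_minus field_simps)
    also have "\<dots> \<le> 1 * (1 / wt \<kappa> \<delta> i x)"
      using that \<gamma> \<kappa> by (intro mult_right_mono) (auto simp: wt_def)
    also have "\<dots> \<le> exp \<delta> + \<kappa>"
    proof (cases "i = 0")
      case True
      have "exp (\<delta> * (1 - x)) \<le> exp \<delta>" using that \<delta> by (auto intro: mult_left_le)
      moreover have "1 / exp (- \<delta> * (1 - x)) = exp (\<delta> * (1 - x))"
        by (metis exp_minus inverse_eq_divide minus_minus mult_minus_left)
      ultimately show ?thesis using True \<kappa> exp_le_cancel_iff[of "\<delta> * (1 - x)" \<delta>] by (auto simp: wt_def intro: add_increasing2)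
    qed (auto simp: wt_def)
    finally show ?thesis .
  qed
  define zz where "zz \<zeta> i t x = W i t x * apply_bcontfun \<zeta> (i, t, x)" for \<zeta> :: "(nat \<times> real \<times> real) \<Rightarrow>\<^sub>C real" and i t x
  have zzc: "continuous_on S (\<lambda>(t, x). zz \<zeta> i t x)" for \<zeta> i S
    unfolding zz_def case_prod_unfold
    by (intro continuous_intros Wc continuous_on_compose2[OF continuous_on_apply_bcontfun[of UNIV \<zeta>]]) auto
  have zzdiff: "\<bar>zz \<zeta> i t x - zz \<zeta>' i t x\<bar> \<le> dist \<zeta> \<zeta>' * W i t x" for \<zeta> \<zeta>' i t x
    using mult_left_mono[OF dist_bounded[of \<zeta> "(i, t, x)" \<zeta>'] less_imp_le[OF Wp[of i t x]]]  Wp[of i t x]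
    by (simp add: zz_def dist_real_def right_diff_distrib[symmetric] abs_mult mult.commute)
  \<comment> \<open>Clamping \<open>t\<close> and \<open>x\<close> and setting the components beyond
    \<open>n\<close> to zero lets the map act on bounded continuous functions on the whole product
    type, which form a complete space.\<close>
  define R where "R \<zeta> = (\<lambda>(i, t, x). if i \<le> n then Tm z0 (zz \<zeta>) i (max 0 t) (max 0 (min 1 x)) /
      W i (max 0 t) (max 0 (min 1 x)) else 0)" for \<zeta>
  have Rc: "continuous_on UNIV (R \<zeta>)" for \<zeta>
  proof (rule continuous_on_UNIV_nat_prod)
    fix i
    show "continuous_on UNIV (\<lambda>y. R \<zeta> (i, y))"
    proof (cases "i \<le> n")
      case True
      have Tc: "continuous_on ({0..} \<times> {0..1}) (\<lambda>(t, x). Tm z0 (zz \<zeta>) i t x)"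
        by (rule Tm_cont) (use True zzc z0 in auto)
      have "continuous_on UNIV (\<lambda>y::real\<times>real. Tm z0 (zz \<zeta>) i (max 0 (fst y)) (max 0 (min 1 (snd y))) /
          W i (max 0 (fst y)) (max 0 (min 1 (snd y))))"
        by (intro continuous_intros continuous_on_comp2[OF Tc] Wc ballI)
          (auto simp: less_imp_neq[OF Wp, symmetric])
      then show ?thesis using True by (simp add: R_def case_prod_unfold)
    qed (simp add: R_def)
  qed
  have T0: "Tm z0 z i t x = z0 i (Q i (P i x - t)) + Tm (\<lambda>_ _. 0) z i t x" for z i t x
    by (simp add: Tm_def)
  have Rb: "bounded (range (R \<zeta>))" for \<zeta>
  proof -
    define B where "B = (\<Sum>i\<le>n. \<bar>Z i\<bar>) * (exp \<delta> + \<kappa>) + dist \<zeta> 0"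
    have B0: "B \<ge> 0" using \<kappa> by (simp add: B_def sum_nonneg)
    have "\<bar>R \<zeta> (i, t, x)\<bar> \<le> B" for i t x
    proof (cases "i \<le> n")
      case True
      define t' x' where "t' = max 0 t" and "x' = max 0 (min 1 x)"
      have tx: "t' \<ge> 0" "x' \<in> {0..1}" by (auto simp: t'_def x'_def)
      have "\<bar>Tm (\<lambda>_ _. 0) (zz \<zeta>) i t' x'\<bar> \<le> dist \<zeta> 0 * (exp (\<gamma> * t') * wt \<kappa> \<delta> i x') / 2"
        by (rule bound[OF _ zero_le_dist _ True tx]) (use zzc zzdiff[of \<zeta> _ _ _ 0] in \<open>auto simp: zz_def W_def\<close>)
      then have 1: "\<bar>Tm (\<lambda>_ _. 0) (zz \<zeta>) i t' x'\<bar> / W i t' x' \<le> dist \<zeta> 0"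
        using Wp[of i t' x'] zero_le_dist[of \<zeta> 0] by (simp add: W_def[symmetric] field_simps)
      have "\<bar>z0 i (Q i (P i x' - t'))\<bar> \<le> \<bar>Z i\<bar>" using Z[OF True Q_in[OF True, of "P i x' - t'"]] by linarith
      also have "\<dots> \<le> (\<Sum>i\<le>n. \<bar>Z i\<bar>)"
        using member_le_sum[of i "{..n}" "\<lambda>i. \<bar>Z i\<bar>"] True by simp
      finally have "\<bar>z0 i (Q i (P i x' - t'))\<bar> * (1 / W i t' x') \<le> (\<Sum>i\<le>n. \<bar>Z i\<bar>) * (exp \<delta> + \<kappa>)"
        using Wlow[OF tx] Wp[of i t' x'] by (intro mult_mono) (auto simp: sum_nonneg less_imp_le)
      then have "\<bar>z0 i (Q i (P i x' - t'))\<bar> / W i t' x' + \<bar>Tm (\<lambda>_ _. 0) (zz \<zeta>) i t' x'\<bar> / W i t' x' \<le> B"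
        using 1 by (simp add: B_def)
      moreover have "\<bar>Tm z0 (zz \<zeta>) i t' x'\<bar> / W i t' x' \<le>
         \<bar>z0 i (Q i (P i x' - t'))\<bar> / W i t' x' + \<bar>Tm (\<lambda>_ _. 0) (zz \<zeta>) i t' x'\<bar> / W i t' x'"
        unfolding T0 add_divide_distrib[symmetric] using Wp[of i t' x'] by (intro divide_right_mono) (auto intro: abs_triangle_ineq)
      ultimately have "\<bar>Tm z0 (zz \<zeta>) i t' x'\<bar> / W i t' x' \<le> B" by linarith
      then show ?thesis using True Wp[of i t' x'] by (simp add: R_def t'_def[symmetric] x'_def[symmetric] abs_divide)
    qed (use B0 in \<open>simp add: R_def\<close>)
    then show ?thesis by (auto simp: bounded_iff intro!: exI[of _ B])
  qed
  define RR where "RR \<zeta> = Bcontfun (R \<zeta>)" for \<zeta>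
  have RR: "apply_bcontfun (RR \<zeta>) = R \<zeta>" for \<zeta>
    unfolding RR_def by (rule Bcontfun_inverse) (simp add: bcontfun_def Rc Rb)
  have contr: "dist (RR \<zeta>) (RR \<zeta>') \<le> 1 / 2 * dist \<zeta> \<zeta>'" for \<zeta> \<zeta>'
  proof (rule dist_bound)
    fix u :: "nat \<times> real \<times> real"
    obtain i t x where u: "u = (i, t, x)" by (cases u) auto
    show "dist (RR \<zeta> u) (RR \<zeta>' u) \<le> 1 / 2 * dist \<zeta> \<zeta>'"
    proof (cases "i \<le> n")
      case True
      define t' x' where "t' = max 0 t" and "x' = max 0 (min 1 x)"
      have tx: "t' \<ge> 0" "x' \<in> {0..1}" by (auto simp: t'_def x'_def)
      have "\<bar>Tm z0 (zz \<zeta>) i t' x' - Tm z0 (zz \<zeta>') i t' x'\<bar> \<le> dist \<zeta> \<zeta>' * (exp (\<gamma> * t') * wt \<kappa> \<delta> i x') / 2"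
      proof -
        have e: "Tm z0 (zz \<zeta>) i t' x' - Tm z0 (zz \<zeta>') i t' x' = Tm (\<lambda>_ _. 0) (\<lambda>j t x. zz \<zeta> j t x - zz \<zeta>' j t x) i t' x'"
          by (rule Tm_diff[OF True tx]) (rule zzc)+
        show ?thesis unfolding e by (rule bound[OF _ zero_le_dist _ True tx])
          (use zzdiff[of \<zeta> _ _ _ \<zeta>'] in \<open>auto simp: W_def case_prod_unfold intro!: continuous_intros zzc[unfolded case_prod_unfold]\<close>)
      qed
      then have "\<bar>Tm z0 (zz \<zeta>) i t' x' - Tm z0 (zz \<zeta>') i t' x'\<bar> / W i t' x' \<le> 1 / 2 * dist \<zeta> \<zeta>'"
        using Wp[of i t' x'] by (simp add: W_def[symmetric] field_simps)
      then show ?thesis using True Wp[of i t' x']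
        by (simp add: RR u R_def t'_def[symmetric] x'_def[symmetric] dist_real_def diff_divide_distrib[symmetric] abs_divide)
    qed (simp add: RR u R_def)
  qed
  have "\<exists>!\<zeta>. RR \<zeta> = \<zeta>" using Banach_fix[of UNIV "1/2" RR] complete_bcontfun contr by auto
  then obtain \<zeta> where \<zeta>: "RR \<zeta> = \<zeta>" by auto
  have "zz \<zeta> i t x = Tm z0 (zz \<zeta>) i t x" if "i \<le> n" "t \<ge> 0" "x \<in> {0..1}" for i t x
  proof -
    have "apply_bcontfun \<zeta> (i, t, x) = R \<zeta> (i, t, x)" using RR[of \<zeta>] \<zeta> by simp
    also have "\<dots> = Tm z0 (zz \<zeta>) i t x / W i t x" using that by (auto simp: R_def max_def min_def)
    finally show ?thesis using Wp[of i t x] by (simp add: zz_def)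
  qed
  then show ?thesis using zzc by blast
qed

end

section \<open>Time averages of mild solutions\<close>

context transport
begin

lemma feedback_cong:
  assumes "\<And>j x. j \<le> n \<Longrightarrow> x \<in> {0..1} \<Longrightarrow> z j x = z' j x"
  shows "feedback z = feedback z'"
  unfolding feedback_def
  by (intro sum.cong refl Henstock_Kurzweil_Integration.integral_cong) (auto simp: assms)

lemma bval_cong:
  assumes "\<And>j x. j \<le> n \<Longrightarrow> x \<in> {0..1} \<Longrightarrow> z j x = z' j x"
  shows "bval i z = bval i z'"
  using feedback_cong[of z z'] assms by (auto simp: bval_def)

text \<open>Fubini. Since the feedback commutes with integration in time, averages of solutions
  satisfy the same nonlocal boundary condition.\<close>

lemma feedback_integral:
  fixes w :: "nat \<Rightarrow> real \<Rightarrow> real \<Rightarrow> real"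
  assumes w: "\<And>j. j \<le> n \<Longrightarrow> continuous_on ({0..} \<times> {0..1}) (\<lambda>(t, x). w j t x)" and t: "0 \<le> t"
  shows "feedback (\<lambda>j x. integral {t..t'} (\<lambda>s. w j s x)) = integral {t..t'} (\<lambda>s. feedback (\<lambda>j. w j s))"
proof -
  have c: "continuous_on ({t..t'} \<times> {0..1}) (\<lambda>(s, x). kk j x * w j s x)" if "j \<le> n" for j
    unfolding case_prod_unfold
    by (intro continuous_intros continuous_on_comp2[OF w[OF that]] continuous_on_compose2[OF kk_cont[OF that]]) (use t in \<open>auto intro: order_trans\<close>)
  have "integral {0..1} (\<lambda>x. kk j x * integral {t..t'} (\<lambda>s. w j s x)) = integral {t..t'} (\<lambda>s. integral {0..1} (\<lambda>x. kk j x * w j s x))"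
    if "j \<le> n" for j
    using integral_swap_continuous[of t 0 t' 1 "\<lambda>s x. kk j x * w j s x"] c[OF that]
    by (simp add: cbox_Pair_eq)
  then have "feedback (\<lambda>j x. integral {t..t'} (\<lambda>s. w j s x)) = (\<Sum>j\<le>n. integral {t..t'} (\<lambda>s. integral {0..1} (\<lambda>x. kk j x * w j s x)))"
    unfolding feedback_def by (intro sum.cong refl) simp
  also have "\<dots> = integral {t..t'} (\<lambda>s. \<Sum>j\<le>n. integral {0..1} (\<lambda>x. kk j x * w j s x))"
  proof (rule integral_sum[symmetric])
    fix j assume "j \<in> {..n}"
    then show "(\<lambda>s. integral {0..1} (\<lambda>x. kk j x * w j s x)) integrable_on {t..t'}"
      using integral_continuous_on_param[of "{t..t'}" 0 1 "\<lambda>s x. kk j x * w j s x"] c[of j]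
      by (auto intro!: integrable_continuous_real)
  qed simp
  finally show ?thesis by (simp add: feedback_def)
qed

lemma feedback_scale: "feedback (\<lambda>j x. c * z j x) = c * feedback z"
  by (simp add: feedback_def sum_distrib_left mult.left_commute[of _ c])

end

context transport_coords
begin

lemma mild_initial:
  assumes "\<And>i t x. i \<le> n \<Longrightarrow> t \<ge> 0 \<Longrightarrow> x \<in> {0..1} \<Longrightarrow> w i t x = Tm z0 w i t x" "i \<le> n" "x \<in> {0..1}"
  shows "w i 0 x = z0 i x"
proof -
  have "max 0 (0 - P i x) = 0" using P_in[OF assms(2,3)] by simp
  then show ?thesis
    using assms(1)[OF assms(2) order_refl assms(3)] QP[OF assms(2,3)] by (simp add: Tm_def)
qed

text \<open>At the inflow point the travel time is zero and the characteristic integral equals the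
  source integral subtracted in \<open>bd\<close>. Compatibility makes the remaining initial value
  cancel \<open>bd w i 0\<close>.\<close>

lemma mild_boundary:
  assumes w: "\<And>i t x. i \<le> n \<Longrightarrow> t \<ge> 0 \<Longrightarrow> x \<in> {0..1} \<Longrightarrow> w i t x = Tm z0 w i t x"
    and compat: "\<And>i. i \<le> n \<Longrightarrow> z0 i (inflow i) = bval i z0" and i: "i \<le> n" and t: "t \<ge> 0"
  shows "w i t (inflow i) = bval i (\<lambda>j. w j t)"
proof -
  have "bval i (\<lambda>j. w j 0) = bval i z0"
    by (rule bval_cong) (rule mild_initial[OF w], auto)
  moreover have "integral {0..t} (\<lambda>s. src w i s (Q i (P i (inflow i) - t + s))) = integral {0..t} (\<lambda>s. src w i s (inflow i))"
    by (rule Henstock_Kurzweil_Integration.integral_cong) (use P_inflow[OF i] Q_inflow[OF i] in auto)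
  ultimately show ?thesis
    using w[OF i t inflow_in] compat[OF i] P_inflow[OF i] Q_inflow[OF i, of "-t"] t by (simp add: Tm_def bd_def)
qed

text \<open>
  Mild solutions are only continuous, but their averages over a time window \<open>[t, t + h]\<close> are
  continuously differentiable solutions, since the system is autonomous.
\<close>

lemma mild_average_deriv:
  assumes w: "\<And>i t x. i \<le> n \<Longrightarrow> t \<ge> 0 \<Longrightarrow> x \<in> {0..1} \<Longrightarrow> w i t x = Tm z0 w i t x"
    and wc: "\<And>j. j \<le> n \<Longrightarrow> continuous_on ({0..} \<times> {0..1}) (\<lambda>(t, x). w j t x)"
    and z0: "\<And>i. i \<le> n \<Longrightarrow> continuous_on {0..1} (z0 i)"
    and i: "i \<le> n" and t: "t \<ge> 0" and h: "h > 0" and x: "x \<in> {0..1}"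
  shows "((\<lambda>x. integral {t..t+h} (\<lambda>s. w i s x)) has_real_derivative
     (integral {t..t+h} (\<lambda>s. src w i s x) - w i (t + h) x + w i t x) / a i x) (at x within {0..1})"
proof -
  define F where "F \<sigma> r = src w i (max 0 \<sigma>) (Q i r)" for \<sigma> r
  define g where "g c = z0 i (Q i (- c)) + (bd w i (max 0 c) - bd w i 0)" for c
  \<comment> \<open>Here \<open>p\<close> is the travel time and \<open>c\<close> is time minus
    travel time, which is constant along a characteristic. For fixed \<open>c\<close> the solution
    changes only by the source, so \<open>H\<close> is differentiable in \<open>p\<close> although
    \<open>w\<close> is only continuous. The lower limit \<open>-T i\<close> bounds every value of
    \<open>c + p\<close> from below, which keeps the intervals oriented; \<open>F\<close> is
    extended to negative times for the same purpose.\<close>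
  define H where "H p c = g c + (integral {-T i..c + p} (\<lambda>\<sigma>. F \<sigma> (\<sigma> - c)) - integral {-T i..0} (\<lambda>\<sigma>. F \<sigma> (\<sigma> - c)))" for p c
  define G where "G s p = w i s (Q i p)" for s p
  have Tp: "T i > 0" using T_pos[OF i] .
  have Fc: "continuous_on S (\<lambda>u. F (f u) (r u))" if "continuous_on S f" "continuous_on S r"
    for f r and S :: "'x::topological_space set"
    unfolding F_def
    by (rule continuous_on_comp2[OF src_cont[OF i wc]])
      (use that Q_in[OF i] in \<open>auto intro!: continuous_intros continuous_on_compose2[OF Q_cont[OF i]]\<close>)
  have gc: "continuous_on S (\<lambda>u. g (f u))" if "continuous_on S f" for f and S :: "'x::topological_space set"
    unfolding g_def using that Q_in[OF i]
    by (intro continuous_intros continuous_on_compose2[OF z0[OF i]] continuous_on_compose2[OF Q_cont[OF i]]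
       continuous_on_compose2[OF bd_cont[OF i wc]]) auto
  have HG: "H p (s - p) = G s p" if "p \<in> {0..T i}" "s \<ge> 0" for p s
  proof -
    have "integral {-T i..0} (\<lambda>\<sigma>. F \<sigma> (\<sigma> - (s - p))) + integral {0..s} (\<lambda>\<sigma>. F \<sigma> (\<sigma> - (s - p)))
        = integral {-T i..s} (\<lambda>\<sigma>. F \<sigma> (\<sigma> - (s - p)))"
      by (rule Henstock_Kurzweil_Integration.integral_combine)
        (use Tp that in \<open>auto intro!: integrable_continuous_real Fc continuous_intros\<close>)
    then have "H p (s - p) = g (s - p) + integral {0..s} (\<lambda>\<sigma>. F \<sigma> (\<sigma> - (s - p)))"
      by (simp add: H_def)
    also have "integral {0..s} (\<lambda>\<sigma>. F \<sigma> (\<sigma> - (s - p))) = integral {0..s} (\<lambda>\<sigma>. src w i \<sigma> (Q i (p - s + \<sigma>)))"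
      by (rule Henstock_Kurzweil_Integration.integral_cong) (auto simp: F_def algebra_simps)
    finally show ?thesis
      unfolding G_def using w[OF i that(2) Q_in[OF i, of p]] PQ[OF i that(1)] by (simp add: Tm_def g_def algebra_simps)
  qed
  have Hc: "continuous_on ({0..T i} \<times> {t - T i..t + h}) (\<lambda>(p, c). H p c)"
  proof -
    let ?S = "{0..T i} \<times> {t - T i..t + h}"
    have 1: "continuous_on ?S (\<lambda>u. integral {0..m u} (\<lambda>\<rho>. F (\<rho> - T i) (\<rho> - T i - snd u)))"
      if "continuous_on ?S m" "\<And>u. u \<in> ?S \<Longrightarrow> 0 \<le> m u" for m
      by (rule continuous_on_integral_upper)
         (use that in \<open>auto simp: case_prod_unfold intro!: Fc continuous_intros\<close>)
    have sh: "integral {-T i..b} (\<lambda>\<sigma>. F \<sigma> (\<sigma> - c)) = integral {0..b + T i} (\<lambda>\<rho>. F (\<rho> - T i) (\<rho> - T i - c))" for b c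
      using integral_shift[of 0 "- T i" "b + T i" "\<lambda>\<sigma>. F \<sigma> (\<sigma> - c)"]
      by (simp add: o_def Fc continuous_on_diff)
    show ?thesis unfolding H_def sh case_prod_unfold
      by (intro continuous_intros gc 1) (use t Tp in auto)
  qed
  have hc: "continuous_on ({0..T i} \<times> {t - T i..t + h}) (\<lambda>(p, c). F (c + p) p)"
    unfolding case_prod_unfold by (intro Fc continuous_intros)
  have Hd: "((\<lambda>p. H p c) has_real_derivative F (c + p) p) (at p within {0..T i})"
    if "p \<in> {0..T i}" "c \<in> {t - T i..t + h}" for p c
  proof -
    have 1: "((\<lambda>u. integral {-T i..u} (\<lambda>\<sigma>. F \<sigma> (\<sigma> - c))) has_real_derivative F (c + p) (c + p - c)) (at (c + p) within {-T i..t + h + T i})"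
      by (rule integral_has_real_derivative) (use that t in \<open>auto intro!: Fc continuous_intros\<close>)
    have 2: "((\<lambda>p. c + p) has_real_derivative 1) (at p within {0..T i})" by (auto intro!: derivative_eq_intros)
    have "((\<lambda>u. integral {-T i..u} (\<lambda>\<sigma>. F \<sigma> (\<sigma> - c))) has_real_derivative F (c + p) (c + p - c)) (at (c + p) within ((\<lambda>p. c + p) ` {0..T i}))"
      using 1 by (rule DERIV_subset) (use that t in auto)
    from DERIV_image_chain[OF this 2]
    show ?thesis unfolding H_def o_def by (auto intro!: derivative_eq_intros)
  qed
  \<comment> \<open>The substitution \<open>s = c + p\<close> turns the fixed window of times into a
    window for \<open>c\<close> that moves with \<open>p\<close>. The time integral thus becomes an
    integral with moving limits, whose end terms are the values of \<open>w\<close> at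
    \<open>t\<close> and \<open>t + h\<close>.\<close>
  define D where "D p = integral {t - p..t + h - p} (H p)" for p
  have px: "P i x \<in> {0..T i}" using P_in[OF i x] .
  have shift: "integral {t - p..t + h - p} f = integral {t..t + h} (\<lambda>s. f (s - p))"
    if "continuous_on {t - p..t + h - p} f" for p and f :: "real \<Rightarrow> real"
    using integral_shift[of t "-p" "t + h" f] that by (simp add: o_def)
  have dD: "(D has_real_derivative (integral {t - P i x..t + h - P i x} (\<lambda>c. F (c + P i x) (P i x))
       + H (P i x) (t + h - P i x) * (- 1) - H (P i x) (t - P i x) * (- 1))) (at (P i x) within {0..T i})"
    unfolding D_def
    by (rule has_real_derivative_moving_integral[OF px Hc hc Hd])
      (use h in \<open>auto intro!: derivative_eq_intros\<close>)
  have e1: "integral {t - P i x..t + h - P i x} (\<lambda>c. F (c + P i x) (P i x)) = integral {t..t + h} (\<lambda>s. src w i s x)"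
  proof -
    have "integral {t - P i x..t + h - P i x} (\<lambda>c. F (c + P i x) (P i x)) = integral {t..t + h} (\<lambda>s. F s (P i x))"
      by (subst shift) (auto intro!: Fc continuous_intros)
    also have "\<dots> = integral {t..t + h} (\<lambda>s. src w i s x)"
      by (rule Henstock_Kurzweil_Integration.integral_cong) (use t QP[OF i x] in \<open>auto simp: F_def\<close>)
    finally show ?thesis .
  qed
  have dD': "(D has_real_derivative (integral {t..t + h} (\<lambda>s. src w i s x) - w i (t + h) x + w i t x)) (at (P i x) within {0..T i})"
    using dD HG[OF px, of "t + h"] HG[OF px, of t] t h QP[OF i x] by (simp add: e1 G_def)
  have DG: "D (P i y) = integral {t..t + h} (\<lambda>s. w i s y)" if "y \<in> {0..1}" for y
  proof -
    have py: "P i y \<in> {0..T i}" using P_in[OF i that] .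
    have "D (P i y) = integral {t..t + h} (\<lambda>s. H (P i y) (s - P i y))"
      unfolding D_def by (rule shift, rule continuous_on_comp2[OF Hc]) (use py in \<open>auto intro!: continuous_intros\<close>)
    also have "\<dots> = integral {t..t + h} (\<lambda>s. w i s y)"
      by (rule Henstock_Kurzweil_Integration.integral_cong) (use HG[OF py] t QP[OF i that] in \<open>auto simp: G_def\<close>)
    finally show ?thesis .
  qed
  have "(D has_real_derivative (integral {t..t + h} (\<lambda>s. src w i s x) - w i (t + h) x + w i t x)) (at (P i x) within (P i ` {0..1}))"
    using dD' by (rule DERIV_subset) (use P_in[OF i] in auto)
  from DERIV_image_chain[OF this P_deriv[OF i x]]
  have "((\<lambda>x. D (P i x)) has_real_derivative (integral {t..t + h} (\<lambda>s. src w i s x) - w i (t + h) x + w i t x) / a i x) (at x within {0..1})"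
    by (simp add: o_def)
  then show ?thesis
    by (rule has_field_derivative_transform_within[OF _ zero_less_one x]) (use DG in auto)
qed

text \<open>The time derivative of the average is a difference quotient of \<open>w\<close>, and its
  \<open>x\<close>-derivative is the one found along characteristics. They satisfy the equation
  pointwise because the coefficients do not depend on time, so that the averaged source is the
  source of the average.\<close>

lemma mild_average_smooth:
  assumes w: "\<And>i t x. i \<le> n \<Longrightarrow> t \<ge> 0 \<Longrightarrow> x \<in> {0..1} \<Longrightarrow> w i t x = Tm z0 w i t x"
    and wc: "\<And>j. j \<le> n \<Longrightarrow> continuous_on ({0..} \<times> {0..1}) (\<lambda>(t, x). w j t x)"
    and z0: "\<And>i. i \<le> n \<Longrightarrow> continuous_on {0..1} (z0 i)"
    and compat: "\<And>i. i \<le> n \<Longrightarrow> z0 i (inflow i) = bval i z0" and h: "h > 0"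
  shows "\<exists>zt zx. smooth_sol (\<lambda>i t x. 1 / h * integral {t..t+h} (\<lambda>s. w i s x)) zt zx"
proof -
  define z where "z i t x = 1 / h * integral {t..t+h} (\<lambda>s. w i s x)" for i t x
  define zt where "zt i t x = 1 / h * (w i (t + h) x - w i t x)" for i t x
  define zx where "zx i t x = (src z i t x - zt i t x) / a i x" for i t x
  have wt: "continuous_on {t..t'} (\<lambda>s. w i s x)" if "i \<le> n" "t \<ge> 0" "x \<in> {0..1}" for i t t' x
    by (rule continuous_on_comp2[OF wc[OF that(1)]]) (use that in \<open>auto intro!: continuous_intros\<close>)
  have zW: "z i t x = 1 / h * (integral {0..t+h} (\<lambda>s. w i s x) - integral {0..t} (\<lambda>s. w i s x))"
    if "i \<le> n" "t \<ge> 0" "x \<in> {0..1}" for i t x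
  proof -
    have "integral {0..t} (\<lambda>s. w i s x) + integral {t..t+h} (\<lambda>s. w i s x) = integral {0..t+h} (\<lambda>s. w i s x)"
      by (rule Henstock_Kurzweil_Integration.integral_combine)
        (use that h in \<open>auto intro!: integrable_continuous_real wt\<close>)
    then show ?thesis by (simp add: z_def)
  qed
  have zc: "continuous_on ({0..} \<times> {0..1}) (\<lambda>(t, x). z i t x)" if i: "i \<le> n" for i
  proof -
    have 1: "continuous_on ({0..} \<times> {0..1}) (\<lambda>u. integral {0..m u} (\<lambda>s. w i s (snd u)))"
      if "continuous_on ({0..} \<times> {0..1}) m" "\<And>u. u \<in> {0..} \<times> {0..1} \<Longrightarrow> 0 \<le> m u" for m :: "real \<times> real \<Rightarrow> real"
      by (rule continuous_on_integral_upper)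
         (use that in \<open>auto simp: case_prod_unfold intro!: continuous_on_comp2[OF wc[OF i]] continuous_intros\<close>)
    have "continuous_on ({0..} \<times> {0..1}) (\<lambda>u. 1 / h * (integral {0..fst u + h} (\<lambda>s. w i s (snd u)) - integral {0..fst u} (\<lambda>s. w i s (snd u))))"
      by (intro continuous_intros 1) (use h in auto)
    then show ?thesis by (rule continuous_on_eq) (use zW[OF i] in auto)
  qed
  have ztc: "continuous_on ({0..} \<times> {0..1}) (\<lambda>(t, x). zt i t x)" if i: "i \<le> n" for i
    unfolding zt_def case_prod_unfold
    by (intro continuous_intros continuous_on_comp2[OF wc[OF i]]) (use h in auto)
  have zxc: "continuous_on ({0..} \<times> {0..1}) (\<lambda>(t, x). zx i t x)" if i: "i \<le> n" for i
    unfolding zx_def case_prod_unfold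
    using src_cont[OF i zc] ztc[OF i] a_nonzero[OF i]
    by (intro continuous_intros continuous_on_compose2[OF a_cont[OF i]]) (auto simp: case_prod_unfold)
  have dt: "((\<lambda>t. z i t x) has_real_derivative zt i t x) (at t within {0..})" if i: "i \<le> n" and t: "t \<ge> 0" and x: "x \<in> {0..1}" for i t x
  proof -
    have d: "((\<lambda>t. integral {0..t} (\<lambda>s. w i s x)) has_real_derivative w i t x) (at t within {0..})" if "t \<ge> 0" for t
    proof -
      have "((\<lambda>t. integral {0..t} (\<lambda>s. w i s x)) has_real_derivative w i t x) (at t within {0..t+1})"
        by (rule integral_has_real_derivative[OF wt]) (use i x that in auto)
      moreover have "at t within {0..t+1} = at t within {0..}"
        by (rule at_within_nhd[of _ "{..<t+1}"]) auto
      ultimately show ?thesis by simp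
    qed
    have "((\<lambda>t. integral {0..t} (\<lambda>s. w i s x)) has_real_derivative w i (t + h) x) (at (t + h) within ((\<lambda>t. t + h) ` {0..}))"
      using d[of "t + h"] t h by (auto intro: DERIV_subset)
    moreover have "((\<lambda>t. t + h) has_real_derivative 1) (at t within {0..})"
      by (auto intro!: derivative_eq_intros)
    ultimately have "((\<lambda>t. integral {0..t+h} (\<lambda>s. w i s x)) has_real_derivative w i (t + h) x) (at t within {0..})"
      using DERIV_image_chain by (fastforce simp: o_def)
    with d[OF t] have "((\<lambda>t. 1 / h * (integral {0..t+h} (\<lambda>s. w i s x) - integral {0..t} (\<lambda>s. w i s x))) has_real_derivative zt i t x) (at t within {0..})"
      unfolding zt_def by (intro DERIV_cmult DERIV_diff)
    then show ?thesis
      by (rule has_field_derivative_transform_within[OF _ zero_less_one]) (use zW i x t in auto)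
  qed
  have dx: "(z i t has_real_derivative zx i t x) (at x within {0..1})" if i: "i \<le> n" and t: "t \<ge> 0" and x: "x \<in> {0..1}" for i t x
  proof -
    have "integral {t..t+h} (\<lambda>s. src w i s x) = (\<Sum>j\<le>n. integral {t..t+h} (\<lambda>s. cf i j x * w j s x))"
      unfolding src_def by (rule integral_sum) (auto intro!: integrable_continuous_real continuous_intros wt t x)
    then have s: "integral {t..t+h} (\<lambda>s. src w i s x) = h * src z i t x"
      using h by (simp add: src_def z_def sum_distrib_left mult.left_commute)
    have "((\<lambda>x. 1 / h * integral {t..t+h} (\<lambda>s. w i s x)) has_real_derivative
      1 / h * ((integral {t..t+h} (\<lambda>s. src w i s x) - w i (t + h) x + w i t x) / a i x)) (at x within {0..1})"
      by (intro DERIV_cmult mild_average_deriv[OF w wc z0 i t h x])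
    moreover have "1 / h * ((integral {t..t+h} (\<lambda>s. src w i s x) - w i (t + h) x + w i t x) / a i x) = zx i t x"
      unfolding s zx_def zt_def using h a_nonzero[OF i x] by (simp add: field_simps)
    ultimately show ?thesis unfolding z_def[abs_def] by metis
  qed
  have bc: "z i t (inflow i) = bval i (\<lambda>j. z j t)" if i: "i \<le> n" and t: "t \<ge> 0" for i t
  proof -
    have "z i t (inflow i) = 1 / h * integral {t..t+h} (\<lambda>s. bval i (\<lambda>j. w j s))"
      unfolding z_def using mild_boundary[OF w compat i] t
      by (auto intro!: Henstock_Kurzweil_Integration.integral_cong)
    also have "\<dots> = bval i (\<lambda>j. z j t)"
    proof (cases "i = 0")
      case True
      have "feedback (\<lambda>j. z j t) = 1 / h * feedback (\<lambda>j x. integral {t..t+h} (\<lambda>s. w j s x))"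
        unfolding feedback_scale[symmetric] by (simp add: z_def[abs_def])
      then show ?thesis using True by (simp add: bval_def feedback_integral[OF wc t])
    qed (simp add: bval_def z_def)
    finally show ?thesis .
  qed
  have "smooth_sol z zt zx"
  proof -
    have "zt i t x + a i x * zx i t x = src z i t x" if "i \<le> n" "x \<in> {0..1}" for i t x
      using a_nonzero[OF that] by (simp add: zx_def)
    then show ?thesis unfolding smooth_sol_def using zc ztc zxc dt dx bc by blast
  qed
  then show ?thesis unfolding z_def[abs_def] by blast
qed

end

section \<open>Square-integrable functions\<close>

lemma L2_on_add:
  assumes "L2_on {a..b} f" "L2_on {a..b} g"
  shows "L2_on {a..b} (\<lambda>x. f x + g x)"
proof -
  have m: "f \<in> borel_measurable (lebesgue_on {a..b})" "g \<in> borel_measurable (lebesgue_on {a..b})"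
    and i: "integrable (lebesgue_on {a..b}) (\<lambda>x. 2 * (f x)\<^sup>2 + 2 * (g x)\<^sup>2)"
    using assms by (auto simp: L2_on_def)
  have "(f x + g x)\<^sup>2 \<le> 2 * (f x)\<^sup>2 + 2 * (g x)\<^sup>2" for x
    using sum_squares_bound[of "f x" "g x"] by (simp add: power2_sum)
  then have "integrable (lebesgue_on {a..b}) (\<lambda>x. (f x + g x)\<^sup>2)"
    by (intro Bochner_Integration.integrable_bound[OF i]) (use m in auto)
  then show ?thesis using m by (auto simp: L2_on_def)
qed

lemma L2_on_mult_bounded:
  assumes "L2_on {a..b} f" "g \<in> borel_measurable (lebesgue_on {a..b})" "\<And>x. x \<in> {a..b} \<Longrightarrow> \<bar>g x\<bar> \<le> B"
  shows "L2_on {a..b} (\<lambda>x. g x * f x)"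
proof -
  have m: "f \<in> borel_measurable (lebesgue_on {a..b})"
    and i: "integrable (lebesgue_on {a..b}) (\<lambda>x. B\<^sup>2 * (f x)\<^sup>2)"
    using assms by (auto simp: L2_on_def)
  have "(g x * f x)\<^sup>2 \<le> B\<^sup>2 * (f x)\<^sup>2" if "x \<in> {a..b}" for x
    using assms(3)[OF that] by (auto simp: power_mult_distrib abs_le_square_iff[symmetric] intro!: mult_right_mono)
  then have "integrable (lebesgue_on {a..b}) (\<lambda>x. (g x * f x)\<^sup>2)"
    by (intro Bochner_Integration.integrable_bound[OF i]) (use m assms(2) in auto)
  then show ?thesis using m assms(2) by (auto simp: L2_on_def)
qed

lemma continuous_on_measurable_lebesgue:
  "continuous_on {a..b} f \<Longrightarrow> f \<in> borel_measurable (lebesgue_on {a..b::real})"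
  by (rule continuous_imp_measurable_on_sets_lebesgue) auto

lemma continuous_on_bounded_Icc:
  fixes f :: "real \<Rightarrow> real"
  assumes "continuous_on {a..b} f"
  obtains B where "B \<ge> 0" "\<And>x. x \<in> {a..b} \<Longrightarrow> \<bar>f x\<bar> \<le> B"
proof -
  from compact_imp_bounded[OF compact_continuous_image[OF assms compact_Icc]]
  obtain B where "B > 0" "\<And>x. x \<in> {a..b} \<Longrightarrow> \<bar>f x\<bar> \<le> B" unfolding bounded_pos by auto
  then show ?thesis using that[of B] by auto
qed

lemma L2_on_mult_continuous:
  assumes "L2_on {a..b} f" "continuous_on {a..b} g"
  shows "L2_on {a..b} (\<lambda>x. g x * f x)"
proof -
  obtain B where "\<And>x. x \<in> {a..b} \<Longrightarrow> \<bar>g x\<bar> \<le> B" using continuous_on_bounded_Icc[OF assms(2)] by blast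
  then show ?thesis by (rule L2_on_mult_bounded[OF assms(1) continuous_on_measurable_lebesgue[OF assms(2)]])
qed

lemma L2_on_continuous: "continuous_on {a..b} f \<Longrightarrow> L2_on {a..b} f"
  unfolding L2_on_def
  by (auto intro!: continuous_on_measurable_lebesgue continuous_imp_integrable_real continuous_intros)

lemma L2_on_const: "L2_on {a..b} (\<lambda>_. c)"
  by (rule L2_on_continuous) auto

lemma L2_on_cmult: "L2_on {a..b} f \<Longrightarrow> L2_on {a..b} (\<lambda>x. c * f x)"
  by (rule L2_on_mult_continuous) auto

lemma L2_on_diff: "L2_on {a..b} f \<Longrightarrow> L2_on {a..b} g \<Longrightarrow> L2_on {a..b} (\<lambda>x. f x - g x)"
  using L2_on_add[of a b f "\<lambda>x. -1 * g x"] L2_on_cmult[of a b g "-1"] by simp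

lemma L2_on_sum: "(\<And>i. i \<in> I \<Longrightarrow> L2_on {a..b} (f i)) \<Longrightarrow> L2_on {a..b} (\<lambda>x. \<Sum>i\<in>I. f i x)"
  by (induction I rule: infinite_finite_induct) (auto intro: L2_on_add L2_on_const)

lemma L2_on_cong: "(\<And>x. x \<in> {a..b} \<Longrightarrow> f x = g x) \<Longrightarrow> L2_on {a..b} f \<longleftrightarrow> L2_on {a..b} g"
  unfolding L2_on_def
  by (intro conj_cong measurable_cong Bochner_Integration.integrable_cong) auto

lemma L2_on_prod_integrable:
  assumes "L2_on {a..b} f" "L2_on {a..b} g"
  shows "integrable (lebesgue_on {a..b}) (\<lambda>x. f x * g x)"
proof -
  have m: "f \<in> borel_measurable (lebesgue_on {a..b})" "g \<in> borel_measurable (lebesgue_on {a..b})"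
    and i: "integrable (lebesgue_on {a..b}) (\<lambda>x. (f x)\<^sup>2 + (g x)\<^sup>2)"
    using assms by (auto simp: L2_on_def)
  have "\<bar>f x * g x\<bar> \<le> (f x)\<^sup>2 + (g x)\<^sup>2" for x
  proof -
    have "0 \<le> \<bar>f x\<bar> * \<bar>g x\<bar>" by simp
    then show ?thesis using sum_squares_bound[of "\<bar>f x\<bar>" "\<bar>g x\<bar>"] unfolding abs_mult power2_abs by linarith
  qed
  then show ?thesis
    by (intro Bochner_Integration.integrable_bound[OF i]) (use m in auto)
qed

lemma integrable_imp_integrable_on_Icc:
  "integrable (lebesgue_on {a..b::real}) f \<Longrightarrow> (f :: real \<Rightarrow> real) integrable_on {a..b}"
  using has_integral_integral_lebesgue_on[of "{a..b}" f] by auto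

lemma L2_on_integrable_on: "L2_on {a..b} f \<Longrightarrow> f integrable_on {a..b}"
  using L2_on_prod_integrable[OF _ L2_on_const[of a b 1], of f] integrable_imp_integrable_on_Icc[of a b f] by auto

lemma L2_on_prod_integrable_on: "L2_on {a..b} f \<Longrightarrow> L2_on {a..b} g \<Longrightarrow> (\<lambda>x. f x * g x) integrable_on {a..b}"
  by (intro integrable_imp_integrable_on_Icc L2_on_prod_integrable)

lemma integral_AE_cong:
  fixes f g :: "real \<Rightarrow> real"
  assumes "AE x in lebesgue_on {a..b}. f x = g x"
  shows "integral {a..b} f = integral {a..b} g"
proof -
  have "AE x in lebesgue. x \<in> {a..b} \<longrightarrow> f x = g x"
    using assms by (subst (asm) AE_restrict_space_iff) auto
  then obtain N where N: "negligible N" "{x. \<not> (x \<in> {a..b} \<longrightarrow> f x = g x)} \<subseteq> N"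
    unfolding eventually_ae_filter negligible_iff_null_sets by auto
  show ?thesis by (rule integral_spike[OF N(1)]) (use N(2) in auto)
qed

abbreviation L2I :: "(real \<Rightarrow> real) \<Rightarrow> bool" where "L2I \<equiv> L2_on {0..1}"

definition l2norm :: "(real \<Rightarrow> real) \<Rightarrow> real" where "l2norm f = sqrt (integral {0..1} (\<lambda>x. (f x)\<^sup>2))"

lemma sq_integrable_on: "L2I f \<Longrightarrow> (\<lambda>x. (f x)\<^sup>2) integrable_on {0..1}"
  using L2_on_prod_integrable_on[of 0 1 f f] by (simp add: power2_eq_square)

lemma integral_sq_nonneg: "integral {0..1} (\<lambda>x. (f x :: real)\<^sup>2) \<ge> 0"
  by (cases "(\<lambda>x. (f x)\<^sup>2) integrable_on {0..1}") (auto intro: integral_nonneg simp: not_integrable_integral)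

lemma l2norm_sq: "(l2norm f)\<^sup>2 = integral {0..1} (\<lambda>x. (f x)\<^sup>2)"
  by (simp add: l2norm_def integral_sq_nonneg)

lemma l2norm_nonneg: "l2norm f \<ge> 0"
  by (simp add: l2norm_def integral_sq_nonneg)

lemma l2norm_cong: "(\<And>x. x \<in> {0..1} \<Longrightarrow> f x = g x) \<Longrightarrow> l2norm f = l2norm g"
  unfolding l2norm_def by (intro arg_cong[where f = sqrt] Henstock_Kurzweil_Integration.integral_cong) auto

lemma l2norm_cmult: "l2norm (\<lambda>x. c * f x) = \<bar>c\<bar> * l2norm f"
  by (simp add: l2norm_def power_mult_distrib real_sqrt_mult)

lemma l2norm_minus_commute: "l2norm (\<lambda>x. f x - g x) = l2norm (\<lambda>x. g x - f x)"
  by (simp add: l2norm_def power2_commute)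

lemma cauchy_schwarz_L2:
  assumes "L2I f" "L2I g"
  shows "\<bar>integral {0..1} (\<lambda>x. f x * g x)\<bar> \<le> l2norm f * l2norm g"
proof -
  define A B C where "A = integral {0..1} (\<lambda>x. (f x)\<^sup>2)" and "B = integral {0..1} (\<lambda>x. f x * g x)"
    and "C = integral {0..1} (\<lambda>x. (g x)\<^sup>2)"
  have q: "0 \<le> s\<^sup>2 * A + 2 * s * t * B + t\<^sup>2 * C" for s t
  proof -
    have i: "(\<lambda>x. s\<^sup>2 * (f x)\<^sup>2) integrable_on {0..1}" "(\<lambda>x. (2 * s * t) * (f x * g x)) integrable_on {0..1}"
       "(\<lambda>x. t\<^sup>2 * (g x)\<^sup>2) integrable_on {0..1}"
      using assms by (auto intro!: integrable_on_mult_right sq_integrable_on L2_on_prod_integrable_on)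
    have "integral {0..1} (\<lambda>x. (s * f x + t * g x)\<^sup>2) = integral {0..1} (\<lambda>x. s\<^sup>2 * (f x)\<^sup>2 + (2 * s * t) * (f x * g x) + t\<^sup>2 * (g x)\<^sup>2)"
      by (intro Henstock_Kurzweil_Integration.integral_cong) (simp add: power2_eq_square algebra_simps)
    also have "\<dots> = s\<^sup>2 * A + 2 * s * t * B + t\<^sup>2 * C"
      unfolding A_def B_def C_def by (simp only: Henstock_Kurzweil_Integration.integral_add i integrable_add integral_mult_right)
    finally show ?thesis using integral_sq_nonneg[of "\<lambda>x. s * f x + t * g x"] by simp
  qed
  have C0: "C \<ge> 0" unfolding C_def by (rule integral_sq_nonneg)
  have "B\<^sup>2 \<le> A * C"
  proof (cases "C = 0")
    case True
    have "B = 0"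
    proof (rule ccontr)
      assume "B \<noteq> 0"
      \<comment> \<open>With this multiplier the quadratic form takes the value
        \<open>A - (A + 1) = -1\<close>.\<close>
      have "0 \<le> A + 2 * (- (A + 1) / (2 * B)) * B" using q[of 1 "- (A + 1) / (2 * B)"] True by simp
      then show False using \<open>B \<noteq> 0\<close> by (simp add: field_simps)
    qed
    then show ?thesis using True by simp
  next
    case False
    then have "C > 0" using C0 by simp
    have "0 \<le> C * (C * A - B\<^sup>2)" using q[of C "-B"] by (simp add: power2_eq_square algebra_simps)
    then show ?thesis using \<open>C > 0\<close> by (simp add: zero_le_mult_iff mult.commute)
  qed
  then have "sqrt (B\<^sup>2) \<le> sqrt (A * C)" by (rule real_sqrt_le_mono)
  then show ?thesis by (simp add: l2norm_def A_def B_def C_def real_sqrt_mult)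
qed

lemma l2norm_triangle:
  assumes "L2I f" "L2I g"
  shows "l2norm (\<lambda>x. f x + g x) \<le> l2norm f + l2norm g"
proof (rule power2_le_imp_le)
  have i: "(\<lambda>x. (f x)\<^sup>2) integrable_on {0..1}" "(\<lambda>x. 2 * (f x * g x)) integrable_on {0..1}"
       "(\<lambda>x. (g x)\<^sup>2) integrable_on {0..1}"
    using assms by (auto intro!: integrable_on_mult_right sq_integrable_on L2_on_prod_integrable_on)
  have "integral {0..1} (\<lambda>x. (f x + g x)\<^sup>2) = integral {0..1} (\<lambda>x. (f x)\<^sup>2 + 2 * (f x * g x) + (g x)\<^sup>2)"
    by (intro Henstock_Kurzweil_Integration.integral_cong) (simp add: power2_eq_square algebra_simps)
  also have "\<dots> = (l2norm f)\<^sup>2 + 2 * integral {0..1} (\<lambda>x. f x * g x) + (l2norm g)\<^sup>2"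
    unfolding l2norm_sq by (simp only: Henstock_Kurzweil_Integration.integral_add i integrable_add integral_mult_right)
  also have "\<dots> \<le> (l2norm f)\<^sup>2 + 2 * (l2norm f * l2norm g) + (l2norm g)\<^sup>2"
    using cauchy_schwarz_L2[OF assms] by simp
  finally show "(l2norm (\<lambda>x. f x + g x))\<^sup>2 \<le> (l2norm f + l2norm g)\<^sup>2"
    by (simp add: l2norm_sq power2_sum)
qed (simp add: l2norm_nonneg)

lemma l2norm_triangle_diff:
  assumes "L2I f" "L2I g" "L2I h"
  shows "l2norm (\<lambda>x. f x - h x) \<le> l2norm (\<lambda>x. f x - g x) + l2norm (\<lambda>x. g x - h x)"
  using l2norm_triangle[of "\<lambda>x. f x - g x" "\<lambda>x. g x - h x"] assms by (simp add: L2_on_diff)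

lemma l2norm_bound:
  assumes "\<And>x. x \<in> {0..1} \<Longrightarrow> \<bar>f x\<bar> \<le> B" "L2I f" "B \<ge> 0"
  shows "l2norm f \<le> B"
proof -
  have "integral {0..1} (\<lambda>x. (f x)\<^sup>2) \<le> integral {0..1::real} (\<lambda>x. B\<^sup>2)"
    by (rule integral_le[OF sq_integrable_on[OF assms(2)]])
       (use assms in \<open>auto simp: abs_le_square_iff[symmetric]\<close>)
  then have "sqrt (integral {0..1} (\<lambda>x. (f x)\<^sup>2)) \<le> sqrt (B\<^sup>2)" by (simp del: real_sqrt_abs)
  then show ?thesis using assms(3) by (simp add: l2norm_def)
qed

lemma l2norm_eq_lebesgue:
  assumes "L2I f" shows "(l2norm f)\<^sup>2 = (\<integral>x. (f x)\<^sup>2 \<partial>lebesgue_on {0..1})"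
  unfolding l2norm_sq using assms by (intro lebesgue_integral_eq_integral[symmetric]) (auto simp: L2_on_def)

lemma l2norm_dominated_convergence:
  assumes f: "L2I f" and s: "\<And>k. L2I (s k)" and g: "L2I g"
    and lim: "AE x in lebesgue_on {0..1}. (\<lambda>k. s k x) \<longlonglongrightarrow> f x"
    and bd: "\<And>k x. x \<in> {0..1} \<Longrightarrow> \<bar>s k x - f x\<bar> \<le> \<bar>g x\<bar>"
  shows "(\<lambda>k. l2norm (\<lambda>x. s k x - f x)) \<longlonglongrightarrow> 0"
proof -
  have "(\<lambda>k. \<integral>x. (s k x - f x)\<^sup>2 \<partial>lebesgue_on {0..1}) \<longlonglongrightarrow> (\<integral>x. 0 \<partial>lebesgue_on {0..1::real})"
  proof (rule integral_dominated_convergence[where w = "\<lambda>x. (g x)\<^sup>2"])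
    show "AE x in lebesgue_on {0..1}. (\<lambda>k. (s k x - f x)\<^sup>2) \<longlonglongrightarrow> 0"
      using lim
    proof eventually_elim
      fix x assume "(\<lambda>k. s k x) \<longlonglongrightarrow> f x"
      then have "(\<lambda>k. (s k x - f x)\<^sup>2) \<longlonglongrightarrow> (f x - f x)\<^sup>2" by (intro tendsto_intros)
      then show "(\<lambda>k. (s k x - f x)\<^sup>2) \<longlonglongrightarrow> 0" by simp
    qed
    show "AE x in lebesgue_on {0..1}. norm ((s k x - f x)\<^sup>2) \<le> (g x)\<^sup>2" for k
      using bd by (auto simp: abs_le_square_iff[symmetric])
  qed (use f s g in \<open>auto simp: L2_on_def intro!: borel_measurable_power borel_measurable_diff\<close>)
  then have "(\<lambda>k. (l2norm (\<lambda>x. s k x - f x))\<^sup>2) \<longlonglongrightarrow> 0"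
    by (simp add: l2norm_eq_lebesgue L2_on_diff f s)
  then have "(\<lambda>k. sqrt ((l2norm (\<lambda>x. s k x - f x))\<^sup>2)) \<longlonglongrightarrow> sqrt 0" by (rule tendsto_real_sqrt)
  then show ?thesis by (simp add: l2norm_nonneg)
qed

text \<open>Truncation makes the function bounded. Measurability supplies continuous functions
  converging almost everywhere, and their truncations are dominated by a constant. A cutoff at both
  ends disappears in the limit and gives approximants with zero boundary values, for which the local
  boundary conditions are trivial.\<close>

lemma L2_dense_continuous:
  assumes f: "L2I f" and e: "\<epsilon> > 0"
  obtains g where "continuous_on UNIV g" "g 0 = 0" "g 1 = 0" "l2norm (\<lambda>x. g x - f x) < \<epsilon>"
proof -
  define tr where "tr k y = max (- real k) (min (real k) y)" for k and y :: real
  have trc: "continuous_on S (\<lambda>x. tr k (h x))" if "continuous_on S h" for S k and h :: "real \<Rightarrow> real"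
    unfolding tr_def by (intro continuous_intros that)
  have fm: "f \<in> borel_measurable (lebesgue_on {0..1})" using f by (simp add: L2_on_def)
  have trb: "\<bar>tr k y\<bar> \<le> real k" for k y by (auto simp: tr_def)
  have bdd: "L2I h" if "h \<in> borel_measurable (lebesgue_on {0..1})" "\<And>x. x \<in> {0..1} \<Longrightarrow> \<bar>h x\<bar> \<le> B" for h B
    using L2_on_mult_bounded[OF L2_on_const[of 0 1 1] that] by simp
  have trL: "L2I (\<lambda>x. tr k (f x))" for k
    by (rule bdd[where B = "real k"]) (use fm trb in \<open>auto simp: tr_def\<close>)
  have "(\<lambda>k. l2norm (\<lambda>x. tr k (f x) - f x)) \<longlonglongrightarrow> 0"
  proof (rule l2norm_dominated_convergence[OF f trL f])
    show "AE x in lebesgue_on {0..1}. (\<lambda>k. tr k (f x)) \<longlonglongrightarrow> f x"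
    proof (rule AE_I2)
      fix x
      obtain K :: nat where "\<bar>f x\<bar> \<le> real K" using real_arch_simple by blast
      then have "\<forall>k\<ge>K. tr k (f x) = f x" by (auto simp: tr_def)
      then show "(\<lambda>k. tr k (f x)) \<longlonglongrightarrow> f x"
        by (intro tendsto_eventually) (auto simp: eventually_sequentially)
    qed
  qed (auto simp: tr_def)
  then have "eventually (\<lambda>k. l2norm (\<lambda>x. tr k (f x) - f x) < \<epsilon> / 2) sequentially"
    using e by (intro order_tendstoD) auto
  then obtain K where K: "l2norm (\<lambda>x. tr K (f x) - f x) < \<epsilon> / 2"
    by (auto simp: eventually_sequentially)
  have "f measurable_on {0..1}" using fm by (subst measurable_on_iff_borel_measurable) auto
  then obtain N F where N: "negligible N" and F: "\<And>k. continuous_on UNIV (F k)"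
    "\<And>x. x \<notin> N \<Longrightarrow> (\<lambda>k. F k x) \<longlonglongrightarrow> (if x \<in> {0..1} then f x else 0)"
    by (auto simp: measurable_on_def)
  \<comment> \<open>The cutoff vanishes at \<open>0\<close> and \<open>1\<close>, and at each
    interior point it equals \<open>1\<close> once \<open>k\<close> is large.\<close>
  define ct where "ct k x = max 0 (min 1 (real k * min x (1 - x)))" for k and x :: real
  define G where "G k x = ct k x * tr K (F k x)" for k x
  have Gc: "continuous_on UNIV (G k)" for k
    unfolding G_def ct_def by (intro continuous_intros trc F(1))
  have ctb: "0 \<le> ct k x" "ct k x \<le> 1" for k x by (auto simp: ct_def)
  have Gb: "\<bar>G k x\<bar> \<le> real K" for k x
    using mult_mono[of "\<bar>ct k x\<bar>" 1 "\<bar>tr K (F k x)\<bar>" "real K"] ctb[of k x] trb[of K "F k x"]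
    by (simp add: G_def abs_mult)
  have "(\<lambda>k. l2norm (\<lambda>x. G k x - tr K (f x))) \<longlonglongrightarrow> 0"
  proof (rule l2norm_dominated_convergence[OF trL _ L2_on_const[of 0 1 "2 * real K"]])
    show "L2I (G k)" for k by (rule L2_on_continuous[OF continuous_on_subset[OF Gc]]) auto
    show "\<bar>G k x - tr K (f x)\<bar> \<le> \<bar>2 * real K\<bar>" for k x
      using Gb[of k x] trb[of K "f x"] by linarith
    have "AE x in lebesgue. x \<notin> N \<union> {0, 1}"
      using N by (intro AE_not_in) (auto simp: negligible_iff_null_sets[symmetric] negligible_Un)
    then have "AE x in lebesgue. x \<in> {0..1} \<longrightarrow> (\<lambda>k. G k x) \<longlonglongrightarrow> tr K (f x)"
    proof (eventually_elim, intro impI)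
      fix x :: real assume x: "x \<notin> N \<union> {0, 1}" "x \<in> {0..1}"
      have "(\<lambda>k. F k x) \<longlonglongrightarrow> f x" using F(2)[of x] x by auto
      then have 1: "(\<lambda>k. tr K (F k x)) \<longlonglongrightarrow> tr K (f x)" unfolding tr_def by (intro tendsto_intros)
      have p: "min x (1 - x) > 0" using x by (auto simp: min_def)
      obtain k0 :: nat where "1 / min x (1 - x) \<le> real k0" using real_arch_simple by blast
      then have k0: "1 \<le> real k0 * min x (1 - x)" using p by (simp add: pos_divide_le_eq)
      have "ct k x = 1" if "k \<ge> k0" for k
      proof -
        have "real k0 * min x (1 - x) \<le> real k * min x (1 - x)" using that p by (intro mult_right_mono) auto
        then show ?thesis using k0 by (simp add: ct_def)
      qed
      then have "(\<lambda>k. ct k x) \<longlonglongrightarrow> 1"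
        by (intro tendsto_eventually) (auto simp: eventually_sequentially)
      from tendsto_mult[OF this 1] show "(\<lambda>k. G k x) \<longlonglongrightarrow> tr K (f x)" by (simp add: G_def)
    qed
    then show "AE x in lebesgue_on {0..1}. (\<lambda>k. G k x) \<longlonglongrightarrow> tr K (f x)"
      by (subst AE_restrict_space_iff) auto
  qed
  then have "eventually (\<lambda>k. l2norm (\<lambda>x. G k x - tr K (f x)) < \<epsilon> / 2) sequentially"
    using e by (intro order_tendstoD) auto
  then obtain k where k: "l2norm (\<lambda>x. G k x - tr K (f x)) < \<epsilon> / 2"
    by (auto simp: eventually_sequentially)
  have "L2I (G k)" by (rule L2_on_continuous[OF continuous_on_subset[OF Gc]]) auto
  from l2norm_triangle_diff[OF this trL[of K] f] K k have "l2norm (\<lambda>x. G k x - f x) < \<epsilon>" by fastforce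
  then show ?thesis by (intro that[of "G k"] Gc) (auto simp: G_def ct_def)
qed

section \<open>Density of smooth initial data\<close>

context transport
begin

text \<open>Component \<open>0\<close> enters at \<open>x = 1\<close>, so its coordinates come from
  the reflected speed through \<open>x \<mapsto> 1 - x\<close>. The inverse is extended beyond
  \<open>{0..T}\<close> by its endpoint values.\<close>

lemma component_coords:
  assumes i: "i \<le> n"
  shows "\<exists>T P Q. T > 0 \<and> (\<forall>x\<in>{0..1}. P x \<in> {0..T}) \<and> (\<forall>p. Q p \<in> {0..1}) \<and> continuous_on UNIV Q \<and>
    (\<forall>x\<in>{0..1}. Q (P x) = x) \<and> (\<forall>p\<in>{0..T}. P (Q p) = p) \<and> (\<forall>p\<le>0. Q p = inflow i) \<and>
    (\<forall>x\<in>{0..1}. (P has_real_derivative 1 / a i x) (at x within {0..1}))"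
proof -
  define b where "b x = (if i = 0 then - a 0 (1 - x) else a i x)" for x
  have bc: "continuous_on {0..1} b"
  proof (cases "i = 0")
    case True
    then show ?thesis unfolding b_def
      by (auto intro!: continuous_intros continuous_on_compose2[OF a_cont[of 0]])
  qed (use a_cont[OF i] in \<open>auto simp: b_def[abs_def]\<close>)
  have bp: "b x > 0" if "x \<in> {0..1}" for x
    using a_pos[of i x] a_neg[of "1 - x"] that i by (cases "i = 0") (auto simp: b_def)
  obtain T P Q where PQ: "T > 0" "P 0 = 0" "P 1 = T" "Q 0 = 0" "Q T = 1"
    "\<And>x. x \<in> {0..1} \<Longrightarrow> P x \<in> {0..T}" "\<And>p. p \<in> {0..T} \<Longrightarrow> Q p \<in> {0..1}"
    "\<And>x. x \<in> {0..1} \<Longrightarrow> Q (P x) = x" "\<And>p. p \<in> {0..T} \<Longrightarrow> P (Q p) = p"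
    "\<And>x. x \<in> {0..1} \<Longrightarrow> (P has_real_derivative 1 / b x) (at x within {0..1})"
    "\<And>p. p \<in> {0..T} \<Longrightarrow> (Q has_real_derivative b (Q p)) (at p within {0..T})"
    by (rule flow_coordinates[OF bc]) (erule bp, rule that, assumption+)
  define r where "r x = (if i = 0 then 1 - x else x)" for x :: real
  define cl where "cl p = max 0 (min T p)" for p :: real
  have cl: "cl p \<in> {0..T}" "p \<in> {0..T} \<Longrightarrow> cl p = p" "p \<le> 0 \<Longrightarrow> cl p = 0" for p
    using PQ(1) by (auto simp: cl_def)
  have rr: "r x \<in> {0..1} \<longleftrightarrow> x \<in> {0..1}" "r (r x) = x" for x by (auto simp: r_def)
  have rc: "continuous_on S r" for S by (cases "i = 0") (auto simp: r_def[abs_def] intro!: continuous_intros)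
  have Qc: "continuous_on {0..T} Q" using PQ(11) by (rule DERIV_continuous_on)
  have clc: "continuous_on UNIV cl" unfolding cl_def by (intro continuous_intros)
  show ?thesis
  proof (rule exI[of _ T], rule exI[of _ "\<lambda>x. P (r x)"], rule exI[of _ "\<lambda>p. r (Q (cl p))"], intro conjI ballI allI impI)
    show "continuous_on UNIV (\<lambda>p. r (Q (cl p)))"
      by (rule continuous_on_compose2[OF rc[of UNIV]], rule continuous_on_compose2[OF Qc clc]) (use cl in auto)
  next
    show "((\<lambda>x. P (r x)) has_real_derivative 1 / a i x) (at x within {0..1})" if x: "x \<in> {0..1}" for x
    proof -
      have "((P \<circ> r) has_real_derivative (1 / b (r x)) * (if i = 0 then -1 else 1)) (at x within {0..1})"
      proof (rule DERIV_image_chain)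
        show "(P has_real_derivative 1 / b (r x)) (at (r x) within r ` {0..1})"
          by (rule DERIV_subset[OF PQ(10)]) (use x rr in auto)
        show "(r has_real_derivative (if i = 0 then - 1 else 1)) (at x within {0..1})"
          by (cases "i = 0") (auto simp: r_def[abs_def] intro!: derivative_eq_intros)
      qed
      then show ?thesis by (cases "i = 0") (auto simp: o_def b_def r_def)
    qed
    show "r (Q (cl p)) = inflow i" if "p \<le> 0" for p
      using cl(3)[OF that] PQ(4) by (auto simp: r_def inflow_def)
  qed (use PQ cl rr in auto)
qed

lemma transport_coords_exist: "\<exists>T P Q. transport_coords n a cf kk T P Q"
proof -
  define C where "C i T P Q \<longleftrightarrow> T > 0 \<and> (\<forall>x\<in>{0..1}. P x \<in> {0..T}) \<and> (\<forall>p. Q p \<in> {0..1}) \<and> continuous_on UNIV Q \<and>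
    (\<forall>x\<in>{0..1}. Q (P x) = x) \<and> (\<forall>p\<in>{0..T}. P (Q p) = p) \<and> (\<forall>p\<le>0. Q p = inflow i) \<and>
    (\<forall>x\<in>{0..1}. (P has_real_derivative 1 / a i x) (at x within {0..1}))" for i T P Q
  have "\<exists>T P Q. i \<le> n \<longrightarrow> C i T P Q" for i
    using component_coords[of i] unfolding C_def by blast
  then obtain T P Q where "\<And>i. i \<le> n \<Longrightarrow> C i (T i) (P i) (Q i)" by metis
  note PQ = this[unfolded C_def]
  have "transport_coords n a cf kk T P Q"
    by unfold_locales (use PQ in blast)+
  then show ?thesis by blast
qed

text \<open>Once the approximants vanish at both ends, only the nonlocal condition
  \<open>y 0 1 = feedback y\<close> is left. It is met by adding to \<open>v\<close> a multiple of a
  spike at \<open>x = 1\<close> that is small in L2; the amplitude solves a scalar linear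
  equation.\<close>

lemma L2_dense_compatible:
  assumes z0: "\<And>i. i \<le> n \<Longrightarrow> L2I (z0 i)" and e: "\<epsilon> > 0"
  obtains y where "\<And>i. i \<le> n \<Longrightarrow> continuous_on {0..1} (y i)" "\<And>i. i \<le> n \<Longrightarrow> y i (inflow i) = bval i y"
    "\<And>i. i \<le> n \<Longrightarrow> l2norm (\<lambda>x. y i x - z0 i x) < \<epsilon>"
proof -
  have "\<exists>g. i \<le> n \<longrightarrow> continuous_on UNIV g \<and> g 0 = 0 \<and> g 1 = 0 \<and> l2norm (\<lambda>x. g x - z0 i x) < \<epsilon> / 2" for i
    using L2_dense_continuous[OF z0, of i "\<epsilon> / 2"] e by (metis half_gt_zero)
  then obtain g where g: "\<And>i. i \<le> n \<Longrightarrow> continuous_on UNIV (g i)" "\<And>i. i \<le> n \<Longrightarrow> g i 0 = 0"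
      "\<And>i. i \<le> n \<Longrightarrow> g i 1 = 0" "\<And>i. i \<le> n \<Longrightarrow> l2norm (\<lambda>x. g i x - z0 i x) < \<epsilon> / 2"
    by metis
  \<comment> \<open>With \<open>Suc k\<close> in place of \<open>k\<close> the spike vanishes at
    \<open>x = 0\<close> for every \<open>k\<close>, so the reflection conditions at that end are
    not disturbed.\<close>
  define f where "f k x = max 0 (1 - real (Suc k) * (1 - x))" for k x
  have fc: "continuous_on S (f k)" for k S unfolding f_def by (intro continuous_intros)
  have fL: "L2I (f k)" for k by (rule L2_on_continuous[OF fc])
  have "(\<lambda>k. l2norm (\<lambda>x. f k x - 0)) \<longlonglongrightarrow> 0"
  proof (rule l2norm_dominated_convergence[OF L2_on_const fL L2_on_const[of 0 1 1]])
    have "AE x in lebesgue. x \<notin> {1::real}" by (rule AE_not_in) auto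
    then have "AE x in lebesgue. x \<in> {0..1} \<longrightarrow> (\<lambda>k. f k x) \<longlonglongrightarrow> 0"
    proof (eventually_elim, intro impI)
      fix x :: real assume x: "x \<notin> {1}" "x \<in> {0..1}"
      then have p: "1 - x > 0" by auto
      obtain k0 :: nat where "1 / (1 - x) \<le> real k0" using real_arch_simple by blast
      then have k0: "1 \<le> real k0 * (1 - x)" using p by (simp add: pos_divide_le_eq)
      have "f k x = 0" if "k \<ge> k0" for k
      proof -
        have "real k0 * (1 - x) \<le> real (Suc k) * (1 - x)" using that p by (intro mult_right_mono) auto
        then show ?thesis using k0 by (simp add: f_def)
      qed
      then show "(\<lambda>k. f k x) \<longlonglongrightarrow> 0"
        by (intro tendsto_eventually) (auto simp: eventually_sequentially)
    qed
    then show "AE x in lebesgue_on {0..1}. (\<lambda>k. f k x) \<longlonglongrightarrow> 0"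
      by (subst AE_restrict_space_iff) auto
    show "\<bar>f k x - 0\<bar> \<le> \<bar>1\<bar>" if "x \<in> {0..1}" for k x
      using that by (auto simp: f_def)
  qed
  then have lim: "(\<lambda>k. l2norm (f k)) \<longlonglongrightarrow> 0" by simp
  \<comment> \<open>The first bound keeps the effect \<open>I\<close> of the spike on the feedback
    at most \<open>1 / 2\<close>, so that \<open>1 - I\<close> can be inverted; the second keeps the
    correction at most a quarter of \<epsilon> in L2.\<close>
  define d where "d = min (1 / (2 * (l2norm (kk 0) + 1))) (\<epsilon> / (8 * (\<bar>feedback g\<bar> + 1)))"
  have kp: "l2norm (kk 0) + 1 > 0" using l2norm_nonneg[of "kk 0"] by linarith
  have "d > 0" using e kp by (simp add: d_def)
  then have "eventually (\<lambda>k. l2norm (f k) < d) sequentially" using lim by (intro order_tendstoD) auto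
  then obtain k where k: "l2norm (f k) < d" by (auto simp: eventually_sequentially)
  define I where "I = integral {0..1} (\<lambda>x. kk 0 x * f k x)"
  have "\<bar>I\<bar> \<le> l2norm (kk 0) * l2norm (f k)"
    unfolding I_def by (rule cauchy_schwarz_L2) (use kk_cont[of 0] fL in \<open>auto intro: L2_on_continuous\<close>)
  also have "\<dots> \<le> (l2norm (kk 0) + 1) * (1 / (2 * (l2norm (kk 0) + 1)))"
    using k kp by (intro mult_mono) (auto simp: d_def l2norm_nonneg)
  also have "\<dots> = 1 / 2" using kp by simp
  finally have I: "\<bar>I\<bar> \<le> 1 / 2" .
  \<comment> \<open>Solution of \<open>\<alpha> = feedback g + \<alpha> * I\<close>: the spike has
    value \<open>1\<close> at \<open>x = 1\<close> and changes the feedback by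
    \<open>I\<close>.\<close>
  define \<alpha> where "\<alpha> = feedback g / (1 - I)"
  have \<alpha>: "\<alpha> * (1 - I) = feedback g" using I by (auto simp: \<alpha>_def)
  have ab: "\<bar>\<alpha>\<bar> \<le> 2 * \<bar>feedback g\<bar>"
  proof -
    have "\<bar>\<alpha>\<bar> * (1 / 2) \<le> \<bar>\<alpha>\<bar> * (1 - I)" using I by (intro mult_left_mono) auto
    also have "\<dots> = \<bar>feedback g\<bar>" unfolding \<alpha>[symmetric] abs_mult using I by simp
    finally show ?thesis by simp
  qed
  define y where "y i x = (if i = 0 then g 0 x + \<alpha> * f k x else g i x)" for i x
  have yc: "continuous_on {0..1} (y i)" if "i \<le> n" for i
    using continuous_on_subset[OF g(1)[OF that]] fc
    by (cases "i = 0") (auto simp: y_def[abs_def] intro!: continuous_intros)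
  have fy: "feedback y = feedback g + \<alpha> * I"
  proof -
    have "feedback y = (\<Sum>j\<le>n. integral {0..1} (\<lambda>\<xi>. kk j \<xi> * g j \<xi>) + (if j = 0 then \<alpha> * I else 0))"
      unfolding feedback_def
    proof (rule sum.cong[OF refl])
      fix j assume "j \<in> {..n}"
      then have j: "j \<le> n" by simp
      show "integral {0..1} (\<lambda>\<xi>. kk j \<xi> * y j \<xi>) = integral {0..1} (\<lambda>\<xi>. kk j \<xi> * g j \<xi>) + (if j = 0 then \<alpha> * I else 0)"
      proof (cases "j = 0")
        case True
        have "integral {0..1} (\<lambda>\<xi>. kk 0 \<xi> * g 0 \<xi> + \<alpha> * (kk 0 \<xi> * f k \<xi>)) = integral {0..1} (\<lambda>\<xi>. kk 0 \<xi> * g 0 \<xi>) + \<alpha> * I"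
          unfolding I_def integral_mult_right[symmetric]
          by (rule Henstock_Kurzweil_Integration.integral_add)
            (auto intro!: integrable_continuous_real continuous_intros kk_cont fc continuous_on_subset[OF g(1)])
        then show ?thesis using True by (simp add: y_def algebra_simps)
      qed (simp add: y_def)
    qed
    also have "\<dots> = feedback g + \<alpha> * I"
      by (simp add: feedback_def sum.distrib)
    finally show ?thesis .
  qed
  show ?thesis
  proof (rule that[OF yc])
    fix i assume i: "i \<le> n"
    show "y i (inflow i) = bval i y"
    proof (cases "i = 0")
      case True
      then show ?thesis using g(3)[of 0] fy \<alpha> by (simp add: inflow_def bval_def y_def f_def algebra_simps)
    next
      case False
      then show ?thesis using g(2)[of i] g(2)[of 0] i by (simp add: inflow_def bval_def y_def f_def)
    qed
    show "l2norm (\<lambda>x. y i x - z0 i x) < \<epsilon>"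
    proof (cases "i = 0")
      case True
      have "\<bar>\<alpha>\<bar> * l2norm (f k) \<le> (2 * (\<bar>feedback g\<bar> + 1)) * (\<epsilon> / (8 * (\<bar>feedback g\<bar> + 1)))"
        using ab k by (intro mult_mono) (auto simp: d_def l2norm_nonneg)
      also have "\<dots> = \<epsilon> / 4"
      proof -
        have "(2 * u) * (\<epsilon> / (8 * u)) = \<epsilon> / 4" if "u \<noteq> 0" for u :: real using that by simp
        moreover have "\<bar>feedback g\<bar> + 1 \<noteq> 0" by linarith
        ultimately show ?thesis by blast
      qed
      finally have 1: "l2norm (\<lambda>x. \<alpha> * f k x) \<le> \<epsilon> / 4" by (simp add: l2norm_cmult)
      have "l2norm (\<lambda>x. (g 0 x - z0 0 x) + \<alpha> * f k x) \<le> l2norm (\<lambda>x. g 0 x - z0 0 x) + l2norm (\<lambda>x. \<alpha> * f k x)"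
        by (intro l2norm_triangle L2_on_diff L2_on_cmult fL z0 L2_on_continuous continuous_on_subset[OF g(1)]) auto
      then show ?thesis using 1 g(4)[of 0] True e by (simp add: y_def algebra_simps)
    qed (use g(4)[OF i] e in \<open>simp add: y_def\<close>)
  qed
qed

text \<open>A mild solution from compatible data is averaged over a window so short that, by uniform
  continuity near \<open>t = 0\<close>, the average starting at time \<open>0\<close> stays close to
  the data.\<close>

theorem smooth_dense:
  assumes z0: "\<And>i. i \<le> n \<Longrightarrow> L2I (z0 i)" and e: "\<epsilon> > 0"
  obtains z zt zx where "smooth_sol z zt zx" "\<And>i. i \<le> n \<Longrightarrow> l2norm (\<lambda>x. z i 0 x - z0 i x) < \<epsilon>"
proof -
  obtain y where y: "\<And>i. i \<le> n \<Longrightarrow> continuous_on {0..1} (y i)" "\<And>i. i \<le> n \<Longrightarrow> y i (inflow i) = bval i y"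
    "\<And>i. i \<le> n \<Longrightarrow> l2norm (\<lambda>x. y i x - z0 i x) < \<epsilon> / 2"
    by (rule L2_dense_compatible[where \<epsilon> = "\<epsilon> / 2" and ?z0.0 = z0]) (use e z0 in auto)
  obtain T P Q where "transport_coords n a cf kk T P Q" using transport_coords_exist by blast
  then interpret transport_coords n a cf q kk T P Q .
  from mild_exists[of y, OF y(1)] obtain w where
    wc: "\<And>i. i \<le> n \<Longrightarrow> continuous_on ({0..} \<times> {0..1}) (\<lambda>(t, x). w i t x)" and
    w: "\<And>i t x. i \<le> n \<Longrightarrow> t \<ge> 0 \<Longrightarrow> x \<in> {0..1} \<Longrightarrow> w i t x = Tm y w i t x" by blast
  have "\<exists>d>0. i \<le> n \<longrightarrow> (\<forall>t x. 0 \<le> t \<longrightarrow> t < d \<longrightarrow> x \<in> {0..1} \<longrightarrow> \<bar>w i t x - w i 0 x\<bar> \<le> \<epsilon> / 4)" for i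
  proof (cases "i \<le> n")
    case True
    have "uniformly_continuous_on ({0..1} \<times> {0..1}) (\<lambda>(t, x). w i t x)"
      by (intro compact_uniformly_continuous continuous_on_subset[OF wc[OF True]]) (auto intro: compact_Times)
    then obtain d where d: "d > 0" "\<And>u v. u \<in> {0..1} \<times> {0..1} \<Longrightarrow> v \<in> {0..1} \<times> {0..1} \<Longrightarrow> dist u v < d \<Longrightarrow>
        dist (case u of (t, x) \<Rightarrow> w i t x) (case v of (t, x) \<Rightarrow> w i t x) < \<epsilon> / 4"
      unfolding uniformly_continuous_on_def using e by (metis (no_types) zero_less_divide_iff zero_less_numeral dist_commute)
    have "\<bar>w i t x - w i 0 x\<bar> \<le> \<epsilon> / 4" if "0 \<le> t" "t < min 1 d" "x \<in> {0..1}" for t x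
      using d(2)[of "(t, x)" "(0, x)"] that by (simp add: dist_Pair_Pair dist_real_def)
    then show ?thesis using d(1) by (intro exI[of _ "min 1 d"]) auto
  qed (auto intro: exI[of _ 1])
  then obtain d where d: "\<And>i. d i > 0" "\<And>i t x. i \<le> n \<Longrightarrow> 0 \<le> t \<Longrightarrow> t < d i \<Longrightarrow> x \<in> {0..1} \<Longrightarrow> \<bar>w i t x - w i 0 x\<bar> \<le> \<epsilon> / 4"
    by metis
  \<comment> \<open>Half of the smallest of finitely many thresholds, so the window is short enough
    for all components simultaneously.\<close>
  define h where "h = Min (d ` {..n}) / 2"
  have h0: "h > 0" using d(1) by (simp add: h_def)
  have hd: "h < d i" if "i \<le> n" for i
  proof -
    have "Min (d ` {..n}) \<le> d i" using that by (intro Min_le) auto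
    then show ?thesis using h0 unfolding h_def by linarith
  qed
  define z where "z = (\<lambda>i t x. 1 / h * integral {t..t+h} (\<lambda>s. w i s x))"
  obtain zt zx where sm: "smooth_sol z zt zx"
    unfolding z_def using mild_average_smooth[of w y h, OF w wc y(1) y(2) h0] by blast
  show ?thesis
  proof (rule that[OF sm])
    fix i assume i: "i \<le> n"
    have zc: "L2I (z i 0)"
      using sm i by (intro L2_on_continuous, unfold smooth_sol_def)
        (intro DERIV_continuous_on[of _ _ "zx i 0"], auto)
    have yi: "w i 0 x = y i x" if "x \<in> {0..1}" for x by (rule mild_initial[OF w i that])
    have close: "\<bar>z i 0 x - y i x\<bar> \<le> \<epsilon> / 4" if x: "x \<in> {0..1}" for x
    proof -
      have c: "continuous_on {0..h} (\<lambda>s. w i s x)"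
        by (rule continuous_on_comp2[OF wc[OF i]]) (use x in \<open>auto intro!: continuous_intros\<close>)
      have "integral {0..h} (\<lambda>s. w i s x) - h * w i 0 x = integral {0..h} (\<lambda>s. w i s x - w i 0 x)"
        using h0 c by (subst Henstock_Kurzweil_Integration.integral_diff) (auto intro!: integrable_continuous_real)
      moreover have "norm (integral {0..h} (\<lambda>s. w i s x - w i 0 x)) \<le> \<epsilon> / 4 * (h - 0)"
        by (rule integral_bound) (use h0 c d(2)[OF i] hd[OF i] x in \<open>auto intro!: continuous_intros\<close>)
      ultimately have "\<bar>integral {0..h} (\<lambda>s. w i s x) - h * w i 0 x\<bar> \<le> \<epsilon> / 4 * h" by simp
      then have "\<bar>1 / h * (integral {0..h} (\<lambda>s. w i s x) - h * w i 0 x)\<bar> \<le> \<epsilon> / 4"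
        unfolding abs_mult using h0 by (simp add: field_simps)
      moreover have "1 / h * (integral {0..h} (\<lambda>s. w i s x) - h * w i 0 x) = z i 0 x - y i x"
        using h0 yi[OF x] by (simp add: z_def right_diff_distrib)
      ultimately show ?thesis by (simp only:)
    qed
    have "l2norm (\<lambda>x. z i 0 x - y i x) \<le> \<epsilon> / 4"
      by (rule l2norm_bound[OF close]) (use e zc y(1)[OF i] in \<open>auto intro: L2_on_diff L2_on_continuous\<close>)
    with l2norm_triangle_diff[OF zc L2_on_continuous[OF y(1)[OF i]] z0[OF i]] y(3)[OF i]
    show "l2norm (\<lambda>x. z i 0 x - z0 i x) < \<epsilon>" using e by linarith
  qed
qed

end

section \<open>Kernel integrals\<close>

lemma mono_from_deriv_Icc:
  fixes Q :: "real \<Rightarrow> real"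
  assumes "\<And>p. p \<in> {0..T} \<Longrightarrow> (Q has_real_derivative Q' p) (at p within {0..T})"
    "\<And>p. p \<in> {0..T} \<Longrightarrow> Q' p \<ge> 0" "0 \<le> p" "p \<le> r" "r \<le> T"
  shows "Q p \<le> Q r"
proof (rule DERIV_nonneg_imp_increasing_open[OF assms(4)])
  show "\<exists>y. DERIV Q x :> y \<and> 0 \<le> y" if "p < x" "x < r" for x
    using assms(1,2)[of x] that assms(3,5) by (auto simp: at_within_Icc_at)
  show "continuous_on {p..r} Q"
    by (rule continuous_on_subset[OF DERIV_continuous_on[OF assms(1)]]) (use assms in auto)
qed

text \<open>Product rule for kernel times test function times Jacobian. The derivative
  \<open>c1\<close> of the speed cancels: the kernel equation contributes it as coefficient of the
  kernel, and the Jacobian of the change of variables contributes it with the opposite sign.\<close>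

lemma kernel_deriv_algebra:
  fixes g k v v1 c c1 :: real
  shows "((g + c1 * k) * v + v1 * - c * k) * c + c1 * - c * (k * v) = (g * v - k * c * v1) * c"
  by (simp add: algebra_simps)

text \<open>
  The kernel need not be differentiable. The substitution \<open>(x, \<xi>) = (X p, Z (c - p))\<close> follows the characteristics,
  along which it is, and the moving limits of integration produce the boundary terms.
\<close>

lemma kernel_integral_deriv:
  fixes \<mu> a a' w w' :: "real \<Rightarrow> real" and \<kappa> \<gamma> :: "real \<Rightarrow> real \<Rightarrow> real"
  assumes \<mu>: "continuous_on {0..1} \<mu>" "\<And>x. x \<in> {0..1} \<Longrightarrow> \<mu> x > 0"
    and a: "\<And>x. x \<in> {0..1} \<Longrightarrow> (a has_real_derivative a' x) (at x within {0..1})" "\<And>x. x \<in> {0..1} \<Longrightarrow> a x > 0"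
    and w: "\<And>x. x \<in> {0..1} \<Longrightarrow> (w has_real_derivative w' x) (at x within {0..1})" "continuous_on {0..1} w'"
    and \<kappa>: "continuous_on kernel_triangle (\<lambda>(x, \<xi>). \<kappa> x \<xi>)"
    and \<gamma>: "continuous_on kernel_triangle (\<lambda>(x, \<xi>). \<gamma> x \<xi>)"
    and char: "\<And>c d X \<Xi>. c < d \<Longrightarrow> integral_curve \<mu> X {c..d} \<Longrightarrow> integral_curve (\<lambda>\<xi>. - a \<xi>) \<Xi> {c..d} \<Longrightarrow>
       (\<forall>s\<in>{c..d}. (X s, \<Xi> s) \<in> kernel_triangle) \<Longrightarrow>
       (\<forall>s\<in>{c..d}. ((\<lambda>s. \<kappa> (X s) (\<Xi> s)) has_real_derivative
          \<gamma> (X s) (\<Xi> s) + a' (\<Xi> s) * \<kappa> (X s) (\<Xi> s)) (at s within {c..d}))"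
    and x: "x \<in> {0..1}"
  shows "((\<lambda>x. integral {0..x} (\<lambda>\<xi>. \<kappa> x \<xi> * w \<xi>)) has_real_derivative
     ((\<mu> x + a x) * \<kappa> x x * w x - a 0 * \<kappa> x 0 * w 0
       + integral {0..x} (\<lambda>\<xi>. \<gamma> x \<xi> * w \<xi> - \<kappa> x \<xi> * a \<xi> * w' \<xi>)) / \<mu> x) (at x within {0..1})"
proof -
  have ac: "continuous_on {0..1} a" using a(1) by (rule DERIV_continuous_on)
  have wc: "continuous_on {0..1} w" using w(1) by (rule DERIV_continuous_on)
  obtain b P X where X: "b > 0" "P 0 = 0" "P 1 = b" "X 0 = 0" "X b = 1"
    "\<And>x. x \<in> {0..1} \<Longrightarrow> P x \<in> {0..b}" "\<And>p. p \<in> {0..b} \<Longrightarrow> X p \<in> {0..1}"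
    "\<And>x. x \<in> {0..1} \<Longrightarrow> X (P x) = x" "\<And>p. p \<in> {0..b} \<Longrightarrow> P (X p) = p"
    "\<And>x. x \<in> {0..1} \<Longrightarrow> (P has_real_derivative 1 / \<mu> x) (at x within {0..1})"
    "\<And>p. p \<in> {0..b} \<Longrightarrow> (X has_real_derivative \<mu> (X p)) (at p within {0..b})"
    by (rule flow_coordinates[OF \<mu>(1)]) (erule \<mu>(2), rule that, assumption+)
  obtain T \<phi> Z where Z: "T > 0" "\<phi> 0 = 0" "\<phi> 1 = T" "Z 0 = 0" "Z T = 1"
    "\<And>x. x \<in> {0..1} \<Longrightarrow> \<phi> x \<in> {0..T}" "\<And>p. p \<in> {0..T} \<Longrightarrow> Z p \<in> {0..1}"
    "\<And>x. x \<in> {0..1} \<Longrightarrow> Z (\<phi> x) = x" "\<And>p. p \<in> {0..T} \<Longrightarrow> \<phi> (Z p) = p"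
    "\<And>x. x \<in> {0..1} \<Longrightarrow> (\<phi> has_real_derivative 1 / a x) (at x within {0..1})"
    "\<And>p. p \<in> {0..T} \<Longrightarrow> (Z has_real_derivative a (Z p)) (at p within {0..T})"
    by (rule flow_coordinates[OF ac]) (erule a(2), rule that, assumption+)
  have Xc: "continuous_on {0..b} X" using X(11) by (rule DERIV_continuous_on)
  have Zc: "continuous_on {0..T} Z" using Z(11) by (rule DERIV_continuous_on)
  have \<phi>c: "continuous_on {0..1} \<phi>" using Z(10) by (rule DERIV_continuous_on)
  have Xm: "X p \<le> X r" if "0 \<le> p" "p \<le> r" "r \<le> b" for p r
    by (rule mono_from_deriv_Icc[OF X(11) _ that]) (assumption | rule less_imp_le \<mu>(2) X(7))+
  have Zm: "Z p \<le> Z r" if "0 \<le> p" "p \<le> r" "r \<le> T" for p r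
    by (rule mono_from_deriv_Icc[OF Z(11) _ that]) (assumption | rule less_imp_le a(2) Z(7))+
  have \<phi>m: "\<phi> p \<le> \<phi> r" if "0 \<le> p" "p \<le> r" "r \<le> 1" for p r
    by (rule mono_from_deriv_Icc[OF Z(10) _ that]) (assumption | rule divide_nonneg_nonneg less_imp_le[OF a(2)] zero_le_one)+
  define R where "R p = \<phi> (X p)" for p
  have Rin: "R p \<in> {0..T}" if "p \<in> {0..b}" for p unfolding R_def by (intro Z(6) X(7) that)
  have Rc: "continuous_on {0..b} R" unfolding R_def by (rule continuous_on_compose2[OF \<phi>c Xc]) (use X(7) in auto)
  have Rm: "R p \<le> R r" if "0 \<le> p" "p \<le> r" "r \<le> b" for p r
    unfolding R_def by (rule \<phi>m) (use Xm[OF that] X(7)[of p] X(7)[of r] that in auto)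
  have RZ: "Z (R p) = X p" if "p \<in> {0..b}" for p unfolding R_def by (rule Z(8)[OF X(7)[OF that]])
  \<comment> \<open>Clamping keeps the point in the triangle for every \<open>c\<close>, so that
    \<open>H\<close> and \<open>h\<close> are continuous on a full rectangle; on the region of
    integration \<rho> is just \<open>c - p\<close>.\<close>
  define \<rho> where "\<rho> p c = max 0 (min (c - p) (R p))" for p c
  have \<rho>in: "\<rho> p c \<in> {0..R p}" if "p \<in> {0..b}" for p c using Rin[OF that] by (auto simp: \<rho>_def)
  have \<rho>T: "\<rho> p c \<in> {0..T}" if "p \<in> {0..b}" for p c using \<rho>in[OF that, of c] Rin[OF that] by auto
  define S where "S = {0..b} \<times> {0..b + T}"
  have X1: "continuous_on S (\<lambda>u. X (fst u))"
    by (rule continuous_on_compose2[OF Xc]) (auto intro!: continuous_intros simp: S_def)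
  have \<rho>1: "continuous_on S (\<lambda>u. \<rho> (fst u) (snd u))"
    unfolding \<rho>_def by (intro continuous_intros continuous_on_compose2[OF Rc]) (auto simp: S_def)
  have Z1: "continuous_on S (\<lambda>u. Z (\<rho> (fst u) (snd u)))"
    by (rule continuous_on_compose2[OF Zc \<rho>1]) (use \<rho>T in \<open>auto simp: S_def\<close>)
  have Zin: "Z (\<rho> p c) \<in> {0..1}" if "p \<in> {0..b}" for p c using Z(7)[OF \<rho>T[OF that]] .
  have tri: "(X p, Z (\<rho> p c)) \<in> kernel_triangle" if "p \<in> {0..b}" for p c
  proof -
    have "Z (\<rho> p c) \<le> Z (R p)" by (rule Zm) (use \<rho>in[OF that, of c] Rin[OF that] in auto)
    then show ?thesis using RZ[OF that] Zin[OF that, of c] X(7)[OF that] by (auto simp: kernel_triangle_def)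
  qed
  define F where "F x \<xi> = \<kappa> x \<xi> * w \<xi>" for x \<xi>
  define G where "G x \<xi> = \<gamma> x \<xi> * w \<xi> - \<kappa> x \<xi> * a \<xi> * w' \<xi>" for x \<xi>
  have snd1: "continuous_on kernel_triangle (\<lambda>u. f (snd u))" if "continuous_on {0..1} f" for f :: "real \<Rightarrow> real"
    by (rule continuous_on_compose2[OF that]) (auto intro!: continuous_intros simp: kernel_triangle_def)
  have Fc: "continuous_on kernel_triangle (\<lambda>(x, \<xi>). F x \<xi>)"
    unfolding F_def case_prod_unfold by (intro continuous_intros \<kappa>[unfolded case_prod_unfold] snd1 wc)
  have Gc: "continuous_on kernel_triangle (\<lambda>(x, \<xi>). G x \<xi>)"
    unfolding G_def case_prod_unfold
    by (intro continuous_intros \<kappa>[unfolded case_prod_unfold] \<gamma>[unfolded case_prod_unfold] snd1 wc ac w(2))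
  have FG1: "continuous_on {0..y} (F y)" "continuous_on {0..y} (G y)" if "y \<in> {0..1}" for y
    by (rule continuous_on_comp2[OF Fc] continuous_on_comp2[OF Gc];
        use that in \<open>auto intro!: continuous_intros simp: kernel_triangle_def\<close>)+
  define H where "H p c = F (X p) (Z (\<rho> p c)) * a (Z (\<rho> p c))" for p c
  define h where "h p c = G (X p) (Z (\<rho> p c)) * a (Z (\<rho> p c))" for p c
  have ZA: "continuous_on S (\<lambda>u. a (Z (\<rho> (fst u) (snd u))))"
    by (rule continuous_on_compose2[OF ac Z1]) (use Zin in \<open>auto simp: S_def\<close>)
  have Hc: "continuous_on ({0..b} \<times> {0..b + T}) (\<lambda>(p, c). H p c)"
    unfolding H_def case_prod_unfold S_def[symmetric]
    by (intro continuous_intros ZA continuous_on_comp2[OF Fc X1 Z1]) (use tri in \<open>auto simp: S_def\<close>)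
  have hc: "continuous_on ({0..b} \<times> {0..b + T}) (\<lambda>(p, c). h p c)"
    unfolding h_def case_prod_unfold S_def[symmetric]
    by (intro continuous_intros ZA continuous_on_comp2[OF Gc X1 Z1]) (use tri in \<open>auto simp: S_def\<close>)
  have subst: "integral {p..p + R p} (\<lambda>c. f (Z (\<rho> p c)) * a (Z (\<rho> p c))) = integral {0..X p} f"
    if p: "p \<in> {0..b}" and f: "continuous_on {0..X p} f" for p f
  proof -
    have Zi: "Z r \<in> {0..X p}" if "r \<in> {0..R p}" for r
      using Zm[of 0 r] Zm[of r "R p"] that Rin[OF p] RZ[OF p] Z(4) by auto
    have "((\<lambda>r. a (Z r) *\<^sub>R f (Z r)) has_integral (integral {Z 0..Z (R p)} f)) {0..R p}"
    proof (rule has_integral_substitution[where c = 0 and d = "X p"])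
      show "(Z has_real_derivative a (Z r)) (at r within {0..R p})" if "r \<in> {0..R p}" for r
        by (rule DERIV_subset[OF Z(11)]) (use that Rin[OF p] in auto)
      show "Z ` {0..R p} \<subseteq> {0..X p}" using Zi by blast
      show "Z 0 \<le> Z (R p)" "0 \<le> R p" using Rin[OF p] Zm[of 0 "R p"] by auto
    qed (rule f)
    then have 1: "integral {0..R p} (\<lambda>r. f (Z r) * a (Z r)) = integral {0..X p} f"
      using RZ[OF p] Z(4) by (simp add: has_integral_iff mult.commute)
    have cc: "continuous_on {0..R p} (\<lambda>r. f (Z r) * a (Z r))"
    proof -
      have Zc': "continuous_on {0..R p} Z" by (rule continuous_on_subset[OF Zc]) (use Rin[OF p] in auto)
      have Z01: "Z ` {0..R p} \<subseteq> {0..1}" "Z ` {0..R p} \<subseteq> {0..X p}" using Zi X(7)[OF p] by force+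
      show ?thesis
        by (intro continuous_intros continuous_on_compose2[OF f Zc' Z01(2)] continuous_on_compose2[OF ac Zc' Z01(1)])
    qed
    have "integral {0 + p..R p + p} (\<lambda>c. f (Z (c - p)) * a (Z (c - p))) = integral {0..R p} ((\<lambda>c. f (Z (c - p)) * a (Z (c - p))) \<circ> (\<lambda>x. x + p))"
    proof (rule integral_shift[symmetric])
      have "continuous_on {0 + p..R p + p} (\<lambda>c. (\<lambda>r. f (Z r) * a (Z r)) ((\<lambda>c. c - p) c))"
        by (rule continuous_on_compose2[OF cc, where f = "\<lambda>c. c - p"]) (auto intro!: continuous_intros)
      then show "continuous_on {0 + p..R p + p} (\<lambda>c. f (Z (c - p)) * a (Z (c - p)))" by simp
    qed
    moreover have "integral {p..p + R p} (\<lambda>c. f (Z (\<rho> p c)) * a (Z (\<rho> p c))) = integral {p..p + R p} (\<lambda>c. f (Z (c - p)) * a (Z (c - p)))"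
      by (rule Henstock_Kurzweil_Integration.integral_cong) (auto simp: \<rho>_def)
    ultimately show ?thesis using 1 by (simp add: o_def add.commute)
  qed
  have Hd: "((\<lambda>s. H s c) has_real_derivative h s c) (at s within {p..min c b})"
    if p: "p \<in> {0..b}" and pc: "p \<le> c" "c \<le> p + R p" "p < min c b" and s: "s \<in> {p..min c b}" for p c s
  proof -
    have \<rho>e: "\<rho> r c = c - r" if "r \<in> {p..min c b}" for r
      using Rm[of p r] that p pc by (auto simp: \<rho>_def)
    have rb: "r \<in> {0..b}" if "r \<in> {p..min c b}" for r using that p by auto
    have crT: "c - r \<in> {0..T}" if "r \<in> {p..min c b}" for r using \<rho>T[OF rb[OF that], of c] \<rho>e[OF that] by simp
    have dX: "(X has_real_derivative \<mu> (X r)) (at r within {p..min c b})" if "r \<in> {p..min c b}" for r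
      by (rule DERIV_subset[OF X(11)[OF rb[OF that]]]) (use p in auto)
    have dZ: "((\<lambda>r. Z (c - r)) has_real_derivative - a (Z (c - r))) (at r within {p..min c b})" if "r \<in> {p..min c b}" for r
    proof -
      have "((Z \<circ> (\<lambda>r. c - r)) has_real_derivative a (Z (c - r)) * (- 1)) (at r within {p..min c b})"
      proof (rule DERIV_image_chain)
        show "(Z has_real_derivative a (Z (c - r))) (at (c - r) within (\<lambda>r. c - r) ` {p..min c b})"
          by (rule DERIV_subset[OF Z(11)[OF crT[OF that]]]) (use crT in auto)
      qed (auto intro!: derivative_eq_intros)
      then show ?thesis by (simp add: o_def)
    qed
    have Zr: "Z (c - r) \<in> {0..1}" if "r \<in> {p..min c b}" for r by (rule Z(7)[OF crT[OF that]])
    have comp: "((\<lambda>r. f (Z (c - r))) has_real_derivative f' (Z (c - s)) * (- a (Z (c - s)))) (at s within {p..min c b})"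
      if f: "\<And>x. x \<in> {0..1} \<Longrightarrow> (f has_real_derivative f' x) (at x within {0..1})" for f f'
    proof -
      have "((f \<circ> (\<lambda>r. Z (c - r))) has_real_derivative f' (Z (c - s)) * (- a (Z (c - s)))) (at s within {p..min c b})"
      proof (rule DERIV_image_chain[OF _ dZ[OF s]])
        show "(f has_real_derivative f' (Z (c - s))) (at (Z (c - s)) within (\<lambda>r. Z (c - r)) ` {p..min c b})"
          by (rule DERIV_subset[OF f[OF Zr[OF s]]]) (use Zr in auto)
      qed
      then show ?thesis by (simp add: o_def)
    qed
    have "((\<lambda>s. \<kappa> (X s) (Z (c - s))) has_real_derivative
          \<gamma> (X s) (Z (c - s)) + a' (Z (c - s)) * \<kappa> (X s) (Z (c - s))) (at s within {p..min c b})"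
    proof -
      have "integral_curve \<mu> X {p..min c b}" "integral_curve (\<lambda>\<xi>. - a \<xi>) (\<lambda>r. Z (c - r)) {p..min c b}"
        unfolding integral_curve_def using dX dZ by blast+
      moreover have "\<forall>r\<in>{p..min c b}. (X r, Z (c - r)) \<in> kernel_triangle"
      proof
        fix r assume r: "r \<in> {p..min c b}"
        show "(X r, Z (c - r)) \<in> kernel_triangle" using tri[OF rb[OF r], of c] unfolding \<rho>e[OF r] .
      qed
      ultimately show ?thesis using char[OF pc(3)] s by blast
    qed
    moreover have "((\<lambda>r. w (Z (c - r))) has_real_derivative w' (Z (c - s)) * (- a (Z (c - s)))) (at s within {p..min c b})"
      by (rule comp) (rule w(1))
    moreover have "((\<lambda>r. a (Z (c - r))) has_real_derivative a' (Z (c - s)) * (- a (Z (c - s)))) (at s within {p..min c b})"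
      by (rule comp) (rule a(1))
    ultimately
    have "((\<lambda>s. \<kappa> (X s) (Z (c - s)) * w (Z (c - s)) * a (Z (c - s))) has_real_derivative h s c) (at s within {p..min c b})"
      unfolding h_def G_def \<rho>e[OF s] kernel_deriv_algebra[where ?c1.0 = "a' (Z (c - s))", symmetric] by (intro DERIV_mult)
    then show ?thesis
      by (rule has_field_derivative_transform_within[OF _ zero_less_one s]) (simp add: H_def F_def \<rho>e)
  qed
  define p where "p = P x"
  have p: "p \<in> {0..b}" "X p = x" using X(6)[OF x] X(8)[OF x] by (auto simp: p_def)
  have dR: "(R has_real_derivative (1 / a x) * \<mu> x) (at p within {0..b})"
  proof -
    have "((\<phi> \<circ> X) has_real_derivative (1 / a (X p)) * \<mu> (X p)) (at p within {0..b})"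
      by (rule DERIV_image_chain[OF DERIV_subset[OF Z(10)[OF X(7)[OF p(1)]]] X(11)[OF p(1)]]) (use X(7) in auto)
    then show ?thesis using p(2) by (simp add: o_def R_def[abs_def])
  qed
  have "((\<lambda>p. integral {p..p + R p} (H p)) has_real_derivative
     integral {p..p + R p} (h p) + H p (p + R p) * (1 + (1 / a x) * \<mu> x) - H p p * 1) (at p within {0..b})"
  \<comment> \<open>For fixed \<open>c\<close> the characteristic leaves the triangle at
    \<open>s = c\<close>, where \<xi> reaches \<open>0\<close>, or at \<open>s = b\<close>, where
    \<open>x\<close> reaches \<open>1\<close>, whichever comes first.\<close>
  proof (rule has_real_derivative_integral_region[OF p(1) Hc hc, where ?p0.0 = "\<lambda>c. min c b"])
    show "continuous_on {0..b + T} (\<lambda>c. min c b)" by (intro continuous_intros)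
    show "((\<lambda>p. p + R p) has_real_derivative 1 + (1 / a x) * \<mu> x) (at p within {0..b})"
      by (intro derivative_intros dR)
    show "0 \<le> p \<and> p \<le> p + R p \<and> p + R p \<le> b + T" if "p \<in> {0..b}" for p using Rin[OF that] that by auto
    show "((\<lambda>s. H s c) has_real_derivative h s c) (at s within {p..min c b})"
      if "p \<in> {0..b}" "p \<le> c" "c \<le> p + R p" "p < min c b" "s \<in> {p..min c b}" for p c s
      using Hd that by blast
    show "((\<lambda>p. p) has_real_derivative 1) (at p within {0..b})" by (rule DERIV_ident)
  qed (use X(1) in auto)
  moreover have "integral {p..p + R p} (h p) = integral {0..x} (G x)"
    unfolding h_def using subst[OF p(1), of "G x"] p(2) FG1(2)[OF x] by simp
  moreover have "H p (p + R p) = \<kappa> x x * w x * a x"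
    using RZ[OF p(1)] Rin[OF p(1)] p(2) by (simp add: H_def \<rho>_def F_def)
  moreover have "H p p = \<kappa> x 0 * w 0 * a 0"
    using Rin[OF p(1)] p(2) Z(4) by (simp add: H_def \<rho>_def F_def)
  \<comment> \<open>At the diagonal the upper limit moves with speed
    \<open>1 + \<mu> x / a x\<close> and the Jacobian is \<open>a x\<close>; their product is the
    factor \<open>\<mu> x + a x\<close> that appears in the diagonal condition of the
    kernel.\<close>
  ultimately have D: "((\<lambda>p. integral {p..p + R p} (H p)) has_real_derivative
     ((\<mu> x + a x) * \<kappa> x x * w x - a 0 * \<kappa> x 0 * w 0 + integral {0..x} (G x))) (at p within {0..b})"
    using a(2)[OF x] by (elim back_subst[where P = "\<lambda>D. (_ has_real_derivative D) _"]) (simp add: field_simps)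
  have e: "integral {p..p + R p} (H p) = integral {0..X p} (F (X p))" if "p \<in> {0..b}" for p
    unfolding H_def using subst[OF that, of "F (X p)"] FG1(1)[OF X(7)[OF that]] by simp
  have "(((\<lambda>p. integral {p..p + R p} (H p)) \<circ> P) has_real_derivative
     ((\<mu> x + a x) * \<kappa> x x * w x - a 0 * \<kappa> x 0 * w 0 + integral {0..x} (G x)) * (1 / \<mu> x)) (at x within {0..1})"
    by (rule DERIV_image_chain[OF DERIV_subset[OF D[unfolded p_def]] X(10)[OF x]]) (use X(6) in auto)
  then have "(((\<lambda>p. integral {p..p + R p} (H p)) \<circ> P) has_real_derivative
     ((\<mu> x + a x) * \<kappa> x x * w x - a 0 * \<kappa> x 0 * w 0 + integral {0..x} (G x)) / \<mu> x) (at x within {0..1})"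
    by simp
  then have "((\<lambda>x. integral {0..x} (F x)) has_real_derivative
     ((\<mu> x + a x) * \<kappa> x x * w x - a 0 * \<kappa> x 0 * w 0 + integral {0..x} (G x)) / \<mu> x) (at x within {0..1})"
    by (rule has_field_derivative_transform_within[OF _ zero_less_one x]) (use e X(6,8) in auto)
  then show ?thesis by (simp add: F_def[abs_def] G_def[abs_def])
qed

text \<open>Both coordinates follow the same flow, so in travel time the characteristics are
  parallel to the diagonal and can be labelled by the lag \<open>c\<close> of \<xi> behind
  \<open>x\<close>. The diagonal is the fixed limit \<open>c = 0\<close> and yields no boundary
  term; only the end \<open>c = p\<close>, where \<xi> is \<open>0\<close>, does.\<close>

lemma kernel_bar_integral_deriv:
  fixes \<mu> \<mu>' w w' :: "real \<Rightarrow> real" and \<kappa> \<gamma> :: "real \<Rightarrow> real \<Rightarrow> real"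
  assumes \<mu>: "\<And>x. x \<in> {0..1} \<Longrightarrow> (\<mu> has_real_derivative \<mu>' x) (at x within {0..1})" "\<And>x. x \<in> {0..1} \<Longrightarrow> \<mu> x > 0"
    and w: "\<And>x. x \<in> {0..1} \<Longrightarrow> (w has_real_derivative w' x) (at x within {0..1})" "continuous_on {0..1} w'"
    and \<kappa>: "continuous_on kernel_triangle (\<lambda>(x, \<xi>). \<kappa> x \<xi>)"
    and \<gamma>: "continuous_on kernel_triangle (\<lambda>(x, \<xi>). \<gamma> x \<xi>)"
    and char: "\<And>c d X \<Xi>. c < d \<Longrightarrow> integral_curve \<mu> X {c..d} \<Longrightarrow> integral_curve \<mu> \<Xi> {c..d} \<Longrightarrow>
       (\<forall>s\<in>{c..d}. (X s, \<Xi> s) \<in> kernel_triangle) \<Longrightarrow>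
       (\<forall>s\<in>{c..d}. ((\<lambda>s. \<kappa> (X s) (\<Xi> s)) has_real_derivative
          - \<mu>' (\<Xi> s) * \<kappa> (X s) (\<Xi> s) + \<gamma> (X s) (\<Xi> s)) (at s within {c..d}))"
    and x: "x \<in> {0..1}"
  shows "((\<lambda>x. integral {0..x} (\<lambda>\<xi>. \<kappa> x \<xi> * w \<xi>)) has_real_derivative
     (\<mu> 0 * \<kappa> x 0 * w 0
       + integral {0..x} (\<lambda>\<xi>. \<gamma> x \<xi> * w \<xi> + \<kappa> x \<xi> * \<mu> \<xi> * w' \<xi>)) / \<mu> x) (at x within {0..1})"
proof -
  have \<mu>c: "continuous_on {0..1} \<mu>" using \<mu>(1) by (rule DERIV_continuous_on)
  have wc: "continuous_on {0..1} w" using w(1) by (rule DERIV_continuous_on)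
  obtain b P X where X: "b > 0" "P 0 = 0" "P 1 = b" "X 0 = 0" "X b = 1"
    "\<And>x. x \<in> {0..1} \<Longrightarrow> P x \<in> {0..b}" "\<And>p. p \<in> {0..b} \<Longrightarrow> X p \<in> {0..1}"
    "\<And>x. x \<in> {0..1} \<Longrightarrow> X (P x) = x" "\<And>p. p \<in> {0..b} \<Longrightarrow> P (X p) = p"
    "\<And>x. x \<in> {0..1} \<Longrightarrow> (P has_real_derivative 1 / \<mu> x) (at x within {0..1})"
    "\<And>p. p \<in> {0..b} \<Longrightarrow> (X has_real_derivative \<mu> (X p)) (at p within {0..b})"
    by (rule flow_coordinates[OF \<mu>c]) (erule \<mu>(2), rule that, assumption+)
  have Xc: "continuous_on {0..b} X" using X(11) by (rule DERIV_continuous_on)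
  have Xm: "X p \<le> X r" if "0 \<le> p" "p \<le> r" "r \<le> b" for p r
    by (rule mono_from_deriv_Icc[OF X(11) _ that]) (assumption | rule less_imp_le \<mu>(2) X(7))+
  define \<rho> where "\<rho> p c = max 0 (p - c)" for p c :: real
  define S where "S = {0..b} \<times> {0..b}"
  have \<rho>in: "\<rho> p c \<in> {0..p}" if "p \<in> {0..b}" "c \<in> {0..b}" for p c using that by (auto simp: \<rho>_def)
  have X1: "continuous_on S (\<lambda>u. X (fst u))"
    by (rule continuous_on_compose2[OF Xc]) (auto intro!: continuous_intros simp: S_def)
  have Z1: "continuous_on S (\<lambda>u. X (\<rho> (fst u) (snd u)))"
    by (rule continuous_on_compose2[OF Xc]) (auto intro!: continuous_intros simp: S_def \<rho>_def)
  have Zin: "X (\<rho> p c) \<in> {0..1}" if "p \<in> {0..b}" "c \<in> {0..b}" for p c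
    using \<rho>in[OF that] that by (intro X(7)) auto
  have tri: "(X p, X (\<rho> p c)) \<in> kernel_triangle" if "p \<in> {0..b}" "c \<in> {0..b}" for p c
    using Xm[of "\<rho> p c" p] \<rho>in[OF that] that Zin[OF that] X(7)[OF that(1)] by (auto simp: kernel_triangle_def)
  define F where "F x \<xi> = \<kappa> x \<xi> * w \<xi>" for x \<xi>
  define G where "G x \<xi> = \<gamma> x \<xi> * w \<xi> + \<kappa> x \<xi> * \<mu> \<xi> * w' \<xi>" for x \<xi>
  have snd1: "continuous_on kernel_triangle (\<lambda>u. f (snd u))" if "continuous_on {0..1} f" for f :: "real \<Rightarrow> real"
    by (rule continuous_on_compose2[OF that]) (auto intro!: continuous_intros simp: kernel_triangle_def)
  have Fc: "continuous_on kernel_triangle (\<lambda>(x, \<xi>). F x \<xi>)"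
    unfolding F_def case_prod_unfold by (intro continuous_intros \<kappa>[unfolded case_prod_unfold] snd1 wc)
  have Gc: "continuous_on kernel_triangle (\<lambda>(x, \<xi>). G x \<xi>)"
    unfolding G_def case_prod_unfold
    by (intro continuous_intros \<kappa>[unfolded case_prod_unfold] \<gamma>[unfolded case_prod_unfold] snd1 wc \<mu>c w(2))
  have FG1: "continuous_on {0..y} (F y)" "continuous_on {0..y} (G y)" if "y \<in> {0..1}" for y
    by (rule continuous_on_comp2[OF Fc] continuous_on_comp2[OF Gc];
        use that in \<open>auto intro!: continuous_intros simp: kernel_triangle_def\<close>)+
  define H where "H p c = F (X p) (X (\<rho> p c)) * \<mu> (X (\<rho> p c))" for p c
  define h where "h p c = G (X p) (X (\<rho> p c)) * \<mu> (X (\<rho> p c))" for p c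
  have ZA: "continuous_on S (\<lambda>u. \<mu> (X (\<rho> (fst u) (snd u))))"
    by (rule continuous_on_compose2[OF \<mu>c Z1]) (use Zin in \<open>auto simp: S_def\<close>)
  have Hc: "continuous_on ({0..b} \<times> {0..b}) (\<lambda>(p, c). H p c)"
    unfolding H_def case_prod_unfold S_def[symmetric]
    by (intro continuous_intros ZA continuous_on_comp2[OF Fc X1 Z1]) (use tri in \<open>auto simp: S_def\<close>)
  have hc: "continuous_on ({0..b} \<times> {0..b}) (\<lambda>(p, c). h p c)"
    unfolding h_def case_prod_unfold S_def[symmetric]
    by (intro continuous_intros ZA continuous_on_comp2[OF Gc X1 Z1]) (use tri in \<open>auto simp: S_def\<close>)
  have subst: "integral {0..p} (\<lambda>c. f (X (\<rho> p c)) * \<mu> (X (\<rho> p c))) = integral {0..X p} f"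
    if p: "p \<in> {0..b}" and f: "continuous_on {0..X p} f" for p f
  proof -
    have Zi: "X (p - r) \<in> {0..X p}" if "r \<in> {0..p}" for r
      using Xm[of "p - r" p] that p X(7)[of "p - r"] by auto
    \<comment> \<open>The substitution reverses the orientation, so the general rule returns a
      difference of two integrals, of which the one over \<open>{X p..0}\<close> vanishes.\<close>
    have "((\<lambda>c. (- \<mu> (X (p - c))) *\<^sub>R f (X (p - c))) has_integral (integral {X (p - 0)..X (p - p)} f - integral {X (p - p)..X (p - 0)} f)) {0..p}"
    proof (rule has_integral_substitution_general[of "{}" 0 p "\<lambda>c. X (p - c)" 0 "X p" f])
      show der: "((\<lambda>c. X (p - c)) has_real_derivative - \<mu> (X (p - c))) (at c within {0..p})" if "c \<in> {0..p} - {}" for c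
      proof -
        have "((X \<circ> (\<lambda>c. p - c)) has_real_derivative \<mu> (X (p - c)) * (- 1)) (at c within {0..p})"
        proof (rule DERIV_image_chain)
          show "(X has_real_derivative \<mu> (X (p - c))) (at (p - c) within (\<lambda>r. p - r) ` {0..p})"
            by (rule DERIV_subset[OF X(11)]) (use that p in auto)
        qed (auto intro!: derivative_eq_intros)
        then show ?thesis by (simp add: o_def)
      qed
      show "(\<lambda>c. X (p - c)) ` {0..p} \<subseteq> {0..X p}" using Zi by blast
      show "continuous_on {0..p} (\<lambda>c. X (p - c))"
        by (rule DERIV_continuous_on) (rule der, simp)
    qed (use p f in auto)
    moreover have "integral {X p..0} f = 0"
      using X(7)[OF p] by (cases "X p = 0") auto
    ultimately have "((\<lambda>c. - (\<mu> (X (p - c)) * f (X (p - c)))) has_integral - integral {0..X p} f) {0..p}"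
      using X(4) by simp
    from has_integral_neg[OF this]
    have "((\<lambda>c. \<mu> (X (p - c)) * f (X (p - c))) has_integral integral {0..X p} f) {0..p}" by simp
    then have "integral {0..p} (\<lambda>c. f (X (p - c)) * \<mu> (X (p - c))) = integral {0..X p} f"
      by (simp add: has_integral_iff mult.commute)
    moreover have "integral {0..p} (\<lambda>c. f (X (\<rho> p c)) * \<mu> (X (\<rho> p c))) = integral {0..p} (\<lambda>c. f (X (p - c)) * \<mu> (X (p - c)))"
      by (rule Henstock_Kurzweil_Integration.integral_cong) (auto simp: \<rho>_def)
    ultimately show ?thesis by simp
  qed
  have Hd: "((\<lambda>s. H s c) has_real_derivative h s c) (at s within {p..b})"
    if p: "p \<in> {0..b}" and pc: "0 \<le> c" "c \<le> p" "p < b" and s: "s \<in> {p..b}" for p c s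
  proof -
    have \<rho>e: "\<rho> r c = r - c" if "r \<in> {p..b}" for r using that p pc by (auto simp: \<rho>_def)
    have rb: "r \<in> {0..b}" if "r \<in> {p..b}" for r using that p by auto
    have crT: "r - c \<in> {0..b}" if "r \<in> {p..b}" for r using that p pc by auto
    have cb: "c \<in> {0..b}" using pc p by auto
    have dX: "(X has_real_derivative \<mu> (X r)) (at r within {p..b})" if "r \<in> {p..b}" for r
      by (rule DERIV_subset[OF X(11)[OF rb[OF that]]]) (use p in auto)
    have dZ: "((\<lambda>r. X (r - c)) has_real_derivative \<mu> (X (r - c))) (at r within {p..b})" if "r \<in> {p..b}" for r
    proof -
      have "((X \<circ> (\<lambda>r. r - c)) has_real_derivative \<mu> (X (r - c)) * 1) (at r within {p..b})"
      proof (rule DERIV_image_chain)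
        show "(X has_real_derivative \<mu> (X (r - c))) (at (r - c) within (\<lambda>r. r - c) ` {p..b})"
          by (rule DERIV_subset[OF X(11)[OF crT[OF that]]]) (use crT in blast)
      qed (auto intro!: derivative_eq_intros)
      then show ?thesis by (simp add: o_def)
    qed
    have Zr: "X (r - c) \<in> {0..1}" if "r \<in> {p..b}" for r by (rule X(7)[OF crT[OF that]])
    have comp: "((\<lambda>r. f (X (r - c))) has_real_derivative f' (X (s - c)) * \<mu> (X (s - c))) (at s within {p..b})"
      if f: "\<And>x. x \<in> {0..1} \<Longrightarrow> (f has_real_derivative f' x) (at x within {0..1})" for f f'
    proof -
      have "((f \<circ> (\<lambda>r. X (r - c))) has_real_derivative f' (X (s - c)) * \<mu> (X (s - c))) (at s within {p..b})"
      proof (rule DERIV_image_chain[OF _ dZ[OF s]])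
        show "(f has_real_derivative f' (X (s - c))) (at (X (s - c)) within (\<lambda>r. X (r - c)) ` {p..b})"
          by (rule DERIV_subset[OF f[OF Zr[OF s]]]) (use Zr in auto)
      qed
      then show ?thesis by (simp add: o_def)
    qed
    have "((\<lambda>s. \<kappa> (X s) (X (s - c))) has_real_derivative
          - \<mu>' (X (s - c)) * \<kappa> (X s) (X (s - c)) + \<gamma> (X s) (X (s - c))) (at s within {p..b})"
    proof -
      have "integral_curve \<mu> X {p..b}" "integral_curve \<mu> (\<lambda>r. X (r - c)) {p..b}"
        unfolding integral_curve_def using dX dZ by blast+
      moreover have "\<forall>r\<in>{p..b}. (X r, X (r - c)) \<in> kernel_triangle"
      proof
        fix r assume r: "r \<in> {p..b}"
        show "(X r, X (r - c)) \<in> kernel_triangle" using tri[OF rb[OF r] cb] unfolding \<rho>e[OF r] .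
      qed
      ultimately show ?thesis using char[OF pc(3)] s by blast
    qed
    moreover have "((\<lambda>r. w (X (r - c))) has_real_derivative w' (X (s - c)) * \<mu> (X (s - c))) (at s within {p..b})"
      by (rule comp) (rule w(1))
    moreover have "((\<lambda>r. \<mu> (X (r - c))) has_real_derivative \<mu>' (X (s - c)) * \<mu> (X (s - c))) (at s within {p..b})"
      by (rule comp) (rule \<mu>(1))
    ultimately have "((\<lambda>s. \<kappa> (X s) (X (s - c)) * w (X (s - c)) * \<mu> (X (s - c))) has_real_derivative
       ((- \<mu>' (X (s - c)) * \<kappa> (X s) (X (s - c)) + \<gamma> (X s) (X (s - c))) * w (X (s - c))
         + w' (X (s - c)) * \<mu> (X (s - c)) * \<kappa> (X s) (X (s - c))) * \<mu> (X (s - c))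
         + \<mu>' (X (s - c)) * \<mu> (X (s - c)) * (\<kappa> (X s) (X (s - c)) * w (X (s - c)))) (at s within {p..b})"
      by (intro DERIV_mult)
    moreover have "((- m1 * k + g) * v + v1 * m * k) * m + m1 * m * (k * v) = (g * v + k * m * v1) * m"
      for m1 k g v v1 m :: real by (simp add: algebra_simps)
    ultimately have "((\<lambda>s. \<kappa> (X s) (X (s - c)) * w (X (s - c)) * \<mu> (X (s - c))) has_real_derivative h s c) (at s within {p..b})"
      unfolding h_def G_def \<rho>e[OF s] by (simp only:)
    then show ?thesis
      by (rule has_field_derivative_transform_within[OF _ zero_less_one s]) (simp add: H_def F_def \<rho>e)
  qed
  define p where "p = P x"
  have p: "p \<in> {0..b}" "X p = x" using X(6)[OF x] X(8)[OF x] by (auto simp: p_def)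
  have "((\<lambda>p. integral {0..p} (H p)) has_real_derivative
     integral {0..p} (h p) + H p p * 1 - H p 0 * 0) (at p within {0..b})"
  proof (rule has_real_derivative_integral_region[OF p(1) Hc hc, where ?p0.0 = "\<lambda>c. b"])
    show "((\<lambda>s. H s c) has_real_derivative h s c) (at s within {p..b})"
      if "p \<in> {0..b}" "0 \<le> c" "c \<le> p" "p < b" "s \<in> {p..b}" for p c s
      using Hd that by blast
    show "((\<lambda>p. p) has_real_derivative 1) (at p within {0..b})" by (rule DERIV_ident)
    show "((\<lambda>p. 0) has_real_derivative 0) (at p within {0..b})" by (rule DERIV_const)
  qed (use X(1) in auto)
  moreover have "integral {0..p} (h p) = integral {0..x} (G x)"
    unfolding h_def using subst[OF p(1), of "G x"] p(2) FG1(2)[OF x] by simp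
  moreover have "H p p = \<kappa> x 0 * w 0 * \<mu> 0"
    using p(2) X(4) by (simp add: H_def \<rho>_def F_def)
  ultimately have D: "((\<lambda>p. integral {0..p} (H p)) has_real_derivative
     (\<mu> 0 * \<kappa> x 0 * w 0 + integral {0..x} (G x))) (at p within {0..b})"
    by (simp add: mult_ac add.commute)
  have e: "integral {0..p} (H p) = integral {0..X p} (F (X p))" if "p \<in> {0..b}" for p
    unfolding H_def using subst[OF that, of "F (X p)"] FG1(1)[OF X(7)[OF that]] by simp
  have "(((\<lambda>p. integral {0..p} (H p)) \<circ> P) has_real_derivative
     (\<mu> 0 * \<kappa> x 0 * w 0 + integral {0..x} (G x)) * (1 / \<mu> x)) (at x within {0..1})"
    by (rule DERIV_image_chain[OF DERIV_subset[OF D[unfolded p_def]] X(10)[OF x]]) (use X(6) in auto)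
  then have "(((\<lambda>p. integral {0..p} (H p)) \<circ> P) has_real_derivative
     (\<mu> 0 * \<kappa> x 0 * w 0 + integral {0..x} (G x)) / \<mu> x) (at x within {0..1})"
    by simp
  then have "((\<lambda>x. integral {0..x} (F x)) has_real_derivative
     (\<mu> 0 * \<kappa> x 0 * w 0 + integral {0..x} (G x)) / \<mu> x) (at x within {0..1})"
    by (rule has_field_derivative_transform_within[OF _ zero_less_one x]) (use e X(6,8) in auto)
  then show ?thesis by (simp add: F_def[abs_def] G_def[abs_def])
qed

lemma continuous_AE_eq_imp_eq:
  fixes f g :: "real \<Rightarrow> real"
  assumes "continuous_on {0..1} f" "continuous_on {0..1} g" "AE x in lebesgue_on {0..1}. f x = g x" "x \<in> {0..1}"
  shows "f x = g x"
proof -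
  have "integral {0..1} (\<lambda>x. (f x - g x)\<^sup>2) = integral {0..1::real} (\<lambda>x. 0)"
    by (rule integral_AE_cong) (use assms(3) in eventually_elim, simp)
  then have "integral {0..1} (\<lambda>x. (f x - g x)\<^sup>2) = 0" by simp
  then have "\<forall>x\<in>{0..1}. (f x - g x)\<^sup>2 = 0"
    by (subst (asm) integral_eq_0_iff) (use assms in \<open>auto intro!: continuous_intros\<close>)
  then show ?thesis using assms(4) by auto
qed

text \<open>Uniform continuity on the compact product bounds the oscillation over a cell of length
  \<open>1 / n\<close> for all parameters \<open>s\<close> at once. Uniformity in \<open>s\<close>
  is what later bounds the quadrature errors on the entire kernel triangle.\<close>

lemma riemann_sum_uniform:
  fixes f :: "'a::metric_space \<Rightarrow> real \<Rightarrow> real"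
  assumes S: "compact S" and f: "continuous_on (S \<times> {0..1}) (\<lambda>(s, y). f s y)" and e: "\<epsilon> > 0"
  obtains N where "\<And>n s. n \<ge> N \<Longrightarrow> s \<in> S \<Longrightarrow>
      \<bar>integral {0..1} (f s) - 1 / real n * (\<Sum>i=1..n. f s (real i / real n))\<bar> \<le> \<epsilon>"
proof -
  have "uniformly_continuous_on (S \<times> {0..1}) (\<lambda>(s, y). f s y)"
    by (intro compact_uniformly_continuous f compact_Times S) auto
  then obtain d where d: "d > 0" "\<And>u v. u \<in> S \<times> {0..1} \<Longrightarrow> v \<in> S \<times> {0..1} \<Longrightarrow> dist u v < d \<Longrightarrow>
      dist (case u of (s, y) \<Rightarrow> f s y) (case v of (s, y) \<Rightarrow> f s y) < \<epsilon>"
    unfolding uniformly_continuous_on_def using e by (metis dist_commute)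
  obtain N :: nat where N: "1 / d < real N" using reals_Archimedean2 by blast
  have "\<bar>integral {0..1} (f s) - 1 / real n * (\<Sum>i=1..n. f s (real i / real n))\<bar> \<le> \<epsilon>"
    if n: "n \<ge> N" and s: "s \<in> S" for n s
  proof -
    have nd: "1 / d < real n" using N n by linarith
    then have np: "real n > 0" using d(1) by (metis less_trans zero_less_divide_1_iff)
    have nd': "1 / real n < d" using nd np d(1) by (simp add: field_simps)
    have fc: "continuous_on {0..1} (f s)"
      by (rule continuous_on_comp2[OF f]) (use s in \<open>auto intro!: continuous_intros\<close>)
    \<comment> \<open>Induction over the number of cells, with an error proportional to the length
      already covered.\<close>
    have "\<bar>integral {0..real m / real n} (f s) - 1 / real n * (\<Sum>i=1..m. f s (real i / real n))\<bar> \<le> \<epsilon> * (real m / real n)"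
      if "m \<le> n" for m
      using that
    proof (induction m)
      case (Suc m)
      define p r where "p = real m / real n" and "r = real (Suc m) / real n"
      have pr: "0 \<le> p" "p \<le> r" "r \<le> 1" "r - p = 1 / real n"
        using np Suc.prems by (auto simp: p_def r_def field_simps)
      have i: "integral {0..p} (f s) + integral {p..r} (f s) = integral {0..r} (f s)"
        by (rule Henstock_Kurzweil_Integration.integral_combine)
          (use pr in \<open>auto intro!: integrable_continuous_real continuous_on_subset[OF fc]\<close>)
      have "norm (integral {p..r} (\<lambda>y. f s y - f s r)) \<le> \<epsilon> * (r - p)"
      proof (rule integral_bound[OF pr(2)])
        show "continuous_on {p..r} (\<lambda>y. f s y - f s r)"
          using pr by (auto intro!: continuous_intros continuous_on_subset[OF fc])
        show "norm (f s y - f s r) \<le> \<epsilon>" if "y \<in> {p..r}" for y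
        proof -
          have "dist (s, y) (s, r) < d" using that pr nd' by (simp add: dist_Pair_Pair dist_real_def)
          then show ?thesis using d(2)[of "(s, y)" "(s, r)"] that pr s by (auto simp: dist_real_def)
        qed
      qed
      moreover have "integral {p..r} (\<lambda>y. f s y - f s r) = integral {p..r} (f s) - 1 / real n * f s r"
        using pr by (subst Henstock_Kurzweil_Integration.integral_diff)
          (auto intro!: integrable_continuous_real continuous_on_subset[OF fc])
      ultimately have "\<bar>integral {p..r} (f s) - 1 / real n * f s r\<bar> \<le> \<epsilon> * (1 / real n)"
        using pr(4) by simp
      moreover have "\<bar>integral {0..p} (f s) - 1 / real n * (\<Sum>i=1..m. f s (real i / real n))\<bar> \<le> \<epsilon> * p"
        using Suc by (simp add: p_def)
      moreover have "\<epsilon> * r = \<epsilon> * p + \<epsilon> * (1 / real n)" using pr(4) by (simp add: algebra_simps)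
      moreover have "(\<Sum>i=1..Suc m. f s (real i / real n)) = (\<Sum>i=1..m. f s (real i / real n)) + f s r"
        by (simp add: r_def)
      ultimately show ?case unfolding r_def[symmetric] i[symmetric] by (simp add: distrib_left)
    qed simp
    from this[of n] np show ?thesis by simp
  qed
  then show ?thesis using that by blast
qed

section \<open>Continuum data and the kernel equations in integrated form\<close>

locale continuum =
  fixes \<mu> q :: "real \<Rightarrow> real"
    and lam W \<theta> :: "real \<Rightarrow> real \<Rightarrow> real"
    and \<sigma> :: "real \<Rightarrow> real \<Rightarrow> real \<Rightarrow> real"
    and lam_min :: real
    and k :: "real \<Rightarrow> real \<Rightarrow> real \<Rightarrow> real"
    and kbar :: "real \<Rightarrow> real \<Rightarrow> real"
  assumes \<mu>_C1: "C1_on {0..1} \<mu>"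
    and lam_C1: "C1_on ({0..1} \<times> {0..1}) (\<lambda>(x, y). lam x y)"
    and W_cont: "continuous_on ({0..1} \<times> {0..1}) (\<lambda>(x, y). W x y)"
    and \<theta>_cont: "continuous_on ({0..1} \<times> {0..1}) (\<lambda>(x, y). \<theta> x y)"
    and \<sigma>_cont: "continuous_on ({0..1} \<times> {0..1} \<times> {0..1}) (\<lambda>(x, y, z). \<sigma> x y z)"
    and q_cont: "continuous_on {0..1} q"
    and \<mu>_pos: "\<forall>x\<in>{0..1}. \<mu> x > 0"
    and lam_min: "lam_min > 0" "\<forall>x\<in>{0..1}. \<forall>y\<in>{0..1}. lam x y \<ge> lam_min"
    and kernel: "continuum_kernel_solution \<mu> lam W \<theta> \<sigma> q k kbar"
begin

definition \<mu>' where "\<mu>' x = vector_derivative \<mu> (at x within {0..1})"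
definition lam' where "lam' x y = vector_derivative (\<lambda>\<xi>. lam \<xi> y) (at x within {0..1})"

lemma \<mu>_deriv: assumes "x \<in> {0..1}" shows "(\<mu> has_real_derivative \<mu>' x) (at x within {0..1})"
proof -
  have "\<mu> differentiable (at x within {0..1})"
    using \<mu>_C1 assms unfolding C1_on_def differentiable_def by blast
  then show ?thesis unfolding \<mu>'_def has_real_derivative_iff_has_vector_derivative
    by (simp add: vector_derivative_works)
qed

lemma lam_deriv:
  assumes x: "x \<in> {0..1}" and y: "y \<in> {0..1}"
  shows "((\<lambda>\<xi>. lam \<xi> y) has_real_derivative lam' x y) (at x within {0..1})"
proof -
  obtain D where "((\<lambda>(x, y). lam x y) has_derivative blinfun_apply D) (at (x, y) within ({0..1} \<times> {0..1}))"
    using lam_C1 x y unfolding C1_on_def by fastforce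
  then have "((\<lambda>(x, y). lam x y) has_derivative blinfun_apply D) (at (x, y) within (\<lambda>\<xi>. (\<xi>, y)) ` {0..1})"
    by (rule has_derivative_subset) (use y in auto)
  moreover have "((\<lambda>\<xi>. (\<xi>, y)) has_derivative (\<lambda>t. (t, 0))) (at x within {0..1})"
    by (auto intro!: derivative_eq_intros)
  ultimately have "(\<lambda>\<xi>. lam \<xi> y) differentiable (at x within {0..1})"
    using diff_chain_within[of "\<lambda>\<xi>. (\<xi>, y)" _ x "{0..1}" "\<lambda>(x, y). lam x y"]
    unfolding differentiable_def by (fastforce simp: o_def)
  then show ?thesis unfolding lam'_def has_real_derivative_iff_has_vector_derivative
    by (simp add: vector_derivative_works)
qed

lemma lam_cont: "continuous_on ({0..1} \<times> {0..1}) (\<lambda>(x, y). lam x y)"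
  using lam_C1 unfolding C1_on_def
  by (metis differentiable_def differentiable_imp_continuous_on differentiable_on_def)

lemma \<mu>_cont: "continuous_on {0..1} \<mu>" using \<mu>_deriv by (rule DERIV_continuous_on)

definition tri3 where "tri3 = {(x, \<xi>, y). (x, \<xi>) \<in> kernel_triangle \<and> y \<in> {0..1::real}}"

lemma k_cont: "continuous_on tri3 (\<lambda>(x, \<xi>, y). k x \<xi> y)"
proof -
  have "continuous_on (kernel_triangle \<times> {0..1}) (\<lambda>((x, \<xi>), y). k x \<xi> y)"
    using kernel by (simp add: continuum_kernel_solution_def)
  then have "continuous_on tri3 (\<lambda>u. (\<lambda>((x, \<xi>), y). k x \<xi> y) ((fst u, fst (snd u)), snd (snd u)))"
    by (rule continuous_on_compose2) (auto simp: tri3_def intro!: continuous_intros)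
  then show ?thesis by (simp add: case_prod_unfold)
qed

lemma kbar_cont: "continuous_on kernel_triangle (\<lambda>(x, \<xi>). kbar x \<xi>)"
  using kernel by (simp add: continuum_kernel_solution_def)

lemma k_diag: "x \<in> {0..1} \<Longrightarrow> y \<in> {0..1} \<Longrightarrow> (\<mu> x + lam x y) * k x x y = - \<theta> x y"
proof -
  assume x: "x \<in> {0..1}" and y: "y \<in> {0..1}"
  then have "k x x y = - (\<theta> x y / (lam x y + \<mu> x))"
    using kernel by (simp add: continuum_kernel_solution_def)
  moreover have "lam x y + \<mu> x \<noteq> 0" using lam_min \<mu>_pos x y by (metis add_pos_pos less_le_trans less_irrefl)
  ultimately show ?thesis by (simp add: add.commute)
qed

lemma kbar_zero: "x \<in> {0..1} \<Longrightarrow> \<mu> 0 * kbar x 0 = integral {0..1} (\<lambda>y. q y * lam 0 y * k x 0 y)"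
  using kernel by (simp add: continuum_kernel_solution_def)

text \<open>Right-hand sides of the kernel equations along characteristics, without the terms that
  contain a derivative of a speed; those cancel against the Jacobian in the integral
  formulas.\<close>

definition gk where "gk x \<xi> y = \<theta> \<xi> y * kbar x \<xi> + integral {0..1} (\<lambda>\<eta>. \<sigma> \<xi> \<eta> y * k x \<xi> \<eta>)"
definition gb where "gb x \<xi> = integral {0..1} (\<lambda>y. W \<xi> y * k x \<xi> y)"

lemma sigma_k_cont: "continuous_on (tri3 \<times> {0..1}) (\<lambda>((x, \<xi>, y), \<eta>). \<sigma> \<xi> \<eta> y * k x \<xi> \<eta>)"
  unfolding case_prod_unfold
  by (intro continuous_intros continuous_on_comp3[OF \<sigma>_cont] continuous_on_comp3[OF k_cont])
    (auto simp: tri3_def kernel_triangle_def)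

lemma W_k_cont: "continuous_on (kernel_triangle \<times> {0..1}) (\<lambda>((x, \<xi>), y). W \<xi> y * k x \<xi> y)"
  unfolding case_prod_unfold
  by (intro continuous_intros continuous_on_comp2[OF W_cont] continuous_on_comp3[OF k_cont])
    (auto simp: tri3_def kernel_triangle_def)

lemma gk_cont: "continuous_on tri3 (\<lambda>(x, \<xi>, y). gk x \<xi> y)"
proof -
  have "continuous_on (tri3 \<times> cbox 0 1) (\<lambda>(u, \<eta>). \<sigma> (fst (snd u)) \<eta> (snd (snd u)) * k (fst u) (fst (snd u)) \<eta>)"
    using sigma_k_cont by (simp add: case_prod_unfold)
  from integral_continuous_on_param[OF this]
  have "continuous_on tri3 (\<lambda>u. integral {0..1} (\<lambda>\<eta>. \<sigma> (fst (snd u)) \<eta> (snd (snd u)) * k (fst u) (fst (snd u)) \<eta>))"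
    by simp
  then show ?thesis unfolding gk_def case_prod_unfold
    by (intro continuous_intros continuous_on_comp2[OF \<theta>_cont] continuous_on_comp2[OF kbar_cont])
      (auto simp: tri3_def kernel_triangle_def)
qed

lemma gb_cont: "continuous_on kernel_triangle (\<lambda>(x, \<xi>). gb x \<xi>)"
proof -
  have "continuous_on (kernel_triangle \<times> cbox 0 1) (\<lambda>(u, y). W (snd u) y * k (fst u) (snd u) y)"
    using W_k_cont by (simp add: case_prod_unfold)
  from integral_continuous_on_param[OF this] show ?thesis
    by (simp add: gb_def case_prod_unfold)
qed

lemma slice_tri3:
  assumes "continuous_on tri3 (\<lambda>(x, \<xi>, y). f x \<xi> y)" "y \<in> {0..1}"
  shows "continuous_on kernel_triangle (\<lambda>(x, \<xi>). f x \<xi> y)"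
  unfolding case_prod_unfold
  by (rule continuous_on_comp3[OF assms(1)]) (use assms(2) in \<open>auto simp: tri3_def intro!: continuous_intros\<close>)

text \<open>
  For almost every \<open>y\<close> this is \<open>kernel_integral_deriv\<close>; the integrated identity extends to all \<open>y\<close> by continuity,
  in particular to the null set of grid points \<open>i / n\<close>.
\<close>

lemma k_integral_deriv:
  assumes w: "\<And>x. x \<in> {0..1} \<Longrightarrow> (w has_real_derivative w' x) (at x within {0..1})" "continuous_on {0..1} w'"
    and x: "x \<in> {0..1}" and y: "y \<in> {0..1}"
  shows "((\<lambda>x. integral {0..x} (\<lambda>\<xi>. k x \<xi> y * w \<xi>)) has_real_derivative
     (- \<theta> x y * w x - lam 0 y * k x 0 y * w 0
       + integral {0..x} (\<lambda>\<xi>. gk x \<xi> y * w \<xi> - k x \<xi> y * lam \<xi> y * w' \<xi>)) / \<mu> x) (at x within {0..1})"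
proof -
  define B where "B x y = integral {0..x} (\<lambda>\<xi>. k x \<xi> y * w \<xi>)" for x y
  define D where "D x y = (- \<theta> x y * w x - lam 0 y * k x 0 y * w 0
       + integral {0..x} (\<lambda>\<xi>. gk x \<xi> y * w \<xi> - k x \<xi> y * lam \<xi> y * w' \<xi>)) / \<mu> x" for x y
  have wc: "continuous_on {0..1} w" using w(1) by (rule DERIV_continuous_on)
  let ?S = "{0..1} \<times> {0..1} :: (real \<times> real) set"
  have up: "continuous_on ?S (\<lambda>u. integral {0..fst u} (\<lambda>\<xi>. f (fst u) \<xi> (snd u)))"
    if "continuous_on tri3 (\<lambda>(x, \<xi>, y). f x \<xi> y)" for f :: "real \<Rightarrow> real \<Rightarrow> real \<Rightarrow> real"
  proof (rule continuous_on_integral_upper)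
    show "continuous_on {(u, s). u \<in> ?S \<and> 0 \<le> s \<and> s \<le> fst u} (\<lambda>(u, \<xi>). f (fst u) \<xi> (snd u))"
      unfolding case_prod_unfold
      by (rule continuous_on_comp3[OF that]) (auto simp: tri3_def kernel_triangle_def intro!: continuous_intros)
  qed (auto intro!: continuous_intros)
  have kw: "continuous_on tri3 (\<lambda>(x, \<xi>, y). k x \<xi> y * w \<xi>)"
    unfolding case_prod_unfold
    by (intro continuous_intros continuous_on_comp3[OF k_cont] continuous_on_compose2[OF wc])
       (auto simp: tri3_def kernel_triangle_def)
  have gw: "continuous_on tri3 (\<lambda>(x, \<xi>, y). gk x \<xi> y * w \<xi> - k x \<xi> y * lam \<xi> y * w' \<xi>)"
    unfolding case_prod_unfold
    by (intro continuous_intros continuous_on_comp3[OF k_cont] continuous_on_comp3[OF gk_cont]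
      continuous_on_comp2[OF lam_cont] continuous_on_compose2[OF wc] continuous_on_compose2[OF w(2)])
       (auto simp: tri3_def kernel_triangle_def)
  have Bc: "continuous_on ?S (\<lambda>(x, y). B x y)" using up[OF kw] by (simp add: B_def case_prod_unfold)
  have Dc: "continuous_on ?S (\<lambda>(x, y). D x y)"
    unfolding D_def case_prod_unfold
    by (intro continuous_intros up[OF gw] continuous_on_comp2[OF \<theta>_cont] continuous_on_comp2[OF lam_cont]
       continuous_on_comp3[OF k_cont] continuous_on_compose2[OF wc] continuous_on_compose2[OF \<mu>_cont] ballI)
      (use \<mu>_pos in \<open>auto simp: tri3_def kernel_triangle_def dest: bspec\<close>)
  have Dx: "continuous_on {0..1} (\<lambda>x. D x y)" if "y \<in> {0..1}" for y
    by (rule continuous_on_comp2[OF Dc]) (use that in \<open>auto intro!: continuous_intros\<close>)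
  have AEy: "AE y in lebesgue_on {0..1}. \<forall>a b X \<Xi>.
        a < b \<longrightarrow> integral_curve \<mu> X {a..b} \<longrightarrow> integral_curve (\<lambda>\<xi>. - lam \<xi> y) \<Xi> {a..b} \<longrightarrow>
        (\<forall>s\<in>{a..b}. (X s, \<Xi> s) \<in> kernel_triangle) \<longrightarrow>
        (\<forall>s\<in>{a..b}. ((\<lambda>s. k (X s) (\<Xi> s) y) has_real_derivative
            gk (X s) (\<Xi> s) y + lam' (\<Xi> s) y * k (X s) (\<Xi> s) y) (at s within {a..b}))"
    using kernel by (simp add: continuum_kernel_solution_def gk_def lam'_def ac_simps)
  have AEy2: "AE y in lebesgue_on {0..1}. \<forall>x\<in>{0..1}. B x y = integral {0..x} (\<lambda>s. D s y)"
    using AEy AE_space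
  proof eventually_elim
    case (elim y)
    then have y: "y \<in> {0..1}" by simp
    have der: "((\<lambda>x. B x y) has_real_derivative D x y) (at x within {0..1})" if x: "x \<in> {0..1}" for x
    proof -
      have "((\<lambda>x. integral {0..x} (\<lambda>\<xi>. k x \<xi> y * w \<xi>)) has_real_derivative
         ((\<mu> x + lam x y) * k x x y * w x - lam 0 y * k x 0 y * w 0
         + integral {0..x} (\<lambda>\<xi>. gk x \<xi> y * w \<xi> - k x \<xi> y * lam \<xi> y * w' \<xi>)) / \<mu> x) (at x within {0..1})"
      proof (rule kernel_integral_deriv[where a' = "\<lambda>\<xi>. lam' \<xi> y"])
        show "lam x y > 0" if "x \<in> {0..1}" for x using lam_min that y by (meson less_le_trans)
        show "\<forall>s\<in>{c..d}. ((\<lambda>s. k (X s) (\<Xi> s) y) has_real_derivative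
           gk (X s) (\<Xi> s) y + lam' (\<Xi> s) y * k (X s) (\<Xi> s) y) (at s within {c..d})"
          if "c < d" "integral_curve \<mu> X {c..d}" "integral_curve (\<lambda>\<xi>. - lam \<xi> y) \<Xi> {c..d}"
            "\<forall>s\<in>{c..d}. (X s, \<Xi> s) \<in> kernel_triangle" for c d X \<Xi>
          using elim(1) that by blast
      qed (use \<mu>_cont \<mu>_pos lam_deriv y w slice_tri3[OF k_cont y] slice_tri3[OF gk_cont y] x in blast)+
      then show ?thesis using k_diag[OF x y] by (simp add: B_def D_def)
    qed
    show ?case
    proof
      fix x :: real assume x: "x \<in> {0..1}"
      have "((\<lambda>s. D s y) has_integral (B x y - B 0 y)) {0..x}"
        by (rule fundamental_theorem_of_calculus)
          (use x in \<open>auto simp: has_real_derivative_iff_has_vector_derivative[symmetric] intro!: DERIV_subset[OF der]\<close>)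
      then show "B x y = integral {0..x} (\<lambda>s. D s y)" by (simp add: has_integral_iff B_def)
    qed
  qed
  have eq: "B x y = integral {0..x} (\<lambda>s. D s y)" if x: "x \<in> {0..1}" for x
  proof (rule continuous_AE_eq_imp_eq[OF _ _ _ y])
    show "continuous_on {0..1} (B x)"
      by (rule continuous_on_comp2[OF Bc]) (use x in \<open>auto intro!: continuous_intros\<close>)
    have "continuous_on ({0..1} \<times> cbox 0 x) (\<lambda>(y, s). D s y)"
      unfolding case_prod_unfold
      by (rule continuous_on_comp2[OF Dc]) (use x in \<open>auto intro!: continuous_intros\<close>)
    from integral_continuous_on_param[OF this]
    show "continuous_on {0..1} (\<lambda>y. integral {0..x} (\<lambda>s. D s y))" by simp
    show "AE y in lebesgue_on {0..1}. B x y = integral {0..x} (\<lambda>s. D s y)"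
      using AEy2 by eventually_elim (use x in blast)
  qed
  have "((\<lambda>x. integral {0..x} (\<lambda>s. D s y)) has_real_derivative D x y) (at x within {0..1})"
    by (rule integral_has_real_derivative[OF Dx[OF y] x])
  then have "((\<lambda>x. B x y) has_real_derivative D x y) (at x within {0..1})"
    by (rule has_field_derivative_transform_within[OF _ zero_less_one x]) (use eq in auto)
  then show ?thesis by (simp add: B_def D_def)
qed

lemma kbar_integral_deriv:
  assumes w: "\<And>x. x \<in> {0..1} \<Longrightarrow> (w has_real_derivative w' x) (at x within {0..1})" "continuous_on {0..1} w'"
    and x: "x \<in> {0..1}"
  shows "((\<lambda>x. integral {0..x} (\<lambda>\<xi>. kbar x \<xi> * w \<xi>)) has_real_derivative
     (\<mu> 0 * kbar x 0 * w 0
       + integral {0..x} (\<lambda>\<xi>. gb x \<xi> * w \<xi> + kbar x \<xi> * \<mu> \<xi> * w' \<xi>)) / \<mu> x) (at x within {0..1})"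
proof (rule kernel_bar_integral_deriv[where \<mu>' = \<mu>'])
  show "\<forall>s\<in>{c..d}. ((\<lambda>s. kbar (X s) (\<Xi> s)) has_real_derivative
     - \<mu>' (\<Xi> s) * kbar (X s) (\<Xi> s) + gb (X s) (\<Xi> s)) (at s within {c..d})"
    if "c < d" "integral_curve \<mu> X {c..d}" "integral_curve \<mu> \<Xi> {c..d}"
      "\<forall>s\<in>{c..d}. (X s, \<Xi> s) \<in> kernel_triangle" for c d X \<Xi>
    using kernel that unfolding continuum_kernel_solution_def gb_def \<mu>'_def by blast
qed (use \<mu>_deriv \<mu>_pos w kbar_cont gb_cont x in blast)+

end

section \<open>The backstepping transformation\<close>

locale discretized = continuum +
  fixes n :: nat
  assumes n_pos: "n \<ge> 1"
begin

definition yy :: "nat \<Rightarrow> real" where "yy i = real i / real n"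

definition a :: "nat \<Rightarrow> real \<Rightarrow> real" where
  "a i x = (if i = 0 then - \<mu> x else lam x (yy i))"

text \<open>The averages over the components are encoded as plain sums over \<open>{..n}\<close> by
  moving the factor \<open>1 / n\<close> into the coefficients of components
  \<open>1, ..., n\<close>; the gains \<open>kk\<close> are treated alike.\<close>

definition cf :: "nat \<Rightarrow> nat \<Rightarrow> real \<Rightarrow> real" where
  "cf i j x = (if i = 0 then (if j = 0 then 0 else 1 / real n * \<theta> x (yy j))
     else if j = 0 then W x (yy i) else 1 / real n * \<sigma> x (yy i) (yy j))"

definition qn :: "nat \<Rightarrow> real" where "qn i = q (yy i)"

definition kk :: "nat \<Rightarrow> real \<Rightarrow> real" where
  "kk j \<xi> = (if j = 0 then kbar 1 \<xi> else 1 / real n * k 1 \<xi> (yy j))"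

lemma yy_in: "i \<le> n \<Longrightarrow> yy i \<in> {0..1}"
  using n_pos by (auto simp: yy_def divide_le_eq)

lemma lam_yy_cont: "i \<le> n \<Longrightarrow> continuous_on {0..1} (\<lambda>x. lam x (yy i))"
  by (rule continuous_on_comp2[OF lam_cont]) (use yy_in[of i] in \<open>auto intro!: continuous_intros\<close>)

sublocale transport n a cf qn kk
proof
  show "continuous_on {0..1} (a i)" if "i \<le> n" for i
    using \<mu>_cont lam_yy_cont[OF that] by (cases "i = 0") (auto simp: a_def[abs_def] intro!: continuous_intros)
  show "a i x > 0" if "i \<in> {1..n}" "x \<in> {0..1}" for i x
  proof -
    have "lam_min \<le> lam x (yy i)" using lam_min(2) that yy_in[of i] by auto
    then show ?thesis using lam_min(1) that by (simp add: a_def)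
  qed
  show "a 0 x < 0" if "x \<in> {0..1}" for x using \<mu>_pos that by (simp add: a_def)
  show "continuous_on {0..1} (cf i j)" if "i \<le> n" "j \<le> n" for i j
    using yy_in that
    by (cases "i = 0"; cases "j = 0")
      (auto simp: cf_def[abs_def] intro!: continuous_intros continuous_on_comp2[OF \<theta>_cont] continuous_on_comp2[OF W_cont]
         continuous_on_comp3[OF \<sigma>_cont])
  show "continuous_on {0..1} (kk j)" if "j \<le> n" for j
    using yy_in that
    by (cases "j = 0")
      (auto simp: kk_def[abs_def] kernel_triangle_def tri3_def intro!: continuous_intros continuous_on_comp2[OF kbar_cont] continuous_on_comp3[OF k_cont])
qed

definition Kint :: "(nat \<Rightarrow> real \<Rightarrow> real) \<Rightarrow> real \<Rightarrow> real" where
  "Kint w x = integral {0..x} (\<lambda>\<xi>. 1 / real n * (\<Sum>i=1..n. k x \<xi> (yy i) * w i \<xi>) + kbar x \<xi> * w 0 \<xi>)"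

lemma sum_split0: "(\<Sum>j\<le>n. f j) = f 0 + (\<Sum>j=1..n. f j)" for f :: "nat \<Rightarrow> real"
  by (simp add: atMost_atLeast0 sum.atLeast_Suc_atMost)

lemma src_0: "src z 0 t x = 1 / real n * (\<Sum>j=1..n. \<theta> x (yy j) * z j t x)"
  unfolding src_def sum_split0 by (simp add: cf_def sum_distrib_left mult.assoc)

lemma src_i: "i \<noteq> 0 \<Longrightarrow> src z i t x = 1 / real n * (\<Sum>j=1..n. \<sigma> x (yy i) (yy j) * z j t x) + W x (yy i) * z 0 t x"
  unfolding src_def sum_split0 by (simp add: cf_def sum_distrib_left mult.assoc)

lemma k_slice: "x \<in> {0..1} \<Longrightarrow> y \<in> {0..1} \<Longrightarrow> continuous_on {0..x} (\<lambda>\<xi>. k x \<xi> y)"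
  by (rule continuous_on_comp3[OF k_cont]) (auto simp: tri3_def kernel_triangle_def intro!: continuous_intros)

lemma gk_slice: "x \<in> {0..1} \<Longrightarrow> y \<in> {0..1} \<Longrightarrow> continuous_on {0..x} (\<lambda>\<xi>. gk x \<xi> y)"
  by (rule continuous_on_comp3[OF gk_cont]) (auto simp: tri3_def kernel_triangle_def intro!: continuous_intros)

lemma kbar_slice: "x \<in> {0..1} \<Longrightarrow> continuous_on {0..x} (\<lambda>\<xi>. kbar x \<xi>)"
  by (rule continuous_on_comp2[OF kbar_cont]) (auto simp: kernel_triangle_def intro!: continuous_intros)

lemma gb_slice: "x \<in> {0..1} \<Longrightarrow> continuous_on {0..x} (\<lambda>\<xi>. gb x \<xi>)"
  by (rule continuous_on_comp2[OF gb_cont]) (auto simp: kernel_triangle_def intro!: continuous_intros)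

lemma Kint_split:
  assumes "\<And>i. i \<le> n \<Longrightarrow> continuous_on {0..1} (w i)" "x \<in> {0..1}"
  shows "Kint w x = 1 / real n * (\<Sum>i=1..n. integral {0..x} (\<lambda>\<xi>. k x \<xi> (yy i) * w i \<xi>)) + integral {0..x} (\<lambda>\<xi>. kbar x \<xi> * w 0 \<xi>)"
proof -
  have w: "continuous_on {0..x} (w i)" if "i \<le> n" for i
    by (rule continuous_on_subset[OF assms(1)[OF that]]) (use assms(2) in auto)
  have 1: "(\<lambda>\<xi>. k x \<xi> (yy i) * w i \<xi>) integrable_on {0..x}" if "i \<in> {1..n}" for i
    using that by (intro integrable_continuous_real continuous_intros w k_slice assms(2) yy_in) auto
  have 2: "(\<lambda>\<xi>. kbar x \<xi> * w 0 \<xi>) integrable_on {0..x}"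
    by (intro integrable_continuous_real continuous_intros w kbar_slice assms(2)) auto
  have "Kint w x = integral {0..x} (\<lambda>\<xi>. 1 / real n * (\<Sum>i=1..n. k x \<xi> (yy i) * w i \<xi>)) + integral {0..x} (\<lambda>\<xi>. kbar x \<xi> * w 0 \<xi>)"
    unfolding Kint_def
    by (rule Henstock_Kurzweil_Integration.integral_add) (intro integrable_on_mult_right integrable_sum 1 2; simp)+
  also have "integral {0..x} (\<lambda>\<xi>. 1 / real n * (\<Sum>i=1..n. k x \<xi> (yy i) * w i \<xi>)) =
      1 / real n * (\<Sum>i=1..n. integral {0..x} (\<lambda>\<xi>. k x \<xi> (yy i) * w i \<xi>))"
    using integral_sum[of "{1..n}" "\<lambda>i \<xi>. k x \<xi> (yy i) * w i \<xi>" "{0..x}"] 1 by (simp only: integral_mult_right finite_atLeastAtMost)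
  finally show ?thesis .
qed

lemma Kint_one: "Kint w 1 = feedback w" if "\<And>i. i \<le> n \<Longrightarrow> continuous_on {0..1} (w i)"
proof -
  have "integral {0..1} (\<lambda>\<xi>. kk j \<xi> * w j \<xi>) = 1 / real n * integral {0..1} (\<lambda>\<xi>. k 1 \<xi> (yy j) * w j \<xi>)" if "j \<in> {1..n}" for j
    unfolding integral_mult_right[symmetric] using that by (simp add: kk_def mult.assoc)
  then have "(\<Sum>j=1..n. integral {0..1} (\<lambda>\<xi>. kk j \<xi> * w j \<xi>)) = 1 / real n * (\<Sum>j=1..n. integral {0..1} (\<lambda>\<xi>. k 1 \<xi> (yy j) * w j \<xi>))"
    unfolding sum_distrib_left by (intro sum.cong refl)
  then show ?thesis
    using Kint_split[of w 1] that unfolding feedback_def sum_split0 by (simp add: kk_def[of 0])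
qed

text \<open>The three Riemann-sum errors belong to the integrals over \<open>y\<close> in the kernel
  problem: the coupling by \<sigma> in the equation of \<open>k\<close>, the coupling by
  \<open>W\<close> in the equation of \<open>kbar\<close>, and the boundary condition at
  \<open>\<xi> = 0\<close>.\<close>

definition resid_i :: "nat \<Rightarrow> real \<Rightarrow> real \<Rightarrow> real" where
  "resid_i j x \<xi> = integral {0..1} (\<lambda>\<eta>. \<sigma> \<xi> \<eta> (yy j) * k x \<xi> \<eta>) - 1 / real n * (\<Sum>i=1..n. \<sigma> \<xi> (yy i) (yy j) * k x \<xi> (yy i))"

definition resid_v :: "real \<Rightarrow> real \<Rightarrow> real" where
  "resid_v x \<xi> = gb x \<xi> - 1 / real n * (\<Sum>i=1..n. W \<xi> (yy i) * k x \<xi> (yy i))"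

definition resid_0 :: "real \<Rightarrow> real" where
  "resid_0 x = integral {0..1} (\<lambda>y. q y * lam 0 y * k x 0 y) - 1 / real n * (\<Sum>i=1..n. q (yy i) * lam 0 (yy i) * k x 0 (yy i))"

text \<open>What is left of \<open>\<beta>\<^sub>t - \<mu> \<beta>\<^sub>x\<close>. It is linear in
  the state, so small quadrature errors give a perturbation that is small relative to the state,
  including its trace at \<open>x = 0\<close>.\<close>

definition resid :: "(nat \<Rightarrow> real \<Rightarrow> real) \<Rightarrow> real \<Rightarrow> real" where
  "resid w x = w 0 0 * resid_0 x + integral {0..x} (\<lambda>\<xi>. 1 / real n * (\<Sum>j=1..n. w j \<xi> * resid_i j x \<xi>) + w 0 \<xi> * resid_v x \<xi>)"

text \<open>The kernel equations make everything cancel except the quadrature errors collected in \<open>resid\<close>.\<close>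

lemma resid_integrand:
  "1 / real n * (\<Sum>i=1..n. gk x \<xi> (yy i) * z i t \<xi> - k x \<xi> (yy i) * src z i t \<xi>) + (gb x \<xi> * z 0 t \<xi> - kbar x \<xi> * src z 0 t \<xi>)
   = 1 / real n * (\<Sum>j=1..n. z j t \<xi> * resid_i j x \<xi>) + z 0 t \<xi> * resid_v x \<xi>"
proof -
  let ?N = "1 / real n"
  have s: "src z i t \<xi> = ?N * (\<Sum>j=1..n. \<sigma> \<xi> (yy i) (yy j) * z j t \<xi>) + W \<xi> (yy i) * z 0 t \<xi>" if "i \<in> {1..n}" for i
    using that by (intro src_i) auto
  have "(\<Sum>i=1..n. k x \<xi> (yy i) * src z i t \<xi>) =
      (\<Sum>i=1..n. \<Sum>j=1..n. ?N * (k x \<xi> (yy i) * \<sigma> \<xi> (yy i) (yy j) * z j t \<xi>)) + z 0 t \<xi> * (\<Sum>i=1..n. W \<xi> (yy i) * k x \<xi> (yy i))"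
    unfolding sum_distrib_left sum.distrib[symmetric]
    by (rule sum.cong[OF refl]) (simp add: s sum_distrib_left distrib_left mult_ac)
  also have "(\<Sum>i=1..n. \<Sum>j=1..n. ?N * (k x \<xi> (yy i) * \<sigma> \<xi> (yy i) (yy j) * z j t \<xi>)) =
      (\<Sum>j=1..n. z j t \<xi> * (?N * (\<Sum>i=1..n. \<sigma> \<xi> (yy i) (yy j) * k x \<xi> (yy i))))"
    by (subst sum.swap) (simp add: sum_distrib_left mult_ac)
  finally have 1: "(\<Sum>i=1..n. k x \<xi> (yy i) * src z i t \<xi>) =
      (\<Sum>j=1..n. z j t \<xi> * (?N * (\<Sum>i=1..n. \<sigma> \<xi> (yy i) (yy j) * k x \<xi> (yy i)))) + z 0 t \<xi> * (\<Sum>i=1..n. W \<xi> (yy i) * k x \<xi> (yy i))" .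
  have 2: "(\<Sum>i=1..n. gk x \<xi> (yy i) * z i t \<xi>) = kbar x \<xi> * (\<Sum>i=1..n. \<theta> \<xi> (yy i) * z i t \<xi>)
      + (\<Sum>j=1..n. z j t \<xi> * integral {0..1} (\<lambda>\<eta>. \<sigma> \<xi> \<eta> (yy j) * k x \<xi> \<eta>))"
    unfolding sum_distrib_left sum.distrib[symmetric]
    by (rule sum.cong[OF refl]) (simp add: gk_def algebra_simps)
  have 3: "(\<Sum>j=1..n. z j t \<xi> * resid_i j x \<xi>) = (\<Sum>j=1..n. z j t \<xi> * integral {0..1} (\<lambda>\<eta>. \<sigma> \<xi> \<eta> (yy j) * k x \<xi> \<eta>))
      - (\<Sum>j=1..n. z j t \<xi> * (?N * (\<Sum>i=1..n. \<sigma> \<xi> (yy i) (yy j) * k x \<xi> (yy i))))"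
    unfolding resid_i_def right_diff_distrib sum_subtractf ..
  show ?thesis
    unfolding sum_subtractf 1 2 3 src_0 resid_v_def by (simp add: right_diff_distrib distrib_left)
qed

end

section \<open>Transport equation of the transformed state\<close>

locale smooth_loop = discretized +
  fixes z zt zx :: "nat \<Rightarrow> real \<Rightarrow> real \<Rightarrow> real"
  assumes smooth: "smooth_sol z zt zx"
begin

lemma
  assumes "i \<le> n"
  shows z_cont: "continuous_on ({0..} \<times> {0..1}) (\<lambda>(t, x). z i t x)"
    and zt_cont: "continuous_on ({0..} \<times> {0..1}) (\<lambda>(t, x). zt i t x)"
    and zx_cont: "continuous_on ({0..} \<times> {0..1}) (\<lambda>(t, x). zx i t x)"
    and z_bc: "t \<ge> 0 \<Longrightarrow> z i t (inflow i) = bval i (\<lambda>j. z j t)"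
    and z_dt: "t \<ge> 0 \<Longrightarrow> x \<in> {0..1} \<Longrightarrow> ((\<lambda>t. z i t x) has_real_derivative zt i t x) (at t within {0..})"
    and z_dx: "t \<ge> 0 \<Longrightarrow> x \<in> {0..1} \<Longrightarrow> (z i t has_real_derivative zx i t x) (at x within {0..1})"
    and z_pde: "t \<ge> 0 \<Longrightarrow> x \<in> {0..1} \<Longrightarrow> zt i t x + a i x * zx i t x = src z i t x"
  using smooth assms unfolding smooth_sol_def by blast+

lemma slice:
  "continuous_on ({0..} \<times> {0..1}) (\<lambda>(t, x). f t x) \<Longrightarrow> t \<ge> 0 \<Longrightarrow> continuous_on {0..1} (f t)"
  for f :: "real \<Rightarrow> real \<Rightarrow> real"
  by (rule continuous_on_comp2) (auto intro!: continuous_intros)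

text \<open>The backstepping transform of \<open>v\<close>; it vanishes at \<open>x = 1\<close> by the choice of the control law.\<close>

definition \<beta> where "\<beta> t x = z 0 t x - Kint (\<lambda>i. z i t) x"
definition \<beta>t where "\<beta>t t x = zt 0 t x - Kint (\<lambda>i. zt i t) x"

text \<open>Differentiating the Volterra integral in \<open>x\<close> produces spatial derivatives
  under the integral. The system equations replace speed times \<open>zx\<close> by sources and
  \<open>zt\<close>, which rebuilds the transform of \<open>zt\<close>, that is
  \<open>\<beta>t\<close>. At \<open>\<xi> = 0\<close> the boundary condition of \<open>kbar\<close>
  meets the reflection of \<open>v\<close> into \<open>u\<close>, with \<open>resid_0\<close> as the
  difference.\<close>

lemma \<beta>_pde:
  assumes t: "t \<ge> 0" and x: "x \<in> {0..1}"
  shows "(\<beta> t has_real_derivative (\<beta>t t x - resid (\<lambda>i. z i t) x) / \<mu> x) (at x within {0..1})"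
proof -
  let ?N = "1 / real n"
  have \<mu>0: "\<mu> x \<noteq> 0" using \<mu>_pos x by force
  have zc: "continuous_on {0..1} (z i t)" "continuous_on {0..1} (zt i t)" "continuous_on {0..1} (zx i t)" if "i \<le> n" for i
    using slice[OF z_cont] slice[OF zt_cont] slice[OF zx_cont] that t by auto
  define Di where "Di i = (- \<theta> x (yy i) * z i t x - lam 0 (yy i) * k x 0 (yy i) * z i t 0
       + integral {0..x} (\<lambda>\<xi>. gk x \<xi> (yy i) * z i t \<xi> - k x \<xi> (yy i) * lam \<xi> (yy i) * zx i t \<xi>)) / \<mu> x" for i
  define D0 where "D0 = (\<mu> 0 * kbar x 0 * z 0 t 0
       + integral {0..x} (\<lambda>\<xi>. gb x \<xi> * z 0 t \<xi> + kbar x \<xi> * \<mu> \<xi> * zx 0 t \<xi>)) / \<mu> x"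
  have "((\<lambda>x. ?N * (\<Sum>i=1..n. integral {0..x} (\<lambda>\<xi>. k x \<xi> (yy i) * z i t \<xi>)) + integral {0..x} (\<lambda>\<xi>. kbar x \<xi> * z 0 t \<xi>))
     has_real_derivative ?N * (\<Sum>i=1..n. Di i) + D0) (at x within {0..1})"
    unfolding Di_def D0_def
    by (intro DERIV_add DERIV_cmult DERIV_sum k_integral_deriv kbar_integral_deriv)
       (use zc z_dx t x yy_in in auto)
  then have dK: "(Kint (\<lambda>i. z i t) has_real_derivative ?N * (\<Sum>i=1..n. Di i) + D0) (at x within {0..1})"
    by (rule has_field_derivative_transform_within[OF _ zero_less_one x]) (rule Kint_split[symmetric], use zc in auto)
  have sub: "continuous_on {0..x} f" if "continuous_on {0..1} f" for f :: "real \<Rightarrow> real"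
    by (rule continuous_on_subset[OF that]) (use x in auto)
  have srcc: "continuous_on {0..1} (\<lambda>\<xi>. src z i t \<xi>)" if "i \<le> n" for i
    by (rule continuous_on_comp2[OF src_cont[OF that z_cont]]) (use t in \<open>auto intro!: continuous_intros\<close>)
  have 1: "\<mu> x * Di i = - \<theta> x (yy i) * z i t x - (q (yy i) * lam 0 (yy i) * k x 0 (yy i)) * z 0 t 0
     + integral {0..x} (\<lambda>\<xi>. gk x \<xi> (yy i) * z i t \<xi> - k x \<xi> (yy i) * src z i t \<xi>) + integral {0..x} (\<lambda>\<xi>. k x \<xi> (yy i) * zt i t \<xi>)"
    if i: "i \<in> {1..n}" for i
  proof -
    have i': "i \<le> n" "i \<noteq> 0" using i by auto
    have "integral {0..x} (\<lambda>\<xi>. gk x \<xi> (yy i) * z i t \<xi> - k x \<xi> (yy i) * lam \<xi> (yy i) * zx i t \<xi>)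
      = integral {0..x} (\<lambda>\<xi>. (gk x \<xi> (yy i) * z i t \<xi> - k x \<xi> (yy i) * src z i t \<xi>) + k x \<xi> (yy i) * zt i t \<xi>)"
    proof (rule Henstock_Kurzweil_Integration.integral_cong)
      fix \<xi> assume "\<xi> \<in> {0..x}"
      then have "lam \<xi> (yy i) * zx i t \<xi> = src z i t \<xi> - zt i t \<xi>"
        using z_pde[OF i'(1) t, of \<xi>] x i' by (simp add: a_def)
      then show "gk x \<xi> (yy i) * z i t \<xi> - k x \<xi> (yy i) * lam \<xi> (yy i) * zx i t \<xi> =
          (gk x \<xi> (yy i) * z i t \<xi> - k x \<xi> (yy i) * src z i t \<xi>) + k x \<xi> (yy i) * zt i t \<xi>"
        by (simp add: mult.assoc right_diff_distrib)
    qed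
    also have "\<dots> = integral {0..x} (\<lambda>\<xi>. gk x \<xi> (yy i) * z i t \<xi> - k x \<xi> (yy i) * src z i t \<xi>) + integral {0..x} (\<lambda>\<xi>. k x \<xi> (yy i) * zt i t \<xi>)"
      by (rule Henstock_Kurzweil_Integration.integral_add)
        (intro integrable_continuous_real continuous_intros gk_slice k_slice sub zc srcc x yy_in i')+
    finally show ?thesis
      using \<mu>0 z_bc[OF i'(1) t] i' unfolding Di_def by (simp add: inflow_def bval_def qn_def)
  qed
  have 2: "\<mu> x * D0 = integral {0..1} (\<lambda>y. q y * lam 0 y * k x 0 y) * z 0 t 0
     + integral {0..x} (\<lambda>\<xi>. gb x \<xi> * z 0 t \<xi> - kbar x \<xi> * src z 0 t \<xi>) + integral {0..x} (\<lambda>\<xi>. kbar x \<xi> * zt 0 t \<xi>)"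
  proof -
    have "integral {0..x} (\<lambda>\<xi>. gb x \<xi> * z 0 t \<xi> + kbar x \<xi> * \<mu> \<xi> * zx 0 t \<xi>)
      = integral {0..x} (\<lambda>\<xi>. (gb x \<xi> * z 0 t \<xi> - kbar x \<xi> * src z 0 t \<xi>) + kbar x \<xi> * zt 0 t \<xi>)"
    proof (rule Henstock_Kurzweil_Integration.integral_cong)
      fix \<xi> assume "\<xi> \<in> {0..x}"
      then have "\<mu> \<xi> * zx 0 t \<xi> = zt 0 t \<xi> - src z 0 t \<xi>"
        using z_pde[of 0 t \<xi>] t x by (simp add: a_def)
      then show "gb x \<xi> * z 0 t \<xi> + kbar x \<xi> * \<mu> \<xi> * zx 0 t \<xi> =
          (gb x \<xi> * z 0 t \<xi> - kbar x \<xi> * src z 0 t \<xi>) + kbar x \<xi> * zt 0 t \<xi>"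
        by (simp add: mult.assoc right_diff_distrib)
    qed
    also have "\<dots> = integral {0..x} (\<lambda>\<xi>. gb x \<xi> * z 0 t \<xi> - kbar x \<xi> * src z 0 t \<xi>) + integral {0..x} (\<lambda>\<xi>. kbar x \<xi> * zt 0 t \<xi>)"
      by (rule Henstock_Kurzweil_Integration.integral_add)
        (intro integrable_continuous_real continuous_intros gb_slice kbar_slice sub zc srcc x le0)+
    finally show ?thesis
      using \<mu>0 kbar_zero[OF x] unfolding D0_def by simp
  qed
  have 3: "?N * (\<Sum>i=1..n. integral {0..x} (\<lambda>\<xi>. gk x \<xi> (yy i) * z i t \<xi> - k x \<xi> (yy i) * src z i t \<xi>))
      + integral {0..x} (\<lambda>\<xi>. gb x \<xi> * z 0 t \<xi> - kbar x \<xi> * src z 0 t \<xi>)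
      = integral {0..x} (\<lambda>\<xi>. ?N * (\<Sum>j=1..n. z j t \<xi> * resid_i j x \<xi>) + z 0 t \<xi> * resid_v x \<xi>)"
  proof -
    have i1: "(\<lambda>\<xi>. gk x \<xi> (yy i) * z i t \<xi> - k x \<xi> (yy i) * src z i t \<xi>) integrable_on {0..x}" if "i \<in> {1..n}" for i
      using that by (intro integrable_continuous_real continuous_intros gk_slice k_slice sub zc srcc x yy_in) auto
    have i2: "(\<lambda>\<xi>. gb x \<xi> * z 0 t \<xi> - kbar x \<xi> * src z 0 t \<xi>) integrable_on {0..x}"
      by (intro integrable_continuous_real continuous_intros gb_slice kbar_slice sub zc srcc x le0)
    have "integral {0..x} (\<lambda>\<xi>. ?N * (\<Sum>i=1..n. gk x \<xi> (yy i) * z i t \<xi> - k x \<xi> (yy i) * src z i t \<xi>)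
        + (gb x \<xi> * z 0 t \<xi> - kbar x \<xi> * src z 0 t \<xi>))
      = integral {0..x} (\<lambda>\<xi>. ?N * (\<Sum>i=1..n. gk x \<xi> (yy i) * z i t \<xi> - k x \<xi> (yy i) * src z i t \<xi>))
        + integral {0..x} (\<lambda>\<xi>. gb x \<xi> * z 0 t \<xi> - kbar x \<xi> * src z 0 t \<xi>)"
      by (rule Henstock_Kurzweil_Integration.integral_add) (intro integrable_on_mult_right integrable_sum i1 i2; simp)+
    also have "integral {0..x} (\<lambda>\<xi>. ?N * (\<Sum>i=1..n. gk x \<xi> (yy i) * z i t \<xi> - k x \<xi> (yy i) * src z i t \<xi>))
       = ?N * (\<Sum>i=1..n. integral {0..x} (\<lambda>\<xi>. gk x \<xi> (yy i) * z i t \<xi> - k x \<xi> (yy i) * src z i t \<xi>))"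
      using integral_sum[of "{1..n}" "\<lambda>i \<xi>. gk x \<xi> (yy i) * z i t \<xi> - k x \<xi> (yy i) * src z i t \<xi>" "{0..x}"] i1
      by (simp only: integral_mult_right finite_atLeastAtMost)
    finally show ?thesis unfolding resid_integrand by simp
  qed
  have K4: "Kint (\<lambda>i. zt i t) x = ?N * (\<Sum>i=1..n. integral {0..x} (\<lambda>\<xi>. k x \<xi> (yy i) * zt i t \<xi>)) + integral {0..x} (\<lambda>\<xi>. kbar x \<xi> * zt 0 t \<xi>)"
    by (rule Kint_split) (use zc x in auto)
  have "\<mu> x * (?N * (\<Sum>i=1..n. Di i) + D0) = ?N * (\<Sum>i=1..n. \<mu> x * Di i) + \<mu> x * D0"
    by (simp add: sum_distrib_left distrib_left mult.left_commute)
  also have "(\<Sum>i=1..n. \<mu> x * Di i) = - (\<Sum>i=1..n. \<theta> x (yy i) * z i t x) - (\<Sum>i=1..n. q (yy i) * lam 0 (yy i) * k x 0 (yy i)) * z 0 t 0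
     + (\<Sum>i=1..n. integral {0..x} (\<lambda>\<xi>. gk x \<xi> (yy i) * z i t \<xi> - k x \<xi> (yy i) * src z i t \<xi>)) + (\<Sum>i=1..n. integral {0..x} (\<lambda>\<xi>. k x \<xi> (yy i) * zt i t \<xi>))"
    unfolding sum_distrib_right sum_negf[symmetric] sum_subtractf[symmetric] sum.distrib[symmetric]
    by (rule sum.cong[OF refl], drule 1) simp
  finally have "\<mu> x * (?N * (\<Sum>i=1..n. Di i) + D0) = - src z 0 t x + resid (\<lambda>i. z i t) x + Kint (\<lambda>i. zt i t) x"
    unfolding 2 K4 resid_def 3[symmetric] resid_0_def src_0 by (simp add: distrib_left left_diff_distrib right_diff_distrib)
  then have K5: "?N * (\<Sum>i=1..n. Di i) + D0 = (- src z 0 t x + resid (\<lambda>i. z i t) x + Kint (\<lambda>i. zt i t) x) / \<mu> x"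
    using \<mu>0 by (metis nonzero_mult_div_cancel_left)
  \<comment> \<open>The diagonal condition turned the diagonal terms into
    \<open>- src z 0 t x\<close>; subtracting them removes the source of \<open>v\<close> from this
    equation.\<close>
  have "zx 0 t x = (zt 0 t x - src z 0 t x) / \<mu> x"
    using z_pde[of 0 t x] t x \<mu>0 by (simp add: a_def field_simps)
  then have "zx 0 t x - (?N * (\<Sum>i=1..n. Di i) + D0) = (\<beta>t t x - resid (\<lambda>i. z i t) x) / \<mu> x"
    unfolding K5 \<beta>t_def by (simp add: diff_divide_distrib add_divide_distrib)
  with DERIV_diff[OF z_dx[OF le0 t x] dK] show ?thesis unfolding \<beta>_def[abs_def] by simp
qed

end

section \<open>Exponential decay of smooth solutions\<close>

lemma integral_mono_continuous:
  fixes f g :: "real \<Rightarrow> real"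
  assumes "continuous_on {a..b} f" "continuous_on {a..b} g" "\<And>x. x \<in> {a..b} \<Longrightarrow> f x \<le> g x"
  shows "integral {a..b} f \<le> integral {a..b} g"
  by (rule integral_le) (use assms in \<open>auto intro: integrable_continuous_real\<close>)

text \<open>Integration by parts against the exponential: in this weighted norm a Volterra integral
  gains a factor \<open>1 / \<delta>\<close>, and the boundary term at \<open>1\<close> has the
  favourable sign. A large \<delta> therefore makes the integral part of the transform
  small.\<close>

lemma weighted_volterra:
  fixes f :: "real \<Rightarrow> real"
  assumes f: "continuous_on {0..1} f" "\<And>x. x \<in> {0..1} \<Longrightarrow> f x \<ge> 0" and \<delta>: "\<delta> > 0"
  shows "integral {0..1} (\<lambda>x. exp (- \<delta> * x) * integral {0..x} f) \<le> integral {0..1} (\<lambda>x. exp (- \<delta> * x) * f x) / \<delta>"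
proof -
  define I where "I x = integral {0..x} f" for x
  have dI: "(I has_real_derivative f x) (at x within {0..1})" if "x \<in> {0..1}" for x
    unfolding I_def by (rule integral_has_real_derivative[OF f(1) that])
  have Ic: "continuous_on {0..1} I" using dI by (rule DERIV_continuous_on)
  have "((\<lambda>x. exp (- \<delta> * x) * I x - exp (- \<delta> * x) * f x / \<delta>) has_integral
      (- exp (- \<delta> * 1) * I 1 / \<delta>) - (- exp (- \<delta> * 0) * I 0 / \<delta>)) {0..1}"
    by (rule fundamental_theorem_of_calculus)
      (use \<delta> in \<open>auto simp: has_real_derivative_iff_has_vector_derivative[symmetric] field_simps intro!: derivative_eq_intros dI\<close>)
  then have 1: "integral {0..1} (\<lambda>x. exp (- \<delta> * x) * I x - exp (- \<delta> * x) * f x / \<delta>) = - exp (- \<delta>) * I 1 / \<delta>"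
    by (simp add: has_integral_iff I_def)
  have 2: "integral {0..1} (\<lambda>x. exp (- \<delta> * x) * I x - exp (- \<delta> * x) * f x / \<delta>) =
      integral {0..1} (\<lambda>x. exp (- \<delta> * x) * I x) - integral {0..1} (\<lambda>x. exp (- \<delta> * x) * f x / \<delta>)"
    by (rule Henstock_Kurzweil_Integration.integral_diff)
      (use \<delta> in \<open>auto intro!: integrable_continuous_real continuous_intros Ic f(1)\<close>)
  have "I 1 \<ge> 0" unfolding I_def by (rule integral_nonneg[OF integrable_continuous_real[OF f(1)] f(2)]) auto
  then have "- exp (- \<delta>) * I 1 / \<delta> \<le> 0" using \<delta> by simp
  then show ?thesis using 1 2 unfolding I_def by simp
qed

text \<open>Expand the integral of \<open>(f - m)\<^sup>2\<close>, where \<open>m\<close> is the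
  integral of \<open>f\<close>, and use that the interval has length at most one.\<close>

lemma integral_square_le:
  fixes f :: "real \<Rightarrow> real"
  assumes x: "x \<in> {0..1}" and f: "continuous_on {0..x} f"
  shows "(integral {0..x} f)\<^sup>2 \<le> integral {0..x} (\<lambda>\<xi>. (f \<xi>)\<^sup>2)"
proof -
  define m where "m = integral {0..x} f"
  have i: "(\<lambda>\<xi>. (f \<xi>)\<^sup>2) integrable_on {0..x}" "(\<lambda>\<xi>. 2 * m * f \<xi>) integrable_on {0..x}" "(\<lambda>\<xi>. m\<^sup>2) integrable_on {0..x}"
    by (auto intro!: integrable_continuous_real continuous_intros f)
  have "integral {0..x} (\<lambda>\<xi>. (f \<xi> - m)\<^sup>2) = integral {0..x} (\<lambda>\<xi>. (f \<xi>)\<^sup>2 - 2 * m * f \<xi> + m\<^sup>2)"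
    by (intro Henstock_Kurzweil_Integration.integral_cong) (simp add: power2_diff algebra_simps)
  also have "\<dots> = integral {0..x} (\<lambda>\<xi>. (f \<xi>)\<^sup>2) - 2 * m * m + x * m\<^sup>2"
    using x by (simp add: Henstock_Kurzweil_Integration.integral_add Henstock_Kurzweil_Integration.integral_diff i integrable_diff m_def[symmetric])
  finally have "0 \<le> integral {0..x} (\<lambda>\<xi>. (f \<xi>)\<^sup>2) - 2 * m * m + x * m\<^sup>2"
    using integral_nonneg[of "\<lambda>\<xi>. (f \<xi> - m)\<^sup>2" "{0..x}"] f by (simp add: integrable_continuous_real continuous_intros)
  moreover have "x * m\<^sup>2 \<le> 1 * m\<^sup>2" using x by (intro mult_right_mono) auto
  ultimately show ?thesis unfolding m_def[symmetric] by (simp add: power2_eq_square)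
qed

lemma mean_square_le:
  fixes f :: "nat \<Rightarrow> real"
  assumes "n \<ge> 1"
  shows "(1 / real n * (\<Sum>i=1..n. f i))\<^sup>2 \<le> 1 / real n * (\<Sum>i=1..n. (f i)\<^sup>2)"
proof -
  have "(\<Sum>i=1..n. f i * 1)\<^sup>2 \<le> (\<Sum>i=1..n. (f i)\<^sup>2) * (\<Sum>i=1..n. 1\<^sup>2)" by (rule Cauchy_Schwarz_ineq_sum)
  then have "(\<Sum>i=1..n. f i)\<^sup>2 \<le> (\<Sum>i=1..n. (f i)\<^sup>2) * real n" by simp
  then have "(1 / real n)\<^sup>2 * (\<Sum>i=1..n. f i)\<^sup>2 \<le> (1 / real n)\<^sup>2 * ((\<Sum>i=1..n. (f i)\<^sup>2) * real n)" by (rule mult_left_mono) simp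
  also have "\<dots> = 1 / real n * (\<Sum>i=1..n. (f i)\<^sup>2)" using assms by (simp add: power2_eq_square)
  finally show ?thesis by (simp only: power_mult_distrib)
qed

lemma exponential_decay_from_deriv:
  fixes f f' :: "real \<Rightarrow> real"
  assumes "\<And>t. t \<ge> 0 \<Longrightarrow> (f has_real_derivative f' t) (at t within {0..})" "\<And>t. t \<ge> 0 \<Longrightarrow> f' t \<le> - c * f t" "t \<ge> 0"
  shows "f t \<le> exp (- c * t) * f 0"
proof -
  have d: "((\<lambda>t. exp (c * t) * f t) has_real_derivative exp (c * s) * (c * f s + f' s)) (at s within {0..})" if "s \<ge> 0" for s
    using assms(1)[OF that] by (auto intro!: derivative_eq_intros simp: algebra_simps)
  have "exp (c * t) * f t \<le> exp (c * 0) * f 0"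
  proof (rule DERIV_nonpos_imp_decreasing_open[OF assms(3)])
    show "continuous_on {0..t} (\<lambda>t. exp (c * t) * f t)"
      by (rule continuous_on_subset[OF DERIV_continuous_on[OF d]]) auto
    fix s assume s: "0 < s" "s < t"
    have "at s within {0..} = at s" using s by (intro at_within_interior) (auto simp: interior_real_atLeast)
    then have "DERIV (\<lambda>t. exp (c * t) * f t) s :> exp (c * s) * (c * f s + f' s)" using d[of s] s by simp
    moreover have "exp (c * s) * (c * f s + f' s) \<le> 0"
      using assms(2)[of s] s by (intro mult_nonneg_nonpos) auto
    ultimately show "\<exists>y. DERIV (\<lambda>t. exp (c * t) * f t) s :> y \<and> y \<le> 0" by blast
  qed
  then have "exp (- c * t) * (exp (c * t) * f t) \<le> exp (- c * t) * f 0" by (intro mult_left_mono) auto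
  then show ?thesis by (simp add: mult.assoc[symmetric] exp_add[symmetric])
qed

context smooth_loop
begin

lemma Kint_cont:
  assumes w: "\<And>i. i \<le> n \<Longrightarrow> continuous_on ({0..} \<times> {0..1}) (\<lambda>(t, x). w i t x)"
  shows "continuous_on ({0..} \<times> {0..1}) (\<lambda>(t, x). Kint (\<lambda>i. w i t) x)"
proof -
  have "continuous_on ({0..} \<times> {0..1}) (\<lambda>u. integral {0..snd u} (\<lambda>\<xi>. 1 / real n * (\<Sum>i=1..n. k (snd u) \<xi> (yy i) * w i (fst u) \<xi>)
      + kbar (snd u) \<xi> * w 0 (fst u) \<xi>))"
  proof (rule continuous_on_integral_upper)
    show "continuous_on {(u, s). u \<in> {0..} \<times> {0..1} \<and> 0 \<le> s \<and> s \<le> snd u}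
        (\<lambda>(u, \<xi>). 1 / real n * (\<Sum>i=1..n. k (snd u) \<xi> (yy i) * w i (fst u) \<xi>) + kbar (snd u) \<xi> * w 0 (fst u) \<xi>)"
      unfolding case_prod_unfold
      by (intro continuous_intros continuous_on_comp3[OF k_cont] continuous_on_comp2[OF kbar_cont] continuous_on_comp2[OF w])
        (use yy_in in \<open>auto simp: tri3_def kernel_triangle_def\<close>)
  qed (auto intro!: continuous_intros)
  then show ?thesis by (simp add: Kint_def case_prod_unfold)
qed

lemma \<beta>_cont: "continuous_on ({0..} \<times> {0..1}) (\<lambda>(t, x). \<beta> t x)"
  and \<beta>t_cont: "continuous_on ({0..} \<times> {0..1}) (\<lambda>(t, x). \<beta>t t x)"
  using continuous_on_diff[OF z_cont[OF le0] Kint_cont[OF z_cont]] continuous_on_diff[OF zt_cont[OF le0] Kint_cont[OF zt_cont]]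
  unfolding \<beta>_def \<beta>t_def case_prod_unfold by auto

lemma \<beta>_dt:
  assumes t: "t \<ge> 0" and x: "x \<in> {0..1}"
  shows "((\<lambda>t. \<beta> t x) has_real_derivative \<beta>t t x) (at t within {0..})"
proof -
  let ?F = "\<lambda>w \<xi>. 1 / real n * (\<Sum>i=1..n. k x \<xi> (yy i) * w i \<xi>) + kbar x \<xi> * w 0 \<xi>"
  have sl: "continuous_on (S \<times> cbox 0 x) (\<lambda>(t, \<xi>). ?F (\<lambda>i. w i t) \<xi>)"
    if "\<And>i. i \<le> n \<Longrightarrow> continuous_on ({0..} \<times> {0..1}) (\<lambda>(t, x). w i t x)" "S \<subseteq> {0..}" for w and S :: "real set"
    unfolding case_prod_unfold
    by (intro continuous_intros continuous_on_comp3[OF k_cont] continuous_on_comp2[OF kbar_cont] continuous_on_comp2[OF that(1)])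
      (use yy_in x that(2) in \<open>auto simp: tri3_def kernel_triangle_def\<close>)
  have "((\<lambda>t. integral (cbox 0 x) (?F (\<lambda>i. z i t))) has_real_derivative integral (cbox 0 x) (?F (\<lambda>i. zt i t))) (at t within {0..})"
  proof (rule leibniz_rule_field_derivative)
    fix s \<xi> :: real assume s: "s \<in> {0..}" and \<xi>: "\<xi> \<in> cbox 0 x"
    show "((\<lambda>t. ?F (\<lambda>i. z i t) \<xi>) has_real_derivative ?F (\<lambda>i. zt i s) \<xi>) (at s within {0..})"
      by (intro DERIV_add DERIV_cmult DERIV_sum z_dt) (use s \<xi> x in auto)
  next
    show "t \<in> {0..}" "convex {0::real..}" using t by auto
  next
    fix s :: real assume s: "s \<in> {0..}"
    have "continuous_on (cbox 0 x) (\<lambda>\<xi>. ?F (\<lambda>i. z i s) \<xi>)"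
      by (rule continuous_on_comp2[OF sl[of "\<lambda>i t x. z i t x" "{0..}"]]) (use s z_cont in \<open>auto intro!: continuous_intros\<close>)
    then show "?F (\<lambda>i. z i s) integrable_on cbox 0 x" by (rule integrable_continuous)
  next
    show "continuous_on ({0..} \<times> cbox 0 x) (\<lambda>(t, \<xi>). ?F (\<lambda>i. zt i t) \<xi>)"
      by (rule sl) (auto intro: zt_cont)
  qed
  from DERIV_diff[OF z_dt[OF le0 t x] this] show ?thesis
    by (simp add: \<beta>_def \<beta>t_def Kint_def)
qed

lemma \<beta>_1: "t \<ge> 0 \<Longrightarrow> \<beta> t 1 = 0"
proof -
  assume t: "t \<ge> 0"
  have "Kint (\<lambda>i. z i t) 1 = feedback (\<lambda>i. z i t)"
    by (rule Kint_one) (use slice[OF z_cont] t in auto)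
  then show ?thesis using z_bc[OF le0 t] by (simp add: \<beta>_def inflow_def bval_def)
qed

lemma \<beta>_0: "\<beta> t 0 = z 0 t 0" by (simp add: \<beta>_def Kint_def)

end

text \<open>
  \<open>\<delta>\<close> makes the dissipation in the interior dominate all couplings, \<open>A\<close> makes the outflow of \<open>\<beta>\<close> at \<open>x = 0\<close>
  absorb the inflow \<open>u\<^sup>i = q\<^sub>i v\<close>, and \<open>\<epsilon>\<close> bounds the quadrature errors.
\<close>

locale lyapunov = smooth_loop +
  fixes C \<epsilon> \<delta> A :: real
  assumes C: "C \<ge> 1" and \<delta>_eq: "\<delta> = 8 * C\<^sup>2 + C + 5" and A_eq: "A = 2 * C\<^sup>2"
    and bnd: "\<And>x y. x \<in> {0..1} \<Longrightarrow> y \<in> {0..1} \<Longrightarrow> \<bar>\<theta> x y\<bar> \<le> C \<and> \<bar>W x y\<bar> \<le> C \<and> lam x y \<le> C \<and> 1 / lam x y \<le> C"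
    and bnd\<sigma>: "\<And>x y y'. x \<in> {0..1} \<Longrightarrow> y \<in> {0..1} \<Longrightarrow> y' \<in> {0..1} \<Longrightarrow> \<bar>\<sigma> x y y'\<bar> \<le> C"
    and bndk: "\<And>x \<xi> y. (x, \<xi>) \<in> kernel_triangle \<Longrightarrow> y \<in> {0..1} \<Longrightarrow> \<bar>k x \<xi> y\<bar> \<le> C"
    and bndkbar: "\<And>x \<xi>. (x, \<xi>) \<in> kernel_triangle \<Longrightarrow> \<bar>kbar x \<xi>\<bar> \<le> C"
    and bndx: "\<And>x. x \<in> {0..1} \<Longrightarrow> \<bar>q x\<bar> \<le> C \<and> \<mu> x \<le> C \<and> 1 / \<mu> x \<le> C"
    and \<epsilon>: "\<epsilon> \<ge> 0" "A * (16 * C * exp (2 * \<delta>) * \<epsilon>\<^sup>2) \<le> 1 / 2"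
    and res_i: "\<And>x \<xi> j. (x, \<xi>) \<in> kernel_triangle \<Longrightarrow> j \<in> {1..n} \<Longrightarrow> \<bar>resid_i j x \<xi>\<bar> \<le> \<epsilon>"
    and res_v: "\<And>x \<xi>. (x, \<xi>) \<in> kernel_triangle \<Longrightarrow> \<bar>resid_v x \<xi>\<bar> \<le> \<epsilon>"
    and res_0: "\<And>x. x \<in> {0..1} \<Longrightarrow> \<bar>resid_0 x\<bar> \<le> \<epsilon>"
begin

lemma \<delta>_pos: "\<delta> > 0" using C by (simp add: \<delta>_eq add_nonneg_pos)

definition ub where "ub t x = 1 / real n * (\<Sum>i=1..n. \<bar>z i t x\<bar>)"
definition u2 where "u2 t x = 1 / real n * (\<Sum>i=1..n. (z i t x)\<^sup>2)"
definition w2 where "w2 t x = u2 t x + (z 0 t x)\<^sup>2"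
text \<open>\<open>U2\<close> and \<open>B2\<close> are what the functional controls; their weights
  are opposite because \<open>u\<close> and \<beta> travel in opposite directions. \<open>V2\<close>
  carries the weight of \<open>U2\<close>, the one suited to the Volterra estimate, and
  \<open>N2\<close> is the unweighted energy.\<close>

definition U2 where "U2 t = integral {0..1} (\<lambda>x. exp (- \<delta> * x) * u2 t x)"
definition V2 where "V2 t = integral {0..1} (\<lambda>x. exp (- \<delta> * x) * (z 0 t x)\<^sup>2)"
definition B2 where "B2 t = integral {0..1} (\<lambda>x. exp (\<delta> * x) * (\<beta> t x)\<^sup>2)"
definition N2 where "N2 t = integral {0..1} (w2 t)"

lemma zc: "t \<ge> 0 \<Longrightarrow> i \<le> n \<Longrightarrow> continuous_on {0..1} (z i t)"
  by (rule slice[OF z_cont])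

lemma \<beta>c: "t \<ge> 0 \<Longrightarrow> continuous_on {0..1} (\<beta> t)"
  by (rule slice[OF \<beta>_cont])

lemma u2c: "t \<ge> 0 \<Longrightarrow> continuous_on {0..1} (u2 t)"
  unfolding u2_def by (intro continuous_intros zc) auto

lemma ubc: "t \<ge> 0 \<Longrightarrow> continuous_on {0..1} (ub t)"
  unfolding ub_def by (intro continuous_intros zc) auto

lemma w2c: "t \<ge> 0 \<Longrightarrow> continuous_on {0..1} (w2 t)"
  unfolding w2_def by (intro continuous_intros zc u2c) auto

lemma u2_nonneg: "u2 t x \<ge> 0" unfolding u2_def by (simp add: sum_nonneg)
lemma w2_nonneg: "w2 t x \<ge> 0" unfolding w2_def using u2_nonneg by simp
lemma ub_nonneg: "ub t x \<ge> 0" unfolding ub_def by (simp add: sum_nonneg)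

lemma ub_sq: "(ub t x)\<^sup>2 \<le> u2 t x"
  using mean_square_le[OF n_pos, of "\<lambda>i. \<bar>z i t x\<bar>"] by (simp add: ub_def u2_def)

lemma g_sq: "(ub t x + \<bar>z 0 t x\<bar>)\<^sup>2 \<le> 2 * w2 t x"
proof -
  have "(ub t x + \<bar>z 0 t x\<bar>)\<^sup>2 \<le> 2 * (ub t x)\<^sup>2 + 2 * (z 0 t x)\<^sup>2"
    using sum_squares_bound[of "ub t x" "\<bar>z 0 t x\<bar>"] by (simp add: power2_sum)
  then show ?thesis using ub_sq[of t x] by (simp add: w2_def)
qed

lemma sum_weighted_bound:
  assumes "\<And>i. i \<in> {1..n} \<Longrightarrow> \<bar>r i\<bar> \<le> B"
  shows "\<bar>1 / real n * (\<Sum>i=1..n. r i * z i t x)\<bar> \<le> B * ub t x"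
proof -
  have "\<bar>\<Sum>i=1..n. r i * z i t x\<bar> \<le> (\<Sum>i=1..n. B * \<bar>z i t x\<bar>)"
    by (rule order_trans[OF sum_abs]) (use assms in \<open>auto simp: abs_mult intro!: sum_mono mult_right_mono\<close>)
  then have "\<bar>\<Sum>i=1..n. r i * z i t x\<bar> \<le> B * (\<Sum>i=1..n. \<bar>z i t x\<bar>)" by (simp only: sum_distrib_left)
  then have "1 / real n * \<bar>\<Sum>i=1..n. r i * z i t x\<bar> \<le> 1 / real n * (B * (\<Sum>i=1..n. \<bar>z i t x\<bar>))"
    by (rule mult_left_mono) simp
  then show ?thesis by (simp add: ub_def abs_mult mult.left_commute)
qed

lemma integral_g_sq:
  assumes t: "t \<ge> 0" and x: "x \<in> {0..1}"
  shows "(integral {0..x} (\<lambda>\<xi>. ub t \<xi> + \<bar>z 0 t \<xi>\<bar>))\<^sup>2 \<le> 2 * integral {0..x} (w2 t)"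
proof -
  have sub: "continuous_on {0..x} f" if "continuous_on {0..1} f" for f :: "real \<Rightarrow> real"
    by (rule continuous_on_subset[OF that]) (use x in auto)
  have gc: "continuous_on {0..x} (\<lambda>\<xi>. ub t \<xi> + \<bar>z 0 t \<xi>\<bar>)"
    by (intro continuous_intros sub ubc zc t le0)
  have "(integral {0..x} (\<lambda>\<xi>. ub t \<xi> + \<bar>z 0 t \<xi>\<bar>))\<^sup>2 \<le> integral {0..x} (\<lambda>\<xi>. (ub t \<xi> + \<bar>z 0 t \<xi>\<bar>)\<^sup>2)"
    by (rule integral_square_le[OF x gc])
  also have "\<dots> \<le> integral {0..x} (\<lambda>\<xi>. 2 * w2 t \<xi>)"
    by (rule integral_mono_continuous) (intro continuous_intros gc sub w2c t g_sq)+
  finally show ?thesis by simp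
qed

lemma Kint_sq:
  assumes t: "t \<ge> 0" and x: "x \<in> {0..1}"
  shows "(Kint (\<lambda>i. z i t) x)\<^sup>2 \<le> 2 * C\<^sup>2 * integral {0..x} (w2 t)"
proof -
  have sub: "continuous_on {0..x} f" if "continuous_on {0..1} f" for f :: "real \<Rightarrow> real"
    by (rule continuous_on_subset[OF that]) (use x in auto)
  have "norm (Kint (\<lambda>i. z i t) x) \<le> integral {0..x} (\<lambda>\<xi>. C * (ub t \<xi> + \<bar>z 0 t \<xi>\<bar>))"
    unfolding Kint_def
  proof (rule integral_norm_bound_integral)
    show "(\<lambda>\<xi>. 1 / real n * (\<Sum>i=1..n. k x \<xi> (yy i) * z i t \<xi>) + kbar x \<xi> * z 0 t \<xi>) integrable_on {0..x}"
      by (intro integrable_continuous_real continuous_intros k_slice kbar_slice sub zc t x yy_in) auto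
    show "(\<lambda>\<xi>. C * (ub t \<xi> + \<bar>z 0 t \<xi>\<bar>)) integrable_on {0..x}"
      by (intro integrable_continuous_real continuous_intros sub zc ubc t x le0)
    fix \<xi> assume "\<xi> \<in> {0..x}"
    then have tri: "(x, \<xi>) \<in> kernel_triangle" using x by (auto simp: kernel_triangle_def)
    have "\<bar>1 / real n * (\<Sum>i=1..n. k x \<xi> (yy i) * z i t \<xi>)\<bar> \<le> C * ub t \<xi>"
      by (rule sum_weighted_bound) (use bndk[OF tri] yy_in in auto)
    moreover have "\<bar>kbar x \<xi> * z 0 t \<xi>\<bar> \<le> C * \<bar>z 0 t \<xi>\<bar>"
      unfolding abs_mult using bndkbar[OF tri] by (intro mult_right_mono) auto
    ultimately show "norm (1 / real n * (\<Sum>i=1..n. k x \<xi> (yy i) * z i t \<xi>) + kbar x \<xi> * z 0 t \<xi>) \<le> C * (ub t \<xi> + \<bar>z 0 t \<xi>\<bar>)"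
      unfolding real_norm_def distrib_left by linarith
  qed
  also have "\<dots> = C * integral {0..x} (\<lambda>\<xi>. ub t \<xi> + \<bar>z 0 t \<xi>\<bar>)" by simp
  finally have "(norm (Kint (\<lambda>i. z i t) x))\<^sup>2 \<le> (C * integral {0..x} (\<lambda>\<xi>. ub t \<xi> + \<bar>z 0 t \<xi>\<bar>))\<^sup>2"
    by (intro power_mono) auto
  also have "\<dots> \<le> C\<^sup>2 * (2 * integral {0..x} (w2 t))"
    unfolding power_mult_distrib by (intro mult_left_mono integral_g_sq t x) auto
  finally show ?thesis by simp
qed

text \<open>Besides the energy, the error contains the trace \<open>z 0 t 0\<close>, which no
  interior norm controls. It is admissible because \<beta> has the same trace at \<open>0\<close>
  and loses it as outflow.\<close>

lemma resid_sq:
  assumes t: "t \<ge> 0" and x: "x \<in> {0..1}"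
  shows "(resid (\<lambda>i. z i t) x)\<^sup>2 \<le> \<epsilon>\<^sup>2 * (2 * (z 0 t 0)\<^sup>2 + 4 * N2 t)"
proof -
  have sub: "continuous_on {0..x} f" if "continuous_on {0..1} f" for f :: "real \<Rightarrow> real"
    by (rule continuous_on_subset[OF that]) (use x in auto)
  have rci: "continuous_on {0..x} (resid_i j x)" if j: "j \<in> {1..n}" for j
  proof -
    have "continuous_on ({0..x} \<times> cbox 0 1) (\<lambda>(\<xi>, \<eta>). \<sigma> \<xi> \<eta> (yy j) * k x \<xi> \<eta>)"
      unfolding case_prod_unfold
      by (intro continuous_intros continuous_on_comp3[OF \<sigma>_cont] continuous_on_comp3[OF k_cont])
        (use x j yy_in[of j] in \<open>auto simp: tri3_def kernel_triangle_def\<close>)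
    from integral_continuous_on_param[OF this]
    show ?thesis unfolding resid_i_def
      by (intro continuous_intros k_slice continuous_on_comp3[OF \<sigma>_cont])
        (use x j yy_in in auto)
  qed
  have rcv: "continuous_on {0..x} (resid_v x)"
    unfolding resid_v_def
    by (intro continuous_intros gb_slice k_slice continuous_on_comp2[OF W_cont]) (use x yy_in in auto)
  define I where "I = integral {0..x} (\<lambda>\<xi>. ub t \<xi> + \<bar>z 0 t \<xi>\<bar>)"
  have "norm (integral {0..x} (\<lambda>\<xi>. 1 / real n * (\<Sum>j=1..n. z j t \<xi> * resid_i j x \<xi>) + z 0 t \<xi> * resid_v x \<xi>))
     \<le> integral {0..x} (\<lambda>\<xi>. \<epsilon> * (ub t \<xi> + \<bar>z 0 t \<xi>\<bar>))"
  proof (rule integral_norm_bound_integral)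
    show "(\<lambda>\<xi>. 1 / real n * (\<Sum>j=1..n. z j t \<xi> * resid_i j x \<xi>) + z 0 t \<xi> * resid_v x \<xi>) integrable_on {0..x}"
      by (intro integrable_continuous_real continuous_intros rci rcv sub zc t) auto
    show "(\<lambda>\<xi>. \<epsilon> * (ub t \<xi> + \<bar>z 0 t \<xi>\<bar>)) integrable_on {0..x}"
      by (intro integrable_continuous_real continuous_intros sub zc ubc t x le0)
    fix \<xi> assume "\<xi> \<in> {0..x}"
    then have tri: "(x, \<xi>) \<in> kernel_triangle" using x by (auto simp: kernel_triangle_def)
    have "\<bar>1 / real n * (\<Sum>j=1..n. resid_i j x \<xi> * z j t \<xi>)\<bar> \<le> \<epsilon> * ub t \<xi>"
      by (rule sum_weighted_bound) (use res_i[OF tri] in auto)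
    moreover have "\<bar>z 0 t \<xi> * resid_v x \<xi>\<bar> \<le> \<epsilon> * \<bar>z 0 t \<xi>\<bar>"
      unfolding abs_mult using res_v[OF tri] by (subst mult.commute) (intro mult_right_mono, auto)
    ultimately show "norm (1 / real n * (\<Sum>j=1..n. z j t \<xi> * resid_i j x \<xi>) + z 0 t \<xi> * resid_v x \<xi>) \<le> \<epsilon> * (ub t \<xi> + \<bar>z 0 t \<xi>\<bar>)"
      unfolding real_norm_def distrib_left mult.commute[of "z _ _ _" "resid_i _ _ _"] by linarith
  qed
  also have "\<dots> = \<epsilon> * I" by (simp add: I_def)
  finally have "\<bar>integral {0..x} (\<lambda>\<xi>. 1 / real n * (\<Sum>j=1..n. z j t \<xi> * resid_i j x \<xi>) + z 0 t \<xi> * resid_v x \<xi>)\<bar> \<le> \<epsilon> * I" by simp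
  moreover have "\<bar>z 0 t 0 * resid_0 x\<bar> \<le> \<epsilon> * \<bar>z 0 t 0\<bar>"
    unfolding abs_mult using res_0[OF x] by (subst mult.commute) (intro mult_right_mono, auto)
  ultimately have "\<bar>resid (\<lambda>i. z i t) x\<bar> \<le> \<epsilon> * (\<bar>z 0 t 0\<bar> + I)"
    unfolding resid_def distrib_left by linarith
  then have "\<bar>resid (\<lambda>i. z i t) x\<bar>\<^sup>2 \<le> (\<epsilon> * (\<bar>z 0 t 0\<bar> + I))\<^sup>2" by (intro power_mono) auto
  also have "\<dots> \<le> \<epsilon>\<^sup>2 * (2 * (z 0 t 0)\<^sup>2 + 2 * I\<^sup>2)"
    unfolding power_mult_distrib using sum_squares_bound[of "\<bar>z 0 t 0\<bar>" I]
    by (intro mult_left_mono) (auto simp: power2_sum)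
  also have "\<dots> \<le> \<epsilon>\<^sup>2 * (2 * (z 0 t 0)\<^sup>2 + 4 * N2 t)"
  proof -
    have "integral {0..x} (w2 t) \<le> integral {0..1} (w2 t)"
      by (rule integral_subset_le) (use x w2_nonneg in \<open>auto intro!: integrable_continuous_real sub w2c t\<close>)
    then show ?thesis using integral_g_sq[OF t x] by (intro mult_left_mono) (auto simp: N2_def I_def)
  qed
  finally show ?thesis by simp
qed

lemma exp_weight_bounds: "exp (- \<delta> * x) \<le> 1" "1 \<le> exp \<delta> * exp (- \<delta> * x)" "exp (- \<delta> * x) \<le> exp (\<delta> * x)" "1 \<le> exp (\<delta> * x)" "exp (\<delta> * x) \<le> exp \<delta>"
  if "x \<in> {0..1}"
proof -
  have "0 \<le> \<delta> * x" "\<delta> * x \<le> \<delta>" using that \<delta>_pos by (auto intro: mult_left_le)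
  then show "exp (- \<delta> * x) \<le> 1" "1 \<le> exp \<delta> * exp (- \<delta> * x)" "exp (- \<delta> * x) \<le> exp (\<delta> * x)" "1 \<le> exp (\<delta> * x)" "exp (\<delta> * x) \<le> exp \<delta>"
    by (auto simp: exp_add[symmetric])
qed

text \<open>In the relation of \<open>v\<close> to \<beta> the Volterra part again contains
  \<open>v\<close>. The weighted estimate multiplies it by \<open>4 * C\<^sup>2 / \<delta>\<close>,
  at most \<open>1 / 2\<close> thanks to the summand \<open>8 * C\<^sup>2\<close> of \<delta>, so
  half of \<open>V2\<close> is absorbed on the left.\<close>

lemma V2_bound: assumes t: "t \<ge> 0" shows "V2 t \<le> 4 * B2 t + U2 t"
proof -
  have i: "continuous_on {0..1} (\<lambda>x. integral {0..x} (w2 t))"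
    by (rule indefinite_integral_continuous_1) (intro integrable_continuous_real w2c t)
  have "V2 t \<le> integral {0..1} (\<lambda>x. 2 * (exp (\<delta> * x) * (\<beta> t x)\<^sup>2) + 4 * C\<^sup>2 * (exp (- \<delta> * x) * integral {0..x} (w2 t)))"
    unfolding V2_def
  proof (rule integral_mono_continuous)
    fix x :: real assume x: "x \<in> {0..1}"
    have "(z 0 t x)\<^sup>2 = (\<beta> t x + Kint (\<lambda>i. z i t) x)\<^sup>2" by (simp add: \<beta>_def)
    also have "\<dots> \<le> 2 * (\<beta> t x)\<^sup>2 + 2 * (Kint (\<lambda>i. z i t) x)\<^sup>2"
      using sum_squares_bound[of "\<beta> t x" "Kint (\<lambda>i. z i t) x"] by (simp add: power2_sum)
    also have "\<dots> \<le> 2 * (\<beta> t x)\<^sup>2 + 4 * C\<^sup>2 * integral {0..x} (w2 t)" using Kint_sq[OF t x] by simp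
    finally have "exp (- \<delta> * x) * (z 0 t x)\<^sup>2 \<le> exp (- \<delta> * x) * (2 * (\<beta> t x)\<^sup>2 + 4 * C\<^sup>2 * integral {0..x} (w2 t))"
      by (intro mult_left_mono) auto
    moreover have "exp (- \<delta> * x) * (2 * (\<beta> t x)\<^sup>2) \<le> exp (\<delta> * x) * (2 * (\<beta> t x)\<^sup>2)"
      by (rule mult_right_mono[OF exp_weight_bounds(3)[OF x]]) simp
    ultimately show "exp (- \<delta> * x) * (z 0 t x)\<^sup>2 \<le> 2 * (exp (\<delta> * x) * (\<beta> t x)\<^sup>2) + 4 * C\<^sup>2 * (exp (- \<delta> * x) * integral {0..x} (w2 t))"
      by (simp add: distrib_left mult_ac)
  qed (intro continuous_intros zc \<beta>c i t le0)+
  also have "\<dots> = integral {0..1} (\<lambda>x. 2 * (exp (\<delta> * x) * (\<beta> t x)\<^sup>2)) + integral {0..1} (\<lambda>x. 4 * C\<^sup>2 * (exp (- \<delta> * x) * integral {0..x} (w2 t)))"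
    by (rule Henstock_Kurzweil_Integration.integral_add) (intro integrable_continuous_real continuous_intros zc \<beta>c i t)+
  also have "\<dots> = 2 * B2 t + 4 * C\<^sup>2 * integral {0..1} (\<lambda>x. exp (- \<delta> * x) * integral {0..x} (w2 t))"
    by (simp only: integral_mult_right B2_def)
  also have "\<dots> \<le> 2 * B2 t + 4 * C\<^sup>2 * ((U2 t + V2 t) / \<delta>)"
  proof -
    have "integral {0..1} (\<lambda>x. exp (- \<delta> * x) * w2 t x) = U2 t + V2 t"
      unfolding w2_def U2_def V2_def distrib_left
      by (rule Henstock_Kurzweil_Integration.integral_add) (intro integrable_continuous_real continuous_intros zc u2c t le0)+
    then have "integral {0..1} (\<lambda>x. exp (- \<delta> * x) * integral {0..x} (w2 t)) \<le> (U2 t + V2 t) / \<delta>"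
      using weighted_volterra[OF w2c[OF t] w2_nonneg \<delta>_pos] by simp
    then show ?thesis by (intro add_left_mono mult_left_mono) auto
  qed
  finally have m: "V2 t \<le> 2 * B2 t + 4 * C\<^sup>2 * ((U2 t + V2 t) / \<delta>)" .
  have "4 * C\<^sup>2 * ((U2 t + V2 t) / \<delta>) \<le> 1 / 2 * (U2 t + V2 t)"
  proof -
    have "U2 t + V2 t \<ge> 0"
      unfolding U2_def V2_def using u2_nonneg
      by (intro add_nonneg_nonneg integral_nonneg integrable_continuous_real continuous_intros zc u2c t le0) auto
    moreover have "4 * C\<^sup>2 / \<delta> \<le> 1 / 2" using C \<delta>_pos by (simp add: \<delta>_eq field_simps)
    ultimately have "4 * C\<^sup>2 / \<delta> * (U2 t + V2 t) \<le> 1 / 2 * (U2 t + V2 t)" by (intro mult_right_mono)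
    then show ?thesis by (simp add: field_simps)
  qed
  from order_trans[OF m add_left_mono[OF this]] show ?thesis by (simp add: field_simps)
qed

end

lemma leibniz_halfline:
  fixes f f' :: "real \<Rightarrow> real \<Rightarrow> real"
  assumes d: "\<And>t x. t \<ge> 0 \<Longrightarrow> x \<in> {0..1} \<Longrightarrow> ((\<lambda>t. f t x) has_real_derivative f' t x) (at t within {0..})"
    and f: "continuous_on ({0..} \<times> {0..1}) (\<lambda>(t, x). f t x)"
    and f': "continuous_on ({0..} \<times> {0..1}) (\<lambda>(t, x). f' t x)" and t: "t \<ge> 0"
  shows "((\<lambda>t. integral {0..1} (f t)) has_real_derivative integral {0..1} (f' t)) (at t within {0..})"
  unfolding cbox_interval[symmetric]
proof (rule leibniz_rule_field_derivative)
  show "f s integrable_on cbox 0 1" if "s \<in> {0..}" for s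
    unfolding cbox_interval
    by (rule integrable_continuous_real, rule continuous_on_comp2[OF f]) (use that in \<open>auto intro!: continuous_intros\<close>)
qed (use d f' t in \<open>auto simp: cbox_interval\<close>)

section \<open>Time derivative of the Lyapunov functional\<close>

context lyapunov
begin

text \<open>Division by \<open>lam\<close> and \<mu> cancels the speeds in front of the spatial
  derivatives, so integration by parts differentiates only the exponential weight.\<close>

definition d1 where "d1 i t = integral {0..1} (\<lambda>x. exp (- \<delta> * x) * (2 * z i t x * zt i t x) / lam x (yy i))"
definition d3 where "d3 t = integral {0..1} (\<lambda>x. exp (\<delta> * x) * (2 * \<beta> t x * \<beta>t t x) / \<mu> x)"
definition V1 where "V1 i t = integral {0..1} (\<lambda>x. exp (- \<delta> * x) * (z i t x)\<^sup>2 / lam x (yy i))"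
definition V3 where "V3 t = integral {0..1} (\<lambda>x. exp (\<delta> * x) * (\<beta> t x)\<^sup>2 / \<mu> x)"

lemma lam_pos: "i \<in> {1..n} \<Longrightarrow> x \<in> {0..1} \<Longrightarrow> lam x (yy i) > 0"
  using a_pos[of i x] by (simp add: a_def)

lemma V1_deriv:
  assumes i: "i \<in> {1..n}" and t: "t \<ge> 0"
  shows "(V1 i has_real_derivative d1 i t) (at t within {0..})"
  unfolding V1_def[abs_def] d1_def
proof (rule leibniz_halfline[OF _ _ _ t])
  have i': "i \<le> n" using i by auto
  have l0: "lam x (yy i) \<noteq> 0" if "x \<in> {0..1}" for x using lam_pos[OF i that] by simp
  show "((\<lambda>t. exp (- \<delta> * x) * (z i t x)\<^sup>2 / lam x (yy i)) has_real_derivative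
     exp (- \<delta> * x) * (2 * z i t x * zt i t x) / lam x (yy i)) (at t within {0..})" if "t \<ge> 0" "x \<in> {0..1}" for t x
    using z_dt[OF i' that] l0[OF that(2)] by (auto intro!: derivative_eq_intros)
  show "continuous_on ({0..} \<times> {0..1}) (\<lambda>(t, x). exp (- \<delta> * x) * (z i t x)\<^sup>2 / lam x (yy i))"
    unfolding case_prod_unfold
    by (intro continuous_intros continuous_on_comp2[OF z_cont[OF i']] continuous_on_compose2[OF lam_yy_cont[OF i']] ballI)
      (use l0 in auto)
  show "continuous_on ({0..} \<times> {0..1}) (\<lambda>(t, x). exp (- \<delta> * x) * (2 * z i t x * zt i t x) / lam x (yy i))"
    unfolding case_prod_unfold
    by (intro continuous_intros continuous_on_comp2[OF z_cont[OF i']] continuous_on_comp2[OF zt_cont[OF i']]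
      continuous_on_compose2[OF lam_yy_cont[OF i']] ballI) (use l0 in auto)
qed

lemma \<mu>_nz: "x \<in> {0..1} \<Longrightarrow> \<mu> x \<noteq> 0" using \<mu>_pos by force

lemma V3_deriv:
  assumes t: "t \<ge> 0"
  shows "(V3 has_real_derivative d3 t) (at t within {0..})"
  unfolding V3_def[abs_def] d3_def
proof (rule leibniz_halfline[OF _ _ _ t])
  show "((\<lambda>t. exp (\<delta> * x) * (\<beta> t x)\<^sup>2 / \<mu> x) has_real_derivative
     exp (\<delta> * x) * (2 * \<beta> t x * \<beta>t t x) / \<mu> x) (at t within {0..})" if "t \<ge> 0" "x \<in> {0..1}" for t x
    using \<beta>_dt[OF that] \<mu>_nz[OF that(2)] by (auto intro!: derivative_eq_intros)
  show "continuous_on ({0..} \<times> {0..1}) (\<lambda>(t, x). exp (\<delta> * x) * (\<beta> t x)\<^sup>2 / \<mu> x)"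
    unfolding case_prod_unfold
    by (intro continuous_intros continuous_on_comp2[OF \<beta>_cont] continuous_on_compose2[OF \<mu>_cont] ballI)
      (use \<mu>_nz in auto)
  show "continuous_on ({0..} \<times> {0..1}) (\<lambda>(t, x). exp (\<delta> * x) * (2 * \<beta> t x * \<beta>t t x) / \<mu> x)"
    unfolding case_prod_unfold
    by (intro continuous_intros continuous_on_comp2[OF \<beta>_cont] continuous_on_comp2[OF \<beta>t_cont]
      continuous_on_compose2[OF \<mu>_cont] ballI) (use \<mu>_nz in auto)
qed

text \<open>Used with \<open>s = - \<delta>\<close> for the components of \<open>u\<close> and with
  \<open>s = \<delta>\<close> for \<beta>. The sign of the spatial derivative in the two equations
  differs as well, so both interior contributions are \<open>- \<delta>\<close> times the weighted
  norm.\<close>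

lemma weighted_ibp:
  assumes "\<And>x. x \<in> {0..1} \<Longrightarrow> (f has_real_derivative f' x) (at x within {0..1})" "continuous_on {0..1} f'"
  shows "integral {0..1} (\<lambda>x. exp (s * x) * (2 * f x * f' x)) =
     exp s * (f 1)\<^sup>2 - (f 0)\<^sup>2 - s * integral {0..1} (\<lambda>x. exp (s * x) * (f x)\<^sup>2)"
proof -
  have fc: "continuous_on {0..1} f" using assms(1) by (rule DERIV_continuous_on)
  have "((\<lambda>x. s * (exp (s * x) * (f x)\<^sup>2) + exp (s * x) * (2 * f x * f' x)) has_integral
     (exp (s * 1) * (f 1)\<^sup>2 - exp (s * 0) * (f 0)\<^sup>2)) {0..1}"
    by (rule fundamental_theorem_of_calculus)
      (auto simp: has_real_derivative_iff_has_vector_derivative[symmetric] algebra_simps power2_eq_square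
        intro!: derivative_eq_intros assms(1))
  then have "integral {0..1} (\<lambda>x. s * (exp (s * x) * (f x)\<^sup>2) + exp (s * x) * (2 * f x * f' x)) = exp s * (f 1)\<^sup>2 - (f 0)\<^sup>2"
    by (simp add: has_integral_iff)
  moreover have "integral {0..1} (\<lambda>x. s * (exp (s * x) * (f x)\<^sup>2) + exp (s * x) * (2 * f x * f' x)) =
      s * integral {0..1} (\<lambda>x. exp (s * x) * (f x)\<^sup>2) + integral {0..1} (\<lambda>x. exp (s * x) * (2 * f x * f' x))"
    unfolding integral_mult_right[symmetric]
    by (rule Henstock_Kurzweil_Integration.integral_add) (intro integrable_continuous_real continuous_intros fc assms(2))+
  ultimately show ?thesis by simp
qed

text \<open>The outflow at \<open>1\<close> is dropped, and the inflow at \<open>0\<close> is a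
  multiple of the trace of \<open>v\<close>. The couplings bring in \<open>V2\<close>, which is
  exchanged for \<open>B2\<close> and \<open>U2\<close> since the functional does not contain
  \<open>v\<close>.\<close>

lemma d1_sum_bound:
  assumes t: "t \<ge> 0"
  shows "1 / real n * (\<Sum>i=1..n. d1 i t) \<le> C\<^sup>2 * (z 0 t 0)\<^sup>2 + (4 * C\<^sup>2 - \<delta>) * U2 t + 4 * C\<^sup>2 * B2 t"
proof -
  let ?N = "1 / real n"
  have srcc: "continuous_on {0..1} (\<lambda>x. src z i t x)" if "i \<le> n" for i
    by (rule continuous_on_comp2[OF src_cont[OF that z_cont]]) (use t in \<open>auto intro!: continuous_intros\<close>)
  have sc: "continuous_on {0..1} (\<lambda>x. exp (- \<delta> * x) * (2 * z i t x * src z i t x / lam x (yy i)))" if "i \<in> {1..n}" for i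
    using that lam_pos[OF that] by (intro continuous_intros zc t srcc lam_yy_cont) force+
  have zxc: "continuous_on {0..1} (zx i t)" if "i \<le> n" for i by (rule slice[OF zx_cont[OF that] t])
  have e: "d1 i t = - exp (- \<delta>) * (z i t 1)\<^sup>2 + (z i t 0)\<^sup>2 - \<delta> * integral {0..1} (\<lambda>x. exp (- \<delta> * x) * (z i t x)\<^sup>2)
      + integral {0..1} (\<lambda>x. exp (- \<delta> * x) * (2 * z i t x * src z i t x / lam x (yy i)))" if i: "i \<in> {1..n}" for i
  proof -
    have i': "i \<le> n" "i \<noteq> 0" using i by auto
    have "d1 i t = integral {0..1} (\<lambda>x. exp (- \<delta> * x) * (2 * z i t x * src z i t x / lam x (yy i)) - exp (- \<delta> * x) * (2 * z i t x * zx i t x))"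
      unfolding d1_def
    proof (rule Henstock_Kurzweil_Integration.integral_cong)
      fix x :: real assume x: "x \<in> {0..1}"
      have zte: "zt i t x = src z i t x - lam x (yy i) * zx i t x"
        using z_pde[OF i'(1) t x] i' by (simp add: a_def)
      show "exp (- \<delta> * x) * (2 * z i t x * zt i t x) / lam x (yy i) =
        exp (- \<delta> * x) * (2 * z i t x * src z i t x / lam x (yy i)) - exp (- \<delta> * x) * (2 * z i t x * zx i t x)"
        unfolding zte using lam_pos[OF i x] by (simp add: field_simps)
    qed
    also have "\<dots> = integral {0..1} (\<lambda>x. exp (- \<delta> * x) * (2 * z i t x * src z i t x / lam x (yy i)))
        - integral {0..1} (\<lambda>x. exp (- \<delta> * x) * (2 * z i t x * zx i t x))"
      by (rule Henstock_Kurzweil_Integration.integral_diff)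
        (intro integrable_continuous_real sc i, intro integrable_continuous_real continuous_intros zc zxc t i')
    also have "integral {0..1} (\<lambda>x. exp (- \<delta> * x) * (2 * z i t x * zx i t x)) =
       exp (- \<delta>) * (z i t 1)\<^sup>2 - (z i t 0)\<^sup>2 - (- \<delta>) * integral {0..1} (\<lambda>x. exp (- \<delta> * x) * (z i t x)\<^sup>2)"
      by (rule weighted_ibp) (use z_dx[OF i'(1) t] zxc[OF i'(1)] in auto)
    finally show ?thesis by simp
  qed
  have "(\<Sum>i=1..n. d1 i t) \<le> (\<Sum>i=1..n. C\<^sup>2 * (z 0 t 0)\<^sup>2 - \<delta> * integral {0..1} (\<lambda>x. exp (- \<delta> * x) * (z i t x)\<^sup>2)
      + integral {0..1} (\<lambda>x. exp (- \<delta> * x) * (2 * z i t x * src z i t x / lam x (yy i))))"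
  proof (rule sum_mono)
    fix i assume i: "i \<in> {1..n}"
    then have i': "i \<le> n" "i \<noteq> 0" by auto
    have "z i t 0 = q (yy i) * z 0 t 0" using z_bc[OF i'(1) t] i' by (simp add: inflow_def bval_def qn_def)
    moreover have "\<bar>q (yy i)\<bar>\<^sup>2 \<le> C\<^sup>2" using bndx[OF yy_in[OF i'(1)]] by (intro power_mono) auto
    ultimately have "(z i t 0)\<^sup>2 \<le> C\<^sup>2 * (z 0 t 0)\<^sup>2" by (simp add: power_mult_distrib mult_right_mono)
    moreover have "- exp (- \<delta>) * (z i t 1)\<^sup>2 \<le> 0" by simp
    ultimately show "d1 i t \<le> C\<^sup>2 * (z 0 t 0)\<^sup>2 - \<delta> * integral {0..1} (\<lambda>x. exp (- \<delta> * x) * (z i t x)\<^sup>2)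
      + integral {0..1} (\<lambda>x. exp (- \<delta> * x) * (2 * z i t x * src z i t x / lam x (yy i)))"
      unfolding e[OF i] by linarith
  qed
  then have "?N * (\<Sum>i=1..n. d1 i t) \<le> ?N * (\<Sum>i=1..n. C\<^sup>2 * (z 0 t 0)\<^sup>2 - \<delta> * integral {0..1} (\<lambda>x. exp (- \<delta> * x) * (z i t x)\<^sup>2)
      + integral {0..1} (\<lambda>x. exp (- \<delta> * x) * (2 * z i t x * src z i t x / lam x (yy i))))"
    by (rule mult_left_mono) simp
  also have "\<dots> = C\<^sup>2 * (z 0 t 0)\<^sup>2 - \<delta> * (?N * (\<Sum>i=1..n. integral {0..1} (\<lambda>x. exp (- \<delta> * x) * (z i t x)\<^sup>2)))
      + ?N * (\<Sum>i=1..n. integral {0..1} (\<lambda>x. exp (- \<delta> * x) * (2 * z i t x * src z i t x / lam x (yy i))))"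
    unfolding sum.distrib sum_subtractf sum_distrib_left[symmetric] using n_pos by (simp add: algebra_simps)
  also have "?N * (\<Sum>i=1..n. integral {0..1} (\<lambda>x. exp (- \<delta> * x) * (z i t x)\<^sup>2)) = U2 t"
  proof -
    have "(\<Sum>i=1..n. integral {0..1} (\<lambda>x. exp (- \<delta> * x) * (z i t x)\<^sup>2)) = integral {0..1} (\<lambda>x. \<Sum>i=1..n. exp (- \<delta> * x) * (z i t x)\<^sup>2)"
      by (rule integral_sum[symmetric]) (auto intro!: integrable_continuous_real continuous_intros zc t)
    moreover have "U2 t = integral {0..1} (\<lambda>x. ?N * (\<Sum>i=1..n. exp (- \<delta> * x) * (z i t x)\<^sup>2))"
      unfolding U2_def u2_def
      by (intro Henstock_Kurzweil_Integration.integral_cong) (simp add: sum_distrib_left mult_ac)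
    ultimately show ?thesis by (simp only: integral_mult_right)
  qed
  also have "?N * (\<Sum>i=1..n. integral {0..1} (\<lambda>x. exp (- \<delta> * x) * (2 * z i t x * src z i t x / lam x (yy i))))
      \<le> C\<^sup>2 * (3 * U2 t + V2 t)"
  proof -
    have "?N * (\<Sum>i=1..n. integral {0..1} (\<lambda>x. exp (- \<delta> * x) * (2 * z i t x * src z i t x / lam x (yy i))))
       = integral {0..1} (\<lambda>x. ?N * (\<Sum>i=1..n. exp (- \<delta> * x) * (2 * z i t x * src z i t x / lam x (yy i))))"
      unfolding integral_mult_right by (subst integral_sum) (simp_all only: finite_atLeastAtMost integrable_continuous_real[OF sc])
    also have "\<dots> \<le> integral {0..1} (\<lambda>x. C\<^sup>2 * (3 * (exp (- \<delta> * x) * u2 t x) + exp (- \<delta> * x) * (z 0 t x)\<^sup>2))"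
    proof (rule integral_mono_continuous)
      show "continuous_on {0..1} (\<lambda>x. ?N * (\<Sum>i=1..n. exp (- \<delta> * x) * (2 * z i t x * src z i t x / lam x (yy i))))"
        by (intro continuous_on_mult continuous_on_const continuous_on_sum sc)
      show "continuous_on {0..1} (\<lambda>x. C\<^sup>2 * (3 * (exp (- \<delta> * x) * u2 t x) + exp (- \<delta> * x) * (z 0 t x)\<^sup>2))"
        by (intro continuous_intros u2c zc t le0)
      fix x :: real assume x: "x \<in> {0..1}"
      define g where "g = ub t x + \<bar>z 0 t x\<bar>"
      have g0: "g \<ge> 0" using ub_nonneg[of t x] by (simp add: g_def)
      \<comment> \<open>The source is at most \<open>C * g\<close> and the reciprocal speed at most
        \<open>C\<close>, whence the factor \<open>C\<^sup>2\<close>; \<open>g\<close> is common to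
        all \<open>i\<close>, so averaging over \<open>i\<close> leaves a product with
        \<open>ub\<close>.\<close>
      have "2 * z i t x * src z i t x / lam x (yy i) \<le> 2 * C\<^sup>2 * g * \<bar>z i t x\<bar>" if i: "i \<in> {1..n}" for i
      proof -
        have i': "i \<le> n" "i \<noteq> 0" using i by auto
        have "\<bar>?N * (\<Sum>j=1..n. \<sigma> x (yy i) (yy j) * z j t x)\<bar> \<le> C * ub t x"
          by (rule sum_weighted_bound) (use bnd\<sigma> x yy_in i' in auto)
        moreover have "\<bar>W x (yy i) * z 0 t x\<bar> \<le> C * \<bar>z 0 t x\<bar>"
          unfolding abs_mult using bnd[OF x yy_in[OF i'(1)]] by (intro mult_right_mono) auto
        ultimately have s: "\<bar>src z i t x\<bar> \<le> C * g"
          unfolding src_i[OF i'(2)] g_def distrib_left by linarith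
        have "2 * z i t x * src z i t x / lam x (yy i) \<le> \<bar>2 * z i t x * src z i t x / lam x (yy i)\<bar>" by (rule abs_ge_self)
        also have "\<dots> = (2 * \<bar>z i t x\<bar>) * (\<bar>src z i t x\<bar> * (1 / lam x (yy i)))"
          using lam_pos[OF i x] by (simp add: abs_mult)
        also have "\<dots> \<le> (2 * \<bar>z i t x\<bar>) * ((C * g) * C)"
          using s bnd[OF x yy_in[OF i'(1)]] lam_pos[OF i x] g0 C by (intro mult_left_mono mult_mono) auto
        finally show ?thesis by (simp add: power2_eq_square mult_ac)
      qed
      then have "?N * (\<Sum>i=1..n. 2 * z i t x * src z i t x / lam x (yy i)) \<le> ?N * (\<Sum>i=1..n. 2 * C\<^sup>2 * g * \<bar>z i t x\<bar>)"
        by (intro mult_left_mono sum_mono) auto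
      also have "\<dots> = C\<^sup>2 * (2 * g * ub t x)"
        unfolding ub_def sum_distrib_left[symmetric] by (simp add: mult_ac)
      also have "\<dots> \<le> C\<^sup>2 * (3 * u2 t x + (z 0 t x)\<^sup>2)"
      proof (rule mult_left_mono)
        have "2 * (ub t x * \<bar>z 0 t x\<bar>) \<le> (ub t x)\<^sup>2 + (z 0 t x)\<^sup>2"
          using sum_squares_bound[of "ub t x" "\<bar>z 0 t x\<bar>"] by simp
        then show "2 * g * ub t x \<le> 3 * u2 t x + (z 0 t x)\<^sup>2"
          using ub_sq[of t x] by (simp add: g_def algebra_simps power2_eq_square)
      qed simp
      finally have "exp (- \<delta> * x) * (?N * (\<Sum>i=1..n. 2 * z i t x * src z i t x / lam x (yy i))) \<le>
         exp (- \<delta> * x) * (C\<^sup>2 * (3 * u2 t x + (z 0 t x)\<^sup>2))" by (rule mult_left_mono) simp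
      then show "?N * (\<Sum>i=1..n. exp (- \<delta> * x) * (2 * z i t x * src z i t x / lam x (yy i)))
         \<le> C\<^sup>2 * (3 * (exp (- \<delta> * x) * u2 t x) + exp (- \<delta> * x) * (z 0 t x)\<^sup>2)"
        unfolding sum_distrib_left[symmetric] by (simp add: algebra_simps)
    qed
    also have "\<dots> = C\<^sup>2 * integral {0..1} (\<lambda>x. 3 * (exp (- \<delta> * x) * u2 t x) + exp (- \<delta> * x) * (z 0 t x)\<^sup>2)"
      by (rule integral_mult_right)
    also have "integral {0..1} (\<lambda>x. 3 * (exp (- \<delta> * x) * u2 t x) + exp (- \<delta> * x) * (z 0 t x)\<^sup>2)
       = integral {0..1} (\<lambda>x. 3 * (exp (- \<delta> * x) * u2 t x)) + V2 t"
      unfolding V2_def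
      by (rule Henstock_Kurzweil_Integration.integral_add) (intro integrable_continuous_real continuous_intros u2c zc t le0)+
    also have "integral {0..1} (\<lambda>x. 3 * (exp (- \<delta> * x) * u2 t x)) = 3 * U2 t"
      unfolding U2_def by (rule integral_mult_right)
    finally show ?thesis .
  qed
  finally have "?N * (\<Sum>i=1..n. d1 i t) \<le> C\<^sup>2 * (z 0 t 0)\<^sup>2 - \<delta> * U2 t + C\<^sup>2 * (3 * U2 t + V2 t)" by simp
  also have "\<dots> \<le> C\<^sup>2 * (z 0 t 0)\<^sup>2 - \<delta> * U2 t + C\<^sup>2 * (3 * U2 t + (4 * B2 t + U2 t))"
    using V2_bound[OF t] by (intro add_left_mono mult_left_mono) auto
  finally show ?thesis by (simp add: algebra_simps)
qed

lemma w2_split: "t \<ge> 0 \<Longrightarrow> integral {0..1} (\<lambda>x. exp (- \<delta> * x) * w2 t x) = U2 t + V2 t"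
  unfolding w2_def U2_def V2_def distrib_left
  by (rule Henstock_Kurzweil_Integration.integral_add) (intro integrable_continuous_real continuous_intros zc u2c le0; assumption)+

lemma N2_bound:
  assumes t: "t \<ge> 0" shows "N2 t \<le> exp \<delta> * (U2 t + V2 t)"
proof -
  have "N2 t \<le> integral {0..1} (\<lambda>x. exp \<delta> * (exp (- \<delta> * x) * w2 t x))"
    unfolding N2_def
  proof (rule integral_mono_continuous)
    show "w2 t x \<le> exp \<delta> * (exp (- \<delta> * x) * w2 t x)" if "x \<in> {0..1}" for x
      using mult_right_mono[OF exp_weight_bounds(2)[OF that] w2_nonneg[of t x]] by (simp add: mult.assoc)
  qed (intro continuous_intros w2c t)+
  then show ?thesis using w2_split[OF t] by (simp only: integral_mult_right)
qed

lemma B2_nonneg: "t \<ge> 0 \<Longrightarrow> B2 t \<ge> 0"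
  unfolding B2_def by (intro integral_nonneg integrable_continuous_real continuous_intros \<beta>c) auto

lemma U2_nonneg: "t \<ge> 0 \<Longrightarrow> U2 t \<ge> 0"
  unfolding U2_def by (intro integral_nonneg integrable_continuous_real continuous_intros u2c) (auto simp: u2_nonneg)

text \<open>\<beta> has no inflow since it vanishes at \<open>1\<close>, and its outflow is the
  trace of \<open>v\<close> at \<open>0\<close>. In the error term one factor
  \<open>exp \<delta>\<close> bounds the weight, the other removes the weight in passing from
  \<open>N2\<close> to \<open>U2\<close> and \<open>V2\<close>. The number \<open>16\<close> stems
  from \<open>4 * N2\<close> combined with
  \<open>N2 \<le> exp \<delta> * (2 * U2 + 4 * B2)\<close>.\<close>

lemma d3_bound:
  assumes t: "t \<ge> 0"
  shows "d3 t \<le> - (z 0 t 0)\<^sup>2 + (C - \<delta>) * B2 t + 16 * C * exp (2 * \<delta>) * \<epsilon>\<^sup>2 * ((z 0 t 0)\<^sup>2 + U2 t + B2 t)"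
proof -
  define R where "R = \<epsilon>\<^sup>2 * (2 * (z 0 t 0)\<^sup>2 + 4 * N2 t)"
  define bx where "bx x = (\<beta>t t x - resid (\<lambda>i. z i t) x) / \<mu> x" for x
  have bt: "continuous_on {0..1} (\<beta>t t)" by (rule slice[OF \<beta>t_cont t])
  have rc: "continuous_on {0..1} (\<lambda>x. resid (\<lambda>i. z i t) x)"
  proof -
    have ri: "continuous_on kernel_triangle (\<lambda>(x, \<xi>). resid_i j x \<xi>)" if j: "j \<in> {1..n}" for j
    proof -
      have "continuous_on (kernel_triangle \<times> cbox 0 1) (\<lambda>(u, \<eta>). \<sigma> (snd u) \<eta> (yy j) * k (fst u) (snd u) \<eta>)"
        unfolding case_prod_unfold
        by (intro continuous_intros continuous_on_comp3[OF \<sigma>_cont] continuous_on_comp3[OF k_cont])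
          (use j yy_in[of j] in \<open>auto simp: tri3_def kernel_triangle_def\<close>)
      from integral_continuous_on_param[OF this]
      show ?thesis unfolding resid_i_def case_prod_unfold
        by (intro continuous_intros continuous_on_comp3[OF k_cont] continuous_on_comp3[OF \<sigma>_cont])
          (use j yy_in in \<open>auto simp: tri3_def kernel_triangle_def\<close>)
    qed
    have rv: "continuous_on kernel_triangle (\<lambda>(x, \<xi>). resid_v x \<xi>)"
      unfolding resid_v_def case_prod_unfold
      by (intro continuous_intros continuous_on_comp2[OF gb_cont] continuous_on_comp3[OF k_cont] continuous_on_comp2[OF W_cont])
        (use yy_in in \<open>auto simp: tri3_def kernel_triangle_def\<close>)
    have "continuous_on {0..1} (\<lambda>x. integral {0..x} (\<lambda>\<xi>. 1 / real n * (\<Sum>j=1..n. z j t \<xi> * resid_i j x \<xi>) + z 0 t \<xi> * resid_v x \<xi>))"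
    proof (rule continuous_on_integral_upper)
      show "continuous_on {(x, s). x \<in> {0..1} \<and> 0 \<le> s \<and> s \<le> x}
          (\<lambda>(x, \<xi>). 1 / real n * (\<Sum>j=1..n. z j t \<xi> * resid_i j x \<xi>) + z 0 t \<xi> * resid_v x \<xi>)"
        unfolding case_prod_unfold
        by (intro continuous_intros continuous_on_comp2[OF ri] continuous_on_comp2[OF rv] continuous_on_compose2[OF zc[OF t]])
          (auto simp: kernel_triangle_def)
    qed (auto intro!: continuous_intros)
    moreover have "continuous_on {0..1} resid_0"
    proof -
      have "continuous_on ({0..1} \<times> cbox 0 1) (\<lambda>(x, y). q y * lam 0 y * k x 0 y)"
        unfolding case_prod_unfold
        by (intro continuous_intros continuous_on_compose2[OF q_cont] continuous_on_comp2[OF lam_cont] continuous_on_comp3[OF k_cont])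
          (auto simp: tri3_def kernel_triangle_def)
      from integral_continuous_on_param[OF this]
      show ?thesis unfolding resid_0_def[abs_def]
        by (intro continuous_intros continuous_on_comp3[OF k_cont])
          (use yy_in in \<open>auto simp: tri3_def kernel_triangle_def\<close>)
    qed
    ultimately show ?thesis unfolding resid_def by (intro continuous_intros)
  qed
  have bxc: "continuous_on {0..1} bx" unfolding bx_def
    by (intro continuous_intros bt rc \<mu>_cont ballI) (rule \<mu>_nz)
  have R0: "R \<ge> 0" unfolding R_def N2_def
    using w2_nonneg by (intro mult_nonneg_nonneg add_nonneg_nonneg integral_nonneg integrable_continuous_real w2c t) auto
  have "d3 t = integral {0..1} (\<lambda>x. exp (\<delta> * x) * (2 * \<beta> t x * bx x) + exp (\<delta> * x) * (2 * \<beta> t x * resid (\<lambda>i. z i t) x / \<mu> x))"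
    unfolding d3_def
    by (rule Henstock_Kurzweil_Integration.integral_cong)
       (simp add: bx_def add_divide_distrib[symmetric] algebra_simps diff_divide_distrib)
  also have "\<dots> = integral {0..1} (\<lambda>x. exp (\<delta> * x) * (2 * \<beta> t x * bx x)) + integral {0..1} (\<lambda>x. exp (\<delta> * x) * (2 * \<beta> t x * resid (\<lambda>i. z i t) x / \<mu> x))"
    by (rule Henstock_Kurzweil_Integration.integral_add)
      (intro integrable_continuous_real continuous_intros bxc \<beta>c rc t \<mu>_cont ballI \<mu>_nz; assumption)+
  also have "integral {0..1} (\<lambda>x. exp (\<delta> * x) * (2 * \<beta> t x * bx x)) = exp \<delta> * (\<beta> t 1)\<^sup>2 - (\<beta> t 0)\<^sup>2 - \<delta> * B2 t"
    unfolding B2_def by (rule weighted_ibp[OF _ bxc]) (use \<beta>_pde[OF t] in \<open>simp add: bx_def\<close>)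
  also have "\<dots> = - (z 0 t 0)\<^sup>2 - \<delta> * B2 t" using \<beta>_1[OF t] \<beta>_0 by simp
  finally have d: "d3 t = - (z 0 t 0)\<^sup>2 - \<delta> * B2 t + integral {0..1} (\<lambda>x. exp (\<delta> * x) * (2 * \<beta> t x * resid (\<lambda>i. z i t) x / \<mu> x))" .
  have "integral {0..1} (\<lambda>x. exp (\<delta> * x) * (2 * \<beta> t x * resid (\<lambda>i. z i t) x / \<mu> x))
     \<le> integral {0..1} (\<lambda>x. C * (exp (\<delta> * x) * (\<beta> t x)\<^sup>2) + C * exp \<delta> * R)"
  proof (rule integral_mono_continuous)
    show "continuous_on {0..1} (\<lambda>x. exp (\<delta> * x) * (2 * \<beta> t x * resid (\<lambda>i. z i t) x / \<mu> x))"
      by (intro continuous_intros \<beta>c rc t \<mu>_cont ballI \<mu>_nz)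
    show "continuous_on {0..1} (\<lambda>x. C * (exp (\<delta> * x) * (\<beta> t x)\<^sup>2) + C * exp \<delta> * R)"
      by (intro continuous_intros \<beta>c t)
    fix x :: real assume x: "x \<in> {0..1}"
    define r where "r = resid (\<lambda>i. z i t) x"
    have r2: "r\<^sup>2 \<le> R" unfolding r_def R_def by (rule resid_sq[OF t x])
    have "2 * \<beta> t x * r \<le> (\<beta> t x)\<^sup>2 + R" using sum_squares_bound[of "\<beta> t x" r] r2 by linarith
    then have "2 * \<beta> t x * r * (1 / \<mu> x) \<le> ((\<beta> t x)\<^sup>2 + R) * (1 / \<mu> x)"
      using \<mu>_pos x by (intro mult_right_mono) (auto simp: less_imp_le)
    also have "\<dots> \<le> ((\<beta> t x)\<^sup>2 + R) * C" using bndx[OF x] R0 by (intro mult_left_mono) auto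
    finally have "exp (\<delta> * x) * (2 * \<beta> t x * r / \<mu> x) \<le> exp (\<delta> * x) * (((\<beta> t x)\<^sup>2 + R) * C)"
      by (intro mult_left_mono) auto
    also have "\<dots> = C * (exp (\<delta> * x) * (\<beta> t x)\<^sup>2) + exp (\<delta> * x) * (C * R)" by (simp add: algebra_simps)
    also have "\<dots> \<le> C * (exp (\<delta> * x) * (\<beta> t x)\<^sup>2) + exp \<delta> * (C * R)"
      using exp_weight_bounds(5)[OF x] C R0 by (intro add_left_mono mult_right_mono) auto
    finally show "exp (\<delta> * x) * (2 * \<beta> t x * resid (\<lambda>i. z i t) x / \<mu> x) \<le> C * (exp (\<delta> * x) * (\<beta> t x)\<^sup>2) + C * exp \<delta> * R"
      by (simp add: r_def mult_ac)
  qed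
  also have "\<dots> = integral {0..1} (\<lambda>x. C * (exp (\<delta> * x) * (\<beta> t x)\<^sup>2)) + integral {0..1::real} (\<lambda>x. C * exp \<delta> * R)"
    by (rule Henstock_Kurzweil_Integration.integral_add) (intro integrable_continuous_real continuous_intros \<beta>c t)+
  also have "\<dots> = C * B2 t + C * exp \<delta> * R" unfolding B2_def by simp
  finally have m: "d3 t \<le> - (z 0 t 0)\<^sup>2 + (C - \<delta>) * B2 t + C * exp \<delta> * R" unfolding d by (simp add: algebra_simps)
  have R1: "R \<le> \<epsilon>\<^sup>2 * (exp \<delta> * (16 * ((z 0 t 0)\<^sup>2 + U2 t + B2 t)))"
    unfolding R_def
  proof (rule mult_left_mono)
    have "N2 t \<le> exp \<delta> * (2 * U2 t + 4 * B2 t)"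
      by (rule order_trans[OF N2_bound[OF t]]) (use V2_bound[OF t] in auto)
    then have 1: "N2 t \<le> 2 * (exp \<delta> * U2 t) + 4 * (exp \<delta> * B2 t)" by (simp add: algebra_simps)
    have 2: "(z 0 t 0)\<^sup>2 * 1 \<le> (z 0 t 0)\<^sup>2 * exp \<delta>" using \<delta>_pos by (intro mult_left_mono) auto
    have 3: "0 \<le> (z 0 t 0)\<^sup>2 * exp \<delta>" "0 \<le> exp \<delta> * U2 t" using U2_nonneg[OF t] by auto
    have "exp \<delta> * (16 * ((z 0 t 0)\<^sup>2 + U2 t + B2 t)) = 16 * ((z 0 t 0)\<^sup>2 * exp \<delta>) + 16 * (exp \<delta> * U2 t) + 16 * (exp \<delta> * B2 t)"
      by (simp add: algebra_simps)
    then show "2 * (z 0 t 0)\<^sup>2 + 4 * N2 t \<le> exp \<delta> * (16 * ((z 0 t 0)\<^sup>2 + U2 t + B2 t))"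
      using 1 2 3 by linarith
  qed simp
  have "C * exp \<delta> * R \<le> C * exp \<delta> * (\<epsilon>\<^sup>2 * (exp \<delta> * (16 * ((z 0 t 0)\<^sup>2 + U2 t + B2 t))))"
    using R1 C by (intro mult_left_mono) auto
  also have "\<dots> = 16 * C * exp (2 * \<delta>) * \<epsilon>\<^sup>2 * ((z 0 t 0)\<^sup>2 + U2 t + B2 t)"
    by (simp add: exp_double power2_eq_square)
  finally show ?thesis using m by linarith
qed

end

context discretized
begin

definition energy :: "(nat \<Rightarrow> real \<Rightarrow> real) \<Rightarrow> real" where
  "energy w = integral {0..1} (\<lambda>x. 1 / real n * (\<Sum>i=1..n. (w i x)\<^sup>2) + (w 0 x)\<^sup>2)"

end

section \<open>Dissipation and comparison of the functional with the energy\<close>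

context lyapunov
begin

definition VV where "VV t = 1 / real n * (\<Sum>i=1..n. V1 i t) + A * V3 t"

lemma C2_ge: "C\<^sup>2 \<ge> 1"
  using C by simp

lemma A_pos: "A \<ge> 1"
  using C2_ge by (simp add: A_eq)

lemma VV_deriv:
  assumes t: "t \<ge> 0"
  shows "(VV has_real_derivative 1 / real n * (\<Sum>i=1..n. d1 i t) + A * d3 t) (at t within {0..})"
  unfolding VV_def[abs_def] by (intro DERIV_add DERIV_cmult DERIV_sum V1_deriv V3_deriv t)

text \<open>The factor \<open>A = 2 * C\<^sup>2\<close> beats the inflow \<open>C\<^sup>2\<close> at
  \<open>x = 0\<close>. As \<open>C - \<delta> \<le> -5\<close>, the term
  \<open>A * (C - \<delta>)\<close> is at most \<open>-10 * C\<^sup>2\<close> and covers the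
  \<open>4 * C\<^sup>2\<close> coming from the couplings. The \<open>1 / 2\<close> in each
  coefficient is the allowance for quadrature errors.\<close>

lemma VV_dissipation:
  assumes t: "t \<ge> 0"
  shows "1 / real n * (\<Sum>i=1..n. d1 i t) + A * d3 t \<le> - (U2 t + B2 t)"
proof -
  define \<eta> where "\<eta> = A * (16 * C * exp (2 * \<delta>) * \<epsilon>\<^sup>2)"
  have \<eta>: "\<eta> \<le> 1 / 2" using \<epsilon>(2) by (simp add: \<eta>_def)
  have C2: "C\<^sup>2 \<ge> 1" by (rule C2_ge)
  define v where "v = (z 0 t 0)\<^sup>2"
  have "A * d3 t \<le> A * (- v + (C - \<delta>) * B2 t + 16 * C * exp (2 * \<delta>) * \<epsilon>\<^sup>2 * (v + U2 t + B2 t))"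
    using d3_bound[OF t] A_pos unfolding v_def by (intro mult_left_mono) auto
  also have "\<dots> = - A * v + A * (C - \<delta>) * B2 t + \<eta> * (v + U2 t + B2 t)"
    by (simp add: \<eta>_def algebra_simps)
  also have "\<dots> \<le> - A * v + A * (C - \<delta>) * B2 t + 1 / 2 * (v + U2 t + B2 t)"
    using \<eta> B2_nonneg[OF t] U2_nonneg[OF t] by (intro add_left_mono mult_right_mono) (auto simp: v_def)
  finally have 1: "1 / real n * (\<Sum>i=1..n. d1 i t) + A * d3 t \<le>
     (C\<^sup>2 - A + 1 / 2) * v + (4 * C\<^sup>2 - \<delta> + 1 / 2) * U2 t + (4 * C\<^sup>2 + A * (C - \<delta>) + 1 / 2) * B2 t"
    using d1_sum_bound[OF t] unfolding v_def by (simp add: algebra_simps)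
  have "(C\<^sup>2 - A + 1 / 2) * v \<le> 0"
  proof (rule mult_nonpos_nonneg)
    show "C\<^sup>2 - A + 1 / 2 \<le> 0" using C2 unfolding A_eq by linarith
  qed (simp add: v_def)
  moreover have "(4 * C\<^sup>2 - \<delta> + 1 / 2) * U2 t \<le> (- 1) * U2 t"
  proof (rule mult_right_mono[OF _ U2_nonneg[OF t]])
    show "4 * C\<^sup>2 - \<delta> + 1 / 2 \<le> - 1" using C C2 unfolding \<delta>_eq by linarith
  qed
  moreover have "(4 * C\<^sup>2 + A * (C - \<delta>) + 1 / 2) * B2 t \<le> (- 1) * B2 t"
  proof (rule mult_right_mono[OF _ B2_nonneg[OF t]])
    have "A * (C - \<delta>) \<le> A * (- 5)" using A_pos C2 by (intro mult_left_mono) (auto simp: \<delta>_eq)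
    then show "4 * C\<^sup>2 + A * (C - \<delta>) + 1 / 2 \<le> - 1" using C2 unfolding A_eq by linarith
  qed
  ultimately show ?thesis using 1 by linarith
qed

lemma V1_sum_eq:
  assumes t: "t \<ge> 0"
  shows "1 / real n * (\<Sum>i=1..n. V1 i t) = integral {0..1} (\<lambda>x. exp (- \<delta> * x) * (1 / real n * (\<Sum>i=1..n. (z i t x)\<^sup>2 / lam x (yy i))))"
    and "continuous_on {0..1} (\<lambda>x. exp (- \<delta> * x) * (1 / real n * (\<Sum>i=1..n. (z i t x)\<^sup>2 / lam x (yy i))))"
proof -
  have c: "continuous_on {0..1} (\<lambda>x. exp (- \<delta> * x) * (z i t x)\<^sup>2 / lam x (yy i))" if "i \<in> {1..n}" for i
    using that lam_pos[OF that] by (intro continuous_intros zc t lam_yy_cont) force+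
  have "(\<Sum>i=1..n. V1 i t) = integral {0..1} (\<lambda>x. \<Sum>i=1..n. exp (- \<delta> * x) * (z i t x)\<^sup>2 / lam x (yy i))"
    unfolding V1_def by (rule integral_sum[symmetric]) (rule finite_atLeastAtMost, rule integrable_continuous_real, rule c)
  then have "1 / real n * (\<Sum>i=1..n. V1 i t) = integral {0..1} (\<lambda>x. 1 / real n * (\<Sum>i=1..n. exp (- \<delta> * x) * (z i t x)\<^sup>2 / lam x (yy i)))"
    by (simp only: integral_mult_right)
  also have "\<dots> = integral {0..1} (\<lambda>x. exp (- \<delta> * x) * (1 / real n * (\<Sum>i=1..n. (z i t x)\<^sup>2 / lam x (yy i))))"
    by (intro Henstock_Kurzweil_Integration.integral_cong) (simp add: sum_distrib_left mult_ac)
  finally show "1 / real n * (\<Sum>i=1..n. V1 i t) = integral {0..1} (\<lambda>x. exp (- \<delta> * x) * (1 / real n * (\<Sum>i=1..n. (z i t x)\<^sup>2 / lam x (yy i))))" .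
  have c2: "continuous_on {0..1} (\<lambda>x. (z i t x)\<^sup>2 / lam x (yy i))" if "i \<in> {1..n}" for i
    using that lam_pos[OF that] by (intro continuous_intros zc t lam_yy_cont) force+
  show "continuous_on {0..1} (\<lambda>x. exp (- \<delta> * x) * (1 / real n * (\<Sum>i=1..n. (z i t x)\<^sup>2 / lam x (yy i))))"
    by (intro continuous_on_mult continuous_on_const continuous_on_sum c2) (auto intro!: continuous_intros)
qed

lemma lam_recip: "i \<in> {1..n} \<Longrightarrow> x \<in> {0..1} \<Longrightarrow> 1 / C \<le> 1 / lam x (yy i) \<and> 1 / lam x (yy i) \<le> C"
  using bnd[of x "yy i"] yy_in[of i] lam_pos[of i x] C by (auto intro!: divide_left_mono mult_pos_pos)

lemma mu_recip: "x \<in> {0..1} \<Longrightarrow> 1 / C \<le> 1 / \<mu> x \<and> 1 / \<mu> x \<le> C"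
  using bndx[of x] \<mu>_pos C by (auto intro!: divide_left_mono mult_pos_pos)

lemma V1_sum_bounds:
  assumes t: "t \<ge> 0"
  shows "1 / real n * (\<Sum>i=1..n. V1 i t) \<le> C * U2 t" and "U2 t \<le> C * (1 / real n * (\<Sum>i=1..n. V1 i t))"
proof -
  have s1: "(\<Sum>i=1..n. (z i t x)\<^sup>2 / lam x (yy i)) \<le> C * (\<Sum>i=1..n. (z i t x)\<^sup>2)" if x: "x \<in> {0..1}" for x
    unfolding sum_distrib_left
  proof (rule sum_mono)
    fix i assume "i \<in> {1..n}"
    from mult_right_mono[OF lam_recip[OF this x, THEN conjunct2], of "(z i t x)\<^sup>2"]
    show "(z i t x)\<^sup>2 / lam x (yy i) \<le> C * (z i t x)\<^sup>2" by simp
  qed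
  have s2: "(\<Sum>i=1..n. (z i t x)\<^sup>2) \<le> C * (\<Sum>i=1..n. (z i t x)\<^sup>2 / lam x (yy i))" if x: "x \<in> {0..1}" for x
    unfolding sum_distrib_left
  proof (rule sum_mono)
    fix i assume "i \<in> {1..n}"
    from mult_right_mono[OF lam_recip[OF this x, THEN conjunct1], of "C * (z i t x)\<^sup>2"]
    show "(z i t x)\<^sup>2 \<le> C * ((z i t x)\<^sup>2 / lam x (yy i))" using C by simp
  qed
  show "1 / real n * (\<Sum>i=1..n. V1 i t) \<le> C * U2 t"
    unfolding V1_sum_eq(1)[OF t] U2_def integral_mult_right[symmetric]
  proof (rule integral_mono_continuous[OF V1_sum_eq(2)[OF t]])
    fix x :: real assume x: "x \<in> {0..1}"
    have "exp (- \<delta> * x) * (1 / real n * (\<Sum>i=1..n. (z i t x)\<^sup>2 / lam x (yy i))) \<le> exp (- \<delta> * x) * (1 / real n * (C * (\<Sum>i=1..n. (z i t x)\<^sup>2)))"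
      using s1[OF x] by (intro mult_left_mono) auto
    then show "exp (- \<delta> * x) * (1 / real n * (\<Sum>i=1..n. (z i t x)\<^sup>2 / lam x (yy i))) \<le> C * (exp (- \<delta> * x) * u2 t x)"
      by (simp add: u2_def mult_ac)
  qed (intro continuous_intros u2c t)
  show "U2 t \<le> C * (1 / real n * (\<Sum>i=1..n. V1 i t))"
    unfolding V1_sum_eq(1)[OF t] U2_def integral_mult_right[symmetric]
  proof (rule integral_mono_continuous)
    fix x :: real assume x: "x \<in> {0..1}"
    have "exp (- \<delta> * x) * (1 / real n * (\<Sum>i=1..n. (z i t x)\<^sup>2)) \<le> exp (- \<delta> * x) * (1 / real n * (C * (\<Sum>i=1..n. (z i t x)\<^sup>2 / lam x (yy i))))"
      using s2[OF x] by (intro mult_left_mono) auto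
    then show "exp (- \<delta> * x) * u2 t x \<le> C * (exp (- \<delta> * x) * (1 / real n * (\<Sum>i=1..n. (z i t x)\<^sup>2 / lam x (yy i))))"
      by (simp add: u2_def mult_ac)
  qed (intro continuous_intros u2c t, intro continuous_on_mult[OF continuous_on_const] V1_sum_eq(2) t)
qed

lemma V3_bounds:
  assumes t: "t \<ge> 0"
  shows "V3 t \<le> C * B2 t" and "B2 t \<le> C * V3 t"
proof -
  have c: "continuous_on {0..1} (\<lambda>x. exp (\<delta> * x) * (\<beta> t x)\<^sup>2 / \<mu> x)"
    by (intro continuous_intros \<beta>c t \<mu>_cont ballI \<mu>_nz)
  show "V3 t \<le> C * B2 t"
    unfolding V3_def B2_def integral_mult_right[symmetric]
  proof (rule integral_mono_continuous[OF c])
    fix x :: real assume "x \<in> {0..1}"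
    from mult_right_mono[OF mu_recip[OF this, THEN conjunct2], of "exp (\<delta> * x) * (\<beta> t x)\<^sup>2"]
    show "exp (\<delta> * x) * (\<beta> t x)\<^sup>2 / \<mu> x \<le> C * (exp (\<delta> * x) * (\<beta> t x)\<^sup>2)" by simp
  qed (intro continuous_intros \<beta>c t)
  show "B2 t \<le> C * V3 t"
    unfolding V3_def B2_def integral_mult_right[symmetric]
  proof (rule integral_mono_continuous)
    fix x :: real assume "x \<in> {0..1}"
    from mult_right_mono[OF mu_recip[OF this, THEN conjunct1], of "C * (exp (\<delta> * x) * (\<beta> t x)\<^sup>2)"]
    show "exp (\<delta> * x) * (\<beta> t x)\<^sup>2 \<le> C * (exp (\<delta> * x) * (\<beta> t x)\<^sup>2 / \<mu> x)" using C by simp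
  qed (intro continuous_intros \<beta>c t, intro continuous_on_mult[OF continuous_on_const] c)
qed

lemma B2_le_N2:
  assumes t: "t \<ge> 0" shows "B2 t \<le> exp \<delta> * (6 * C\<^sup>2 * N2 t)"
proof -
  have N0: "N2 t \<ge> 0" unfolding N2_def using w2_nonneg
    by (intro integral_nonneg integrable_continuous_real w2c t) auto
  have "B2 t \<le> integral {0..1} (\<lambda>x. exp \<delta> * (2 * w2 t x + 4 * C\<^sup>2 * N2 t))"
    unfolding B2_def
  proof (rule integral_mono_continuous)
    fix x :: real assume x: "x \<in> {0..1}"
    have "(\<beta> t x)\<^sup>2 \<le> 2 * (z 0 t x)\<^sup>2 + 2 * (Kint (\<lambda>i. z i t) x)\<^sup>2"
      using sum_squares_bound[of "z 0 t x" "- Kint (\<lambda>i. z i t) x"] by (simp add: \<beta>_def power2_diff)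
    also have "\<dots> \<le> 2 * w2 t x + 2 * (2 * C\<^sup>2 * N2 t)"
    proof -
      have "integral {0..x} (w2 t) \<le> integral {0..1} (w2 t)"
        by (rule integral_subset_le) (use x w2_nonneg in \<open>auto intro!: integrable_continuous_real continuous_on_subset[OF w2c[OF t]]\<close>)
      then have "2 * C\<^sup>2 * integral {0..x} (w2 t) \<le> 2 * C\<^sup>2 * N2 t" unfolding N2_def by (intro mult_left_mono) auto
      then show ?thesis using Kint_sq[OF t x] u2_nonneg[of t x] by (simp add: w2_def)
    qed
    finally have "exp (\<delta> * x) * (\<beta> t x)\<^sup>2 \<le> exp \<delta> * (2 * w2 t x + 2 * (2 * C\<^sup>2 * N2 t))"
      using exp_weight_bounds(5)[OF x] by (intro mult_mono) auto
    then show "exp (\<delta> * x) * (\<beta> t x)\<^sup>2 \<le> exp \<delta> * (2 * w2 t x + 4 * C\<^sup>2 * N2 t)" by (simp add: mult.assoc)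
  qed (intro continuous_intros \<beta>c w2c t)+
  also have "\<dots> = exp \<delta> * integral {0..1} (\<lambda>x. 2 * w2 t x + 4 * C\<^sup>2 * N2 t)" by (rule integral_mult_right)
  also have "integral {0..1} (\<lambda>x. 2 * w2 t x + 4 * C\<^sup>2 * N2 t) = integral {0..1} (\<lambda>x. 2 * w2 t x) + integral {0..1::real} (\<lambda>x. 4 * C\<^sup>2 * N2 t)"
    by (rule Henstock_Kurzweil_Integration.integral_add) (intro integrable_continuous_real continuous_intros w2c t)+
  also have "\<dots> = 2 * N2 t + 4 * C\<^sup>2 * N2 t" by (simp add: N2_def)
  also have "\<dots> \<le> 6 * C\<^sup>2 * N2 t"
  proof -
    have "2 * N2 t * 1 \<le> 2 * N2 t * C\<^sup>2" using C2_ge N0 by (intro mult_left_mono) auto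
    then show ?thesis by (simp add: algebra_simps)
  qed
  finally show ?thesis by simp
qed

lemma U2_le_N2: assumes t: "t \<ge> 0" shows "U2 t \<le> N2 t"
  unfolding U2_def N2_def
proof (rule integral_mono_continuous)
  fix x :: real assume x: "x \<in> {0..1}"
  have "exp (- \<delta> * x) * u2 t x \<le> 1 * u2 t x" using exp_weight_bounds(1)[OF x] u2_nonneg by (intro mult_right_mono) auto
  also have "\<dots> \<le> w2 t x" by (simp add: w2_def)
  finally show "exp (- \<delta> * x) * u2 t x \<le> w2 t x" .
qed (intro continuous_intros u2c w2c t)+

text \<open>With \<open>L = A * C = 2 * C ^ 3\<close> the functional is at most
  \<open>L * (U2 + B2)\<close>, so dissipation gives the rate \<open>1 / L\<close>. Returning to
  \<open>N2\<close> costs \<open>4 * C * exp \<delta>\<close> at time \<open>t\<close>, where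
  \<open>v\<close> is recovered from \<beta>, and the rest of the constant at time \<open>0\<close>,
  where \<beta> is bounded by the state.\<close>

lemma N2_decay:
  assumes t: "t \<ge> 0"
  shows "N2 t \<le> (4 * C * exp \<delta> * (2 * C ^ 3) * (1 + exp \<delta> * (6 * C\<^sup>2))) * exp (- (1 / (2 * C ^ 3)) * t) * N2 0"
proof -
  define L where "L = 2 * C ^ 3"
  have L0: "L > 0" using C by (simp add: L_def)
  have V3n: "V3 t \<ge> 0" if "t \<ge> 0" for t
  proof -
    have "0 \<le> C * V3 t" using V3_bounds(2)[OF that] B2_nonneg[OF that] by linarith
    then show ?thesis using C by (simp add: zero_le_mult_iff)
  qed
  have VU: "VV t \<le> L * (U2 t + B2 t)" if "t \<ge> 0" for t
  proof -
    have "A * V3 t \<le> A * (C * B2 t)" using V3_bounds(1)[OF that] A_pos by (intro mult_left_mono) auto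
    moreover have "A * (C * B2 t) = L * B2 t" by (simp add: A_eq L_def power2_eq_square power3_eq_cube)
    moreover have "C * U2 t \<le> L * U2 t"
    proof (rule mult_right_mono[OF _ U2_nonneg[OF that]])
      have "C * 1 \<le> C * A" using A_pos C by (intro mult_left_mono) auto
      then show "C \<le> L" by (simp add: A_eq L_def power2_eq_square power3_eq_cube)
    qed
    ultimately show ?thesis using V1_sum_bounds(1)[OF that] by (simp add: VV_def distrib_left)
  qed
  have "VV t \<le> exp (- (1 / L) * t) * VV 0"
  proof (rule exponential_decay_from_deriv[OF VV_deriv _ t])
    fix s :: real assume s: "s \<ge> 0"
    have "1 / L * VV s \<le> 1 / L * (L * (U2 s + B2 s))" using VU[OF s] L0 by (intro mult_left_mono) auto
    also have "\<dots> = U2 s + B2 s" using L0 by simp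
    finally show "1 / real n * (\<Sum>i=1..n. d1 i s) + A * d3 s \<le> - (1 / L) * VV s"
      using VV_dissipation[OF s] by simp
  qed
  have NV: "N2 t \<le> 4 * C * exp \<delta> * VV t"
  proof -
    have "N2 t \<le> exp \<delta> * (U2 t + V2 t)" by (rule N2_bound[OF t])
    also have "\<dots> \<le> exp \<delta> * (4 * C * VV t)"
    proof (rule mult_left_mono)
      have "1 * V3 t \<le> A * V3 t" using A_pos V3n[OF t] by (intro mult_right_mono)
      then have "C * (1 / real n * (\<Sum>i=1..n. V1 i t)) + C * V3 t \<le> C * VV t"
        unfolding VV_def distrib_left[symmetric] using C by (intro mult_left_mono) auto
      then show "U2 t + V2 t \<le> 4 * C * VV t"
        using V2_bound[OF t] V1_sum_bounds(2)[OF t] V3_bounds(2)[OF t] U2_nonneg[OF t] B2_nonneg[OF t] by linarith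
    qed simp
    finally show ?thesis by (simp add: mult_ac)
  qed
  have "VV 0 \<le> L * (N2 0 + exp \<delta> * (6 * C\<^sup>2 * N2 0))"
  proof -
    have "U2 0 + B2 0 \<le> N2 0 + exp \<delta> * (6 * C\<^sup>2 * N2 0)" by (intro add_mono U2_le_N2 B2_le_N2) auto
    then have "L * (U2 0 + B2 0) \<le> L * (N2 0 + exp \<delta> * (6 * C\<^sup>2 * N2 0))" using L0 by (intro mult_left_mono) auto
    then show ?thesis using VU[of 0] by linarith
  qed
  then have V0: "VV 0 \<le> L * (1 + exp \<delta> * (6 * C\<^sup>2)) * N2 0" by (simp add: algebra_simps)
  have "N2 t \<le> 4 * C * exp \<delta> * (exp (- (1 / L) * t) * (L * (1 + exp \<delta> * (6 * C\<^sup>2)) * N2 0))"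
  proof (rule order_trans[OF NV mult_left_mono])
    show "VV t \<le> exp (- (1 / L) * t) * (L * (1 + exp \<delta> * (6 * C\<^sup>2)) * N2 0)"
      by (rule order_trans[OF \<open>VV t \<le> exp (- (1 / L) * t) * VV 0\<close> mult_left_mono[OF V0]]) simp
  qed (use C in auto)
  then show ?thesis by (simp add: L_def mult_ac)
qed

end

section \<open>Constants and the threshold for the number of components\<close>

context continuum
begin

lemma compact_tri: "compact kernel_triangle"
proof -
  have "kernel_triangle = {u. 0 \<le> snd u} \<inter> {u. snd u \<le> fst u} \<inter> {u. fst u \<le> 1}"
    by (auto simp: kernel_triangle_def)
  moreover have "closed ({u :: real \<times> real. 0 \<le> snd u} \<inter> {u. snd u \<le> fst u} \<inter> {u. fst u \<le> 1})"
    by (intro closed_Int closed_Collect_le continuous_intros)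
  moreover have "kernel_triangle \<subseteq> {0..1} \<times> {0..1}" by (auto simp: kernel_triangle_def)
  then have "bounded kernel_triangle" by (rule bounded_subset[rotated]) (auto intro: bounded_Times)
  ultimately show ?thesis by (simp add: compact_eq_bounded_closed)
qed

lemma compact_tri3: "compact tri3"
proof -
  have "compact ((\<lambda>u. (fst (fst u), snd (fst u), snd u)) ` (kernel_triangle \<times> {0..1::real}))"
    by (intro compact_continuous_image compact_Times compact_tri continuous_intros) auto
  moreover have "(\<lambda>u. (fst (fst u), snd (fst u), snd u)) ` (kernel_triangle \<times> {0..1::real}) = tri3"
    by (force simp: tri3_def image_iff)
  ultimately show ?thesis by simp
qed

lemma bounded_on_compact:
  fixes f :: "'x::topological_space \<Rightarrow> real"
  assumes "compact S" "continuous_on S f"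
  obtains B where "B \<ge> 1" "\<And>x. x \<in> S \<Longrightarrow> \<bar>f x\<bar> \<le> B"
proof -
  from compact_imp_bounded[OF compact_continuous_image[OF assms(2,1)]]
  obtain B where "\<And>x. x \<in> S \<Longrightarrow> \<bar>f x\<bar> \<le> B" unfolding bounded_pos by auto
  then show ?thesis using that[of "max 1 B"] by (force simp: le_max_iff_disj)
qed

text \<open>The constants are bounds of the continuum data on compact sets. They determine
  \<epsilon>, and only then does the uniform Riemann-sum estimate select \<open>N\<close>. The proof
  supplies the same \<open>M\<close> and the same rate for all \<open>n \<ge> N\<close>.\<close>

theorem smooth_decay:
  obtains N where "N \<ge> 1" "\<And>n. n \<ge> N \<Longrightarrow> \<exists>M>0. \<exists>c>0. \<forall>z zt zx.
     transport.smooth_sol n (discretized.a \<mu> lam n) (discretized.cf W \<theta> \<sigma> n) (discretized.qn q n) (discretized.kk k kbar n) z zt zx \<longrightarrow>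
     (\<forall>t\<ge>0. discretized.energy n (\<lambda>i. z i t) \<le> M * exp (- c * t) * discretized.energy n (\<lambda>i. z i 0))"
proof -
  have sq: "compact ({0..1} \<times> {0..1} :: (real \<times> real) set)" by (intro compact_Times) auto
  obtain C1 where C1: "C1 \<ge> 1" "\<And>u. u \<in> {0..1} \<times> {0..1} \<Longrightarrow> \<bar>case u of (x, y) \<Rightarrow> \<theta> x y\<bar> \<le> C1"
    using bounded_on_compact[OF sq \<theta>_cont] by metis
  obtain C2 where C2: "C2 \<ge> 1" "\<And>u. u \<in> {0..1} \<times> {0..1} \<Longrightarrow> \<bar>case u of (x, y) \<Rightarrow> W x y\<bar> \<le> C2"
    using bounded_on_compact[OF sq W_cont] by metis
  obtain C3 where C3: "C3 \<ge> 1" "\<And>u. u \<in> {0..1} \<times> {0..1} \<Longrightarrow> \<bar>case u of (x, y) \<Rightarrow> lam x y\<bar> \<le> C3"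
    using bounded_on_compact[OF sq lam_cont] by metis
  obtain C4 where C4: "C4 \<ge> 1" "\<And>u. u \<in> {0..1} \<times> {0..1} \<times> {0..1} \<Longrightarrow> \<bar>case u of (x, y, z) \<Rightarrow> \<sigma> x y z\<bar> \<le> C4"
    by (rule bounded_on_compact[OF _ \<sigma>_cont]) (auto intro: compact_Times)
  obtain C5 where C5: "C5 \<ge> 1" "\<And>u. u \<in> tri3 \<Longrightarrow> \<bar>case u of (x, \<xi>, y) \<Rightarrow> k x \<xi> y\<bar> \<le> C5"
    using bounded_on_compact[OF compact_tri3 k_cont] by metis
  obtain C6 where C6: "C6 \<ge> 1" "\<And>u. u \<in> kernel_triangle \<Longrightarrow> \<bar>case u of (x, \<xi>) \<Rightarrow> kbar x \<xi>\<bar> \<le> C6"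
    using bounded_on_compact[OF compact_tri kbar_cont] by metis
  obtain C7 where C7: "C7 \<ge> 1" "\<And>u. u \<in> {0..1} \<Longrightarrow> \<bar>q u\<bar> \<le> C7"
    using bounded_on_compact[OF compact_Icc q_cont] by metis
  obtain C8 where C8: "C8 \<ge> 1" "\<And>u. u \<in> {0..1} \<Longrightarrow> \<bar>\<mu> u\<bar> \<le> C8"
    using bounded_on_compact[OF compact_Icc \<mu>_cont] by metis
  have "continuous_on {0..1} (\<lambda>x. 1 / \<mu> x)" by (intro continuous_intros \<mu>_cont) (use \<mu>_pos in force)
  then obtain C9 where C9: "C9 \<ge> 1" "\<And>u. u \<in> {0..1} \<Longrightarrow> \<bar>1 / \<mu> u\<bar> \<le> C9"
    using bounded_on_compact[OF compact_Icc] by metis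
  define C where "C = C1 + C2 + C3 + C4 + C5 + C6 + C7 + C8 + C9 + 1 / lam_min"
  have lm: "1 / lam_min > 0" using lam_min(1) by simp
  have Cge: "C \<ge> 1" "C1 \<le> C" "C2 \<le> C" "C3 \<le> C" "C4 \<le> C" "C5 \<le> C" "C6 \<le> C" "C7 \<le> C" "C8 \<le> C" "C9 \<le> C" "1 / lam_min \<le> C"
    using C1(1) C2(1) C3(1) C4(1) C5(1) C6(1) C7(1) C8(1) C9(1) lm unfolding C_def by linarith+
  define \<delta> where "\<delta> = 8 * C\<^sup>2 + C + 5"
  define A where "A = 2 * C\<^sup>2"
  define D where "D = A * (16 * C * exp (2 * \<delta>))"
  have D0: "D > 0" using Cge(1) by (simp add: D_def A_def)
  \<comment> \<open>Because \<epsilon> is at most \<open>1\<close>, its square is at most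
    \<open>1 / (2 * D)\<close>, and no square root is required.\<close>
  define \<epsilon> where "\<epsilon> = min 1 (1 / (2 * D))"
  have \<epsilon>0: "\<epsilon> > 0" using D0 by (simp add: \<epsilon>_def)
  have \<epsilon>2: "A * (16 * C * exp (2 * \<delta>) * \<epsilon>\<^sup>2) \<le> 1 / 2"
  proof -
    have "\<epsilon> * \<epsilon> \<le> 1 * (1 / (2 * D))" using \<epsilon>0 by (intro mult_mono) (auto simp: \<epsilon>_def)
    then have "D * (\<epsilon> * \<epsilon>) \<le> D * (1 / (2 * D))" using D0 by (intro mult_left_mono) auto
    also have "D * (1 / (2 * D)) = 1 / 2" using D0 by simp
    finally show ?thesis by (simp add: D_def power2_eq_square mult.assoc)
  qed
  have c1: "continuous_on (tri3 \<times> {0..1}) (\<lambda>(u, \<eta>). \<sigma> (fst (snd u)) \<eta> (snd (snd u)) * k (fst u) (fst (snd u)) \<eta>)"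
    using sigma_k_cont by (simp add: case_prod_unfold)
  obtain N1 where N1: "\<And>n u. n \<ge> N1 \<Longrightarrow> u \<in> tri3 \<Longrightarrow>
      \<bar>integral {0..1} (\<lambda>\<eta>. \<sigma> (fst (snd u)) \<eta> (snd (snd u)) * k (fst u) (fst (snd u)) \<eta>)
        - 1 / real n * (\<Sum>i=1..n. \<sigma> (fst (snd u)) (real i / real n) (snd (snd u)) * k (fst u) (fst (snd u)) (real i / real n))\<bar> \<le> \<epsilon>"
    by (rule riemann_sum_uniform[OF compact_tri3 c1 \<epsilon>0]) (rule that, assumption)
  have c2: "continuous_on (kernel_triangle \<times> {0..1}) (\<lambda>(u, y). W (snd u) y * k (fst u) (snd u) y)"
    using W_k_cont by (simp add: case_prod_unfold)
  obtain N2 where N2: "\<And>n u. n \<ge> N2 \<Longrightarrow> u \<in> kernel_triangle \<Longrightarrow>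
      \<bar>integral {0..1} (\<lambda>y. W (snd u) y * k (fst u) (snd u) y)
        - 1 / real n * (\<Sum>i=1..n. W (snd u) (real i / real n) * k (fst u) (snd u) (real i / real n))\<bar> \<le> \<epsilon>"
    by (rule riemann_sum_uniform[OF compact_tri c2 \<epsilon>0]) (rule that, assumption)
  have c3: "continuous_on ({0..1} \<times> {0..1}) (\<lambda>(x, y). q y * lam 0 y * k x 0 y)"
    unfolding case_prod_unfold
    by (intro continuous_intros continuous_on_compose2[OF q_cont] continuous_on_comp2[OF lam_cont] continuous_on_comp3[OF k_cont])
      (auto simp: tri3_def kernel_triangle_def)
  obtain N3 where N3: "\<And>n x. n \<ge> N3 \<Longrightarrow> x \<in> {0..1} \<Longrightarrow>
      \<bar>integral {0..1} (\<lambda>y. q y * lam 0 y * k x 0 y)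
        - 1 / real n * (\<Sum>i=1..n. q (real i / real n) * lam 0 (real i / real n) * k x 0 (real i / real n))\<bar> \<le> \<epsilon>"
    by (rule riemann_sum_uniform[OF compact_Icc c3 \<epsilon>0]) (rule that, assumption)
  define N where "N = max 1 (max N1 (max N2 N3))"
  show ?thesis
  proof (rule that[of N])
    show "N \<ge> 1" by (simp add: N_def)
    fix n assume n: "n \<ge> N"
    interpret dd: discretized \<mu> q lam W \<theta> \<sigma> lam_min k kbar n
      by unfold_locales (use n in \<open>simp add: N_def\<close>)
    define M where "M = 4 * C * exp \<delta> * (2 * C ^ 3) * (1 + exp \<delta> * (6 * C\<^sup>2))"
    have M0: "M > 0" unfolding M_def using Cge(1) by (intro mult_pos_pos add_pos_nonneg) auto
    have "dd.energy (\<lambda>i. z i t) \<le> M * exp (- (1 / (2 * C ^ 3)) * t) * dd.energy (\<lambda>i. z i 0)"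
      if s: "dd.smooth_sol z zt zx" and t: "t \<ge> 0" for z zt zx t
    proof -
      interpret ly: lyapunov \<mu> q lam W \<theta> \<sigma> lam_min k kbar n z zt zx C \<epsilon> \<delta> A
      proof
        show "dd.smooth_sol z zt zx" by (rule s)
        show "C \<ge> 1" by (rule Cge(1))
        show "\<bar>\<theta> x y\<bar> \<le> C \<and> \<bar>W x y\<bar> \<le> C \<and> lam x y \<le> C \<and> 1 / lam x y \<le> C" if xy: "x \<in> {0..1}" "y \<in> {0..1}" for x y
        proof -
          have "1 / lam x y \<le> 1 / lam_min" 
          proof (rule divide_left_mono)
            show le: "lam_min \<le> lam x y" using lam_min(2) xy by blast
            show "0 < lam x y * lam_min" using le lam_min(1) by (intro mult_pos_pos) linarith+
          qed simp
          then show ?thesis using C1(2)[of "(x, y)"] C2(2)[of "(x, y)"] C3(2)[of "(x, y)"] xy Cge by auto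
        qed
        show "\<bar>\<sigma> x y y'\<bar> \<le> C" if "x \<in> {0..1}" "y \<in> {0..1}" "y' \<in> {0..1}" for x y y'
          using C4(2)[of "(x, y, y')"] that Cge by auto
        show "\<bar>k x \<xi> y\<bar> \<le> C" if "(x, \<xi>) \<in> kernel_triangle" "y \<in> {0..1}" for x \<xi> y
          using C5(2)[of "(x, \<xi>, y)"] that Cge by (auto simp: tri3_def)
        show "\<bar>kbar x \<xi>\<bar> \<le> C" if "(x, \<xi>) \<in> kernel_triangle" for x \<xi>
          using C6(2)[of "(x, \<xi>)"] that Cge by auto
        show "\<bar>q x\<bar> \<le> C \<and> \<mu> x \<le> C \<and> 1 / \<mu> x \<le> C" if "x \<in> {0..1}" for x
          using C7(2)[OF that] C8(2)[OF that] C9(2)[OF that] Cge by linarith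
        show "\<bar>dd.resid_i j x \<xi>\<bar> \<le> \<epsilon>" if "(x, \<xi>) \<in> kernel_triangle" "j \<in> {1..n}" for x \<xi> j
          using N1[of n "(x, \<xi>, dd.yy j)"] that n dd.yy_in[of j] by (simp add: dd.resid_i_def dd.yy_def tri3_def N_def)
        show "\<bar>dd.resid_v x \<xi>\<bar> \<le> \<epsilon>" if "(x, \<xi>) \<in> kernel_triangle" for x \<xi>
          using N2[of n "(x, \<xi>)"] that n by (simp add: dd.resid_v_def dd.yy_def gb_def N_def)
        show "\<bar>dd.resid_0 x\<bar> \<le> \<epsilon>" if "x \<in> {0..1}" for x
          using N3[of n x] that n by (simp add: dd.resid_0_def dd.yy_def N_def)
      qed (use \<epsilon>0 \<epsilon>2 in \<open>simp_all add: \<delta>_def A_def\<close>)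
      have "ly.N2 s = dd.energy (\<lambda>i. z i s)" for s
        by (simp add: ly.N2_def dd.energy_def ly.w2_def[abs_def] ly.u2_def)
      then show ?thesis using ly.N2_decay[OF t] by (simp add: M_def)
    qed
    moreover have "1 / (2 * C ^ 3) > 0" using Cge(1) by simp
    ultimately show "\<exists>M>0. \<exists>c>0. \<forall>z zt zx. dd.smooth_sol z zt zx \<longrightarrow>
       (\<forall>t\<ge>0. dd.energy (\<lambda>i. z i t) \<le> M * exp (- c * t) * dd.energy (\<lambda>i. z i 0))"
      using M0 by blast
  qed
qed

end

section \<open>Energy estimate for classical solutions\<close>

text \<open>Cauchy-Schwarz with the indicator function of \<open>{0..x}\<close>, whose norm is at
  most one.\<close>

lemma integral_prefix_le_l2norm:
  assumes h: "L2I h" and x: "x \<in> {0..1}"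
  shows "\<bar>integral {0..x} h\<bar> \<le> l2norm h"
proof -
  define r where "r y = (if y \<in> {0..x} then 1 else 0 :: real)" for y
  have rm: "r \<in> borel_measurable (lebesgue_on {0..1})"
  proof -
    have "indicat_real {0..x} \<in> borel_measurable (lebesgue_on {0..1})"
      by (intro borel_measurable_indicator) (use x in \<open>auto simp: sets_restrict_space_iff\<close>)
    moreover have "r = indicat_real {0..x}" by (auto simp: r_def fun_eq_iff)
    ultimately show ?thesis by simp
  qed
  have rL: "L2I r"
  proof -
    have "\<bar>r y\<bar> \<le> 1" for y by (simp add: r_def)
    then show ?thesis using L2_on_mult_bounded[OF L2_on_const[of 0 1 1] rm, of 1] by simp
  qed
  have "integral {0..x} h = integral {0..1} (\<lambda>y. if y \<in> {0..x} then h y else 0)"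
  proof -
    have "{0..x} \<inter> {0..1} = {0..x}" using x by auto
    then show ?thesis using integral_restrict_Int[of "{0..1}" "{0..x}" h] by (simp only:)
  qed
  also have "\<dots> = integral {0..1} (\<lambda>y. r y * h y)"
    by (intro Henstock_Kurzweil_Integration.integral_cong) (simp add: r_def)
  finally have "\<bar>integral {0..x} h\<bar> \<le> l2norm r * l2norm h" using cauchy_schwarz_L2[OF rL h] by simp
  also have "\<dots> \<le> 1 * l2norm h"
    by (intro mult_right_mono l2norm_nonneg l2norm_bound rL) (auto simp: r_def)
  finally show ?thesis by simp
qed

lemma H1_continuous:
  assumes "has_H1_derivative f g a b"
  shows "continuous_on {a..b} f"
proof -
  have "continuous_on {a..b} (\<lambda>x. f a + integral {a..x} g)"
    using assms by (intro continuous_intros indefinite_integral_continuous_1 L2_on_integrable_on) (unfold has_H1_derivative_def, rule conjunct1)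
  then show ?thesis by (rule continuous_on_eq) (metis assms has_H1_derivative_def)
qed

lemma H1_L2:
  assumes "has_H1_derivative f g 0 1" shows "L2I f" "L2I g"
proof -
  show "L2I f" by (rule L2_on_continuous[OF H1_continuous[OF assms]])
  show "L2I g" using assms unfolding has_H1_derivative_def by (rule conjunct1)
qed

text \<open>The weak derivative is approximated in L2 by continuous functions. Their primitives
  converge uniformly, and the identity for continuously differentiable functions passes to the
  limit.\<close>

lemma H1_integral_square:
  assumes H: "has_H1_derivative f g 0 1"
  shows "2 * integral {0..1} (\<lambda>x. f x * g x) = (f 1)\<^sup>2 - (f 0)\<^sup>2"
proof -
  have fL: "L2I f" and gL: "L2I g" using H1_L2[OF H] .
  have "\<exists>c. continuous_on UNIV c \<and> l2norm (\<lambda>x. c x - g x) < 1 / real (Suc m)" for m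
    using L2_dense_continuous[OF gL, of "1 / real (Suc m)"] by (metis of_nat_0_less_iff zero_less_Suc zero_less_divide_1_iff)
  then obtain c where c: "\<And>m. continuous_on UNIV (c m)" "\<And>m. l2norm (\<lambda>x. c m x - g x) < 1 / real (Suc m)" by metis
  have cc: "continuous_on {0..1} (c m)" for m by (rule continuous_on_subset[OF c(1)]) auto
  have cL: "L2I (c m)" for m by (rule L2_on_continuous[OF cc])
  define e where "e m = l2norm (\<lambda>x. c m x - g x)" for m
  have e0: "e m \<ge> 0" for m by (simp add: e_def l2norm_nonneg)
  have elim: "e \<longlonglongrightarrow> 0"
    by (rule tendsto_sandwich[OF _ _ tendsto_const LIMSEQ_inverse_real_of_nat])
      (use e0 c(2) in \<open>auto simp: e_def inverse_eq_divide less_imp_le intro!: always_eventually\<close>)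
  define F where "F m x = f 0 + integral {0..x} (c m)" for m x
  have dF: "(F m has_real_derivative c m x) (at x within {0..1})" if "x \<in> {0..1}" for m x
    unfolding F_def using integral_has_real_derivative[OF cc that] by (auto intro!: derivative_eq_intros)
  have Fc: "continuous_on {0..1} (F m)" for m using dF by (rule DERIV_continuous_on)
  have FL: "L2I (F m)" for m by (rule L2_on_continuous[OF Fc])
  have close: "\<bar>F m x - f x\<bar> \<le> e m" if x: "x \<in> {0..1}" for m x
  proof -
    have sub: "h integrable_on {0..x}" if "L2I h" for h
      using L2_on_integrable_on[OF that] by (rule integrable_on_subinterval) (use x in auto)
    have "F m x - f x = integral {0..x} (\<lambda>y. c m y - g y)"
    proof -
      have "f x = f 0 + integral {0..x} g" using H x unfolding has_H1_derivative_def by blast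
      moreover have "integral {0..x} (\<lambda>y. c m y - g y) = integral {0..x} (c m) - integral {0..x} g"
        by (rule Henstock_Kurzweil_Integration.integral_diff) (intro sub cL gL)+
      ultimately show ?thesis unfolding F_def by linarith
    qed
    then show ?thesis using integral_prefix_le_l2norm[OF L2_on_diff[OF cL gL] x] by (simp add: e_def)
  qed
  have l2c: "l2norm (\<lambda>x. F m x - f x) \<le> e m" for m
    by (rule l2norm_bound[OF close L2_on_diff[OF FL fL] e0])
  have id: "2 * integral {0..1} (\<lambda>x. F m x * c m x) = (F m 1)\<^sup>2 - (F m 0)\<^sup>2" for m
  proof -
    have "((\<lambda>x. 2 * (F m x * c m x)) has_integral (F m 1)\<^sup>2 - (F m 0)\<^sup>2) {0..1}"
      by (rule fundamental_theorem_of_calculus)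
        (auto simp: has_real_derivative_iff_has_vector_derivative[symmetric] mult.assoc intro!: derivative_eq_intros dF)
    then show ?thesis by (simp add: has_integral_iff)
  qed
  have lim1: "(\<lambda>m. integral {0..1} (\<lambda>x. F m x * c m x)) \<longlonglongrightarrow> integral {0..1} (\<lambda>x. f x * g x)"
  proof (rule LIM_zero_cancel, rule Lim_null_comparison)
    show "\<forall>\<^sub>F m in sequentially. norm (integral {0..1} (\<lambda>x. F m x * c m x) - integral {0..1} (\<lambda>x. f x * g x))
        \<le> (l2norm f + e m) * e m + e m * l2norm g"
    proof (intro always_eventually allI)
      fix m
      have "integral {0..1} (\<lambda>x. F m x * c m x) - integral {0..1} (\<lambda>x. f x * g x)
         = integral {0..1} (\<lambda>x. F m x * c m x - f x * g x)"
        by (rule Henstock_Kurzweil_Integration.integral_diff[symmetric]) (intro L2_on_prod_integrable_on FL cL fL gL)+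
      also have "\<dots> = integral {0..1} (\<lambda>x. F m x * (c m x - g x) + (F m x - f x) * g x)"
        by (intro Henstock_Kurzweil_Integration.integral_cong) (simp add: algebra_simps)
      also have "\<dots> = integral {0..1} (\<lambda>x. F m x * (c m x - g x)) + integral {0..1} (\<lambda>x. (F m x - f x) * g x)"
        by (rule Henstock_Kurzweil_Integration.integral_add) (intro L2_on_prod_integrable_on L2_on_diff FL cL fL gL)+
      finally have eq: "integral {0..1} (\<lambda>x. F m x * c m x) - integral {0..1} (\<lambda>x. f x * g x) = \<dots>" .
      have "\<bar>integral {0..1} (\<lambda>x. F m x * (c m x - g x))\<bar> \<le> l2norm (F m) * e m"
        unfolding e_def by (intro cauchy_schwarz_L2 FL L2_on_diff cL gL)
      also have "\<dots> \<le> (l2norm f + e m) * e m"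
        using l2norm_triangle[OF fL L2_on_diff[OF FL fL], of m] l2c[of m] e0[of m] by (intro mult_right_mono) auto
      finally have 1: "\<bar>integral {0..1} (\<lambda>x. F m x * (c m x - g x))\<bar> \<le> (l2norm f + e m) * e m" .
      have "\<bar>integral {0..1} (\<lambda>x. (F m x - f x) * g x)\<bar> \<le> l2norm (\<lambda>x. F m x - f x) * l2norm g"
        by (intro cauchy_schwarz_L2 FL L2_on_diff fL gL)
      also have "\<dots> \<le> e m * l2norm g" by (intro mult_right_mono l2c l2norm_nonneg)
      finally show "norm (integral {0..1} (\<lambda>x. F m x * c m x) - integral {0..1} (\<lambda>x. f x * g x))
        \<le> (l2norm f + e m) * e m + e m * l2norm g"
        unfolding eq real_norm_def using 1 by linarith
    qed
    have "(\<lambda>m. (l2norm f + e m) * e m + e m * l2norm g) \<longlonglongrightarrow> (l2norm f + 0) * 0 + 0 * l2norm g"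
      by (intro tendsto_intros elim)
    then show "(\<lambda>m. (l2norm f + e m) * e m + e m * l2norm g) \<longlonglongrightarrow> 0" by simp
  qed
  have Fl: "(\<lambda>m. F m x) \<longlonglongrightarrow> f x" if "x \<in> {0..1}" for x
  proof (rule LIM_zero_cancel, rule Lim_null_comparison[OF _ elim])
    show "\<forall>\<^sub>F m in sequentially. norm (F m x - f x) \<le> e m" using close[OF that] by (auto intro!: always_eventually)
  qed
  have "(\<lambda>m. 2 * integral {0..1} (\<lambda>x. F m x * c m x)) \<longlonglongrightarrow> 2 * integral {0..1} (\<lambda>x. f x * g x)"
    by (intro tendsto_intros lim1)
  moreover have "(\<lambda>m. 2 * integral {0..1} (\<lambda>x. F m x * c m x)) \<longlonglongrightarrow> (f 1)\<^sup>2 - (f 0)\<^sup>2"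
    unfolding id by (intro tendsto_intros Fl) auto
  ultimately show ?thesis by (rule LIMSEQ_unique)
qed

lemma l2norm_mult_le:
  assumes "continuous_on {0..1} w" "\<And>x. x \<in> {0..1} \<Longrightarrow> \<bar>w x\<bar> \<le> B" "B \<ge> 0" "L2I h"
  shows "l2norm (\<lambda>x. w x * h x) \<le> B * l2norm h"
proof (rule power2_le_imp_le)
  have "integral {0..1} (\<lambda>x. (w x * h x)\<^sup>2) \<le> integral {0..1} (\<lambda>x. B\<^sup>2 * (h x)\<^sup>2)"
  proof (rule integral_le)
    show "(w x * h x)\<^sup>2 \<le> B\<^sup>2 * (h x)\<^sup>2" if "x \<in> {0..1}" for x
      using power_mono[OF assms(2)[OF that] abs_ge_zero, of 2] by (simp add: power_mult_distrib mult_right_mono)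
  qed (intro sq_integrable_on integrable_on_mult_right L2_on_mult_continuous assms)+
  then show "(l2norm (\<lambda>x. w x * h x))\<^sup>2 \<le> (B * l2norm h)\<^sup>2" by (simp add: l2norm_sq power_mult_distrib)
qed (simp add: assms(3) l2norm_nonneg)

text \<open>The state is differentiable in time only as a curve in L2, so a pointwise product rule
  is not at hand; the difference quotient of the square is expanded and estimated by
  Cauchy-Schwarz.\<close>

lemma weighted_square_deriv:
  fixes f :: "real \<Rightarrow> real \<Rightarrow> real"
  assumes fL: "\<And>s. s \<ge> 0 \<Longrightarrow> L2I (f s)" and gL: "L2I g" and t: "t \<ge> 0" and w: "continuous_on {0..1} w"
    and lim: "((\<lambda>s. l2norm (\<lambda>x. (f s x - f t x) / (s - t) - g x)) \<longlongrightarrow> 0) (at t within {0..})"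
  shows "((\<lambda>s. integral {0..1} (\<lambda>x. w x * (f s x)\<^sup>2)) has_real_derivative
     2 * integral {0..1} (\<lambda>x. w x * (f t x * g x))) (at t within {0..})"
proof -
  obtain B where B: "B \<ge> 0" "\<And>x. x \<in> {0..1} \<Longrightarrow> \<bar>w x\<bar> \<le> B" using continuous_on_bounded_Icc[OF w] by blast
  have wb: "\<bar>integral {0..1} (\<lambda>x. w x * (h x * k x))\<bar> \<le> B * (l2norm h * l2norm k)" if "L2I h" "L2I k" for h k
  proof -
    have "\<bar>integral {0..1} (\<lambda>x. (w x * h x) * k x)\<bar> \<le> l2norm (\<lambda>x. w x * h x) * l2norm k"
      by (intro cauchy_schwarz_L2 L2_on_mult_continuous that w)
    also have "l2norm (\<lambda>x. w x * h x) \<le> B * l2norm h" by (rule l2norm_mult_le[OF w B(2,1) that(1)])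
    finally show ?thesis using l2norm_nonneg[of k] by (simp add: mult.assoc mult_right_mono)
  qed
  define e where "e s = l2norm (\<lambda>x. (f s x - f t x) / (s - t) - g x)" for s
  have e0: "e s \<ge> 0" for s by (simp add: e_def l2norm_nonneg)
  define b where "b s = \<bar>s - t\<bar> * (e s + l2norm g)" for s
  have wi: "(\<lambda>x. w x * (h x * k x)) integrable_on {0..1}" if "L2I h" "L2I k" for h k
    using L2_on_prod_integrable_on[OF L2_on_mult_continuous[OF that(1) w] that(2)] by (simp add: mult.assoc)
  have key: "\<bar>(integral {0..1} (\<lambda>x. w x * (f s x)\<^sup>2) - integral {0..1} (\<lambda>x. w x * (f t x)\<^sup>2)) / (s - t) - 2 * integral {0..1} (\<lambda>x. w x * (f t x * g x))\<bar>
      \<le> B * (e s * (2 * l2norm (f t) + b s)) + B * (l2norm g * b s)" if s: "s \<ge> 0" "s \<noteq> t" for s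
  proof -
    define D where "D x = (f s x - f t x) / (s - t)" for x
    have DL: "L2I D" unfolding D_def using L2_on_cmult[OF L2_on_diff[OF fL[OF s(1)] fL[OF t]], of "1 / (s - t)"] by simp
    have dl: "l2norm (\<lambda>x. f s x - f t x) \<le> b s"
    proof -
      have "l2norm (\<lambda>x. f s x - f t x) = l2norm (\<lambda>x. (s - t) * D x)" using s by (intro l2norm_cong) (simp add: D_def)
      also have "\<dots> = \<bar>s - t\<bar> * l2norm D" by (rule l2norm_cmult)
      also have "l2norm D \<le> e s + l2norm g"
        using l2norm_triangle[OF L2_on_diff[OF DL gL] gL] by (simp add: e_def D_def[abs_def])
      finally show ?thesis by (simp add: b_def mult_left_mono)
    qed
    have "(integral {0..1} (\<lambda>x. w x * (f s x)\<^sup>2) - integral {0..1} (\<lambda>x. w x * (f t x)\<^sup>2)) / (s - t) - 2 * integral {0..1} (\<lambda>x. w x * (f t x * g x))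
      = integral {0..1} (\<lambda>x. (w x * (f s x * f s x) - w x * (f t x * f t x)) / (s - t) - 2 * (w x * (f t x * g x)))"
      by (simp add: Henstock_Kurzweil_Integration.integral_diff wi fL s t gL integrable_diff integrable_on_mult_right power2_eq_square)
    \<comment> \<open>With \<open>D\<close> the difference quotient,
      \<open>D * (f s + f t) - 2 * f t * g\<close> equals
      \<open>(D - g) * (f s + f t) + g * (f s - f t)\<close>; the first term is small by
      differentiability, the second by continuity.\<close>
    also have "\<dots> = integral {0..1} (\<lambda>x. w x * ((D x - g x) * (f s x + f t x)) + w x * (g x * (f s x - f t x)))"
    proof (rule Henstock_Kurzweil_Integration.integral_cong)
      fix x
      have "(w x * (f s x * f s x) - w x * (f t x * f t x)) / (s - t) = w x * (D x * (f s x + f t x))"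
        by (simp add: D_def algebra_simps diff_divide_distrib add_divide_distrib)
      then show "(w x * (f s x * f s x) - w x * (f t x * f t x)) / (s - t) - 2 * (w x * (f t x * g x))
        = w x * ((D x - g x) * (f s x + f t x)) + w x * (g x * (f s x - f t x))" by (simp add: algebra_simps)
    qed
    also have "\<dots> = integral {0..1} (\<lambda>x. w x * ((D x - g x) * (f s x + f t x))) + integral {0..1} (\<lambda>x. w x * (g x * (f s x - f t x)))"
      by (rule Henstock_Kurzweil_Integration.integral_add) (intro wi L2_on_diff L2_on_add DL gL fL s t)+
    finally have eq: "(integral {0..1} (\<lambda>x. w x * (f s x)\<^sup>2) - integral {0..1} (\<lambda>x. w x * (f t x)\<^sup>2)) / (s - t) - 2 * integral {0..1} (\<lambda>x. w x * (f t x * g x)) = \<dots>" .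
    have "\<bar>integral {0..1} (\<lambda>x. w x * ((D x - g x) * (f s x + f t x)))\<bar> \<le> B * (l2norm (\<lambda>x. D x - g x) * l2norm (\<lambda>x. f s x + f t x))"
      by (intro wb L2_on_diff L2_on_add DL gL fL s t)
    also have "\<dots> \<le> B * (e s * (2 * l2norm (f t) + b s))"
    proof -
      have "l2norm (\<lambda>x. (f s x - f t x) + 2 * f t x) \<le> l2norm (\<lambda>x. f s x - f t x) + l2norm (\<lambda>x. 2 * f t x)"
        by (intro l2norm_triangle L2_on_diff L2_on_cmult fL s t)
      then have "l2norm (\<lambda>x. f s x + f t x) \<le> 2 * l2norm (f t) + b s"
        using dl unfolding l2norm_cmult by (simp add: algebra_simps)
      then show ?thesis using B(1) e0 by (intro mult_left_mono mult_mono) (auto simp: e_def D_def l2norm_nonneg)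
    qed
    finally have 1: "\<bar>integral {0..1} (\<lambda>x. w x * ((D x - g x) * (f s x + f t x)))\<bar> \<le> B * (e s * (2 * l2norm (f t) + b s))" .
    have "\<bar>integral {0..1} (\<lambda>x. w x * (g x * (f s x - f t x)))\<bar> \<le> B * (l2norm g * l2norm (\<lambda>x. f s x - f t x))"
      by (intro wb L2_on_diff gL fL s t)
    also have "\<dots> \<le> B * (l2norm g * b s)" using dl B(1) by (intro mult_left_mono l2norm_nonneg)
    finally show ?thesis unfolding eq using 1 by linarith
  qed
  show ?thesis unfolding has_field_derivative_iff
  proof (rule LIM_zero_cancel, rule Lim_null_comparison)
    show "\<forall>\<^sub>F s in at t within {0..}. norm ((integral {0..1} (\<lambda>x. w x * (f s x)\<^sup>2) - integral {0..1} (\<lambda>x. w x * (f t x)\<^sup>2)) / (s - t) - 2 * integral {0..1} (\<lambda>x. w x * (f t x * g x)))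
      \<le> B * (e s * (2 * l2norm (f t) + b s)) + B * (l2norm g * b s)"
      unfolding eventually_at using key by (auto intro!: exI[of _ 1])
    have el: "(e \<longlongrightarrow> 0) (at t within {0..})" using lim by (simp add: e_def[abs_def])
    have "((\<lambda>s. \<bar>s - t\<bar> * (e s + l2norm g)) \<longlongrightarrow> \<bar>t - t\<bar> * (0 + l2norm g)) (at t within {0..})"
      by (intro tendsto_intros el)
    then have bl: "(b \<longlongrightarrow> 0) (at t within {0..})" by (simp add: b_def[abs_def])
    have "((\<lambda>s. B * (e s * (2 * l2norm (f t) + b s)) + B * (l2norm g * b s)) \<longlongrightarrow> B * (0 * (2 * l2norm (f t) + 0)) + B * (l2norm g * 0)) (at t within {0..})"
      by (intro tendsto_intros el bl)
    then show "((\<lambda>s. B * (e s * (2 * l2norm (f t) + b s)) + B * (l2norm g * b s)) \<longlongrightarrow> 0) (at t within {0..})" by simp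
  qed
qed

text \<open>Riesz-Fischer for representatives: a subsequence with summable differences converges
  almost everywhere, and Fatou's lemma transfers the Cauchy bound to its limit.\<close>

lemma L2_complete:
  assumes f: "\<And>m. L2I (f m)"
    and C: "\<And>\<epsilon>. \<epsilon> > 0 \<Longrightarrow> \<exists>N. \<forall>m\<ge>N. \<forall>k\<ge>N. l2norm (\<lambda>x. f m x - f k x) < \<epsilon>"
  obtains g where "L2I g" "(\<lambda>m. l2norm (\<lambda>x. f m x - g x)) \<longlonglongrightarrow> 0"
proof -
  let ?M = "lebesgue_on {0..1::real}"
  have "\<exists>N. \<forall>m\<ge>N. \<forall>l\<ge>N. l2norm (\<lambda>x. f m x - f l x) < (1/2)^k" for k :: nat by (rule C) simp
  then obtain N where N: "\<And>k m l. m \<ge> N k \<Longrightarrow> l \<ge> N k \<Longrightarrow> l2norm (\<lambda>x. f m x - f l x) < (1/2)^k" by metis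
  \<comment> \<open>Summing the thresholds puts both \<open>r k\<close> and \<open>r (Suc k)\<close>
    beyond \<open>N k\<close>; the added \<open>k\<close> gives \<open>r k \<ge> k\<close>, so the
    subsequence passes every index.\<close>
  define r where "r k = (\<Sum>i\<le>k. N i) + k" for k
  have rN: "r k \<ge> N k" for k unfolding r_def using member_le_sum[of k "{..k}" N] by simp
  have rN': "r (Suc k) \<ge> N k" for k unfolding r_def using member_le_sum[of k "{..Suc k}" N] by (simp add: trans_le_add1)
  have rk: "r k \<ge> k" for k by (simp add: r_def)
  have fm: "f m \<in> borel_measurable ?M" for m using f by (simp add: L2_on_def)
  define d where "d k x = \<bar>f (r (Suc k)) x - f (r k) x\<bar>" for k x
  have dm: "d k \<in> borel_measurable ?M" for k unfolding d_def[abs_def] using fm by auto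
  have dL: "L2I (d k)" for k
    using L2_on_diff[OF f f, of "r (Suc k)" "r k"] dm[of k] unfolding L2_on_def d_def by simp
  have dn: "l2norm (d k) \<le> (1/2)^k" for k
    using N[OF rN' rN, of k] by (simp add: d_def[abs_def] l2norm_def)
  have di: "(\<integral>\<^sup>+x. ennreal (d k x) \<partial>?M) \<le> ennreal ((1/2)^k)" for k
  proof -
    have int: "integrable ?M (d k)" using L2_on_prod_integrable[OF dL[of k] L2_on_const[of 0 1 1]] by simp
    have "(\<integral>\<^sup>+x. ennreal (d k x) \<partial>?M) = ennreal (\<integral>x. d k x \<partial>?M)"
      by (rule nn_integral_eq_integral[OF int]) (simp add: d_def)
    also have "(\<integral>x. d k x \<partial>?M) = integral {0..1} (d k)" by (rule lebesgue_integral_eq_integral[OF int]) simp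
    also have "integral {0..1} (d k) \<le> l2norm (d k)" using integral_prefix_le_l2norm[OF dL, of 1 k] by simp
    also note dn
    finally show ?thesis by (simp add: ennreal_leI)
  qed
  have "(\<integral>\<^sup>+x. (\<Sum>k. ennreal (d k x)) \<partial>?M) = (\<Sum>k. \<integral>\<^sup>+x. ennreal (d k x) \<partial>?M)"
    by (rule nn_integral_suminf) (use dm in auto)
  also have "\<dots> \<le> (\<Sum>k. ennreal ((1/2)^k))" by (rule suminf_le) (use di in auto)
  also have "\<dots> < \<infinity>" by (subst suminf_ennreal2) (auto simp: summable_geometric)
  finally have "AE x in ?M. (\<Sum>k. ennreal (d k x)) \<noteq> \<infinity>"
    by (intro nn_integral_PInf_AE) (use dm in auto)
  then have conv: "AE x in ?M. (\<lambda>k. f (r k) x) \<longlonglongrightarrow> lim (\<lambda>k. f (r k) x)"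
  proof eventually_elim
    case (elim x)
    have "summable (\<lambda>k. d k x)" by (rule summable_suminf_not_top) (use elim in \<open>auto simp: d_def\<close>)
    then have "summable (\<lambda>k. f (r (Suc k)) x - f (r k) x)" unfolding d_def by (rule summable_rabs_cancel)
    then have "convergent (\<lambda>K. \<Sum>k<K. f (r (Suc k)) x - f (r k) x)" by (simp add: summable_iff_convergent)
    then have "convergent (\<lambda>K. f (r K) x - f (r 0) x)" by (simp add: sum_lessThan_telescope[of "\<lambda>k. f (r k) x"])
    then have "convergent (\<lambda>K. f (r 0) x + (f (r K) x - f (r 0) x))" by (intro convergent_add convergent_const)
    then have "convergent (\<lambda>K. f (r K) x)" by simp
    then show ?case by (simp add: convergent_LIMSEQ_iff)
  qed
  define g where "g x = lim (\<lambda>k. f (r k) x)" for x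
  have gm: "g \<in> borel_measurable ?M" unfolding g_def[abs_def] by (rule borel_measurable_lim_metric) (rule fm)
  have est: "L2I (\<lambda>x. f m x - g x) \<and> l2norm (\<lambda>x. f m x - g x) \<le> \<epsilon>"
    if \<epsilon>: "\<epsilon> > 0" and Nm: "\<And>m k. m \<ge> N0 \<Longrightarrow> k \<ge> N0 \<Longrightarrow> l2norm (\<lambda>x. f m x - f k x) < \<epsilon>" and m: "m \<ge> N0" for \<epsilon> N0 m
  proof -
    have b: "(\<integral>\<^sup>+x. ennreal ((f m x - f (r k) x)\<^sup>2) \<partial>?M) \<le> ennreal (\<epsilon>\<^sup>2)" if "k \<ge> N0" for k
    proof -
      have L: "L2I (\<lambda>x. f m x - f (r k) x)" by (intro L2_on_diff f)
      have "(\<integral>\<^sup>+x. ennreal ((f m x - f (r k) x)\<^sup>2) \<partial>?M) = ennreal ((l2norm (\<lambda>x. f m x - f (r k) x))\<^sup>2)"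
        unfolding l2norm_eq_lebesgue[OF L] by (rule nn_integral_eq_integral) (use L in \<open>auto simp: L2_on_def\<close>)
      also have "\<dots> \<le> ennreal (\<epsilon>\<^sup>2)"
        using Nm[OF m, of "r k"] rk[of k] that by (intro ennreal_leI power_mono l2norm_nonneg) auto
      finally show ?thesis .
    qed
    have "(\<integral>\<^sup>+x. ennreal ((f m x - g x)\<^sup>2) \<partial>?M) = (\<integral>\<^sup>+x. liminf (\<lambda>k. ennreal ((f m x - f (r k) x)\<^sup>2)) \<partial>?M)"
    proof (rule nn_integral_cong_AE)
      show "AE x in ?M. ennreal ((f m x - g x)\<^sup>2) = liminf (\<lambda>k. ennreal ((f m x - f (r k) x)\<^sup>2))"
        using conv
      proof eventually_elim
        case (elim x)
        then have "(\<lambda>k. ennreal ((f m x - f (r k) x)\<^sup>2)) \<longlonglongrightarrow> ennreal ((f m x - g x)\<^sup>2)"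
          unfolding g_def by (intro tendsto_intros tendsto_ennrealI)
        then show ?case by (intro lim_imp_Liminf[symmetric]) auto
      qed
    qed
    also have "\<dots> \<le> liminf (\<lambda>k. \<integral>\<^sup>+x. ennreal ((f m x - f (r k) x)\<^sup>2) \<partial>?M)"
      by (rule nn_integral_liminf) (use fm in auto)
    also have "\<dots> \<le> limsup (\<lambda>k. \<integral>\<^sup>+x. ennreal ((f m x - f (r k) x)\<^sup>2) \<partial>?M)"
      by (rule Liminf_le_Limsup) simp
    also have "\<dots> \<le> ennreal (\<epsilon>\<^sup>2)"
      by (rule Limsup_bounded) (use b in \<open>auto simp: eventually_sequentially\<close>)
    finally have le: "(\<integral>\<^sup>+x. ennreal ((f m x - g x)\<^sup>2) \<partial>?M) \<le> ennreal (\<epsilon>\<^sup>2)" .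
    have i: "integrable ?M (\<lambda>x. (f m x - g x)\<^sup>2)"
      by (rule integrableI_bounded) (use le fm gm in \<open>auto simp: ennreal_mult_less_top top_unique less_top[symmetric]\<close>)
    have L: "L2I (\<lambda>x. f m x - g x)" using i fm gm by (auto simp: L2_on_def)
    have "ennreal ((l2norm (\<lambda>x. f m x - g x))\<^sup>2) \<le> ennreal (\<epsilon>\<^sup>2)"
      using le unfolding l2norm_eq_lebesgue[OF L] by (subst (asm) nn_integral_eq_integral[OF i]) auto
    then have "(l2norm (\<lambda>x. f m x - g x))\<^sup>2 \<le> \<epsilon>\<^sup>2" by simp
    then show ?thesis using L \<epsilon> by (auto intro: power2_le_imp_le)
  qed
  obtain N1 where N1: "\<forall>m\<ge>N1. \<forall>k\<ge>N1. l2norm (\<lambda>x. f m x - f k x) < 1" using C[of 1] by auto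
  have "L2I (\<lambda>x. f N1 x - g x)" using est[of 1 N1 N1] N1 by auto
  from L2_on_diff[OF f[of N1] this] have "L2I g" by simp
  moreover have "(\<lambda>m. l2norm (\<lambda>x. f m x - g x)) \<longlonglongrightarrow> 0"
  proof (rule LIMSEQ_I)
    fix e :: real assume e: "e > 0"
    then obtain N0 where "\<forall>m\<ge>N0. \<forall>k\<ge>N0. l2norm (\<lambda>x. f m x - f k x) < e / 2" using C[of "e / 2"] by auto
    then have "l2norm (\<lambda>x. f m x - g x) \<le> e / 2" if "m \<ge> N0" for m using est[of "e / 2" N0 m] that e by auto
    then have "\<forall>m\<ge>N0. norm (l2norm (\<lambda>x. f m x - g x) - 0) < e" using e by (force simp: l2norm_nonneg)
    then show "\<exists>N0. \<forall>m\<ge>N0. norm (l2norm (\<lambda>x. f m x - g x) - 0) < e" by blast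
  qed
  ultimately show ?thesis using that by blast
qed

text \<open>Integrating factor \<open>exp (- K * t)\<close>. The source stays under the integral, so
  an input will enter only through its L2 norm in time, the sense in which the inputs of weak
  solutions converge.\<close>

lemma gronwall_source:
  fixes F F' r :: "real \<Rightarrow> real"
  assumes F: "\<And>t. t \<ge> 0 \<Longrightarrow> (F has_real_derivative F' t) (at t within {0..})"
    and le: "\<And>t. t \<ge> 0 \<Longrightarrow> F' t \<le> K * F t + r t" and r: "continuous_on {0..} r" and t: "t \<ge> 0"
  shows "exp (- K * t) * F t \<le> F 0 + integral {0..t} (\<lambda>s. exp (- K * s) * r s)"
proof -
  have rc: "continuous_on {0..t} (\<lambda>s. exp (- K * s) * r s)"
    by (intro continuous_intros continuous_on_subset[OF r]) auto
  define G where "G s = exp (- K * s) * F s - integral {0..s} (\<lambda>s. exp (- K * s) * r s)" for s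
  have d: "(G has_real_derivative exp (- K * s) * (F' s - K * F s - r s)) (at s within {0..t})" if "s \<in> {0..t}" for s
  proof -
    have "(F has_real_derivative F' s) (at s within {0..t})"
      by (rule DERIV_subset[OF F]) (use that in auto)
    moreover have "((\<lambda>s. integral {0..s} (\<lambda>s. exp (- K * s) * r s)) has_real_derivative exp (- K * s) * r s) (at s within {0..t})"
      by (rule integral_has_real_derivative[OF rc that])
    ultimately show ?thesis unfolding G_def by (auto intro!: derivative_eq_intros simp: algebra_simps)
  qed
  have "G t \<le> G 0"
  proof (rule DERIV_nonpos_imp_decreasing_open[OF t])
    show "continuous_on {0..t} G" using d by (rule DERIV_continuous_on)
    fix s assume s: "0 < s" "s < t"
    have "DERIV G s :> exp (- K * s) * (F' s - K * F s - r s)" using d[of s] s by (simp add: at_within_Icc_at)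
    moreover have "exp (- K * s) * (F' s - K * F s - r s) \<le> 0"
      using le[of s] s by (intro mult_nonneg_nonpos) auto
    ultimately show "\<exists>y. DERIV G s :> y \<and> y \<le> 0" by blast
  qed
  then show ?thesis by (simp add: G_def)
qed

section \<open>Solutions with a prescribed input\<close>

context transport
begin

text \<open>Classical solutions in the indexing of \<open>transport\<close>, with a free input in
  place of the feedback. Time derivatives are limits in L2 and space derivatives are weak, which is
  what the approximants of a weak solution provide.\<close>

definition l2_sol :: "(real \<Rightarrow> real) \<Rightarrow> (nat \<Rightarrow> real \<Rightarrow> real \<Rightarrow> real) \<Rightarrow> (nat \<Rightarrow> real \<Rightarrow> real \<Rightarrow> real) \<Rightarrow>
    (nat \<Rightarrow> real \<Rightarrow> real \<Rightarrow> real) \<Rightarrow> bool" where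
  "l2_sol U z zt zx \<longleftrightarrow> (\<forall>t\<ge>0. z 0 t 1 = U t \<and> (\<forall>i\<le>n.
     L2I (zt i t) \<and> has_H1_derivative (z i t) (zx i t) 0 1 \<and>
     ((\<lambda>s. l2norm (\<lambda>x. (z i s x - z i t x) / (s - t) - zt i t x)) \<longlongrightarrow> 0) (at t within {0..}) \<and>
     (AE x in lebesgue_on {0..1}. zt i t x + a i x * zx i t x = src z i t x) \<and>
     (i \<noteq> 0 \<longrightarrow> z i t 0 = q i * z 0 t 0)))"

lemma recip_bounds: "\<exists>lo>0. \<exists>hi. \<forall>i\<le>n. \<forall>x\<in>{0..1}. lo \<le> 1 / \<bar>a i x\<bar> \<and> 1 / \<bar>a i x\<bar> \<le> hi"
proof -
  have "\<exists>l>0. \<exists>h. \<forall>x\<in>{0..1}. l \<le> 1 / \<bar>a i x\<bar> \<and> 1 / \<bar>a i x\<bar> \<le> h" if i: "i \<le> n" for i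
  proof -
    obtain B where B: "B \<ge> 0" "\<And>x. x \<in> {0..1} \<Longrightarrow> \<bar>a i x\<bar> \<le> B" using continuous_on_bounded_Icc[OF a_cont[OF i]] by blast
    have "continuous_on {0..1} (\<lambda>x. 1 / \<bar>a i x\<bar>)" using a_nonzero[OF i] by (intro continuous_intros a_cont i) auto
    then obtain h where h: "\<And>x. x \<in> {0..1} \<Longrightarrow> \<bar>1 / \<bar>a i x\<bar>\<bar> \<le> h" using continuous_on_bounded_Icc by metis
    have "1 / (B + 1) \<le> 1 / \<bar>a i x\<bar>" if x: "x \<in> {0..1}" for x
      using B(2)[OF x] B(1) a_nonzero[OF i x] by (intro divide_left_mono) auto
    then show ?thesis using h B(1) by (intro exI[of _ "1 / (B + 1)"] conjI exI[of _ h]) auto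
  qed
  then obtain l h where lh: "\<And>i. i \<le> n \<Longrightarrow> l i > 0" "\<And>i x. i \<le> n \<Longrightarrow> x \<in> {0..1} \<Longrightarrow> l i \<le> 1 / \<bar>a i x\<bar> \<and> 1 / \<bar>a i x\<bar> \<le> h i" by metis
  have "Min (l ` {..n}) > 0" using lh(1) by simp
  moreover have "Min (l ` {..n}) \<le> l i" "h i \<le> Max (h ` {..n})" if "i \<le> n" for i using that by auto
  ultimately have "Min (l ` {..n}) > 0 \<and> (\<forall>i\<le>n. \<forall>x\<in>{0..1}. Min (l ` {..n}) \<le> 1 / \<bar>a i x\<bar> \<and> 1 / \<bar>a i x\<bar> \<le> Max (h ` {..n}))"
    using lh(2) by (meson order_trans)
  then show ?thesis by blast
qed

text \<open>The weights \<open>1 / \<bar>a i\<bar>\<close> keep derivatives of the speeds out of the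
  estimate, and a small factor \<kappa> on the components of \<open>u\<close> lets the outflow of
  \<open>v\<close> at \<open>0\<close> pay for the reflected inflow. Of the boundary terms only the
  input squared remains. The constants are uniform over inputs and solutions, so the estimate
  applies to differences of approximants.\<close>

theorem l2_energy:
  "\<exists>c1>0. \<exists>c2\<ge>0. \<exists>K. \<forall>U z zt zx t. l2_sol U z zt zx \<longrightarrow> continuous_on {0..} U \<longrightarrow> t \<ge> 0 \<longrightarrow>
     exp (- K * t) * (c1 * (\<Sum>i\<le>n. (l2norm (z i t))\<^sup>2)) \<le> c2 * (\<Sum>i\<le>n. (l2norm (z i 0))\<^sup>2) + integral {0..t} (\<lambda>s. exp (- K * s) * (U s)\<^sup>2)"
proof -
  obtain lo hi where lo: "lo > 0" and lohi: "\<And>i x. i \<le> n \<Longrightarrow> x \<in> {0..1} \<Longrightarrow> lo \<le> 1 / \<bar>a i x\<bar>"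
     "\<And>i x. i \<le> n \<Longrightarrow> x \<in> {0..1} \<Longrightarrow> 1 / \<bar>a i x\<bar> \<le> hi" using recip_bounds by blast
  have hi0: "hi \<ge> 0" using lohi(1)[of 0 0] lohi(2)[of 0 0] lo by auto
  obtain Cm where Cm: "Cm > 0" "\<And>i x. i \<le> n \<Longrightarrow> x \<in> {0..1} \<Longrightarrow> (\<Sum>j\<le>n. \<bar>cf i j x\<bar>) \<le> Cm" using cf_bound by blast
  define B where "B = hi * Cm"
  have B0: "B \<ge> 0" using hi0 Cm(1) by (simp add: B_def)
  define \<kappa> where "\<kappa> = 1 / (1 + (\<Sum>i=1..n. (q i)\<^sup>2))"
  have q0: "(\<Sum>i=1..n. (q i)\<^sup>2) \<ge> 0" by (simp add: sum_nonneg)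
  have \<kappa>: "\<kappa> > 0" "\<kappa> \<le> 1" "\<kappa> * (\<Sum>i=1..n. (q i)\<^sup>2) \<le> 1" using q0 by (auto simp: \<kappa>_def field_simps add_pos_nonneg)
  define \<omega> where "\<omega> i = (if i = 0 then 1 else \<kappa>)" for i :: nat
  have \<omega>: "\<omega> i \<ge> \<kappa>" "\<omega> i \<le> 1" "\<omega> i \<ge> 0" for i using \<kappa> by (auto simp: \<omega>_def)
  define w where "w i x = 1 / \<bar>a i x\<bar>" for i x
  have wc: "continuous_on {0..1} (w i)" if "i \<le> n" for i
    unfolding w_def using a_nonzero[OF that] by (intro continuous_intros a_cont that) auto
  define c1 where "c1 = \<kappa> * lo"
  have c10: "c1 > 0" using \<kappa> lo by (simp add: c1_def)
  \<comment> \<open>The coupling costs \<open>real (n + 2) * B\<close> for each of the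
    \<open>n + 1\<close> components, and \<open>c1\<close> converts the sum of squared norms into
    the functional.\<close>
  define K where "K = real (n + 1) * (real (n + 2) * B) / c1"
  have main: "exp (- K * t) * (c1 * (\<Sum>i\<le>n. (l2norm (z i t))\<^sup>2)) \<le> hi * (\<Sum>i\<le>n. (l2norm (z i 0))\<^sup>2) + integral {0..t} (\<lambda>s. exp (- K * s) * (U s)\<^sup>2)"
    if sol: "l2_sol U z zt zx" and Uc: "continuous_on {0..} U" and t: "t \<ge> 0" for U z zt zx t
  proof -
    have zL: "L2I (z i s)" and zxL: "L2I (zx i s)" and ztL: "L2I (zt i s)" if "i \<le> n" "s \<ge> 0" for i s
      using sol that H1_L2[of "z i s" "zx i s"] unfolding l2_sol_def by blast+
    define S where "S s = (\<Sum>i\<le>n. (l2norm (z i s))\<^sup>2)" for s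
    have S0: "S s \<ge> 0" for s by (simp add: S_def sum_nonneg)
    define F where "F s = (\<Sum>i\<le>n. \<omega> i * integral {0..1} (\<lambda>x. w i x * (z i s x)\<^sup>2))" for s
    define F' where "F' s = (\<Sum>i\<le>n. \<omega> i * (2 * integral {0..1} (\<lambda>x. w i x * (z i s x * zt i s x))))" for s
    have dF: "(F has_real_derivative F' s) (at s within {0..})" if s: "s \<ge> 0" for s
      unfolding F_def[abs_def] F'_def
    proof (intro DERIV_sum DERIV_cmult weighted_square_deriv s)
      fix i assume "i \<in> {..n}"
      then have i: "i \<le> n" by simp
      show "L2I (z i s')" if "s' \<ge> 0" for s' using zL[OF i that] .
      show "L2I (zt i s)" using ztL[OF i s] .
      show "continuous_on {0..1} (w i)" using wc[OF i] .
      show "((\<lambda>s'. l2norm (\<lambda>x. (z i s' x - z i s x) / (s' - s) - zt i s x)) \<longlongrightarrow> 0) (at s within {0..})"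
        using sol i s unfolding l2_sol_def by blast
    qed
    have wsq: "(\<lambda>x. w i x * (z i s x)\<^sup>2) integrable_on {0..1}" if "i \<le> n" "s \<ge> 0" for i s
      using L2_on_prod_integrable_on[OF L2_on_mult_continuous[OF zL[OF that] wc[OF that(1)]] zL[OF that]]
      by (simp add: mult.assoc power2_eq_square)
    have Flow: "c1 * S s \<le> F s" and Fup: "F s \<le> hi * S s" if s: "s \<ge> 0" for s
    proof -
      have 1: "lo * (l2norm (z i s))\<^sup>2 \<le> integral {0..1} (\<lambda>x. w i x * (z i s x)\<^sup>2)" if i: "i \<le> n" for i
        unfolding l2norm_sq integral_mult_right[symmetric]
        by (rule integral_le[OF integrable_on_mult_right[OF sq_integrable_on[OF zL[OF i s]]] wsq[OF i s]])
           (unfold w_def, rule mult_right_mono[OF lohi(1)[OF i]], assumption, simp)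
      have 2: "integral {0..1} (\<lambda>x. w i x * (z i s x)\<^sup>2) \<le> hi * (l2norm (z i s))\<^sup>2" if i: "i \<le> n" for i
        unfolding l2norm_sq integral_mult_right[symmetric]
        by (rule integral_le[OF wsq[OF i s] integrable_on_mult_right[OF sq_integrable_on[OF zL[OF i s]]]])
           (unfold w_def, rule mult_right_mono[OF lohi(2)[OF i]], assumption, simp)
      show "c1 * S s \<le> F s" unfolding S_def F_def sum_distrib_left
      proof (rule sum_mono)
        fix i assume "i \<in> {..n}"
        then have "lo * (l2norm (z i s))\<^sup>2 \<le> integral {0..1} (\<lambda>x. w i x * (z i s x)\<^sup>2)" using 1 by simp
        then have "\<kappa> * (lo * (l2norm (z i s))\<^sup>2) \<le> \<omega> i * integral {0..1} (\<lambda>x. w i x * (z i s x)\<^sup>2)"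
          using \<omega>[of i] lo by (intro mult_mono) auto
        then show "c1 * (l2norm (z i s))\<^sup>2 \<le> \<omega> i * integral {0..1} (\<lambda>x. w i x * (z i s x)\<^sup>2)" by (simp add: c1_def mult.assoc)
      qed
      show "F s \<le> hi * S s" unfolding S_def F_def sum_distrib_left
      proof (rule sum_mono)
        fix i assume "i \<in> {..n}"
        then have i: "i \<le> n" by simp
        have "0 \<le> integral {0..1} (\<lambda>x. w i x * (z i s x)\<^sup>2)"
          by (rule integral_nonneg[OF wsq[OF i s]]) (simp add: w_def)
        then have "\<omega> i * integral {0..1} (\<lambda>x. w i x * (z i s x)\<^sup>2) \<le> 1 * integral {0..1} (\<lambda>x. w i x * (z i s x)\<^sup>2)"
          using \<omega>[of i] by (intro mult_right_mono) auto
        then show "\<omega> i * integral {0..1} (\<lambda>x. w i x * (z i s x)\<^sup>2) \<le> hi * (l2norm (z i s))\<^sup>2" using 2[OF i] by simp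
      qed
    qed
    have diss: "F' s \<le> K * F s + (U s)\<^sup>2" if s: "s \<ge> 0" for s
    proof -
      have srcL: "L2I (\<lambda>x. cf i j x * z j s x)" if "i \<le> n" "j \<le> n" for i j
        using that by (intro L2_on_mult_continuous zL s cf_cont)
      \<comment> \<open>Sign of the transport speed: after division by its modulus only this sign is
        left in front of the spatial derivative.\<close>
      define sg where "sg i = (if i = 0 then - 1 else 1 :: real)" for i :: nat
      have ws: "w i x * a i x = sg i" if "i \<le> n" "x \<in> {0..1}" for i x
        using a_pos[of i x] a_neg[of x] that by (cases "i = 0") (auto simp: w_def sg_def)
      have each: "2 * integral {0..1} (\<lambda>x. w i x * (z i s x * zt i s x)) \<le> real (n + 2) * B * S s - sg i * ((z i s 1)\<^sup>2 - (z i s 0)\<^sup>2)"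
        if i: "i \<le> n" for i
      proof -
        have H: "has_H1_derivative (z i s) (zx i s) 0 1"
          and pde: "AE x in lebesgue_on {0..1}. zt i s x + a i x * zx i s x = src z i s x"
          using sol i s unfolding l2_sol_def by blast+
        have wzL: "L2I (\<lambda>x. w i x * z i s x)" by (intro L2_on_mult_continuous zL wc i s)
        have sL: "L2I (\<lambda>x. src z i s x)" unfolding src_def by (intro L2_on_sum srcL) (use i in auto)
        have "integral {0..1} (\<lambda>x. w i x * (z i s x * zt i s x)) = integral {0..1} (\<lambda>x. (w i x * z i s x) * src z i s x - sg i * (z i s x * zx i s x))"
        proof (rule integral_AE_cong)
          show "AE x in lebesgue_on {0..1}. w i x * (z i s x * zt i s x) = (w i x * z i s x) * src z i s x - sg i * (z i s x * zx i s x)"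
            using pde AE_space
          proof eventually_elim
            case (elim x)
            then have x: "x \<in> {0..1}" by simp
            have zte: "zt i s x = src z i s x - a i x * zx i s x" using elim by simp
            show ?case unfolding zte ws[OF i x, symmetric] by (simp add: algebra_simps)
          qed
        qed
        also have "\<dots> = integral {0..1} (\<lambda>x. (w i x * z i s x) * src z i s x) - integral {0..1} (\<lambda>x. sg i * (z i s x * zx i s x))"
          by (rule Henstock_Kurzweil_Integration.integral_diff)
            (intro L2_on_prod_integrable_on integrable_on_mult_right wzL sL zL zxL i s)+
        also have "integral {0..1} (\<lambda>x. sg i * (z i s x * zx i s x)) = sg i * integral {0..1} (\<lambda>x. z i s x * zx i s x)"
          by (rule integral_mult_right)
        finally have e0: "integral {0..1} (\<lambda>x. w i x * (z i s x * zt i s x)) =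
           integral {0..1} (\<lambda>x. (w i x * z i s x) * src z i s x) - sg i * integral {0..1} (\<lambda>x. z i s x * zx i s x)" .
        have e: "2 * integral {0..1} (\<lambda>x. w i x * (z i s x * zt i s x)) =
           2 * integral {0..1} (\<lambda>x. (w i x * z i s x) * src z i s x) - sg i * ((z i s 1)\<^sup>2 - (z i s 0)\<^sup>2)"
          unfolding e0 H1_integral_square[OF H, symmetric] by (simp add: algebra_simps)
        have "integral {0..1} (\<lambda>x. (w i x * z i s x) * src z i s x) = (\<Sum>j\<le>n. integral {0..1} (\<lambda>x. (w i x * z i s x) * (cf i j x * z j s x)))"
          unfolding src_def sum_distrib_left
          by (rule integral_sum) (auto intro!: L2_on_prod_integrable_on wzL srcL i)
        also have "\<dots> \<le> (\<Sum>j\<le>n. B * (l2norm (z i s) * l2norm (z j s)))"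
        proof (rule sum_mono)
          fix j assume "j \<in> {..n}"
          then have j: "j \<le> n" by simp
          have "integral {0..1} (\<lambda>x. (w i x * z i s x) * (cf i j x * z j s x)) = integral {0..1} (\<lambda>x. ((w i x * cf i j x) * z i s x) * z j s x)"
            by (intro Henstock_Kurzweil_Integration.integral_cong) (simp add: mult_ac)
          also have "\<dots> \<le> l2norm (\<lambda>x. (w i x * cf i j x) * z i s x) * l2norm (z j s)"
            by (rule order_trans[OF abs_ge_self cauchy_schwarz_L2])
              (intro L2_on_mult_continuous continuous_on_mult zL wc cf_cont i j s)+
          also have "\<dots> \<le> (B * l2norm (z i s)) * l2norm (z j s)"
          proof (rule mult_right_mono[OF l2norm_mult_le l2norm_nonneg])
            show "\<bar>w i x * cf i j x\<bar> \<le> B" if x: "x \<in> {0..1}" for x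
            proof -
              have "\<bar>cf i j x\<bar> \<le> Cm"
                using member_le_sum[of j "{..n}" "\<lambda>j. \<bar>cf i j x\<bar>"] j Cm(2)[OF i x] by simp
              moreover have "\<bar>w i x\<bar> \<le> hi" using lohi(2)[OF i x] by (simp add: w_def)
              ultimately show ?thesis unfolding abs_mult B_def using hi0 by (intro mult_mono) auto
            qed
          qed (intro continuous_intros wc cf_cont i j B0 zL s)+
          finally show "integral {0..1} (\<lambda>x. (w i x * z i s x) * (cf i j x * z j s x)) \<le> B * (l2norm (z i s) * l2norm (z j s))"
            by (simp add: mult.assoc)
        qed
        also have "2 * (\<Sum>j\<le>n. B * (l2norm (z i s) * l2norm (z j s))) \<le> (\<Sum>j\<le>n. B * ((l2norm (z i s))\<^sup>2 + (l2norm (z j s))\<^sup>2))"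
          unfolding sum_distrib_left
        proof (rule sum_mono)
          fix j
          have "B * (2 * l2norm (z i s) * l2norm (z j s)) \<le> B * ((l2norm (z i s))\<^sup>2 + (l2norm (z j s))\<^sup>2)"
            by (rule mult_left_mono[OF sum_squares_bound B0])
          then show "2 * (B * (l2norm (z i s) * l2norm (z j s))) \<le> B * ((l2norm (z i s))\<^sup>2 + (l2norm (z j s))\<^sup>2)" by (simp add: algebra_simps)
        qed
        also have "\<dots> = B * (real (n + 1) * (l2norm (z i s))\<^sup>2 + S s)"
          unfolding sum_distrib_left[symmetric] sum.distrib S_def by simp
        also have "\<dots> \<le> B * (real (n + 1) * S s + S s)"
        proof -
          have "(l2norm (z i s))\<^sup>2 \<le> S s" unfolding S_def
            using member_le_sum[of i "{..n}" "\<lambda>i. (l2norm (z i s))\<^sup>2"] i by simp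
          then show ?thesis using B0 by (intro mult_left_mono add_right_mono) auto
        qed
        finally have "2 * integral {0..1} (\<lambda>x. (w i x * z i s x) * src z i s x) \<le> real (n + 2) * B * S s"
          by (simp add: algebra_simps)
        then show ?thesis unfolding e by linarith
      qed
      have RS: "real (n + 2) * B * S s \<ge> 0" using B0 S0 by simp
      \<comment> \<open>The factor \<open>\<omega> i\<close> is replaced by \<open>1\<close> in the
        growth term but kept in the boundary terms, where it balances the reflection.\<close>
      have "F' s \<le> (\<Sum>i\<le>n. real (n + 2) * B * S s - \<omega> i * sg i * ((z i s 1)\<^sup>2 - (z i s 0)\<^sup>2))"
        unfolding F'_def
      proof (rule sum_mono)
        fix i assume "i \<in> {..n}"
        then have "\<omega> i * (2 * integral {0..1} (\<lambda>x. w i x * (z i s x * zt i s x))) \<le>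
            \<omega> i * (real (n + 2) * B * S s - sg i * ((z i s 1)\<^sup>2 - (z i s 0)\<^sup>2))"
          using each[of i] \<omega>[of i] by (intro mult_left_mono) auto
        also have "\<dots> = \<omega> i * (real (n + 2) * B * S s) - \<omega> i * sg i * ((z i s 1)\<^sup>2 - (z i s 0)\<^sup>2)" by (simp add: algebra_simps)
        also have "\<dots> \<le> 1 * (real (n + 2) * B * S s) - \<omega> i * sg i * ((z i s 1)\<^sup>2 - (z i s 0)\<^sup>2)"
          using \<omega>[of i] RS by (intro diff_right_mono mult_right_mono) auto
        finally show "\<omega> i * (2 * integral {0..1} (\<lambda>x. w i x * (z i s x * zt i s x))) \<le>
            real (n + 2) * B * S s - \<omega> i * sg i * ((z i s 1)\<^sup>2 - (z i s 0)\<^sup>2)" by simp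
      qed
      also have "\<dots> = real (n + 1) * (real (n + 2) * B * S s) - (\<Sum>i\<le>n. \<omega> i * sg i * ((z i s 1)\<^sup>2 - (z i s 0)\<^sup>2))"
        by (simp add: sum_subtractf)
      finally have f1: "F' s \<le> real (n + 1) * (real (n + 2) * B * S s) - (\<Sum>i\<le>n. \<omega> i * sg i * ((z i s 1)\<^sup>2 - (z i s 0)\<^sup>2))" .
      have f2: "(\<Sum>i\<le>n. \<omega> i * sg i * ((z i s 1)\<^sup>2 - (z i s 0)\<^sup>2)) \<ge> - (U s)\<^sup>2"
      proof -
        have "(\<Sum>i\<le>n. \<omega> i * sg i * ((z i s 1)\<^sup>2 - (z i s 0)\<^sup>2)) =
            - ((z 0 s 1)\<^sup>2 - (z 0 s 0)\<^sup>2) + (\<Sum>i=1..n. \<kappa> * ((z i s 1)\<^sup>2 - (z i s 0)\<^sup>2))"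
          unfolding atMost_atLeast0 by (subst sum.atLeast_Suc_atMost) (auto simp: \<omega>_def sg_def)
        moreover have "(\<Sum>i=1..n. \<kappa> * ((z i s 1)\<^sup>2 - (z i s 0)\<^sup>2)) \<ge> (\<Sum>i=1..n. - (\<kappa> * (q i)\<^sup>2 * (z 0 s 0)\<^sup>2))"
        proof (rule sum_mono)
          fix i assume "i \<in> {1..n}"
          then have "z i s 0 = q i * z 0 s 0" using sol s unfolding l2_sol_def by auto
          then show "\<kappa> * ((z i s 1)\<^sup>2 - (z i s 0)\<^sup>2) \<ge> - (\<kappa> * (q i)\<^sup>2 * (z 0 s 0)\<^sup>2)"
            using \<kappa>(1) by (simp add: power_mult_distrib right_diff_distrib)
        qed
        moreover have "(\<Sum>i=1..n. - (\<kappa> * (q i)\<^sup>2 * (z 0 s 0)\<^sup>2)) = - (\<kappa> * (\<Sum>i=1..n. (q i)\<^sup>2)) * (z 0 s 0)\<^sup>2"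
          by (simp add: sum_negf sum_distrib_left sum_distrib_right)
        moreover have "(\<kappa> * (\<Sum>i=1..n. (q i)\<^sup>2)) * (z 0 s 0)\<^sup>2 \<le> 1 * (z 0 s 0)\<^sup>2"
          by (rule mult_right_mono[OF \<kappa>(3)]) simp
        moreover have "z 0 s 1 = U s" using sol s unfolding l2_sol_def by blast
        ultimately show ?thesis by simp
      qed
      have "F' s \<le> real (n + 1) * (real (n + 2) * B * S s) + (U s)\<^sup>2" using f1 f2 by linarith
      also have "real (n + 1) * (real (n + 2) * B * S s) = K * (c1 * S s)" using c10 by (simp add: K_def)
      also have "K * (c1 * S s) \<le> K * F s" using Flow[OF s] B0 c10 by (intro mult_left_mono) (auto simp: K_def)
      finally show ?thesis by simp
    qed
    have Usq: "continuous_on {0..} (\<lambda>s. (U s)\<^sup>2)" by (intro continuous_intros Uc)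
    have "exp (- K * t) * F t \<le> F 0 + integral {0..t} (\<lambda>s. exp (- K * s) * (U s)\<^sup>2)"
      by (rule gronwall_source[OF dF diss Usq t])
    moreover have "exp (- K * t) * (c1 * S t) \<le> exp (- K * t) * F t" using Flow[OF t] by (intro mult_left_mono) auto
    ultimately show ?thesis using Fup[of 0] unfolding S_def by linarith
  qed
  then show ?thesis using c10 hi0 by (intro exI[of _ c1] conjI exI[of _ hi] exI[of _ K] allI impI) auto
qed

end

section \<open>Weak solutions of the closed loop\<close>

lemma has_integral_derivative_halfline:
  fixes f :: "real \<Rightarrow> real"
  assumes "continuous_on {0..} f" "t \<ge> 0"
  shows "((\<lambda>t. integral {0..t} f) has_real_derivative f t) (at t within {0..})"
proof -
  have "((\<lambda>t. integral {0..t} f) has_real_derivative f t) (at t within {0..t+1})"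
    by (rule integral_has_real_derivative) (use assms in \<open>auto intro: continuous_on_subset\<close>)
  moreover have "at t within {0..t+1} = at t within {0..}"
    by (rule at_within_nhd[of _ "{..<t+1}"]) auto
  ultimately show ?thesis by simp
qed

text \<open>The differential version is applied to the primitive of \<psi>, as \<psi> itself is only
  continuous.\<close>

lemma gronwall_zero:
  fixes \<psi> :: "real \<Rightarrow> real"
  assumes c: "continuous_on {0..} \<psi>" and le: "\<And>t. t \<ge> 0 \<Longrightarrow> \<psi> t \<le> C * integral {0..t} \<psi>"
    and C: "C \<ge> 0" and t: "t \<ge> 0"
  shows "\<psi> t \<le> 0"
proof -
  have "exp (- C * t) * integral {0..t} \<psi> \<le> integral {0..0} \<psi> + integral {0..t} (\<lambda>s. exp (- C * s) * 0)"
    by (rule gronwall_source[OF has_integral_derivative_halfline[OF c]]) (use le t in auto)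
  then have "integral {0..t} \<psi> \<le> 0" by (simp add: mult_le_0_iff)
  then have "C * integral {0..t} \<psi> \<le> 0" using C by (simp add: mult_nonneg_nonpos)
  then show ?thesis using le[OF t] by linarith
qed

text \<open>Component \<open>0\<close> is \<open>v\<close>, as in the locale \<open>transport\<close>.\<close>

definition comb :: "(nat \<Rightarrow> real \<Rightarrow> real) \<Rightarrow> (real \<Rightarrow> real) \<Rightarrow> nat \<Rightarrow> real \<Rightarrow> real" where
  "comb u v i = (if i = 0 then v else u i)"

definition enorm :: "nat \<Rightarrow> (nat \<Rightarrow> real \<Rightarrow> real) \<Rightarrow> real" where
  "enorm n w = sqrt (integral {0..1} (\<lambda>x. 1 / real n * (\<Sum>i=1..n. (w i x)\<^sup>2) + (w 0 x)\<^sup>2))"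

lemma E_norm_comb: "E_norm n u v = enorm n (comb u v)"
  by (simp add: E_norm_def enorm_def comb_def)

lemma E_norm_comb_diff: "E_norm n (u - u') (v - v') = enorm n (\<lambda>i x. comb u v i x - comb u' v' i x)"
  by (simp add: E_norm_def enorm_def comb_def)

lemma in_E_comb: "in_E n u v \<longleftrightarrow> (\<forall>i\<le>n. L2I (comb u v i))"
proof
  assume "in_E n u v" then show "\<forall>i\<le>n. L2I (comb u v i)" by (auto simp: in_E_def comb_def)
next
  assume a: "\<forall>i\<le>n. L2I (comb u v i)"
  then have "L2I (u i)" if "i \<in> {1..n}" for i using that by (auto simp: comb_def dest!: spec[of _ i])
  moreover have "L2I v" using a by (auto simp: comb_def dest: spec[of _ 0])
  ultimately show "in_E n u v" by (simp add: in_E_def)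
qed

section \<open>The state norm as a weighted Euclidean norm\<close>

definition cn :: "nat \<Rightarrow> nat \<Rightarrow> real" where "cn n i = (if i = 0 then 1 else sqrt (1 / real n))"

text \<open>In this form the triangle inequality is inherited from \<open>L2_set\<close> and from
  the norms of the components.\<close>

lemma enorm_eq:
  assumes "\<And>i. i \<le> n \<Longrightarrow> L2I (w i)"
  shows "enorm n w = L2_set (\<lambda>i. cn n i * l2norm (w i)) {..n}"
proof -
  have i: "(\<lambda>x. (w i x)\<^sup>2) integrable_on {0..1}" if "i \<le> n" for i by (rule sq_integrable_on[OF assms[OF that]])
  have "integral {0..1} (\<lambda>x. 1 / real n * (\<Sum>i=1..n. (w i x)\<^sup>2) + (w 0 x)\<^sup>2) =
     integral {0..1} (\<lambda>x. 1 / real n * (\<Sum>i=1..n. (w i x)\<^sup>2)) + integral {0..1} (\<lambda>x. (w 0 x)\<^sup>2)"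
    by (rule Henstock_Kurzweil_Integration.integral_add) (intro integrable_on_mult_right integrable_sum i; simp)+
  also have "integral {0..1} (\<lambda>x. 1 / real n * (\<Sum>i=1..n. (w i x)\<^sup>2)) = 1 / real n * integral {0..1} (\<lambda>x. \<Sum>i=1..n. (w i x)\<^sup>2)"
    by (rule integral_mult_right)
  also have "integral {0..1} (\<lambda>x. \<Sum>i=1..n. (w i x)\<^sup>2) = (\<Sum>i=1..n. (l2norm (w i))\<^sup>2)"
    unfolding l2norm_sq by (rule integral_sum) (use i in auto)
  also have "1 / real n * (\<Sum>i=1..n. (l2norm (w i))\<^sup>2) + integral {0..1} (\<lambda>x. (w 0 x)\<^sup>2) = (\<Sum>i\<le>n. (cn n i * l2norm (w i))\<^sup>2)"
    unfolding atMost_atLeast0 sum.atLeast_Suc_atMost[OF le0]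
    by (auto simp: cn_def l2norm_sq power_mult_distrib sum_distrib_left intro!: sum.cong)
  finally show ?thesis by (simp add: enorm_def L2_set_def)
qed

lemma enorm_nonneg: "enorm n w \<ge> 0"
proof -
  let ?f = "\<lambda>x. 1 / real n * (\<Sum>i=1..n. (w i x)\<^sup>2) + (w 0 x)\<^sup>2"
  have "integral {0..1} ?f \<ge> 0"
    by (cases "?f integrable_on {0..1}") (auto intro!: integral_nonneg add_nonneg_nonneg sum_nonneg divide_nonneg_nonneg simp: not_integrable_integral)
  then show ?thesis by (simp add: enorm_def)
qed

lemma cn_nonneg: "cn n i \<ge> 0" and cn_le1: "cn n i \<le> 1"
proof -
  show "cn n i \<ge> 0" by (simp add: cn_def)
  show "cn n i \<le> 1" by (cases n) (auto simp: cn_def)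
qed

lemma enorm_triangle:
  assumes f: "\<And>i. i \<le> n \<Longrightarrow> L2I (f i)" and g: "\<And>i. i \<le> n \<Longrightarrow> L2I (g i)"
  shows "enorm n (\<lambda>i x. f i x + g i x) \<le> enorm n f + enorm n g"
proof -
  have "enorm n (\<lambda>i x. f i x + g i x) = L2_set (\<lambda>i. cn n i * l2norm (\<lambda>x. f i x + g i x)) {..n}"
    by (rule enorm_eq) (intro L2_on_add f g)
  also have "\<dots> \<le> L2_set (\<lambda>i. cn n i * l2norm (f i) + cn n i * l2norm (g i)) {..n}"
  proof (rule L2_set_mono)
    fix i assume "i \<in> {..n}"
    then have "l2norm (\<lambda>x. f i x + g i x) \<le> l2norm (f i) + l2norm (g i)" by (intro l2norm_triangle f g) auto
    from mult_left_mono[OF this cn_nonneg]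
    show "cn n i * l2norm (\<lambda>x. f i x + g i x) \<le> cn n i * l2norm (f i) + cn n i * l2norm (g i)" by (simp add: distrib_left)
  qed (simp add: cn_nonneg l2norm_nonneg)
  also have "\<dots> \<le> L2_set (\<lambda>i. cn n i * l2norm (f i)) {..n} + L2_set (\<lambda>i. cn n i * l2norm (g i)) {..n}"
    by (rule L2_set_triangle_ineq)
  finally show ?thesis using enorm_eq[OF f] enorm_eq[OF g] by simp
qed

lemma enorm_triangle_diff:
  assumes f: "\<And>i. i \<le> n \<Longrightarrow> L2I (f i)" and g: "\<And>i. i \<le> n \<Longrightarrow> L2I (g i)" and h: "\<And>i. i \<le> n \<Longrightarrow> L2I (h i)"
  shows "enorm n (\<lambda>i x. f i x - h i x) \<le> enorm n (\<lambda>i x. f i x - g i x) + enorm n (\<lambda>i x. g i x - h i x)"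
  using enorm_triangle[of n "\<lambda>i x. f i x - g i x" "\<lambda>i x. g i x - h i x"] f g h by (simp add: L2_on_diff)

lemma enorm_triangle_sub:
  assumes f: "\<And>i. i \<le> n \<Longrightarrow> L2I (f i)" and g: "\<And>i. i \<le> n \<Longrightarrow> L2I (g i)"
  shows "enorm n f \<le> enorm n (\<lambda>i x. f i x - g i x) + enorm n g"
  using enorm_triangle[of n "\<lambda>i x. f i x - g i x" g] f g by (simp add: L2_on_diff)

lemma enorm_minus_commute: "enorm n (\<lambda>i x. f i x - g i x) = enorm n (\<lambda>i x. g i x - f i x)"
  by (simp add: enorm_def power2_commute)

text \<open>The factor \<open>sqrt (real n)\<close> undoes the weight \<open>1 / n\<close> of a
  single component. Since \<open>n\<close> is fixed at this stage, convergence in \<open>E\<close>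
  and convergence of the components are interchangeable.\<close>

lemma l2norm_le_enorm:
  assumes n: "n \<ge> 1" and w: "\<And>i. i \<le> n \<Longrightarrow> L2I (w i)" and i: "i \<le> n"
  shows "l2norm (w i) \<le> sqrt (real n) * enorm n w"
proof -
  have "cn n i * l2norm (w i) \<le> enorm n w"
  proof -
    have e: "enorm n w = L2_set (\<lambda>i. cn n i * l2norm (w i)) {..n}" by (rule enorm_eq) (rule w)
    show ?thesis unfolding e by (rule member_le_L2_set) (use i in auto)
  qed
  then have "sqrt (real n) * (cn n i * l2norm (w i)) \<le> sqrt (real n) * enorm n w" by (intro mult_left_mono) auto
  moreover have "1 \<le> sqrt (real n) * cn n i" using n by (auto simp: cn_def real_sqrt_divide)
  then have "1 * l2norm (w i) \<le> (sqrt (real n) * cn n i) * l2norm (w i)" by (intro mult_right_mono l2norm_nonneg)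
  ultimately show ?thesis by (simp add: mult.assoc)
qed

lemma enorm_le_sum:
  assumes w: "\<And>i. i \<le> n \<Longrightarrow> L2I (w i)"
  shows "enorm n w \<le> (\<Sum>i\<le>n. l2norm (w i))"
proof -
  have "enorm n w \<le> (\<Sum>i\<le>n. cn n i * l2norm (w i))"
  proof -
    have e: "enorm n w = L2_set (\<lambda>i. cn n i * l2norm (w i)) {..n}" by (rule enorm_eq) (rule w)
    show ?thesis unfolding e by (rule L2_set_le_sum) (simp add: cn_nonneg l2norm_nonneg)
  qed
  also have "\<dots> \<le> (\<Sum>i\<le>n. 1 * l2norm (w i))"
    by (intro sum_mono mult_right_mono cn_le1 l2norm_nonneg)
  finally show ?thesis by simp
qed

lemma tendsto_l2norm_from_enorm:
  assumes n: "n \<ge> 1" and w: "\<forall>\<^sub>F m in F. \<forall>i\<le>n. L2I (w m i)" and i: "i \<le> n" and lim: "((\<lambda>m. enorm n (w m)) \<longlongrightarrow> 0) F"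
  shows "((\<lambda>m. l2norm (w m i)) \<longlongrightarrow> 0) F"
proof (rule Lim_null_comparison)
  show "\<forall>\<^sub>F m in F. norm (l2norm (w m i)) \<le> sqrt (real n) * enorm n (w m)"
    using w
  proof eventually_elim
    case (elim m)
    have "l2norm (w m i) \<le> sqrt (real n) * enorm n (w m)"
      by (rule l2norm_le_enorm) (use elim n i in auto)
    then show ?case by (simp add: l2norm_nonneg)
  qed
  show "((\<lambda>m. sqrt (real n) * enorm n (w m)) \<longlongrightarrow> 0) F"
    using tendsto_mult_left[OF lim, of "sqrt (real n)"] by simp
qed

lemma l2norm_abs_diff_le:
  assumes "L2I f" "L2I g" shows "\<bar>l2norm f - l2norm g\<bar> \<le> l2norm (\<lambda>x. f x - g x)"
proof -
  have "l2norm f \<le> l2norm (\<lambda>x. f x - g x) + l2norm g" "l2norm g \<le> l2norm (\<lambda>x. g x - f x) + l2norm f"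
    using l2norm_triangle[of "\<lambda>x. f x - g x" g] l2norm_triangle[of "\<lambda>x. g x - f x" f] assms by (simp_all add: L2_on_diff)
  then show ?thesis using l2norm_minus_commute[of f g] by linarith
qed

lemma tendsto_l2norm:
  assumes f: "\<forall>\<^sub>F m in F. L2I (f m)" and g: "L2I g" and lim: "((\<lambda>m. l2norm (\<lambda>x. f m x - g x)) \<longlongrightarrow> 0) F"
  shows "((\<lambda>m. l2norm (f m)) \<longlongrightarrow> l2norm g) F"
proof (rule LIM_zero_cancel, rule Lim_null_comparison[OF _ lim])
  show "\<forall>\<^sub>F m in F. norm (l2norm (f m) - l2norm g) \<le> l2norm (\<lambda>x. f m x - g x)"
    using f by eventually_elim (use l2norm_abs_diff_le[OF _ g] in auto)
qed

lemma eventually_at_halfline: "\<forall>\<^sub>F s in at t within {0..}. (s :: real) \<ge> 0"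
  by (simp add: eventually_at_filter)

lemma has_H1_derivative_diff:
  assumes "has_H1_derivative f f' 0 1" "has_H1_derivative g g' 0 1"
  shows "has_H1_derivative (\<lambda>x. f x - g x) (\<lambda>x. f' x - g' x) 0 1"
  unfolding has_H1_derivative_def
proof (intro conjI ballI)
  have L: "L2I f'" "L2I g'" using H1_L2(2)[OF assms(1)] H1_L2(2)[OF assms(2)] .
  show "L2I (\<lambda>x. f' x - g' x)" by (intro L2_on_diff L)
  fix x :: real assume x: "x \<in> {0..1}"
  have sub: "h integrable_on {0..x}" if "L2I h" for h
    using L2_on_integrable_on[OF that] by (rule integrable_on_subinterval) (use x in auto)
  have "integral {0..x} (\<lambda>x. f' x - g' x) = integral {0..x} f' - integral {0..x} g'"
    by (rule Henstock_Kurzweil_Integration.integral_diff) (intro sub L)+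
  moreover have "f x = f 0 + integral {0..x} f'" "g x = g 0 + integral {0..x} g'"
    using assms x unfolding has_H1_derivative_def by blast+
  ultimately show "f x - g x = f 0 - g 0 + integral {0..x} (\<lambda>x. f' x - g' x)" by linarith
qed

text \<open>Continuity is known on compact intervals; every point of the half-line has a relatively
  open neighbourhood \<open>{0..<T}\<close> inside one of them.\<close>

lemma H1_loc_continuous: assumes "H1_loc f" shows "continuous_on {0..} f"
proof -
  have "continuous_on {0..<real (Suc T)} f" for T
  proof -
    obtain g where "has_H1_derivative f g 0 (real (Suc T))" using assms unfolding H1_loc_def by (metis of_nat_0_less_iff zero_less_Suc)
    from H1_continuous[OF this] show ?thesis by (rule continuous_on_subset) auto
  qed
  moreover have "openin (top_of_set {0..}) {0..<real (Suc T)}" for T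
  proof -
    have "{0..<real (Suc T)} = {0..} \<inter> {..<real (Suc T)}" by auto
    then show ?thesis by (metis open_lessThan openin_open_Int)
  qed
  moreover have "{0..} = (\<Union>T. {0..<real (Suc T)})"
  proof (intro equalityI subsetI)
    fix x :: real assume "x \<in> {0..}"
    moreover obtain T where "x < real T" using reals_Archimedean2 by blast
    ultimately show "x \<in> (\<Union>T. {0..<real (Suc T)})" by (auto intro!: exI[of _ T])
  qed auto
  ultimately show ?thesis unfolding continuous_on_eq_continuous_within
  proof (intro ballI)
    fix x :: real assume c: "\<And>T. \<forall>x\<in>{0..<real (Suc T)}. continuous (at x within {0..<real (Suc T)}) f" and x: "x \<in> {0..}"
    obtain T where T: "x < real T" using reals_Archimedean2 by blast
    have "at x within {0..<real (Suc T)} = at x within {0..}"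
      by (rule at_within_nhd[of _ "{..<real (Suc T)}"]) (use T in auto)
    moreover have "continuous (at x within {0..<real (Suc T)}) f" using c[of T] x T by auto
    ultimately show "continuous (at x within {0..}) f" by (simp only:)
  qed
qed

section \<open>Linearity of the equations and bounds for the feedback\<close>

context transport
begin

lemma l2_sol_diff:
  assumes "l2_sol U z zt zx" "l2_sol U' z' zt' zx'"
  shows "l2_sol (\<lambda>t. U t - U' t) (\<lambda>i t x. z i t x - z' i t x) (\<lambda>i t x. zt i t x - zt' i t x) (\<lambda>i t x. zx i t x - zx' i t x)"
  unfolding l2_sol_def
proof (intro allI impI conjI)
  fix t :: real assume t: "t \<ge> 0"
  show "z 0 t 1 - z' 0 t 1 = U t - U' t" using assms t unfolding l2_sol_def by simp
  fix i assume i: "i \<le> n"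
  have zL: "L2I (z i s)" "L2I (z' i s)" "L2I (zt i s)" "L2I (zt' i s)" if "s \<ge> 0" for s
    using assms that i H1_L2(1) unfolding l2_sol_def by blast+
  show "L2I (\<lambda>x. zt i t x - zt' i t x)" by (intro L2_on_diff zL t)
  show "has_H1_derivative (\<lambda>x. z i t x - z' i t x) (\<lambda>x. zx i t x - zx' i t x) 0 1"
    by (rule has_H1_derivative_diff) (use assms t i in \<open>simp_all add: l2_sol_def\<close>)
  have l1: "((\<lambda>s. l2norm (\<lambda>x. (z i s x - z i t x) / (s - t) - zt i t x)) \<longlongrightarrow> 0) (at t within {0..})"
    and l2: "((\<lambda>s. l2norm (\<lambda>x. (z' i s x - z' i t x) / (s - t) - zt' i t x)) \<longlongrightarrow> 0) (at t within {0..})"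
    using assms t i by (simp_all add: l2_sol_def)
  show "((\<lambda>s. l2norm (\<lambda>x. (z i s x - z' i s x - (z i t x - z' i t x)) / (s - t) - (zt i t x - zt' i t x))) \<longlongrightarrow> 0) (at t within {0..})"
  proof (rule Lim_null_comparison)
    show "((\<lambda>s. l2norm (\<lambda>x. (z i s x - z i t x) / (s - t) - zt i t x) + l2norm (\<lambda>x. (z' i s x - z' i t x) / (s - t) - zt' i t x)) \<longlongrightarrow> 0) (at t within {0..})"
      using tendsto_add[OF l1 l2] by simp
    show "\<forall>\<^sub>F s in at t within {0..}. norm (l2norm (\<lambda>x. (z i s x - z' i s x - (z i t x - z' i t x)) / (s - t) - (zt i t x - zt' i t x)))
       \<le> l2norm (\<lambda>x. (z i s x - z i t x) / (s - t) - zt i t x) + l2norm (\<lambda>x. (z' i s x - z' i t x) / (s - t) - zt' i t x)"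
      unfolding eventually_at
    proof (intro exI[of _ 1] conjI ballI impI)
      fix s :: real assume s: "s \<in> {0..}"
      have dL: "L2I (\<lambda>x. (f s x - f t x) / (s - t) - g x)" if "L2I (f s)" "L2I (f t)" "L2I g" for f :: "real \<Rightarrow> real \<Rightarrow> real" and g
        using L2_on_diff[OF L2_on_cmult[OF L2_on_diff[OF that(1,2)], of "1 / (s - t)"] that(3)] by simp
      have "l2norm (\<lambda>x. ((z i s x - z i t x) / (s - t) - zt i t x) + (-1) * ((z' i s x - z' i t x) / (s - t) - zt' i t x))
        \<le> l2norm (\<lambda>x. (z i s x - z i t x) / (s - t) - zt i t x) + l2norm (\<lambda>x. (-1) * ((z' i s x - z' i t x) / (s - t) - zt' i t x))"
        by (intro l2norm_triangle L2_on_cmult dL zL t) (use s in auto)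
      moreover have "l2norm (\<lambda>x. ((z i s x - z i t x) / (s - t) - zt i t x) + (-1) * ((z' i s x - z' i t x) / (s - t) - zt' i t x))
        = l2norm (\<lambda>x. (z i s x - z' i s x - (z i t x - z' i t x)) / (s - t) - (zt i t x - zt' i t x))"
        by (intro l2norm_cong) (simp add: diff_divide_distrib add_divide_distrib algebra_simps)
      ultimately show "norm (l2norm (\<lambda>x. (z i s x - z' i s x - (z i t x - z' i t x)) / (s - t) - (zt i t x - zt' i t x)))
       \<le> l2norm (\<lambda>x. (z i s x - z i t x) / (s - t) - zt i t x) + l2norm (\<lambda>x. (z' i s x - z' i t x) / (s - t) - zt' i t x)"
        unfolding l2norm_cmult by (simp add: l2norm_nonneg)
    qed simp
  qed
  have "AE x in lebesgue_on {0..1}. zt i t x + a i x * zx i t x = src z i t x"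
    "AE x in lebesgue_on {0..1}. zt' i t x + a i x * zx' i t x = src z' i t x"
    using assms t i by (simp_all add: l2_sol_def)
  then show "AE x in lebesgue_on {0..1}. zt i t x - zt' i t x + a i x * (zx i t x - zx' i t x) = src (\<lambda>i t x. z i t x - z' i t x) i t x"
  proof eventually_elim
    case (elim x)
    have "src (\<lambda>i t x. z i t x - z' i t x) i t x = src z i t x - src z' i t x"
      by (simp add: src_def right_diff_distrib sum_subtractf)
    then show ?case using elim by (simp add: right_diff_distrib)
  qed
  show "i \<noteq> 0 \<Longrightarrow> z i t 0 - z' i t 0 = q i * (z 0 t 0 - z' 0 t 0)"
    using assms t i by (simp add: l2_sol_def right_diff_distrib)
qed

text \<open>Through this lemma the decay estimate also measures the distance between two smooth
  closed-loop solutions.\<close>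

lemma smooth_sol_diff:
  assumes "smooth_sol z zt zx" "smooth_sol z' zt' zx'"
  shows "smooth_sol (\<lambda>i t x. z i t x - z' i t x) (\<lambda>i t x. zt i t x - zt' i t x) (\<lambda>i t x. zx i t x - zx' i t x)"
  unfolding smooth_sol_def
proof (intro allI impI conjI ballI)
  fix i assume i: "i \<le> n"
  note A = assms[unfolded smooth_sol_def, rule_format, OF i]
  show "continuous_on ({0..} \<times> {0..1}) (\<lambda>(t, x). z i t x - z' i t x)"
    "continuous_on ({0..} \<times> {0..1}) (\<lambda>(t, x). zt i t x - zt' i t x)"
    "continuous_on ({0..} \<times> {0..1}) (\<lambda>(t, x). zx i t x - zx' i t x)"
    using A unfolding case_prod_unfold by (auto intro!: continuous_intros)
  fix t :: real assume t: "t \<ge> 0"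
  have c: "continuous_on {0..1} (z j t)" "continuous_on {0..1} (z' j t)" if j: "j \<le> n" for j
    using assms j t unfolding smooth_sol_def by (meson DERIV_continuous_on)+
  show "z i t (inflow i) - z' i t (inflow i) = bval i (\<lambda>j x. z j t x - z' j t x)"
    using A t bval_diff[of "\<lambda>j. z j t" "\<lambda>j. z' j t" i, OF c] by simp
  fix x :: real assume x: "x \<in> {0..1}"
  show "((\<lambda>t. z i t x - z' i t x) has_real_derivative zt i t x - zt' i t x) (at t within {0..})"
    "((\<lambda>x. z i t x - z' i t x) has_real_derivative zx i t x - zx' i t x) (at x within {0..1})"
    using A t x by (auto intro!: DERIV_diff)
  have "src (\<lambda>i t x. z i t x - z' i t x) i t x = src z i t x - src z' i t x"
    by (simp add: src_def right_diff_distrib sum_subtractf)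
  moreover have "zt i t x + a i x * zx i t x = src z i t x" "zt' i t x + a i x * zx' i t x = src z' i t x"
    using A t x by blast+
  ultimately show "zt i t x - zt' i t x + a i x * (zx i t x - zx' i t x) = src (\<lambda>i t x. z i t x - z' i t x) i t x"
    by (simp add: right_diff_distrib)
qed

lemma feedback_diff_L2:
  assumes "\<And>j. j \<le> n \<Longrightarrow> L2I (z j)" "\<And>j. j \<le> n \<Longrightarrow> L2I (z' j)"
  shows "feedback (\<lambda>j x. z j x - z' j x) = feedback z - feedback z'"
  unfolding feedback_def sum_subtractf[symmetric]
proof (rule sum.cong[OF refl])
  fix j assume "j \<in> {..n}"
  then have "(\<lambda>x. kk j x * z j x) integrable_on {0..1}" "(\<lambda>x. kk j x * z' j x) integrable_on {0..1}"
    by (auto intro!: L2_on_prod_integrable_on L2_on_continuous kk_cont assms)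
  from integral_diff[OF this]
  show "integral {0..1} (\<lambda>x. kk j x * (z j x - z' j x)) =
    integral {0..1} (\<lambda>x. kk j x * z j x) - integral {0..1} (\<lambda>x. kk j x * z' j x)"
    by (simp add: algebra_simps)
qed

definition Kn where "Kn = (\<Sum>j\<le>n. l2norm (kk j))"

lemma Kn_nonneg: "Kn \<ge> 0" by (simp add: Kn_def sum_nonneg l2norm_nonneg)

lemma feedback_bound:
  assumes z: "\<And>j. j \<le> n \<Longrightarrow> L2I (z j)" and L: "\<And>j. j \<le> n \<Longrightarrow> l2norm (z j) \<le> L"
  shows "\<bar>feedback z\<bar> \<le> Kn * L"
proof -
  have "\<bar>feedback z\<bar> \<le> (\<Sum>j\<le>n. l2norm (kk j) * L)"
    unfolding feedback_def
  proof (rule order_trans[OF sum_abs sum_mono])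
    fix j assume "j \<in> {..n}"
    then have j: "j \<le> n" by simp
    have "\<bar>integral {0..1} (\<lambda>\<xi>. kk j \<xi> * z j \<xi>)\<bar> \<le> l2norm (kk j) * l2norm (z j)"
      by (intro cauchy_schwarz_L2 L2_on_continuous kk_cont z j)
    also have "\<dots> \<le> l2norm (kk j) * L" by (intro mult_left_mono L j l2norm_nonneg)
    finally show "\<bar>integral {0..1} (\<lambda>\<xi>. kk j \<xi> * z j \<xi>)\<bar> \<le> l2norm (kk j) * L" .
  qed
  then show ?thesis by (simp add: Kn_def sum_distrib_right)
qed

text \<open>Weak solutions are limits with inputs that are locally in H1; this derivative shows that
  the feedback along a smooth solution is such an input.\<close>

lemma feedback_deriv:
  assumes s: "smooth_sol z zt zx" and t: "t \<ge> 0"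
  shows "((\<lambda>t. feedback (\<lambda>j. z j t)) has_real_derivative feedback (\<lambda>j. zt j t)) (at t within {0..})"
  unfolding feedback_def
proof (rule DERIV_sum)
  fix j assume "j \<in> {..n}"
  then have j: "j \<le> n" by simp
  note A = s[unfolded smooth_sol_def, rule_format, OF j]
  have c: "continuous_on ({0..} \<times> {0..1}) (\<lambda>(t, x). kk j x * f t x)" if "continuous_on ({0..} \<times> {0..1}) (\<lambda>(t, x). f t x)" for f :: "real \<Rightarrow> real \<Rightarrow> real"
    unfolding case_prod_unfold by (intro continuous_intros continuous_on_comp2[OF that] continuous_on_compose2[OF kk_cont[OF j]]) auto
  show "((\<lambda>t. integral {0..1} (\<lambda>\<xi>. kk j \<xi> * z j t \<xi>)) has_real_derivative integral {0..1} (\<lambda>\<xi>. kk j \<xi> * zt j t \<xi>)) (at t within {0..})"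
    by (rule leibniz_halfline[OF _ _ _ t]) (use A c in \<open>auto intro!: DERIV_cmult\<close>)
qed

end

lemma E_continuous_joint:
  assumes z: "\<And>i. i \<le> n \<Longrightarrow> continuous_on ({0..} \<times> {0..1}) (\<lambda>(t, x). z i t x)"
  shows "E_continuous n (\<lambda>t i. z i t) (\<lambda>t. z 0 t)"
  unfolding E_continuous_def
proof (intro conjI allI impI)
  fix t :: real assume t: "t \<ge> 0"
  have zc: "continuous_on {0..1} (z i t)" if "i \<le> n" for i
    by (rule continuous_on_comp2[OF z[OF that]]) (use t in \<open>auto intro!: continuous_intros\<close>)
  show "in_E n (\<lambda>i. z i t) (z 0 t)" unfolding in_E_def by (auto intro!: L2_on_continuous zc)
  let ?g = "\<lambda>s x. 1 / real n * (\<Sum>i=1..n. \<bar>z i s x - z i t x\<bar>\<^sup>2) + \<bar>z 0 s x - z 0 t x\<bar>\<^sup>2"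
  have c: "continuous_on ({0..} \<times> {0..1}) (\<lambda>p. z i (fst p) (snd p) - z i t (snd p))" if "i \<le> n" for i
    by (intro continuous_intros continuous_on_comp2[OF z[OF that]] continuous_on_compose2[OF zc[OF that]]) auto
  have "continuous_on ({0..} \<times> cbox 0 1) (\<lambda>(s, x). ?g s x)"
    unfolding case_prod_unfold cbox_interval by (intro continuous_intros c) auto
  from integral_continuous_on_param[OF this]
  have "continuous_on {0..} (\<lambda>s. sqrt (integral {0..1} (?g s)))" by (intro continuous_intros) simp
  from bspec[OF this[unfolded continuous_on_def], of t] t show "((\<lambda>s. E_norm n ((\<lambda>i. z i s) - (\<lambda>i. z i t)) (z 0 s - z 0 t)) \<longlongrightarrow> 0) (at t within {0..})"
    by (simp add: E_norm_def)
qed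

text \<open>The difference quotient at \<open>s\<close> is the mean of \<open>z'\<close> over the
  segment from \<open>t\<close> to \<open>s\<close>. This mean is jointly continuous in
  \<open>s\<close> and \<open>x\<close>, also at \<open>s = t\<close>, so differentiability in
  \<open>E\<close> reduces to continuity in \<open>E\<close>.\<close>

lemma E_has_derivative_joint:
  assumes z': "\<And>i. i \<le> n \<Longrightarrow> continuous_on ({0..} \<times> {0..1}) (\<lambda>(t, x). z' i t x)"
    and d: "\<And>i t x. i \<le> n \<Longrightarrow> t \<ge> 0 \<Longrightarrow> x \<in> {0..1} \<Longrightarrow> ((\<lambda>t. z i t x) has_real_derivative z' i t x) (at t within {0..})"
  shows "E_has_derivative n (\<lambda>t i. z i t) (\<lambda>t. z 0 t) (\<lambda>t i. z' i t) (\<lambda>t. z' 0 t)"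
  unfolding E_has_derivative_def
proof (intro allI impI)
  fix t :: real assume t: "t \<ge> 0"
  define h where "h i s x = integral {0..1} (\<lambda>r. z' i (t + r * (s - t)) x)" for i s x
  have pos: "t + r * (s - t) \<ge> 0" if "s \<ge> 0" "r \<in> {0..1}" for s r :: real
  proof -
    have "t + r * (s - t) = (1 - r) * t + r * s" by (simp add: algebra_simps)
    also have "\<dots> \<ge> 0" using that t by simp
    finally show ?thesis .
  qed
  have hc: "continuous_on ({0..} \<times> {0..1}) (\<lambda>(s, x). h i s x)" if i: "i \<le> n" for i
  proof -
    have "continuous_on (({0..} \<times> {0..1}) \<times> cbox 0 1) (\<lambda>(p, r). z' i (t + r * (fst p - t)) (snd p))"
      unfolding case_prod_unfold by (intro continuous_on_comp2[OF z'[OF i]] continuous_intros) (auto intro: pos)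
    from integral_continuous_on_param[OF this] show ?thesis by (simp add: h_def case_prod_unfold)
  qed
  have ht: "h i t x = z' i t x" for i x by (simp add: h_def)
  have hq: "(z i s x - z i t x) / (s - t) = h i s x" if i: "i \<le> n" and s: "s \<ge> 0" "s \<noteq> t" and x: "x \<in> {0..1}" for i s x
  proof -
    have "((\<lambda>r. (s - t) * z' i (t + r * (s - t)) x) has_integral z i (t + 1 * (s - t)) x - z i (t + 0 * (s - t)) x) {0..1}"
    proof (rule fundamental_theorem_of_calculus)
      fix r :: real assume r: "r \<in> {0..1}"
      have "((\<lambda>t. z i t x) has_real_derivative z' i (t + r * (s - t)) x) (at (t + r * (s - t)) within (\<lambda>r. t + r * (s - t)) ` {0..1})"
        by (rule has_field_derivative_subset[OF d]) (use i x pos s r in auto)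
      moreover have "((\<lambda>r. t + r * (s - t)) has_real_derivative (s - t)) (at r within {0..1})"
        by (auto intro!: derivative_eq_intros)
      ultimately have "((\<lambda>t. z i t x) \<circ> (\<lambda>r. t + r * (s - t)) has_real_derivative z' i (t + r * (s - t)) x * (s - t)) (at r within {0..1})"
        by (rule DERIV_image_chain)
      then show "((\<lambda>r. z i (t + r * (s - t)) x) has_vector_derivative (s - t) * z' i (t + r * (s - t)) x) (at r within {0..1})"
        by (simp add: has_real_derivative_iff_has_vector_derivative o_def mult.commute)
    qed simp
    from integral_unique[OF this] have "z i s x - z i t x = integral {0..1} (\<lambda>r. (s - t) * z' i (t + r * (s - t)) x)"
      by simp
    also have "\<dots> = (s - t) * h i s x" unfolding h_def by (rule integral_mult_right)
    finally show ?thesis using s by (simp add: field_simps)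
  qed
  have "((\<lambda>s. E_norm n ((\<lambda>i. h i s) - (\<lambda>i. h i t)) (h 0 s - h 0 t)) \<longlongrightarrow> 0) (at t within {0..})"
    using E_continuous_joint[of n h, OF hc] t unfolding E_continuous_def by blast
  then show "((\<lambda>s. E_norm n (\<lambda>i x. (z i s x - z i t x) / (s - t) - z' i t x) (\<lambda>x. (z 0 s x - z 0 t x) / (s - t) - z' 0 t x)) \<longlongrightarrow> 0) (at t within {0..})"
  proof (rule Lim_transform_within[OF _ zero_less_one])
    fix s :: real assume s: "s \<in> {0..}" "0 < dist s t"
    then show "E_norm n ((\<lambda>i. h i s) - (\<lambda>i. h i t)) (h 0 s - h 0 t) =
        E_norm n (\<lambda>i x. (z i s x - z i t x) / (s - t) - z' i t x) (\<lambda>x. (z 0 s x - z 0 t x) / (s - t) - z' 0 t x)"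
      unfolding E_norm_def
      by (intro arg_cong[where f = sqrt] Henstock_Kurzweil_Integration.integral_cong arg_cong2[where f = "(+)"] arg_cong2[where f = "(*)"] sum.cong refl)
        (auto simp: hq ht)
  qed
qed

lemma has_H1_derivative_C1:
  assumes "\<And>x. x \<in> {a..b} \<Longrightarrow> (f has_real_derivative g x) (at x within {a..b})" "continuous_on {a..b} g"
  shows "has_H1_derivative f g a b"
  unfolding has_H1_derivative_def
proof (intro conjI ballI L2_on_continuous assms(2))
  fix x assume x: "x \<in> {a..b}"
  have "(g has_integral f x - f a) {a..x}"
    by (rule fundamental_theorem_of_calculus)
      (use x in \<open>auto simp: has_real_derivative_iff_has_vector_derivative[symmetric] intro!: has_field_derivative_subset[OF assms(1)]\<close>)
  then show "f x = f a + integral {a..x} g" by (simp add: integral_unique)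
qed

section \<open>Identification with the given system of n+1 equations\<close>

locale nplus1_system = discretized +
  fixes lam_n W_n \<theta>_n :: "nat \<Rightarrow> real \<Rightarrow> real" and \<sigma>_n :: "nat \<Rightarrow> nat \<Rightarrow> real \<Rightarrow> real" and q_n :: "nat \<Rightarrow> real"
  assumes lam_n: "x \<in> {0..1} \<Longrightarrow> i \<in> {1..n} \<Longrightarrow> lam_n i x = lam x (yy i)"
    and W_n: "x \<in> {0..1} \<Longrightarrow> i \<in> {1..n} \<Longrightarrow> W_n i x = W x (yy i)"
    and \<theta>_n: "x \<in> {0..1} \<Longrightarrow> i \<in> {1..n} \<Longrightarrow> \<theta>_n i x = \<theta> x (yy i)"
    and \<sigma>_n: "x \<in> {0..1} \<Longrightarrow> i \<in> {1..n} \<Longrightarrow> j \<in> {1..n} \<Longrightarrow> \<sigma>_n i j x = \<sigma> x (yy i) (yy j)"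
    and q_n: "i \<in> {1..n} \<Longrightarrow> q_n i = qn i"
begin

lemma rhs_i: "1 / real n * (\<Sum>j=1..n. \<sigma>_n i j x * z j t x) + W_n i x * z 0 t x = src z i t x"
  if "x \<in> {0..1}" "i \<in> {1..n}"
  using that by (simp add: src_i \<sigma>_n W_n)

lemma rhs_0: "1 / real n * (\<Sum>j=1..n. \<theta>_n j x * z j t x) = src z 0 t x" if "x \<in> {0..1}"
  using that by (simp add: src_0 \<theta>_n)

lemma smooth_classical:
  assumes s: "smooth_sol z zt zx"
  shows "classical_solution n lam_n \<mu> \<sigma>_n W_n \<theta>_n q_n (\<lambda>t. feedback (\<lambda>i. z i t)) (\<lambda>t i. z i t) (\<lambda>t. z 0 t)"
proof -
  note A = s[unfolded smooth_sol_def, rule_format]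
  have H: "has_H1_derivative (z i t) (zx i t) 0 1" if "i \<le> n" "t \<ge> 0" for i t
    by (rule has_H1_derivative_C1) (use A that in \<open>auto intro!: continuous_on_comp2[of _ "zx i"] continuous_intros\<close>)
  have eqi: "zt i t x + lam_n i x * zx i t x = 1 / real n * (\<Sum>j=1..n. \<sigma>_n i j x * z j t x) + W_n i x * z 0 t x"
    if "t \<ge> 0" "i \<in> {1..n}" "x \<in> {0..1}" for i t x
    unfolding rhs_i[OF that(3,2), of z t] using A[of i] that by (simp add: lam_n a_def)
  have eq0: "zt 0 t x - \<mu> x * zx 0 t x = 1 / real n * (\<Sum>j=1..n. \<theta>_n j x * z j t x)" if "t \<ge> 0" "x \<in> {0..1}" for t x
    unfolding rhs_0[OF that(2), of z t] using A[of 0] that by (simp add: a_def)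
  have bc: "z i t (inflow i) = bval i (\<lambda>j. z j t)" if "t \<ge> 0" "i \<le> n" for t i using A that by blast
  show ?thesis unfolding classical_solution_def
  proof (rule exI[of _ "\<lambda>t i. zt i t"], rule exI[of _ "\<lambda>t. zt 0 t"], rule exI[of _ "\<lambda>t i. zx i t"], rule exI[of _ "\<lambda>t. zx 0 t"],
      intro conjI allI impI ballI)
    show "E_continuous n (\<lambda>t i. z i t) (\<lambda>t. z 0 t)" by (rule E_continuous_joint) (use A in blast)
    show "E_continuous n (\<lambda>t i. zt i t) (\<lambda>t. zt 0 t)" by (rule E_continuous_joint) (use A in blast)
    show "E_has_derivative n (\<lambda>t i. z i t) (\<lambda>t. z 0 t) (\<lambda>t i. zt i t) (\<lambda>t. zt 0 t)"
      by (rule E_has_derivative_joint) (use A in blast)+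
    fix t :: real assume t: "t \<ge> 0"
    show "has_H1_derivative (z 0 t) (zx 0 t) 0 1" by (rule H) (use t in auto)
    show "AE x in lebesgue_on {0..1}. zt 0 t x - \<mu> x * zx 0 t x = 1 / real n * (\<Sum>j=1..n. \<theta>_n j x * z j t x)"
      by (rule AE_I2) (use eq0 t in simp)
    show "z 0 t 1 = feedback (\<lambda>i. z i t)" using bc[OF t, of 0] by (simp add: inflow_def bval_def)
    fix i assume i: "i \<in> {1..n}"
    show "has_H1_derivative (z i t) (zx i t) 0 1" by (rule H) (use t i in auto)
    show "AE x in lebesgue_on {0..1}. zt i t x + lam_n i x * zx i t x = 1 / real n * (\<Sum>j=1..n. \<sigma>_n i j x * z j t x) + W_n i x * z 0 t x"
      by (rule AE_I2) (use eqi t i in simp)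
    show "z i t 0 = q_n i * z 0 t 0" using bc[OF t, of i] i by (simp add: inflow_def bval_def q_n)
  qed
qed

text \<open>Convergence of the difference quotients in \<open>E\<close> is passed on to the
  components; every classical solution then falls under \<open>l2_energy\<close>.\<close>

lemma classical_l2_sol:
  assumes "classical_solution n lam_n \<mu> \<sigma>_n W_n \<theta>_n q_n U u v"
  obtains zt zx where "l2_sol U (\<lambda>i t. comb (u t) (v t) i) zt zx"
proof -
  obtain ut vt ux vx where uv: "E_continuous n u v" and t: "E_continuous n ut vt" and d: "E_has_derivative n u v ut vt" and
        Hu: "\<forall>t\<ge>0. \<forall>i\<in>{1..n}. has_H1_derivative (u t i) (ux t i) 0 1" and
        Hv: "\<forall>t\<ge>0. has_H1_derivative (v t) (vx t) 0 1" and
        eqi: "\<forall>t\<ge>0. \<forall>i\<in>{1..n}. AE x in lebesgue_on {0..1}.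
           ut t i x + lam_n i x * ux t i x = 1 / real n * (\<Sum>j=1..n. \<sigma>_n i j x * u t j x) + W_n i x * v t x" and
        eq0: "\<forall>t\<ge>0. AE x in lebesgue_on {0..1}. vt t x - \<mu> x * vx t x = 1 / real n * (\<Sum>j=1..n. \<theta>_n j x * u t j x)" and
        b0: "\<forall>t\<ge>0. \<forall>i\<in>{1..n}. u t i 0 = q_n i * v t 0" and b1: "\<forall>t\<ge>0. v t 1 = U t"
    using assms unfolding classical_solution_def by blast
  let ?z = "\<lambda>i t. comb (u t) (v t) i" and ?zt = "\<lambda>i t. comb (ut t) (vt t) i" and ?zx = "\<lambda>i t. comb (ux t) (vx t) i"
  have zL: "L2I (?z i t)" "L2I (?zt i t)" if "i \<le> n" "t \<ge> 0" for i t
    using uv t that unfolding E_continuous_def in_E_comb by blast+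
  have "l2_sol U ?z ?zt ?zx" unfolding l2_sol_def
  proof (intro allI impI conjI)
    fix t :: real assume t: "t \<ge> 0"
    show "?z 0 t 1 = U t" using b1 t by (simp add: comb_def)
    fix i assume i: "i \<le> n"
    show "L2I (?zt i t)" by (rule zL[OF i t])
    show "has_H1_derivative (?z i t) (?zx i t) 0 1" using Hu Hv t i by (cases "i = 0") (simp_all add: comb_def)
    show "?z i t 0 = qn i * ?z 0 t 0" if "i \<noteq> 0" using b0 t i that by (simp add: comb_def q_n[symmetric])
    have "AE x in lebesgue_on {0..1}. x \<in> {0..1::real}" by (rule AE_I2) simp
    then show "AE x in lebesgue_on {0..1}. ?zt i t x + a i x * ?zx i t x = src ?z i t x"
    proof (cases "i = 0")
      case True
      from eq0 t have "AE x in lebesgue_on {0..1}. vt t x - \<mu> x * vx t x = 1 / real n * (\<Sum>j=1..n. \<theta>_n j x * u t j x)" by blast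
      with \<open>AE x in lebesgue_on {0..1}. x \<in> {0..1::real}\<close> show ?thesis
      proof eventually_elim
        case (elim x)
        then show ?case using True rhs_0[OF elim(1), of ?z t] by (simp add: comb_def a_def)
      qed
    next
      case False
      then have i': "i \<in> {1..n}" using i by simp
      with eqi t have "AE x in lebesgue_on {0..1}. ut t i x + lam_n i x * ux t i x = 1 / real n * (\<Sum>j=1..n. \<sigma>_n i j x * u t j x) + W_n i x * v t x" by blast
      with \<open>AE x in lebesgue_on {0..1}. x \<in> {0..1::real}\<close> show ?thesis
      proof eventually_elim
        case (elim x)
        then show ?case using False rhs_i[OF elim(1) i', of ?z t] i' by (simp add: comb_def a_def lam_n)
      qed
    qed
    show "((\<lambda>s. l2norm (\<lambda>x. (?z i s x - ?z i t x) / (s - t) - ?zt i t x)) \<longlongrightarrow> 0) (at t within {0..})"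
    proof (rule tendsto_l2norm_from_enorm[OF n_pos _ i, where w = "\<lambda>s i x. (?z i s x - ?z i t x) / (s - t) - ?zt i t x"])
      show "\<forall>\<^sub>F s in at t within {0..}. \<forall>i\<le>n. L2I (\<lambda>x. (?z i s x - ?z i t x) / (s - t) - ?zt i t x)"
        using eventually_at_halfline
      proof (eventually_elim, intro allI impI)
        fix s :: real and i assume "s \<ge> 0" "i \<le> n"
        then show "L2I (\<lambda>x. (?z i s x - ?z i t x) / (s - t) - ?zt i t x)"
          using L2_on_diff[OF L2_on_cmult[OF L2_on_diff[OF zL(1)[of i s] zL(1)[of i t]], of "1 / (s - t)"] zL(2)[of i t]] t by simp
      qed
      have "(\<lambda>s. enorm n (\<lambda>i x. (?z i s x - ?z i t x) / (s - t) - ?zt i t x)) = 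
         (\<lambda>s. E_norm n (\<lambda>i x. (u s i x - u t i x) / (s - t) - ut t i x) (\<lambda>x. (v s x - v t x) / (s - t) - vt t x))"
        by (simp add: enorm_def E_norm_def comb_def)
      then show "((\<lambda>s. enorm n (\<lambda>i x. (?z i s x - ?z i t x) / (s - t) - ?zt i t x)) \<longlongrightarrow> 0) (at t within {0..})"
        using d t unfolding E_has_derivative_def by simp
    qed
  qed
  then show ?thesis by (rule that)
qed

text \<open>The integral of the sum is split into integrals of its terms, each integrable because
  the state is in \<open>E\<close>.\<close>

lemma feedback_law:
  assumes "in_E n u v"
  shows "integral {0..1} (\<lambda>\<xi>. 1 / real n * (\<Sum>i=1..n. k 1 \<xi> (real i / real n) * u i \<xi>) + kbar 1 \<xi> * v \<xi>) = feedback (comb u v)"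
proof -
  have "integral {0..1} (\<lambda>\<xi>. \<Sum>j\<le>n. kk j \<xi> * comb u v j \<xi>) = feedback (comb u v)"
    unfolding feedback_def
  proof (rule integral_sum)
    fix j assume "j \<in> {..n}"
    then show "(\<lambda>\<xi>. kk j \<xi> * comb u v j \<xi>) integrable_on {0..1}"
      using assms by (intro L2_on_prod_integrable_on L2_on_continuous[OF kk_cont]) (auto simp: in_E_comb)
  qed simp
  moreover have "(\<lambda>\<xi>. \<Sum>j\<le>n. kk j \<xi> * comb u v j \<xi>) =
      (\<lambda>\<xi>. 1 / real n * (\<Sum>i=1..n. k 1 \<xi> (real i / real n) * u i \<xi>) + kbar 1 \<xi> * v \<xi>)"
    unfolding sum_split0 by (simp add: kk_def comb_def yy_def sum_distrib_left mult.assoc add.commute)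
  ultimately show ?thesis by simp
qed

lemma feedback_enorm_bound:
  assumes "\<And>i. i \<le> n \<Longrightarrow> L2I (w i)" "\<And>i. i \<le> n \<Longrightarrow> L2I (w' i)"
  shows "\<bar>feedback w - feedback w'\<bar> \<le> Kn * sqrt (real n) * enorm n (\<lambda>i x. w i x - w' i x)"
proof -
  have "\<bar>feedback (\<lambda>i x. w i x - w' i x)\<bar> \<le> Kn * (sqrt (real n) * enorm n (\<lambda>i x. w i x - w' i x))"
    by (rule feedback_bound) (auto intro!: L2_on_diff assms l2norm_le_enorm n_pos)
  then show ?thesis using feedback_diff_L2[of w w', OF assms] by (simp add: mult.assoc)
qed

lemma E_continuous_iff_enorm:
  "E_continuous n u v \<longleftrightarrow> (\<forall>t\<ge>0. (\<forall>i\<le>n. L2I (comb (u t) (v t) i)) \<and>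
     ((\<lambda>s. enorm n (\<lambda>i x. comb (u s) (v s) i x - comb (u t) (v t) i x)) \<longlongrightarrow> 0) (at t within {0..}))"
  unfolding E_continuous_def E_norm_comb_diff in_E_comb by blast

text \<open>The feedback is Lipschitz on \<open>E\<close>, so the closed-loop input inherits
  continuity in time from the state; in particular it is locally square integrable.\<close>

lemma feedback_continuous:
  assumes "E_continuous n u v"
  shows "continuous_on {0..} (\<lambda>t. feedback (comb (u t) (v t)))"
  unfolding continuous_on_def
proof
  fix t :: real assume "t \<in> {0..}"
  then have t: "t \<ge> 0" by simp
  note A = assms[unfolded E_continuous_iff_enorm, rule_format]
  show "((\<lambda>t. feedback (comb (u t) (v t))) \<longlongrightarrow> feedback (comb (u t) (v t))) (at t within {0..})"
  proof (rule LIM_zero_cancel, rule Lim_null_comparison)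
    show "\<forall>\<^sub>F s in at t within {0..}. norm (feedback (comb (u s) (v s)) - feedback (comb (u t) (v t)))
        \<le> Kn * sqrt (real n) * enorm n (\<lambda>i x. comb (u s) (v s) i x - comb (u t) (v t) i x)"
      using eventually_at_halfline
    proof eventually_elim
      case (elim s)
      show ?case unfolding real_norm_def by (rule feedback_enorm_bound) (use A elim t in blast)+
    qed
    show "((\<lambda>s. Kn * sqrt (real n) * enorm n (\<lambda>i x. comb (u s) (v s) i x - comb (u t) (v t) i x)) \<longlongrightarrow> 0) (at t within {0..})"
      using tendsto_mult_left[of _ 0 _ "Kn * sqrt (real n)"] A[OF t] by fastforce
  qed
qed

text \<open>The constants become \<open>sqrt M\<close> and \<open>c / 2\<close> because
  \<open>energy\<close> is the square of the norm. The inputs of the approximants are their own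
  feedbacks, which converge by the Lipschitz bound on \<open>E\<close>; hence the limit state solves
  the system with the feedback of the limit.\<close>

theorem weak_solution_exists:
  assumes decay: "\<And>z zt zx t. smooth_sol z zt zx \<Longrightarrow> t \<ge> 0 \<Longrightarrow>
      energy (\<lambda>i. z i t) \<le> M * exp (- c * t) * energy (\<lambda>i. z i 0)"
    and M: "M > 0" and c: "c > 0" and uv0: "in_E n u0 v0"
  obtains u v where "weak_solution n lam_n \<mu> \<sigma>_n W_n \<theta>_n q_n u0 v0 (\<lambda>t. feedback (comb (u t) (v t))) u v"
    "\<And>t. t \<ge> 0 \<Longrightarrow> E_norm n (u t) (v t) \<le> sqrt M * exp (- (c / 2) * t) * E_norm n u0 v0"
proof -
  define z0 where "z0 = comb u0 v0"
  have z0: "L2I (z0 i)" if "i \<le> n" for i using uv0 that by (simp add: in_E_comb z0_def)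
  have en: "enorm n w = sqrt (energy w)" for w by (simp add: enorm_def energy_def)
  have edecay: "enorm n (\<lambda>i. z i t) \<le> sqrt M * exp (- (c / 2) * t) * enorm n (\<lambda>i. z i 0)"
    if "smooth_sol z zt zx" "t \<ge> 0" for z zt zx t
  proof -
    have "enorm n (\<lambda>i. z i t) \<le> sqrt (M * exp (- c * t) * energy (\<lambda>i. z i 0))"
      unfolding en by (rule real_sqrt_le_mono[OF decay[OF that]])
    also have "\<dots> = sqrt M * sqrt (exp (- c * t)) * enorm n (\<lambda>i. z i 0)"
      by (simp add: real_sqrt_mult en)
    also have "sqrt (exp (- c * t)) = exp (- (c / 2) * t)"
      by (rule real_sqrt_unique) (simp_all add: power2_eq_square exp_add[symmetric])
    finally show ?thesis .
  qed
  have "\<exists>z zt zx. smooth_sol z zt zx \<and> (\<forall>i\<le>n. l2norm (\<lambda>x. z i 0 x - z0 i x) < 1 / real (Suc m))" for m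
    by (rule smooth_dense[of z0 "1 / real (Suc m)"]) (use z0 in auto)
  then obtain z zt zx where sol: "\<And>m. smooth_sol (z m) (zt m) (zx m)"
    and init: "\<And>m i. i \<le> n \<Longrightarrow> l2norm (\<lambda>x. z m i 0 x - z0 i x) < 1 / real (Suc m)" by metis
  note S = sol[unfolded smooth_sol_def, rule_format]
  have zL: "L2I (z m i t)" if "i \<le> n" "t \<ge> 0" for m i t
    by (rule L2_on_continuous, rule continuous_on_comp2[of _ "z m i"]) (use S that in \<open>auto intro!: continuous_intros\<close>)
  \<comment> \<open>Bound for the distance of the initial data in \<open>E\<close>: there are
    \<open>n + 1\<close> components, each closer than \<open>1 / real (Suc m)\<close>.\<close>
  define \<eta> where "\<eta> m = real (Suc n) * (1 / real (Suc m))" for m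
  have \<eta>0: "\<eta> \<longlonglongrightarrow> 0" unfolding \<eta>_def[abs_def]
    using tendsto_mult_left[OF LIMSEQ_inverse_real_of_nat, of "real (Suc n)"] by (simp add: inverse_eq_divide)
  have e0: "enorm n (\<lambda>i x. z m i 0 x - z0 i x) \<le> \<eta> m" for m
  proof -
    have "enorm n (\<lambda>i x. z m i 0 x - z0 i x) \<le> (\<Sum>i\<le>n. l2norm (\<lambda>x. z m i 0 x - z0 i x))"
      by (rule enorm_le_sum) (intro L2_on_diff zL z0, auto)
    also have "\<dots> \<le> (\<Sum>i\<le>n. 1 / real (Suc m))" by (rule sum_mono, rule less_imp_le, rule init) simp
    also have "\<dots> = \<eta> m" by (simp add: \<eta>_def)
    finally show ?thesis .
  qed
  define D where "D m = sqrt M * \<eta> m" for m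
  have D0: "D \<longlonglongrightarrow> 0" unfolding D_def[abs_def] using tendsto_mult_left[OF \<eta>0, of "sqrt M"] by simp
  have cauchy: "enorm n (\<lambda>i x. z m i t x - z l i t x) \<le> D m + D l" if t: "t \<ge> 0" for m l t
  proof -
    have "enorm n (\<lambda>i x. z m i t x - z l i t x) \<le> sqrt M * exp (- (c / 2) * t) * enorm n (\<lambda>i x. z m i 0 x - z l i 0 x)"
      by (rule edecay[OF smooth_sol_diff[OF sol sol] t])
    also have "\<dots> \<le> sqrt M * 1 * (\<eta> m + \<eta> l)"
    proof (intro mult_mono)
      have "enorm n (\<lambda>i x. z m i 0 x - z l i 0 x) \<le> enorm n (\<lambda>i x. z m i 0 x - z0 i x) + enorm n (\<lambda>i x. z0 i x - z l i 0 x)"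
        by (rule enorm_triangle_diff) (intro zL z0; simp)+
      then show "enorm n (\<lambda>i x. z m i 0 x - z l i 0 x) \<le> \<eta> m + \<eta> l"
        using e0[of m] e0[of l] enorm_minus_commute[of n z0 "\<lambda>i. z l i 0"] by linarith
    qed (use t c M in \<open>auto simp: enorm_nonneg\<close>)
    finally show ?thesis by (simp add: D_def distrib_left)
  qed
  have "\<exists>g. L2I g \<and> (\<lambda>m. l2norm (\<lambda>x. z m i t x - g x)) \<longlonglongrightarrow> 0" if i: "i \<le> n" and t: "t \<ge> 0" for i t
  proof (rule L2_complete[of "\<lambda>m. z m i t"])
    fix \<epsilon> :: real assume \<epsilon>: "\<epsilon> > 0"
    have "(\<lambda>m. sqrt (real n) * D m) \<longlonglongrightarrow> 0" using tendsto_mult_left[OF D0, of "sqrt (real n)"] by simp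
    from order_tendstoD(2)[OF this, of "\<epsilon> / 2"] \<epsilon>
    obtain N where N: "\<And>m. m \<ge> N \<Longrightarrow> sqrt (real n) * D m < \<epsilon> / 2" by (auto simp: eventually_sequentially)
    have "l2norm (\<lambda>x. z m i t x - z l i t x) < \<epsilon>" if "m \<ge> N" "l \<ge> N" for m l
    proof -
      have "l2norm (\<lambda>x. z m i t x - z l i t x) \<le> sqrt (real n) * enorm n (\<lambda>i x. z m i t x - z l i t x)"
        by (rule l2norm_le_enorm[OF n_pos _ i, of "\<lambda>i x. z m i t x - z l i t x"]) (intro L2_on_diff zL t)
      also have "\<dots> \<le> sqrt (real n) * (D m + D l)" by (rule mult_left_mono[OF cauchy[OF t]]) simp
      also have "\<dots> = sqrt (real n) * D m + sqrt (real n) * D l" by (rule distrib_left)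
      finally show ?thesis using N[OF that(1)] N[OF that(2)] by linarith
    qed
    then show "\<exists>N. \<forall>m\<ge>N. \<forall>k\<ge>N. l2norm (\<lambda>x. z m i t x - z k i t x) < \<epsilon>" by blast
  qed (use zL i t in blast)+
  then obtain g where gL: "\<And>i t. i \<le> n \<Longrightarrow> t \<ge> 0 \<Longrightarrow> L2I (g i t)"
    and glim: "\<And>i t. i \<le> n \<Longrightarrow> t \<ge> 0 \<Longrightarrow> (\<lambda>m. l2norm (\<lambda>x. z m i t x - g i t x)) \<longlonglongrightarrow> 0" by metis
  \<comment> \<open>The Cauchy estimate is taken to the limit in \<open>l\<close> at each fixed
    \<open>t\<close>. The bound \<open>D m\<close> does not depend on \<open>t\<close>, which makes
    the convergence uniform on the half-line.\<close>
  have conv: "enorm n (\<lambda>i x. z m i t x - g i t x) \<le> D m" if t: "t \<ge> 0" for m t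
  proof (rule LIMSEQ_le_const)
    have "(\<lambda>l. D m + D l + (\<Sum>i\<le>n. l2norm (\<lambda>x. z l i t x - g i t x))) \<longlonglongrightarrow> D m + 0 + (\<Sum>i\<le>n. 0)"
      by (intro tendsto_intros D0 glim t) auto
    then show "(\<lambda>l. D m + D l + (\<Sum>i\<le>n. l2norm (\<lambda>x. z l i t x - g i t x))) \<longlonglongrightarrow> D m" by simp
    have "enorm n (\<lambda>i x. z m i t x - g i t x) \<le> D m + D l + (\<Sum>i\<le>n. l2norm (\<lambda>x. z l i t x - g i t x))" for l
    proof -
      have "enorm n (\<lambda>i x. z m i t x - g i t x) \<le> enorm n (\<lambda>i x. z m i t x - z l i t x) + enorm n (\<lambda>i x. z l i t x - g i t x)"
        by (rule enorm_triangle_diff) (intro zL gL t; simp)+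
      moreover have "enorm n (\<lambda>i x. z l i t x - g i t x) \<le> (\<Sum>i\<le>n. l2norm (\<lambda>x. z l i t x - g i t x))"
        by (rule enorm_le_sum) (intro L2_on_diff zL gL t)
      ultimately show ?thesis using cauchy[OF t, of m l] by linarith
    qed
    then show "\<exists>N. \<forall>l\<ge>N. enorm n (\<lambda>i x. z m i t x - g i t x) \<le> D m + D l + (\<Sum>i\<le>n. l2norm (\<lambda>x. z l i t x - g i t x))" by blast
  qed
  define u v where "u t i = g i t" and "v t = g 0 t" for t i
  have cg: "comb (u t) (v t) = (\<lambda>i. g i t)" for t by (auto simp: u_def v_def comb_def)
  have cz: "comb (\<lambda>i. z m i t) (z m 0 t) = (\<lambda>i. z m i t)" for m t by (auto simp: comb_def)
  have zcont: "E_continuous n (\<lambda>t i. z m i t) (\<lambda>t. z m 0 t)" for m by (rule E_continuous_joint) (use S in blast)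
  have gcont: "E_continuous n u v" unfolding E_continuous_iff_enorm cg
  proof (intro allI impI conjI gL tendstoI)
    fix t \<epsilon> :: real assume t: "t \<ge> 0" and \<epsilon>: "\<epsilon> > 0"
    obtain m where m: "D m < \<epsilon> / 3"
      using order_tendstoD(2)[OF D0, of "\<epsilon> / 3"] \<epsilon> by (auto simp: eventually_sequentially)
    have "((\<lambda>s. enorm n (\<lambda>i x. z m i s x - z m i t x)) \<longlongrightarrow> 0) (at t within {0..})"
      using zcont[of m] t unfolding E_continuous_iff_enorm cz by blast
    then have "\<forall>\<^sub>F s in at t within {0..}. enorm n (\<lambda>i x. z m i s x - z m i t x) < \<epsilon> / 3"
      by (rule order_tendstoD) (use \<epsilon> in simp)
    then show "\<forall>\<^sub>F s in at t within {0..}. dist (enorm n (\<lambda>i x. g i s x - g i t x)) 0 < \<epsilon>"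
      using eventually_at_halfline
    proof eventually_elim
      case (elim s)
      have "enorm n (\<lambda>i x. g i s x - g i t x) \<le> enorm n (\<lambda>i x. g i s x - z m i s x) + enorm n (\<lambda>i x. z m i s x - g i t x)"
        by (rule enorm_triangle_diff) (intro zL gL t elim; simp)+
      moreover have "enorm n (\<lambda>i x. z m i s x - g i t x) \<le> enorm n (\<lambda>i x. z m i s x - z m i t x) + enorm n (\<lambda>i x. z m i t x - g i t x)"
        by (rule enorm_triangle_diff) (intro zL gL t elim; simp)+
      ultimately have "enorm n (\<lambda>i x. g i s x - g i t x) < \<epsilon>"
        using elim m conv[OF t, of m] conv[OF elim(2), of m] enorm_minus_commute[of n "\<lambda>i. g i s" "\<lambda>i. z m i s"] by linarith
      then show ?case by (simp add: enorm_nonneg)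
    qed
  qed
  have bound: "E_norm n (u t) (v t) \<le> sqrt M * exp (- (c / 2) * t) * E_norm n u0 v0" if t: "t \<ge> 0" for t
    unfolding E_norm_comb cg z0_def[symmetric]
  proof (rule LIMSEQ_le_const)
    let ?e = "sqrt M * exp (- (c / 2) * t)"
    have "(\<lambda>m. D m + ?e * (\<eta> m + enorm n z0)) \<longlonglongrightarrow> 0 + ?e * (0 + enorm n z0)"
      by (intro tendsto_intros D0 \<eta>0)
    then show "(\<lambda>m. D m + ?e * (\<eta> m + enorm n z0)) \<longlonglongrightarrow> ?e * enorm n z0" by simp
    have "enorm n (\<lambda>i. g i t) \<le> D m + ?e * (\<eta> m + enorm n z0)" for m
    proof -
      have 1: "enorm n (\<lambda>i. g i t) \<le> enorm n (\<lambda>i x. g i t x - z m i t x) + enorm n (\<lambda>i. z m i t)"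
        by (rule enorm_triangle_sub) (intro gL zL t; simp)+
      have 2: "enorm n (\<lambda>i. z m i 0) \<le> enorm n (\<lambda>i x. z m i 0 x - z0 i x) + enorm n z0"
        by (rule enorm_triangle_sub) (intro z0 zL; simp)+
      have "?e * enorm n (\<lambda>i. z m i 0) \<le> ?e * (\<eta> m + enorm n z0)"
        by (intro mult_left_mono) (use 2 e0[of m] M in auto)
      then show ?thesis
        using 1 edecay[OF sol[of m] t] conv[OF t, of m] enorm_minus_commute[of n "\<lambda>i. g i t" "\<lambda>i. z m i t"] by linarith
    qed
    then show "\<exists>N. \<forall>m\<ge>N. enorm n (\<lambda>i. g i t) \<le> D m + ?e * (\<eta> m + enorm n z0)" by blast
  qed
  define U where "U t = feedback (\<lambda>i. g i t)" for t
  define V where "V m t = feedback (\<lambda>i. z m i t)" for m t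
  have Ucont: "continuous_on {0..} U" using feedback_continuous[OF gcont] unfolding cg U_def[abs_def] .
  have Vcont: "continuous_on {0..} (V m)" for m using feedback_continuous[OF zcont[of m]] unfolding cz V_def[abs_def] .
  have VU: "\<bar>V m t - U t\<bar> \<le> Kn * sqrt (real n) * D m" if t: "t \<ge> 0" for m t
  proof -
    have "\<bar>V m t - U t\<bar> \<le> Kn * sqrt (real n) * enorm n (\<lambda>i x. z m i t x - g i t x)"
      unfolding U_def V_def by (rule feedback_enorm_bound) (intro zL gL t; assumption)+
    also have "\<dots> \<le> Kn * sqrt (real n) * D m" by (intro mult_left_mono conv t mult_nonneg_nonneg Kn_nonneg) simp
    finally show ?thesis .
  qed
  have "weak_solution n lam_n \<mu> \<sigma>_n W_n \<theta>_n q_n u0 v0 U u v"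
    unfolding weak_solution_def
  proof (intro conjI uv0 gcont exI[of _ V] exI[of _ "\<lambda>m t i. z m i t"] exI[of _ "\<lambda>m t. z m 0 t"] allI impI)
    show "L2_loc U" unfolding L2_loc_def
      by (intro allI impI L2_on_continuous continuous_on_subset[OF Ucont]) auto
    show "H1_loc (V m)" for m unfolding H1_loc_def
    proof (intro allI impI exI[of _ "\<lambda>t. feedback (\<lambda>j. zt m j t)"] has_H1_derivative_C1)
      fix T :: real
      show "(V m has_real_derivative feedback (\<lambda>j. zt m j x)) (at x within {0..T})" if "x \<in> {0..T}" for x
        using feedback_deriv[OF sol[of m], of x] that unfolding V_def[abs_def] by (rule_tac has_field_derivative_subset) auto
      show "continuous_on {0..T} (\<lambda>t. feedback (\<lambda>j. zt m j t))"
        by (rule continuous_on_subset[OF feedback_cont]) (use S in auto)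
    qed
    show "classical_solution n lam_n \<mu> \<sigma>_n W_n \<theta>_n q_n (V m) (\<lambda>t i. z m i t) (\<lambda>t. z m 0 t)" for m
      using smooth_classical[OF sol[of m]] unfolding V_def[abs_def] .
    show "(\<lambda>m. E_norm n ((\<lambda>i. z m i 0) - u0) (z m 0 0 - v0)) \<longlonglongrightarrow> 0"
      unfolding E_norm_comb_diff cz z0_def[symmetric]
      by (rule Lim_null_comparison[OF _ \<eta>0]) (use e0 in \<open>simp add: enorm_nonneg\<close>)
    fix T :: real assume T: "T > 0"
    show "(\<lambda>m. integral {0..T} (\<lambda>t. (V m t - U t)\<^sup>2)) \<longlonglongrightarrow> 0"
    proof (rule Lim_null_comparison)
      have "(\<lambda>m. (Kn * sqrt (real n) * D m)\<^sup>2 * T) \<longlonglongrightarrow> (Kn * sqrt (real n) * 0)\<^sup>2 * T" by (intro tendsto_intros D0)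
      then show "(\<lambda>m. (Kn * sqrt (real n) * D m)\<^sup>2 * T) \<longlonglongrightarrow> 0" by simp
      have "norm (integral {0..T} (\<lambda>t. (V m t - U t)\<^sup>2)) \<le> (Kn * sqrt (real n) * D m)\<^sup>2 * (T - 0)" for m
      proof (rule integral_bound)
        show "continuous_on {0..T} (\<lambda>t. (V m t - U t)\<^sup>2)"
          by (intro continuous_intros continuous_on_subset[OF Ucont] continuous_on_subset[OF Vcont]) auto
        show "norm ((V m t - U t)\<^sup>2) \<le> (Kn * sqrt (real n) * D m)\<^sup>2" if "t \<in> {0..T}" for t
          using power_mono[OF VU[of t m], of 2] that by simp
      qed (use T in simp)
      then show "\<forall>\<^sub>F m in sequentially. norm (integral {0..T} (\<lambda>t. (V m t - U t)\<^sup>2)) \<le> (Kn * sqrt (real n) * D m)\<^sup>2 * T" by simp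
    qed
    show "uniform_limit {0..T} (\<lambda>m t. E_norm n ((\<lambda>i. z m i t) - u t) (z m 0 t - v t)) (\<lambda>t. 0) sequentially"
      unfolding E_norm_comb_diff cz cg
    proof (rule uniform_limitI)
      fix \<epsilon> :: real assume "\<epsilon> > 0"
      from order_tendstoD(2)[OF D0 this]
      show "\<forall>\<^sub>F m in sequentially. \<forall>t\<in>{0..T}. dist (enorm n (\<lambda>i x. z m i t x - g i t x)) 0 < \<epsilon>"
      proof eventually_elim
        case (elim m)
        have "enorm n (\<lambda>i x. z m i t x - g i t x) < \<epsilon>" if "t \<in> {0..T}" for t using conv[of t m] elim that by simp
        then show ?case by (simp add: enorm_nonneg)
      qed
    qed
  qed
  then have "weak_solution n lam_n \<mu> \<sigma>_n W_n \<theta>_n q_n u0 v0 (\<lambda>t. feedback (comb (u t) (v t))) u v"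
    unfolding cg U_def[abs_def] .
  from that[OF this bound] show ?thesis by blast
qed

text \<open>The classical approximants of the two weak solutions have arbitrary inputs, so
  closed-loop decay says nothing about them. The estimate with prescribed input is applied to their
  differences; only in the limit is the input difference a feedback of the state difference. The
  result is a Gronwall inequality for the squared distance.\<close>

theorem weak_solution_unique:
  assumes w1: "weak_solution n lam_n \<mu> \<sigma>_n W_n \<theta>_n q_n u0 v0 U u v"
    and w2: "weak_solution n lam_n \<mu> \<sigma>_n W_n \<theta>_n q_n u0 v0 U' u' v'"
    and U: "\<And>t. t \<ge> 0 \<Longrightarrow> U t = feedback (comb (u t) (v t))"
    and U': "\<And>t. t \<ge> 0 \<Longrightarrow> U' t = feedback (comb (u' t) (v' t))"
    and T: "T \<ge> 0"
  shows "E_norm n (u' T - u T) (v' T - v T) = 0"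
proof -
  have uv0: "in_E n u0 v0" and uv: "E_continuous n u v" and uv': "E_continuous n u' v'"
    using w1 w2 unfolding weak_solution_def by blast+
  obtain Um um vm where A: "\<forall>m. H1_loc (Um m) \<and> classical_solution n lam_n \<mu> \<sigma>_n W_n \<theta>_n q_n (Um m) (um m) (vm m)"
    and i0: "(\<lambda>m. E_norm n (um m 0 - u0) (vm m 0 - v0)) \<longlonglongrightarrow> 0"
    and Ul: "\<forall>T>0. (\<lambda>m. integral {0..T} (\<lambda>t. (Um m t - U t)\<^sup>2)) \<longlonglongrightarrow> 0"
    and ul: "\<forall>T>0. uniform_limit {0..T} (\<lambda>m t. E_norm n (um m t - u t) (vm m t - v t)) (\<lambda>t. 0) sequentially"
    using w1 unfolding weak_solution_def by blast
  obtain Um' um' vm' where A': "\<forall>m. H1_loc (Um' m) \<and> classical_solution n lam_n \<mu> \<sigma>_n W_n \<theta>_n q_n (Um' m) (um' m) (vm' m)"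
    and i0': "(\<lambda>m. E_norm n (um' m 0 - u0) (vm' m 0 - v0)) \<longlonglongrightarrow> 0"
    and Ul': "\<forall>T>0. (\<lambda>m. integral {0..T} (\<lambda>t. (Um' m t - U' t)\<^sup>2)) \<longlonglongrightarrow> 0"
    and ul': "\<forall>T>0. uniform_limit {0..T} (\<lambda>m t. E_norm n (um' m t - u' t) (vm' m t - v' t)) (\<lambda>t. 0) sequentially"
    using w2 unfolding weak_solution_def by blast
  note H = A[rule_format, THEN conjunct1] and cl = A[rule_format, THEN conjunct2]
    and H' = A'[rule_format, THEN conjunct1] and cl' = A'[rule_format, THEN conjunct2]
  note Ul = Ul[rule_format] and Ul' = Ul'[rule_format] and ul = ul[rule_format] and ul' = ul'[rule_format]
  define z z' where "z i t = comb (u t) (v t) i" and "z' i t = comb (u' t) (v' t) i" for i t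
  define y y' where "y m i t = comb (um m t) (vm m t) i" and "y' m i t = comb (um' m t) (vm' m t) i" for m i t
  have "\<exists>zt zx. l2_sol (Um m) (y m) zt zx" for m
    by (rule classical_l2_sol[OF cl[of m]]) (unfold y_def[abs_def], blast)
  then obtain yt yx where sol: "\<And>m. l2_sol (Um m) (y m) (yt m) (yx m)" by metis
  have "\<exists>zt zx. l2_sol (Um' m) (y' m) zt zx" for m
    by (rule classical_l2_sol[OF cl'[of m]]) (unfold y'_def[abs_def], blast)
  then obtain yt' yx' where sol': "\<And>m. l2_sol (Um' m) (y' m) (yt' m) (yx' m)" by metis
  have yL: "L2I (y m i t)" "L2I (y' m i t)" if "i \<le> n" "t \<ge> 0" for m i t
    using sol[of m] sol'[of m] that H1_L2(1) unfolding l2_sol_def by blast+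
  have zL: "L2I (z i t)" "L2I (z' i t)" if "i \<le> n" "t \<ge> 0" for i t
    using uv uv' that unfolding E_continuous_iff_enorm z_def z'_def by blast+
  have z0L: "L2I (comb u0 v0 i)" if "i \<le> n" for i using uv0 that by (simp add: in_E_comb)
  have lim: "(\<lambda>m. l2norm (\<lambda>x. y m i t x - z i t x)) \<longlonglongrightarrow> 0" "(\<lambda>m. l2norm (\<lambda>x. y' m i t x - z' i t x)) \<longlonglongrightarrow> 0"
    if i: "i \<le> n" and t: "t \<ge> 0" for i t
  proof -
    \<comment> \<open>Uniform convergence is given on intervals \<open>{0..T}\<close> with
      \<open>T > 0\<close>, whereas \<open>t\<close> may be \<open>0\<close>.\<close>
    have "t \<in> {0..t + 1}" "t + 1 > 0" using t by auto
    then have "(\<lambda>m. E_norm n (um m t - u t) (vm m t - v t)) \<longlonglongrightarrow> 0" "(\<lambda>m. E_norm n (um' m t - u' t) (vm' m t - v' t)) \<longlonglongrightarrow> 0"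
      using tendsto_uniform_limitI[OF ul] tendsto_uniform_limitI[OF ul'] by blast+
    then have e: "(\<lambda>m. enorm n (\<lambda>i x. y m i t x - z i t x)) \<longlonglongrightarrow> 0" "(\<lambda>m. enorm n (\<lambda>i x. y' m i t x - z' i t x)) \<longlonglongrightarrow> 0"
      unfolding E_norm_comb_diff y_def z_def y'_def z'_def .
    show "(\<lambda>m. l2norm (\<lambda>x. y m i t x - z i t x)) \<longlonglongrightarrow> 0"
      by (rule tendsto_l2norm_from_enorm[OF n_pos _ i e(1)]) (use t in \<open>auto intro!: always_eventually L2_on_diff yL zL\<close>)
    show "(\<lambda>m. l2norm (\<lambda>x. y' m i t x - z' i t x)) \<longlonglongrightarrow> 0"
      by (rule tendsto_l2norm_from_enorm[OF n_pos _ i e(2)]) (use t in \<open>auto intro!: always_eventually L2_on_diff yL zL\<close>)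
  qed
  have lim0: "(\<lambda>m. l2norm (\<lambda>x. y m i 0 x - y' m i 0 x)) \<longlonglongrightarrow> 0" if i: "i \<le> n" for i
  proof -
    have e: "(\<lambda>m. enorm n (\<lambda>i x. y m i 0 x - comb u0 v0 i x)) \<longlonglongrightarrow> 0" "(\<lambda>m. enorm n (\<lambda>i x. y' m i 0 x - comb u0 v0 i x)) \<longlonglongrightarrow> 0"
      using i0 i0' unfolding E_norm_comb_diff y_def y'_def .
    have 1: "(\<lambda>m. l2norm (\<lambda>x. y m i 0 x - comb u0 v0 i x)) \<longlonglongrightarrow> 0"
      by (rule tendsto_l2norm_from_enorm[OF n_pos _ i e(1)]) (auto intro!: always_eventually L2_on_diff yL z0L)
    have 2: "(\<lambda>m. l2norm (\<lambda>x. y' m i 0 x - comb u0 v0 i x)) \<longlonglongrightarrow> 0"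
      by (rule tendsto_l2norm_from_enorm[OF n_pos _ i e(2)]) (auto intro!: always_eventually L2_on_diff yL z0L)
    show ?thesis
    proof (rule Lim_null_comparison)
      show "(\<lambda>m. l2norm (\<lambda>x. y m i 0 x - comb u0 v0 i x) + l2norm (\<lambda>x. y' m i 0 x - comb u0 v0 i x)) \<longlonglongrightarrow> 0"
        using tendsto_add[OF 1 2] by simp
      have "l2norm (\<lambda>x. y m i 0 x - y' m i 0 x) \<le> l2norm (\<lambda>x. y m i 0 x - comb u0 v0 i x) + l2norm (\<lambda>x. y' m i 0 x - comb u0 v0 i x)" for m
        using l2norm_triangle_diff[of "y m i 0" "comb u0 v0 i" "y' m i 0"] yL[OF i] z0L[OF i]
          l2norm_minus_commute[of "y' m i 0" "comb u0 v0 i"] by simp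
      then show "\<forall>\<^sub>F m in sequentially. norm (l2norm (\<lambda>x. y m i 0 x - y' m i 0 x)) \<le> l2norm (\<lambda>x. y m i 0 x - comb u0 v0 i x) + l2norm (\<lambda>x. y' m i 0 x - comb u0 v0 i x)"
        by (simp add: l2norm_nonneg)
    qed
  qed
  define d where "d i t x = z i t x - z' i t x" for i t x
  define S where "S t = (\<Sum>i\<le>n. (l2norm (d i t))\<^sup>2)" for t
  define Sm where "Sm m t = (\<Sum>i\<le>n. (l2norm (\<lambda>x. y m i t x - y' m i t x))\<^sup>2)" for m t
  have dL: "L2I (d i t)" if "i \<le> n" "t \<ge> 0" for i t unfolding d_def[abs_def] by (intro L2_on_diff zL that)
  have Sm_lim: "(\<lambda>m. Sm m t) \<longlonglongrightarrow> S t" if t: "t \<ge> 0" for t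
    unfolding Sm_def S_def
  proof (intro tendsto_sum tendsto_power tendsto_l2norm)
    fix i assume "i \<in> {..n}"
    then have i: "i \<le> n" by simp
    show "L2I (d i t)" by (rule dL[OF i t])
    show "\<forall>\<^sub>F m in sequentially. L2I (\<lambda>x. y m i t x - y' m i t x)" by (intro always_eventually allI L2_on_diff yL i t)
    show "(\<lambda>m. l2norm (\<lambda>x. y m i t x - y' m i t x - d i t x)) \<longlonglongrightarrow> 0"
    proof (rule Lim_null_comparison)
      show "(\<lambda>m. l2norm (\<lambda>x. y m i t x - z i t x) + l2norm (\<lambda>x. z' i t x - y' m i t x)) \<longlonglongrightarrow> 0"
        using tendsto_add[OF lim[OF i t]] l2norm_minus_commute[of "z' i t"] by simp
      have "l2norm (\<lambda>x. y m i t x - y' m i t x - d i t x) \<le> l2norm (\<lambda>x. y m i t x - z i t x) + l2norm (\<lambda>x. z' i t x - y' m i t x)" for m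
      proof -
        have "l2norm (\<lambda>x. (y m i t x - z i t x) + (z' i t x - y' m i t x)) \<le> l2norm (\<lambda>x. y m i t x - z i t x) + l2norm (\<lambda>x. z' i t x - y' m i t x)"
          by (rule l2norm_triangle) (intro L2_on_diff yL zL i t)+
        then show ?thesis by (simp add: d_def algebra_simps)
      qed
      then show "\<forall>\<^sub>F m in sequentially. norm (l2norm (\<lambda>x. y m i t x - y' m i t x - d i t x)) \<le> l2norm (\<lambda>x. y m i t x - z i t x) + l2norm (\<lambda>x. z' i t x - y' m i t x)"
        by (simp add: l2norm_nonneg)
    qed
  qed
  have Sm0: "(\<lambda>m. Sm m 0) \<longlonglongrightarrow> 0"
  proof -
    have "(\<lambda>m. Sm m 0) \<longlonglongrightarrow> (\<Sum>i\<le>n. 0\<^sup>2)" unfolding Sm_def by (intro tendsto_sum tendsto_power lim0) simp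
    then show ?thesis by simp
  qed
  have Scont: "continuous_on {0..} S"
    unfolding S_def[abs_def]
  proof (intro continuous_on_sum continuous_on_power)
    fix i assume "i \<in> {..n}"
    then have i: "i \<le> n" by simp
    show "continuous_on {0..} (\<lambda>t. l2norm (d i t))" unfolding continuous_on_def
    proof
      fix t :: real assume "t \<in> {0..}"
      then have t: "t \<ge> 0" by simp
      have e: "((\<lambda>s. enorm n (\<lambda>i x. z i s x - z i t x)) \<longlongrightarrow> 0) (at t within {0..})"
        "((\<lambda>s. enorm n (\<lambda>i x. z' i s x - z' i t x)) \<longlongrightarrow> 0) (at t within {0..})"
        using uv uv' t unfolding E_continuous_iff_enorm z_def z'_def by blast+
      have 1: "((\<lambda>s. l2norm (\<lambda>x. z i s x - z i t x)) \<longlongrightarrow> 0) (at t within {0..})"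
        by (rule tendsto_l2norm_from_enorm[OF n_pos _ i e(1)])
          (rule eventually_mono[OF eventually_at_halfline], intro allI impI L2_on_diff zL t; assumption)
      have 2: "((\<lambda>s. l2norm (\<lambda>x. z' i s x - z' i t x)) \<longlongrightarrow> 0) (at t within {0..})"
        by (rule tendsto_l2norm_from_enorm[OF n_pos _ i e(2)])
          (rule eventually_mono[OF eventually_at_halfline], intro allI impI L2_on_diff zL t; assumption)
      show "((\<lambda>s. l2norm (d i s)) \<longlongrightarrow> l2norm (d i t)) (at t within {0..})"
      proof (rule tendsto_l2norm[OF _ dL[OF i t]])
        show "\<forall>\<^sub>F s in at t within {0..}. L2I (d i s)"
          by (rule eventually_mono[OF eventually_at_halfline]) (rule dL[OF i])
        show "((\<lambda>s. l2norm (\<lambda>x. d i s x - d i t x)) \<longlongrightarrow> 0) (at t within {0..})"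
        proof (rule Lim_null_comparison)
          show "((\<lambda>s. l2norm (\<lambda>x. z i s x - z i t x) + l2norm (\<lambda>x. z' i t x - z' i s x)) \<longlongrightarrow> 0) (at t within {0..})"
            using tendsto_add[OF 1 2] l2norm_minus_commute[of "z' i t"] by simp
          show "\<forall>\<^sub>F s in at t within {0..}. norm (l2norm (\<lambda>x. d i s x - d i t x)) \<le> l2norm (\<lambda>x. z i s x - z i t x) + l2norm (\<lambda>x. z' i t x - z' i s x)"
            using eventually_at_halfline
          proof eventually_elim
            case (elim s)
            have "l2norm (\<lambda>x. (z i s x - z i t x) + (z' i t x - z' i s x)) \<le> l2norm (\<lambda>x. z i s x - z i t x) + l2norm (\<lambda>x. z' i t x - z' i s x)"
              by (rule l2norm_triangle) (intro L2_on_diff zL i t elim)+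
            then show ?case by (simp add: d_def algebra_simps l2norm_nonneg)
          qed
        qed
      qed
    qed
  qed
  have S0: "S t \<ge> 0" for t by (simp add: S_def sum_nonneg)
  have comb_z: "comb (u t) (v t) = (\<lambda>i. z i t)" "comb (u' t) (v' t) = (\<lambda>i. z' i t)" for t by (auto simp: z_def z'_def)
  have Ucont: "continuous_on {0..} U" "continuous_on {0..} U'"
    by (rule continuous_on_eq[OF feedback_continuous[OF uv]], simp add: U) (rule continuous_on_eq[OF feedback_continuous[OF uv']], simp add: U')
  have UU: "(U t - U' t)\<^sup>2 \<le> Kn\<^sup>2 * S t" if t: "t \<ge> 0" for t
  proof -
    have l: "l2norm (d j t) \<le> sqrt (S t)" if "j \<le> n" for j
      by (rule real_le_rsqrt) (auto simp: S_def that intro!: member_le_sum[of j "{..n}" "\<lambda>i. (l2norm (d i t))\<^sup>2"])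
    have "\<bar>U t - U' t\<bar> = \<bar>feedback (\<lambda>j. d j t)\<bar>"
      using feedback_diff_L2[of "\<lambda>i. z i t" "\<lambda>i. z' i t"] zL t by (simp add: U U' comb_z d_def[abs_def])
    also have "\<dots> \<le> Kn * sqrt (S t)" by (rule feedback_bound[OF dL[OF _ t] l])
    finally have "(U t - U' t)\<^sup>2 \<le> (Kn * sqrt (S t))\<^sup>2" by (metis power_mono abs_ge_zero power2_abs)
    then show ?thesis using S0[of t] by (simp add: power_mult_distrib)
  qed
  obtain c1 c2 K where c1: "c1 > 0" and c2: "c2 \<ge> 0" and
    en: "\<And>U z zt zx t. l2_sol U z zt zx \<Longrightarrow> continuous_on {0..} U \<Longrightarrow> t \<ge> 0 \<Longrightarrow>
     exp (- K * t) * (c1 * (\<Sum>i\<le>n. (l2norm (z i t))\<^sup>2)) \<le> c2 * (\<Sum>i\<le>n. (l2norm (z i 0))\<^sup>2) + integral {0..t} (\<lambda>s. exp (- K * s) * (U s)\<^sup>2)"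
    using l2_energy by blast
  define \<psi> where "\<psi> t = exp (- K * t) * S t" for t
  have \<psi>cont: "continuous_on {0..} \<psi>" unfolding \<psi>_def[abs_def] by (intro continuous_intros Scont)
  note Hc = H1_loc_continuous[OF H] H1_loc_continuous[OF H']
  have \<psi>le: "\<psi> t \<le> 2 * Kn\<^sup>2 / c1 * integral {0..t} \<psi>" if t: "t \<ge> 0" for t
  proof -
    \<comment> \<open>Dominates \<open>exp (- K * s)\<close> for \<open>s\<close> in
      \<open>{0..t}\<close>, whatever the sign of \<open>K\<close>.\<close>
    define B where "B = exp (\<bar>K\<bar> * t)"
    \<comment> \<open>The interval is enlarged to length \<open>t + 1\<close> because convergence of
      the inputs is given for positive lengths only; the integrals of squares can only grow.\<close>
    define I where "I m = integral {0..t+1} (\<lambda>s. (Um m s - U s)\<^sup>2)" for m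
    define I' where "I' m = integral {0..t+1} (\<lambda>s. (Um' m s - U' s)\<^sup>2)" for m
    have sub: "continuous_on {0..t} f" "continuous_on {0..t+1} f" if "continuous_on {0..} f" for f :: "real \<Rightarrow> real"
      by (rule continuous_on_subset[OF that], use t in auto)+
    have main: "c1 * (exp (- K * t) * Sm m t) \<le> c2 * Sm m 0 + (2 * Kn\<^sup>2 * integral {0..t} \<psi> + 4 * B * I m + 4 * B * I' m)" for m
    proof -
      have "c1 * (exp (- K * t) * Sm m t) \<le> c2 * Sm m 0 + integral {0..t} (\<lambda>s. exp (- K * s) * (Um m s - Um' m s)\<^sup>2)"
        using en[OF l2_sol_diff[OF sol[of m] sol'[of m]] _ t] Hc[of m] by (simp add: Sm_def continuous_on_diff mult.left_commute)
      also have "integral {0..t} (\<lambda>s. exp (- K * s) * (Um m s - Um' m s)\<^sup>2)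
         \<le> integral {0..t} (\<lambda>s. 2 * Kn\<^sup>2 * \<psi> s + 4 * B * (Um m s - U s)\<^sup>2 + 4 * B * (Um' m s - U' s)\<^sup>2)"
      proof (rule integral_le)
        show "(\<lambda>s. exp (- K * s) * (Um m s - Um' m s)\<^sup>2) integrable_on {0..t}"
          by (intro integrable_continuous_real continuous_intros sub Hc)
        show "(\<lambda>s. 2 * Kn\<^sup>2 * \<psi> s + 4 * B * (Um m s - U s)\<^sup>2 + 4 * B * (Um' m s - U' s)\<^sup>2) integrable_on {0..t}"
          by (intro integrable_continuous_real continuous_intros sub Hc Ucont \<psi>cont)
        fix s assume s: "s \<in> {0..t}"
        have "- K * s \<le> \<bar>K\<bar> * t"
          using s by (intro order_trans[OF mult_right_mono[of "- K" "\<bar>K\<bar>" s] mult_left_mono]) auto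
        then have eB: "exp (- K * s) \<le> B" by (simp add: B_def)
        have "(Um m s - Um' m s)\<^sup>2 \<le> 2 * (U s - U' s)\<^sup>2 + 4 * (Um m s - U s)\<^sup>2 + 4 * (Um' m s - U' s)\<^sup>2"
        proof -
          \<comment> \<open>Sum-of-squares form of the bound for \<open>(p + r - w)\<^sup>2\<close>.
            Here \<open>p\<close> is the difference of the limit inputs, while \<open>r\<close> and
            \<open>w\<close> are the errors of the approximating inputs, which vanish in the
            limit.\<close>
          have "2 * p\<^sup>2 + 4 * r\<^sup>2 + 4 * w\<^sup>2 - (p + r - w)\<^sup>2 = (p - r + w)\<^sup>2 + 2 * (r + w)\<^sup>2" for p r w :: real
            by (simp add: power2_eq_square algebra_simps)
          from this[of "U s - U' s" "Um m s - U s" "Um' m s - U' s"] show ?thesis by (smt (verit) zero_le_power2)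
        qed
        then have "exp (- K * s) * (Um m s - Um' m s)\<^sup>2 \<le> exp (- K * s) * (2 * (U s - U' s)\<^sup>2 + 4 * (Um m s - U s)\<^sup>2 + 4 * (Um' m s - U' s)\<^sup>2)"
          by (intro mult_left_mono) auto
        also have "\<dots> = exp (- K * s) * (2 * (U s - U' s)\<^sup>2) + exp (- K * s) * (4 * (Um m s - U s)\<^sup>2) + exp (- K * s) * (4 * (Um' m s - U' s)\<^sup>2)"
          by (simp only: distrib_left)
        also have "\<dots> \<le> exp (- K * s) * (2 * (Kn\<^sup>2 * S s)) + B * (4 * (Um m s - U s)\<^sup>2) + B * (4 * (Um' m s - U' s)\<^sup>2)"
          by (intro add_mono mult_left_mono mult_right_mono eB UU) (use s in auto)
        also have "\<dots> = 2 * Kn\<^sup>2 * \<psi> s + 4 * B * (Um m s - U s)\<^sup>2 + 4 * B * (Um' m s - U' s)\<^sup>2"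
          by (simp add: \<psi>_def)
        finally show "exp (- K * s) * (Um m s - Um' m s)\<^sup>2 \<le> 2 * Kn\<^sup>2 * \<psi> s + 4 * B * (Um m s - U s)\<^sup>2 + 4 * B * (Um' m s - U' s)\<^sup>2" .
      qed
      also have "\<dots> = 2 * Kn\<^sup>2 * integral {0..t} \<psi> + 4 * B * integral {0..t} (\<lambda>s. (Um m s - U s)\<^sup>2) + 4 * B * integral {0..t} (\<lambda>s. (Um' m s - U' s)\<^sup>2)"
        by (subst Henstock_Kurzweil_Integration.integral_add
              | intro integrable_continuous_real continuous_intros sub Hc Ucont \<psi>cont | simp only: integral_mult_right)+
      also have "\<dots> \<le> 2 * Kn\<^sup>2 * integral {0..t} \<psi> + 4 * B * I m + 4 * B * I' m"
        unfolding I_def I'_def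
        by (intro add_mono mult_left_mono order_refl integral_subset_le integrable_continuous_real continuous_intros sub Hc Ucont) (auto simp: B_def)
      finally show ?thesis by simp
    qed
    have "c1 * (exp (- K * t) * S t) \<le> c2 * 0 + (2 * Kn\<^sup>2 * integral {0..t} \<psi> + 4 * B * 0 + 4 * B * 0)"
    proof (rule LIMSEQ_le)
      show "(\<lambda>m. c1 * (exp (- K * t) * Sm m t)) \<longlonglongrightarrow> c1 * (exp (- K * t) * S t)" by (intro tendsto_intros Sm_lim t)
      show "(\<lambda>m. c2 * Sm m 0 + (2 * Kn\<^sup>2 * integral {0..t} \<psi> + 4 * B * I m + 4 * B * I' m)) \<longlonglongrightarrow>
         c2 * 0 + (2 * Kn\<^sup>2 * integral {0..t} \<psi> + 4 * B * 0 + 4 * B * 0)"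
        unfolding I_def I'_def by (intro tendsto_intros Sm0 Ul Ul') (use t in auto)
      show "\<exists>N. \<forall>m\<ge>N. c1 * (exp (- K * t) * Sm m t) \<le> c2 * Sm m 0 + (2 * Kn\<^sup>2 * integral {0..t} \<psi> + 4 * B * I m + 4 * B * I' m)"
        using main by blast
    qed
    then show ?thesis using c1 by (simp add: \<psi>_def field_simps)
  qed
  have "\<psi> T \<le> 0" by (rule gronwall_zero[OF \<psi>cont \<psi>le _ T]) (use c1 in auto)
  then have "S T = 0" using S0[of T] by (simp add: \<psi>_def mult_le_0_iff)
  then have "\<forall>i\<in>{..n}. (l2norm (d i T))\<^sup>2 = 0" unfolding S_def by (subst (asm) sum_nonneg_eq_0_iff) auto
  then have "(\<Sum>i\<le>n. l2norm (d i T)) = 0" by simp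
  then have "enorm n (\<lambda>i. d i T) \<le> 0" using enorm_le_sum[of n "\<lambda>i. d i T"] dL T by simp
  then have "enorm n (\<lambda>i x. z' i T x - z i T x) = 0"
    using enorm_nonneg[of n "\<lambda>i. d i T"] enorm_minus_commute[of n "\<lambda>i. z i T" "\<lambda>i. z' i T"] by (simp add: d_def[abs_def])
  then show ?thesis by (simp add: E_norm_comb_diff z_def z'_def)
qed

end

text \<open>The integral law and \<open>feedback\<close> are known to agree on states in
  \<open>E\<close>, that is for \<open>t \<ge> 0\<close>; the notion of weak solution depends on the
  input only at such times.\<close>

lemma weak_solution_cong_input:
  assumes "\<And>t. t \<ge> 0 \<Longrightarrow> U t = U' t"
  shows "weak_solution n lam \<mu> \<sigma> W \<theta> q u0 v0 U u v \<longleftrightarrow> weak_solution n lam \<mu> \<sigma> W \<theta> q u0 v0 U' u v"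
proof -
  have "L2_on {0..T} U \<longleftrightarrow> L2_on {0..T} U'" for T by (rule L2_on_cong) (simp add: assms)
  then have "L2_loc U \<longleftrightarrow> L2_loc U'" unfolding L2_loc_def by blast
  moreover have "integral {0..T} (\<lambda>t. (f t - U t)\<^sup>2) = integral {0..T} (\<lambda>t. (f t - U' t)\<^sup>2)" for f T
    by (rule Henstock_Kurzweil_Integration.integral_cong) (simp add: assms)
  ultimately show ?thesis unfolding weak_solution_def by (simp only:)
qed

theorem mainTheorem1:
  fixes \<mu> q :: "real \<Rightarrow> real"
    and lam W \<theta> :: "real \<Rightarrow> real \<Rightarrow> real"
    and \<sigma> :: "real \<Rightarrow> real \<Rightarrow> real \<Rightarrow> real"
    and lam_min :: real
    and k :: "real \<Rightarrow> real \<Rightarrow> real \<Rightarrow> real"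
    and kbar :: "real \<Rightarrow> real \<Rightarrow> real"
  assumes "C1_on {0..1} \<mu>"
    and "C1_on ({0..1} \<times> {0..1}) (\<lambda>(x, y). lam x y)"
    and "continuous_on ({0..1} \<times> {0..1}) (\<lambda>(x, y). W x y)"
    and "continuous_on ({0..1} \<times> {0..1}) (\<lambda>(x, y). \<theta> x y)"
    and "continuous_on ({0..1} \<times> {0..1} \<times> {0..1}) (\<lambda>(x, y, z). \<sigma> x y z)"
    and "continuous_on {0..1} q"
    and "\<forall>x\<in>{0..1}. \<mu> x > 0"
    and "lam_min > 0"
    and "\<forall>x\<in>{0..1}. \<forall>y\<in>{0..1}. lam x y \<ge> lam_min"
    and "continuum_kernel_solution \<mu> lam W \<theta> \<sigma> q k kbar"
  shows "\<exists>N::nat. \<forall>n\<ge>N. \<forall>(lam_n :: nat \<Rightarrow> real \<Rightarrow> real) (W_n :: nat \<Rightarrow> real \<Rightarrow> real)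
      (\<theta>_n :: nat \<Rightarrow> real \<Rightarrow> real) (\<sigma>_n :: nat \<Rightarrow> nat \<Rightarrow> real \<Rightarrow> real) (q_n :: nat \<Rightarrow> real).
      (\<forall>i\<in>{1..n}. C1_on {0..1} (lam_n i) \<and> (\<forall>x\<in>{0..1}. lam_n i x > 0)) \<longrightarrow>
      (\<forall>i\<in>{1..n}. continuous_on {0..1} (W_n i) \<and> continuous_on {0..1} (\<theta>_n i)) \<longrightarrow>
      (\<forall>i\<in>{1..n}. \<forall>j\<in>{1..n}. continuous_on {0..1} (\<sigma>_n i j)) \<longrightarrow>
      (\<forall>x\<in>{0..1}. \<forall>i\<in>{1..n}. lam x (real i / real n) = lam_n i x \<and>
         W x (real i / real n) = W_n i x \<and> \<theta> x (real i / real n) = \<theta>_n i x) \<longrightarrow>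
      (\<forall>x\<in>{0..1}. \<forall>i\<in>{1..n}. \<forall>j\<in>{1..n}.
         \<sigma> x (real i / real n) (real j / real n) = \<sigma>_n i j x) \<longrightarrow>
      (\<forall>i\<in>{1..n}. q (real i / real n) = q_n i) \<longrightarrow>
      exponentially_stabilized n lam_n \<mu> \<sigma>_n W_n \<theta>_n q_n
        (\<lambda>u v. integral {0..1} (\<lambda>\<xi>.
           1 / real n * (\<Sum>i=1..n. k 1 \<xi> (real i / real n) * u i \<xi>) + kbar 1 \<xi> * v \<xi>))"
proof -
  interpret continuum \<mu> q lam W \<theta> \<sigma> lam_min k kbar
    by unfold_locales (use assms in auto)
  \<comment> \<open>\<open>N\<close> is fixed by the continuum data alone, before the coefficient
    families are introduced; on \<open>{0..1}\<close> those coincide with the sampled continuum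
    coefficients.\<close>
  obtain N where N: "N \<ge> 1" and decay: "\<And>n. n \<ge> N \<Longrightarrow> \<exists>M>0. \<exists>c>0. \<forall>z zt zx.
      transport.smooth_sol n (discretized.a \<mu> lam n) (discretized.cf W \<theta> \<sigma> n) (discretized.qn q n) (discretized.kk k kbar n) z zt zx \<longrightarrow>
      (\<forall>t\<ge>0. discretized.energy n (\<lambda>i. z i t) \<le> M * exp (- c * t) * discretized.energy n (\<lambda>i. z i 0))"
    by (rule smooth_decay) (rule that, assumption+)
  show ?thesis
  proof (intro exI[of _ N] allI impI)
    fix n :: nat and lam_n W_n \<theta>_n :: "nat \<Rightarrow> real \<Rightarrow> real" and \<sigma>_n :: "nat \<Rightarrow> nat \<Rightarrow> real \<Rightarrow> real" and q_n :: "nat \<Rightarrow> real"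
    assume n: "N \<le> n"
      and e1: "\<forall>x\<in>{0..1}. \<forall>i\<in>{1..n}. lam x (real i / real n) = lam_n i x \<and> W x (real i / real n) = W_n i x \<and> \<theta> x (real i / real n) = \<theta>_n i x"
      and e2: "\<forall>x\<in>{0..1}. \<forall>i\<in>{1..n}. \<forall>j\<in>{1..n}. \<sigma> x (real i / real n) (real j / real n) = \<sigma>_n i j x"
      and e3: "\<forall>i\<in>{1..n}. q (real i / real n) = q_n i"
    interpret discretized \<mu> q lam W \<theta> \<sigma> lam_min k kbar n by unfold_locales (use n N in linarith)
    interpret nplus1_system \<mu> q lam W \<theta> \<sigma> lam_min k kbar n lam_n W_n \<theta>_n \<sigma>_n q_n
      by unfold_locales (use e1 e2 e3 in \<open>auto simp: yy_def qn_def\<close>)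
    obtain M c where M: "M > 0" and c: "c > 0"
      and dec: "\<forall>z zt zx. smooth_sol z zt zx \<longrightarrow> (\<forall>t\<ge>0. energy (\<lambda>i. z i t) \<le> M * exp (- c * t) * energy (\<lambda>i. z i 0))"
      using decay[OF n] by blast
    let ?K = "\<lambda>u v. integral {0..1} (\<lambda>\<xi>. 1 / real n * (\<Sum>i=1..n. k 1 \<xi> (real i / real n) * u i \<xi>) + kbar 1 \<xi> * v \<xi>)"
    let ?weak = "weak_solution n lam_n \<mu> \<sigma>_n W_n \<theta>_n q_n"
    show "exponentially_stabilized n lam_n \<mu> \<sigma>_n W_n \<theta>_n q_n ?K"
      unfolding exponentially_stabilized_def
    proof (rule exI[of _ "sqrt M"], rule conjI, use M in simp, rule exI[of _ "c / 2"], rule conjI, use c in simp, intro allI impI)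
      fix u0 v0 assume uv0: "in_E n u0 v0"
      obtain u v where w: "?weak u0 v0 (\<lambda>t. feedback (comb (u t) (v t))) u v"
        and b: "\<And>t. t \<ge> 0 \<Longrightarrow> E_norm n (u t) (v t) \<le> sqrt M * exp (- (c / 2) * t) * E_norm n u0 v0"
        by (rule weak_solution_exists[OF _ M c uv0]) (use dec in blast)+
      have K: "?K (u t) (v t) = feedback (comb (u t) (v t))" if "?weak u0 v0 U u v" "t \<ge> 0" for U u v t
        using that by (intro feedback_law) (simp add: weak_solution_def E_continuous_def)
      have w': "?weak u0 v0 (\<lambda>t. ?K (u t) (v t)) u v"
        by (rule iffD1[OF weak_solution_cong_input w]) (rule K[OF w, symmetric])
      show "\<exists>u v. ?weak u0 v0 (\<lambda>t. ?K (u t) (v t)) u v \<and>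
          (\<forall>u' v'. ?weak u0 v0 (\<lambda>t. ?K (u' t) (v' t)) u' v' \<longrightarrow> (\<forall>t\<ge>0. E_norm n (u' t - u t) (v' t - v t) = 0)) \<and>
          (\<forall>t\<ge>0. E_norm n (u t) (v t) \<le> sqrt M * exp (- (c / 2) * t) * E_norm n u0 v0)"
      proof (intro exI[of _ u] exI[of _ v] conjI allI impI w' b)
        fix u' v' and t :: real
        assume w'': "?weak u0 v0 (\<lambda>t. ?K (u' t) (v' t)) u' v'" and t: "t \<ge> 0"
        show "E_norm n (u' t - u t) (v' t - v t) = 0"
          by (rule weak_solution_unique[OF w' w'' _ _ t]) (rule K[OF w'] K[OF w''], assumption)+
      qed
    qed
  qed
qed

end
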